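(* Let $D \in \mathbb{N}$ be a non-square discriminant and let $d \in \mathbb{N}$ be relatively prime to the conductor of $D$. Then $X_{D,d}^{(3)}$ is non-empty if and only if $d$ satisfies the prime factor condition in $\mathcal{O}_D$. Moreover, in this case $X_{D,d}^{(3)}$ consists of the $2^s$ irreducible components $X_{\mathfrak{a}}^{(3)}$, where $s$ is the number of splitting prime divisors of $d$.
   Context: A discriminant is an integer $D\equiv 0,1 \bmod 4$. For $D>0$ non-square put $K=\mathbb{Q}(\sqrt D)$, $\gamma_D=\frac{D+\sqrt D}{2}$, $\mathcal{O}_D=\langle 1,\gamma_D\rangle_{\mathbb{Z}}\subset K$; $\sigma$ (written $x\mapsto x^\sigma$) is the Galois conjugation of $K$ and $\mathrm{tr}(x)=x+x^\sigma$. The conductor of $D$ is the $f\in\mathbb{N}$ with $D=f^2\Delta_K$, where $\Delta_K$ is the discriminant of the ring of integers of $K$. Prime factor condition: let $d$ be relatively prime to the conductor of $D$ with prime factorization $d=\prod p_i^{k_i}$. Then $d$ satisfies the prime factor condition in $\mathcal{O}_D$ if no $p_i$ is inert in $K$ and $k_i=1$ whenever $p_i$ is ramified in $K$. A splitting prime divisor of $d$ is a prime $p\mid d$ that splits in $K$. A polarization on a complex torus $V/\Lambda$ is a positive definite Hermitian form $H$ on $V$ with $E_H:=\mathrm{Im}\,H$ integer-valued on $\Lambda$; its type is the type (elementary divisors) of $E_H|_{\Lambda\times\Lambda}$. Real multiplication by $\mathcal{O}_D$ on a polarized Abelian surface $(S,H)$ is an injective ring homomorphism $\rho:\mathcal{O}_D\hookrightarrow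 \mathrm{End}(S)$ whose image consists of endomorphisms self-adjoint with respect to $H$ and which is proper (it does not extend to an injective ring homomorphism from a strictly larger order of $K$). $X_{D,d}^{(3)}$ is the moduli space of all isomorphism classes $[(A,H,S,\rho)]$, where $(A,H)$ is a three-dimensional principally polarized complex Abelian variety, $S\subset A$ is a two-dimensional Abelian subvariety on which the induced polarization has type $(1,d)$, and $\rho$ is real multiplication by $\mathcal{O}_D$ on $S$. An isomorphism $(A,H,S,\rho)\to(A',H',S',\rho')$ is an isomorphism $f:(A,H)\to(A',H')$ of polarized Abelian varieties with $f(S)=S'$ such that $f|_S$ commutes with the actions of $\mathcal{O}_D$. The trace pairing on $K^2$ is $\langle (x,y),(\tilde x,\tilde y)\rangle=\mathrm{tr}(\tilde x y-x\tilde y)$. A non-zero ideal $\mathfrak a\subseteq\mathcal{O}_D$ is primitive if $\frac1m\mathfrak a\subset\mathcal{O}_D$ with $m\in\mathbb{Z}$ implies $m=\pm1$; its norm is $[\mathcal{O}_D:\mathfrak a]$. For a primitive ideal $\mathfrak a$ of norm $d$, $X_{\mathfrak a}^{(3)}\subseteq X_{D,d}^{(3)}$ is the locus of classes $[(A,H,S,\rho)]$ such that, writing $S=V_2/\Lambda_2$, the lattice $\Lambda_2$ with its $\mathcal{O}_D$-module structure and the form $E_H$ is isomorphic, as $\mathcal{O}_D$-module with symplectic form, to $\mathcal{O}_D\oplus\frac1{\sqrt D}\mathfrak a$ with the trace pairing. The components in the claim are indexed by the primitive ideals $\mathfrak a$ of $\mathcal{O}_D$ of norm $d$. *)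

theory Defs
  imports "HOL-Analysis.Analysis" "HOL-Computational_Algebra.Computational_Algebra"
    "HOL-Algebra.Ideal_Product" "HOL-Algebra.Subrings"
begin

section \<open>Real quadratic fields and their orders\<close>

text \<open>The field \<open>K\<close> and all its orders are realised inside \<open>\<real>\<close>; \<open>ring_on\<close> turns
  such a set of real numbers into a ring in the sense of HOL-Algebra.\<close>

definition ring_on :: "real set \<Rightarrow> real ring" where
  "ring_on R = \<lparr>carrier = R, monoid.mult = (*), one = 1, zero = 0, add = (+)\<rparr>"

definition quad_field :: "nat \<Rightarrow> real set" where
  "quad_field D = {x. \<exists>a\<in>\<rat>. \<exists>b\<in>\<rat>. x = a + b * sqrt (real D)}"

text \<open>The following two are meaningful only for non-square \<open>D\<close> and on \<^term>\<open>quad_field D\<close>.\<close>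

definition quad_conj :: "nat \<Rightarrow> real \<Rightarrow> real" where
  "quad_conj D x =
     (THE y. \<exists>a\<in>\<rat>. \<exists>b\<in>\<rat>. x = a + b * sqrt (real D) \<and> y = a - b * sqrt (real D))"

definition quad_tr :: "nat \<Rightarrow> real \<Rightarrow> real" where
  "quad_tr D x = x + quad_conj D x"

definition int_basis2 :: "real \<Rightarrow> real \<Rightarrow> real set \<Rightarrow> bool" where
  "int_basis2 b1 b2 M \<longleftrightarrow>
     M = {of_int m * b1 + of_int n * b2 | m n :: int. True} \<and>
     (\<forall>m n :: int. of_int m * b1 + of_int n * b2 = 0 \<longrightarrow> m = 0 \<and> n = 0)"

definition quad_order :: "nat \<Rightarrow> real set" where
  "quad_order D =
     {of_int m + of_int n * ((real D + sqrt (real D)) / 2) | m n :: int. True}"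

definition is_order :: "nat \<Rightarrow> real set \<Rightarrow> bool" where
  "is_order D R \<longleftrightarrow> subring R (ring_on (quad_field D)) \<and> (\<exists>b1 b2. int_basis2 b1 b2 R)"

definition ring_of_integers :: "nat \<Rightarrow> real set" where
  "ring_of_integers D = {x \<in> quad_field D. algebraic_int x}"

definition field_discriminant :: "nat \<Rightarrow> int" where
  "field_discriminant D =
     (THE \<Delta>. \<exists>b1 b2. int_basis2 b1 b2 (ring_of_integers D) \<and>
        of_int \<Delta> = (b1 * quad_conj D b2 - b2 * quad_conj D b1)\<^sup>2)"

definition conductor :: "nat \<Rightarrow> nat" where
  "conductor D = (THE f. int D = int (f\<^sup>2) * field_discriminant D)"

abbreviation prime_ext :: "nat \<Rightarrow> nat \<Rightarrow> real set" where
  "prime_ext D p \<equiv> cgenideal (ring_on (ring_of_integers D)) (real p)"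

definition inert_in :: "nat \<Rightarrow> nat \<Rightarrow> bool" where
  "inert_in D p \<longleftrightarrow> primeideal (prime_ext D p) (ring_on (ring_of_integers D))"

definition ramified_in :: "nat \<Rightarrow> nat \<Rightarrow> bool" where
  "ramified_in D p \<longleftrightarrow>
     (\<exists>P. primeideal P (ring_on (ring_of_integers D)) \<and>
          prime_ext D p = ideal_prod (ring_on (ring_of_integers D)) P P)"

definition split_in :: "nat \<Rightarrow> nat \<Rightarrow> bool" where
  "split_in D p \<longleftrightarrow>
     (\<exists>P Q. primeideal P (ring_on (ring_of_integers D)) \<and>
            primeideal Q (ring_on (ring_of_integers D)) \<and> P \<noteq> Q \<and>
            prime_ext D p = ideal_prod (ring_on (ring_of_integers D)) P Q)"

definition prime_factor_condition :: "nat \<Rightarrow> nat \<Rightarrow> bool" where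
  "prime_factor_condition D d \<longleftrightarrow>
     (\<forall>p. prime p \<and> p dvd d \<longrightarrow>
        \<not> inert_in D p \<and> (ramified_in D p \<longrightarrow> multiplicity p d = 1))"

definition splitting_primes :: "nat \<Rightarrow> nat \<Rightarrow> nat set" where
  "splitting_primes D d = {p. prime p \<and> p dvd d \<and> split_in D p}"

definition primitive_ideal :: "nat \<Rightarrow> real set \<Rightarrow> bool" where
  "primitive_ideal D \<aa> \<longleftrightarrow>
     ideal \<aa> (ring_on (quad_order D)) \<and> \<aa> \<noteq> {0} \<and>
     (\<forall>m::int. m \<noteq> 0 \<and> (\<lambda>x. x / of_int m) ` \<aa> \<subseteq> quad_order D \<longrightarrow> m = 1 \<or> m = -1)"

definition ideal_norm :: "nat \<Rightarrow> real set \<Rightarrow> nat" where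
  "ideal_norm D \<aa> = card (A_RCOSETS (ring_on (quad_order D)) \<aa>)"

definition primitive_ideals :: "nat \<Rightarrow> nat \<Rightarrow> real set set" where
  "primitive_ideals D d = {\<aa>. primitive_ideal D \<aa> \<and> ideal_norm D \<aa> = d}"

definition trace_pairing :: "nat \<Rightarrow> real \<times> real \<Rightarrow> real \<times> real \<Rightarrow> real" where
  "trace_pairing D = (\<lambda>(x, y) (x', y'). quad_tr D (x' * y - x * y'))"

section \<open>Polarized complex tori and real multiplication\<close>

text \<open>A complex torus is a pair \<open>(V, \<Lambda>)\<close> of a complex subspace \<open>V\<close> of some \<open>\<complex>\<^sup>n\<close> and a lattice
  \<open>\<Lambda>\<close> in \<open>V\<close>, so that subtori of \<open>\<complex>\<^sup>n/\<Lambda>\<close> are again objects of the same kind. Homomorphisms of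
  tori are represented by their (unique) linear lifts to the covering vector spaces.\<close>

definition is_lattice :: "(complex^'n) set \<Rightarrow> (complex^'n) set \<Rightarrow> bool" where
  "is_lattice V \<Lambda> \<longleftrightarrow>
     (\<exists>B. independent B \<and> span B = V \<and>
          \<Lambda> = {\<Sum>b\<in>B. real_of_int (c b) *\<^sub>R b | c. True})"

definition complex_torus :: "(complex^'n) set \<Rightarrow> (complex^'n) set \<Rightarrow> bool" where
  "complex_torus V \<Lambda> \<longleftrightarrow> vec.subspace V \<and> is_lattice V \<Lambda>"

definition pos_hermitian_on ::
    "(complex^'n) set \<Rightarrow> (complex^'n \<Rightarrow> complex^'n \<Rightarrow> complex) \<Rightarrow> bool" where
  "pos_hermitian_on V H \<longleftrightarrow>
     (\<forall>x\<in>V. \<forall>y\<in>V. \<forall>z\<in>V. H (x + y) z = H x z + H y z) \<and>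
     (\<forall>c. \<forall>x\<in>V. \<forall>y\<in>V. H (c *s x) y = c * H x y) \<and>
     (\<forall>x\<in>V. \<forall>y\<in>V. H y x = cnj (H x y)) \<and>
     (\<forall>x\<in>V. x \<noteq> 0 \<longrightarrow> Re (H x x) > 0)"

definition polarization ::
    "(complex^'n) set \<Rightarrow> (complex^'n) set \<Rightarrow> (complex^'n \<Rightarrow> complex^'n \<Rightarrow> complex) \<Rightarrow> bool" where
  "polarization V \<Lambda> H \<longleftrightarrow>
     pos_hermitian_on V H \<and> (\<forall>x\<in>\<Lambda>. \<forall>y\<in>\<Lambda>. Im (H x y) \<in> \<int>)"

text \<open>\<open>a\<^sub>0, \<dots>, b\<^sub>0, \<dots>\<close> is a symplectic basis of \<open>\<Lambda>\<close> exhibiting the elementary divisors \<open>ds\<close>;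
  its linear independence follows from positivity of the \<open>ds\<close>.\<close>

definition polarization_type ::
    "(complex^'n) set \<Rightarrow> (complex^'n \<Rightarrow> complex^'n \<Rightarrow> complex) \<Rightarrow> nat list \<Rightarrow> bool" where
  "polarization_type \<Lambda> H ds \<longleftrightarrow>
     (\<forall>i < length ds. ds ! i > 0) \<and>
     (\<forall>i. Suc i < length ds \<longrightarrow> ds ! i dvd ds ! Suc i) \<and>
     (\<exists>a b :: nat \<Rightarrow> complex^'n.
        \<Lambda> = {\<Sum>i<length ds. real_of_int (m i) *\<^sub>R a i + real_of_int (n i) *\<^sub>R b i | m n. True} \<and>
        (\<forall>i < length ds. \<forall>j < length ds.
           Im (H (a i) (a j)) = 0 \<and> Im (H (b i) (b j)) = 0 \<and>
           Im (H (a i) (b j)) = (if i = j then real (ds ! i) else 0)))"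

definition End_ring ::
    "(complex^'n) set \<Rightarrow> (complex^'n) set \<Rightarrow> (complex^'n \<Rightarrow> complex^'n) ring" where
  "End_ring V \<Lambda> =
     \<lparr>carrier = {F \<in> V \<rightarrow>\<^sub>E V. (\<forall>x\<in>V. \<forall>y\<in>V. F (x + y) = F x + F y) \<and>
                            (\<forall>c. \<forall>x\<in>V. F (c *s x) = c *s F x) \<and> F ` \<Lambda> \<subseteq> \<Lambda>},
      monoid.mult = compose V, one = (\<lambda>x\<in>V. x),
      zero = (\<lambda>x\<in>V. 0), add = (\<lambda>F G. \<lambda>x\<in>V. F x + G x)\<rparr>"

definition real_multiplication ::
    "nat \<Rightarrow> (complex^'n) set \<Rightarrow> (complex^'n) set \<Rightarrow> (complex^'n \<Rightarrow> complex^'n \<Rightarrow> complex) \<Rightarrow>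
     (real \<Rightarrow> complex^'n \<Rightarrow> complex^'n) \<Rightarrow> bool" where
  "real_multiplication D V \<Lambda> H \<rho> \<longleftrightarrow>
     \<rho> \<in> ring_hom (ring_on (quad_order D)) (End_ring V \<Lambda>) \<and>
     inj_on \<rho> (quad_order D) \<and>
     (\<forall>\<alpha>\<in>quad_order D. \<forall>x\<in>V. \<forall>y\<in>V. H (\<rho> \<alpha> x) y = H x (\<rho> \<alpha> y)) \<and>
     \<not> (\<exists>R \<rho>'. is_order D R \<and> quad_order D \<subset> R \<and>
               \<rho>' \<in> ring_hom (ring_on R) (End_ring V \<Lambda>) \<and> inj_on \<rho>' R \<and>
               (\<forall>\<alpha>\<in>quad_order D. \<rho>' \<alpha> = \<rho> \<alpha>))"

section \<open>The moduli space as a set\<close>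

text \<open>\<open>(\<Lambda>, H, W, \<rho>)\<close> stands for \<open>A = \<complex>\<^sup>3/\<Lambda>\<close> with polarization \<open>H\<close>, the Abelian subvariety
  \<open>S = W/(W \<inter> \<Lambda>)\<close> and real multiplication \<open>\<rho>\<close> on \<open>S\<close>. Only the values of \<open>\<rho>\<close> on the order
  matter.\<close>

type_synonym rm_data =
  "(complex^3) set \<times> (complex^3 \<Rightarrow> complex^3 \<Rightarrow> complex) \<times> (complex^3) set \<times>
   (real \<Rightarrow> complex^3 \<Rightarrow> complex^3)"

definition rm_objects :: "nat \<Rightarrow> nat \<Rightarrow> rm_data set" where
  "rm_objects D d = {(\<Lambda>, H, W, \<rho>).
     complex_torus UNIV \<Lambda> \<and> polarization UNIV \<Lambda> H \<and> polarization_type \<Lambda> H [1, 1, 1] \<and>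
     complex_torus W (W \<inter> \<Lambda>) \<and> vec.dim W = 2 \<and> polarization_type (W \<inter> \<Lambda>) H [1, d] \<and>
     real_multiplication D W (W \<inter> \<Lambda>) H \<rho>}"

definition rm_isomorphic :: "nat \<Rightarrow> rm_data \<Rightarrow> rm_data \<Rightarrow> bool" where
  "rm_isomorphic D = (\<lambda>(\<Lambda>, H, W, \<rho>) (\<Lambda>', H', W', \<rho>').
     \<exists>f. Vector_Spaces.linear (*s) (*s) f \<and> bij f \<and> f ` \<Lambda> = \<Lambda>' \<and>
         (\<forall>x y. H' (f x) (f y) = H x y) \<and> f ` W = W' \<and>
         (\<forall>\<alpha>\<in>quad_order D. \<forall>x\<in>W. f (\<rho> \<alpha> x) = \<rho>' \<alpha> (f x)))"

definition rm_iso_rel :: "nat \<Rightarrow> nat \<Rightarrow> (rm_data \<times> rm_data) set" where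
  "rm_iso_rel D d =
     {(q, q'). q \<in> rm_objects D d \<and> q' \<in> rm_objects D d \<and> rm_isomorphic D q q'}"

definition moduli_space :: "nat \<Rightarrow> nat \<Rightarrow> rm_data set set" where
  "moduli_space D d = rm_objects D d // rm_iso_rel D d"

definition moduli_locus :: "nat \<Rightarrow> nat \<Rightarrow> real set \<Rightarrow> rm_data set set" where
  "moduli_locus D d \<aa> = {C \<in> moduli_space D d. \<exists>(\<Lambda>, H, W, \<rho>) \<in> C.
     \<exists>\<phi>. bij_betw \<phi> (W \<inter> \<Lambda>) (quad_order D \<times> (\<lambda>x. x / sqrt (real D)) ` \<aa>) \<and>
         (\<forall>u\<in>W \<inter> \<Lambda>. \<forall>v\<in>W \<inter> \<Lambda>. \<phi> (u + v) = \<phi> u + \<phi> v) \<and>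
         (\<forall>\<alpha>\<in>quad_order D. \<forall>u\<in>W \<inter> \<Lambda>. \<phi> (\<rho> \<alpha> u) = (\<alpha> * fst (\<phi> u), \<alpha> * snd (\<phi> u))) \<and>
         (\<forall>u\<in>W \<inter> \<Lambda>. \<forall>v\<in>W \<inter> \<Lambda>. trace_pairing D (\<phi> u) (\<phi> v) = Im (H u v))}"

section \<open>Analytic structure and irreducible components\<close>

definition holomorphic3 :: "(complex^3^3 \<Rightarrow> complex) \<Rightarrow> (complex^3^3) set \<Rightarrow> bool" where
  "holomorphic3 f N \<longleftrightarrow>
     (\<forall>Z\<in>N. \<exists>f'. (f has_derivative f') (at Z) \<and>
               (\<forall>c v. f' (\<chi> i j. c * v $ i $ j) = c * f' v))"

text \<open>Closed analytic subsets of a subspace \<open>M\<close> of the affine space of complex matrices: the local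
  condition is imposed at every point of \<open>M\<close>, not just at the points of \<open>Y\<close>.\<close>

definition analytic_subset :: "(complex^3^3) set \<Rightarrow> (complex^3^3) set \<Rightarrow> bool" where
  "analytic_subset M Y \<longleftrightarrow>
     Y \<subseteq> M \<and>
     (\<forall>Z\<in>M. \<exists>N F. open N \<and> Z \<in> N \<and> finite F \<and> (\<forall>f\<in>F. holomorphic3 f N) \<and>
               Y \<inter> N = {T \<in> M \<inter> N. \<forall>f\<in>F. f T = 0})"

definition Im_matrix :: "complex^3^3 \<Rightarrow> real^3^3" where
  "Im_matrix Z = (\<chi> i j. Im (Z $ i $ j))"

definition siegel_space :: "(complex^3^3) set" where
  "siegel_space =
     {Z. transpose Z = Z \<and> (\<forall>v. v \<noteq> 0 \<longrightarrow> v \<bullet> (Im_matrix Z *v v) > 0)}"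

text \<open>The principally polarized Abelian variety
  \<open>A\<^sub>Z = \<complex>\<^sup>3 / (Z \<int>\<^sup>3 + \<int>\<^sup>3)\<close> with \<open>H\<^sub>Z(x, y) = x\<^sup>t (Im Z)\<^sup>-\<^sup>1 cnj(y)\<close>, its first homology being
  identified with \<open>\<int>\<^sup>3 \<times> \<int>\<^sup>3\<close>.\<close>

definition period_vec :: "complex^3^3 \<Rightarrow> (int^3) \<times> (int^3) \<Rightarrow> complex^3" where
  "period_vec Z = (\<lambda>(m, n). Z *v (\<chi> i. of_int (m $ i)) + (\<chi> i. of_int (n $ i)))"

definition siegel_form :: "complex^3^3 \<Rightarrow> complex^3 \<Rightarrow> complex^3 \<Rightarrow> complex" where
  "siegel_form Z x y =
     (\<Sum>i\<in>UNIV. \<Sum>j\<in>UNIV. x $ i * of_real (matrix_inv (Im_matrix Z) $ i $ j) * cnj (y $ j))"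

text \<open>The moduli space carries its usual structure of a complex analytic space as a quotient of
  the spaces of marked objects. A marking is a discrete datum: the sublattice \<open>L\<close> of
  \<open>\<int>\<^sup>3 \<times> \<int>\<^sup>3\<close> belonging to \<open>S\<close> and the action \<open>r\<close> of the order on it. For fixed \<open>(L, r)\<close> the marked
  objects form an analytic subspace \<open>siegel_preimage D d L r (moduli_space D d)\<close> of Siegel
  space, every object has a marking, and two markings of isomorphic objects differ by an element
  of the discrete group \<open>Sp\<^sub>6(\<int>)\<close>. Hence the analytic subsets of the quotient are the sets whose
  preimages are all analytic.\<close>

definition siegel_preimage ::
    "nat \<Rightarrow> nat \<Rightarrow> ((int^3) \<times> (int^3)) set \<Rightarrow> (real \<Rightarrow> (int^3) \<times> (int^3) \<Rightarrow> (int^3) \<times> (int^3)) \<Rightarrow>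
     rm_data set set \<Rightarrow> (complex^3^3) set" where
  "siegel_preimage D d L r Y =
     {Z \<in> siegel_space. \<exists>W \<rho>.
        let q = (range (period_vec Z), siegel_form Z, W, \<rho>) in
        q \<in> rm_objects D d \<and>
        {c. period_vec Z c \<in> W} = L \<and>
        (\<forall>\<alpha>\<in>quad_order D. \<forall>c\<in>L. \<rho> \<alpha> (period_vec Z c) = period_vec Z (r \<alpha> c)) \<and>
        rm_iso_rel D d `` {q} \<in> Y}"

definition moduli_analytic :: "nat \<Rightarrow> nat \<Rightarrow> rm_data set set \<Rightarrow> bool" where
  "moduli_analytic D d Y \<longleftrightarrow>
     Y \<subseteq> moduli_space D d \<and>
     (\<forall>L r. analytic_subset (siegel_preimage D d L r (moduli_space D d))
                           (siegel_preimage D d L r Y))"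

definition moduli_irreducible :: "nat \<Rightarrow> nat \<Rightarrow> rm_data set set \<Rightarrow> bool" where
  "moduli_irreducible D d Y \<longleftrightarrow>
     moduli_analytic D d Y \<and> Y \<noteq> {} \<and>
     (\<forall>Y1 Y2. moduli_analytic D d Y1 \<and> moduli_analytic D d Y2 \<and> Y = Y1 \<union> Y2 \<longrightarrow>
              Y = Y1 \<or> Y = Y2)"

definition irreducible_components :: "nat \<Rightarrow> nat \<Rightarrow> rm_data set set set" where
  "irreducible_components D d =
     {Y. moduli_irreducible D d Y \<and>
         (\<forall>Y'. moduli_irreducible D d Y' \<and> Y \<subseteq> Y' \<longrightarrow> Y' = Y)}"

end

theory Submission
  imports Defs "HOL-Complex_Analysis.Conformal_Mappings"
begin

text \<open>Write \<open>\<gamma> = (D + \<surd>D)/2\<close> and \<open>F c = c\<^sup>2 + D c + (D\<^sup>2 - D)/4\<close>, the norm of \<open>\<gamma> + c\<close>.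

  \<^emph>\<open>Ideals.\<close> The primitive ideals of norm \<open>d\<close> are the ideals \<open>\<aa>\<^sub>c = \<int> d + \<int> (\<gamma> + c)\<close> with \<open>d\<close>
  dividing \<open>F c\<close>, and \<open>c\<close> is unique modulo \<open>d\<close> (\<open>primitive_ideals_roots\<close>). By the Chinese remainder
  theorem the roots of \<open>F\<close> are counted one prime power at a time. For \<open>d\<close> prime to the conductor, \<open>F\<close>
  may be replaced by the norm polynomial of the maximal order; a prime \<open>p\<close> is inert, ramified or
  split according as that polynomial has no root, a double root or two roots modulo \<open>p\<close>. Modulo
  \<open>p\<^sup>k\<close> the two roots of a split prime survive by Hensel's lemma, and the double root of a ramified
  one is lost for \<open>k > 1\<close>. So there are \<open>2\<^sup>s\<close> primitive ideals of norm \<open>d\<close> if the prime factor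
  condition holds, and none otherwise (\<open>primitive_ideals_count\<close>).

  \<^emph>\<open>Lattices.\<close> With respect to a symplectic basis of type \<open>(1, d)\<close> a self-adjoint \<open>\<gamma>\<close> is given by six
  integers, which properness forces to be coprime in a suitable sense (\<open>proper_coprime\<close>). Hence some
  vector \<open>u\<close> spans, together with \<open>\<gamma> u\<close>, an isotropic direct summand, and the lattice with its module
  structure and its form is \<open>\<O>\<^sub>D \<oplus> \<aa>\<^sub>c / \<surd>D\<close> for a root \<open>c\<close> (\<open>adapted_exists\<close>,
  \<open>adapted_module_type\<close>) that is determined modulo \<open>d\<close> (\<open>adapted_unique\<close>). The moduli space is
  therefore the disjoint union of the loci of the primitive ideals of norm \<open>d\<close>.

  \<^emph>\<open>Families.\<close> For each root \<open>c\<close> there is a family of period matrices \<open>M diag(\<tau>) M\<^sup>t\<close> over the product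
  of three upper half planes, with a fixed real matrix \<open>M\<close>. The plane of the abelian surface, the
  action of the order on it and even its sublattice in lattice coordinates are the same for all
  members. Every object in the locus of \<open>\<aa>\<^sub>c\<close> is isomorphic to a member (\<open>family_isomorphic\<close>):
  the basis of \<open>W \<inter> \<Lambda>\<close> extends to a symplectic basis of \<open>\<Lambda>\<close> in which \<open>W \<inter> \<Lambda>\<close> has the same position
  as in the family (\<open>symplectic_extension\<close>), and the two eigenlines of \<open>\<gamma>\<close> in \<open>W\<close> and the orthogonal
  complement of \<open>W\<close> are orthogonal lines on which the periods are read off.

  \<^emph>\<open>Components.\<close> A marking determines the module and its form, so that an analytic set remains analytic
  when it is intersected with a locus or with its complement (\<open>moduli_analytic_locus\<close>). Hence an
  irreducible set lies in one of the loci. Each locus is irreducible (\<open>locus_irreducible\<close>): two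
  points of the product of half planes lie on a complex line, which meets the product in a convex
  region, and by the identity theorem this region is not the union of two proper analytic subsets.
  So the components are the loci, and there are as many as primitive ideals of norm \<open>d\<close>.\<close>

section \<open>Arithmetic of a quadratic order\<close>

locale quadratic_discriminant =
  fixes D :: nat
  assumes disc: "D mod 4 = 0 \<or> D mod 4 = 1"
    and nonsquare: "\<not> (\<exists>k::nat. D = k\<^sup>2)"
begin

abbreviation rootD :: real where "rootD \<equiv> sqrt (real D)"
definition gen :: real where "gen = (real D + rootD) / 2"
definition gnorm :: int where "gnorm = (int D * int D - int D) div 4"
text \<open>The norm of \<open>\<gamma> + c\<close>, or the minimal polynomial of \<open>\<gamma>\<close> at \<open>- c\<close>.\<close>

definition genpoly :: "int \<Rightarrow> int" where "genpoly c = c\<^sup>2 + int D * c + gnorm"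

lemma D_pos: "D > 0"
  using nonsquare by (metis gr0I power_zero_numeral)

lemma gnorm4: "4 * gnorm = int D * int D - int D"
proof -
  have "(4::int) dvd int D * int D - int D"
  proof -
    obtain q where "D = 4 * q \<or> D = 4 * q + 1"
      using disc by (metis add.right_neutral mult_div_mod_eq)
    then show ?thesis
    proof
      assume "D = 4 * q"
      then have "int D * int D - int D = 4 * (int q * int D - int q)" by (simp add: algebra_simps)
      then show ?thesis by simp
    next
      assume "D = 4 * q + 1"
      then have "int D * int D - int D = 4 * (int q * (4 * int q + 1))" by (simp add: algebra_simps)
      then show ?thesis by simp
    qed
  qed
  then show ?thesis unfolding gnorm_def by simp
qed

lemma gnorm_real: "4 * real_of_int gnorm = real D * real D - real D"
proof -
  have "real_of_int (4 * gnorm) = real_of_int (int D * int D - int D)" by (simp only: gnorm4)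
  then show ?thesis by simp
qed

lemma rootD_sq [simp]: "rootD * rootD = real D" by simp

lemma rootD_pos: "rootD > 0" using D_pos by simp

lemma rootD_irrational: "rootD \<notin> \<rat>"
proof
  assume "rootD \<in> \<rat>"
  moreover have "algebraic_int rootD"
    by (intro algebraic_int_sqrt) (auto intro: int_imp_algebraic_int)
  ultimately have "rootD \<in> \<int>" by (rule rational_algebraic_int_is_int[rotated])
  then obtain k where k: "rootD = of_int k" by (auto elim: Ints_cases)
  then have "real D = of_int (k * k)" using rootD_sq by (metis of_int_mult)
  then have "int D = k * k" by (metis of_int_eq_iff of_int_of_nat_eq)
  then have "int D = int ((nat \<bar>k\<bar>)\<^sup>2)" by (simp add: power2_eq_square)
  then have "D = (nat \<bar>k\<bar>)\<^sup>2" by (simp only: of_nat_eq_iff)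
  then show False using nonsquare by blast
qed

lemma rat_coords_zero:
  assumes "a \<in> \<rat>" "b \<in> \<rat>" "a + b * rootD = 0"
  shows "a = 0 \<and> b = 0"
proof (rule ccontr)
  assume *: "\<not> ?thesis"
  then have "b \<noteq> 0" using assms by auto
  then have "rootD = - a / b" using assms(3) by (simp add: field_simps)
  moreover have "- a / b \<in> \<rat>" using assms by (intro Rats_divide) auto
  ultimately show False using rootD_irrational by simp
qed

lemma rat_coords_unique:
  assumes "a \<in> \<rat>" "b \<in> \<rat>" "a' \<in> \<rat>" "b' \<in> \<rat>" "a + b * rootD = a' + b' * rootD"
  shows "a = a' \<and> b = b'"
proof -
  have "(a - a') + (b - b') * rootD = (a + b * rootD) - (a' + b' * rootD)" by (simp add: algebra_simps)
  then have "(a - a') + (b - b') * rootD = 0" using assms(5) by linarith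
  moreover have "a - a' \<in> \<rat>" "b - b' \<in> \<rat>" using assms by auto
  ultimately have "a - a' = 0 \<and> b - b' = 0" by (intro rat_coords_zero)
  then show ?thesis by simp
qed

lemma conj_coords [simp]:
  assumes "a \<in> \<rat>" "b \<in> \<rat>"
  shows "quad_conj D (a + b * rootD) = a - b * rootD"
  unfolding quad_conj_def
proof (rule the_equality)
  show "\<exists>a'\<in>\<rat>. \<exists>b'\<in>\<rat>. a + b * rootD = a' + b' * rootD \<and> a - b * rootD = a' - b' * rootD"
    using assms by blast
next
  fix y assume "\<exists>a'\<in>\<rat>. \<exists>b'\<in>\<rat>. a + b * rootD = a' + b' * rootD \<and> y = a' - b' * rootD"
  then show "y = a - b * rootD" using rat_coords_unique assms by blast
qed

lemma quad_fieldI: "a \<in> \<rat> \<Longrightarrow> b \<in> \<rat> \<Longrightarrow> a + b * rootD \<in> quad_field D"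
  unfolding quad_field_def by blast

lemma quad_fieldE:
  assumes "x \<in> quad_field D"
  obtains a b where "a \<in> \<rat>" "b \<in> \<rat>" "x = a + b * rootD" "quad_conj D x = a - b * rootD"
  using assms unfolding quad_field_def by auto

lemma conj_rat [simp]: "a \<in> \<rat> \<Longrightarrow> quad_conj D a = a"
  using conj_coords[of a 0] by simp

lemma conj_of_int [simp]: "quad_conj D (of_int m) = of_int m" by simp

lemma conj_add:
  assumes "x \<in> quad_field D" "y \<in> quad_field D"
  shows "x + y \<in> quad_field D \<and> quad_conj D (x + y) = quad_conj D x + quad_conj D y"
proof -
  obtain a b where x: "a \<in> \<rat>" "b \<in> \<rat>" "x = a + b * rootD" "quad_conj D x = a - b * rootD"
    using quad_fieldE[OF assms(1)] .
  obtain a' b' where y: "a' \<in> \<rat>" "b' \<in> \<rat>" "y = a' + b' * rootD" "quad_conj D y = a' - b' * rootD"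
    using quad_fieldE[OF assms(2)] .
  have "x + y = (a + a') + (b + b') * rootD" using x y by (simp add: algebra_simps)
  then show ?thesis using quad_fieldI[of "a + a'" "b + b'"] conj_coords[of "a + a'" "b + b'"] x y
    by (simp add: algebra_simps)
qed

lemma conj_mult:
  assumes "x \<in> quad_field D" "y \<in> quad_field D"
  shows "x * y \<in> quad_field D \<and> quad_conj D (x * y) = quad_conj D x * quad_conj D y"
proof -
  obtain a b where x: "a \<in> \<rat>" "b \<in> \<rat>" "x = a + b * rootD" "quad_conj D x = a - b * rootD"
    using quad_fieldE[OF assms(1)] .
  obtain a' b' where y: "a' \<in> \<rat>" "b' \<in> \<rat>" "y = a' + b' * rootD" "quad_conj D y = a' - b' * rootD"
    using quad_fieldE[OF assms(2)] .
  have e: "x * y = (a * a' + b * b' * real D) + (a * b' + b * a') * rootD"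
    using x y rootD_sq by (simp add: algebra_simps)
  have r: "a * a' + b * b' * real D \<in> \<rat>" "a * b' + b * a' \<in> \<rat>"
    using x y by auto
  have "quad_conj D (x * y) = (a * a' + b * b' * real D) - (a * b' + b * a') * rootD"
    unfolding e by (rule conj_coords[OF r])
  also have "\<dots> = quad_conj D x * quad_conj D y"
    using x y by (simp add: algebra_simps)
  finally show ?thesis using quad_fieldI[OF r] e by simp
qed

lemma rat_in_field [simp]: "a \<in> \<rat> \<Longrightarrow> a \<in> quad_field D"
  using quad_fieldI[of a 0] by simp

lemma rootD_in_field [simp]: "rootD \<in> quad_field D"
  using quad_fieldI[of 0 1] by simp

lemma conj_rootD [simp]: "quad_conj D rootD = - rootD"
  using conj_coords[of 0 1] by simp

lemma conj_minus:
  assumes "x \<in> quad_field D"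
  shows "- x \<in> quad_field D \<and> quad_conj D (- x) = - quad_conj D x"
  using conj_mult[of "-1" x] assms by simp

lemma conj_diff:
  assumes "x \<in> quad_field D" "y \<in> quad_field D"
  shows "x - y \<in> quad_field D \<and> quad_conj D (x - y) = quad_conj D x - quad_conj D y"
  using conj_add[of x "- y"] conj_minus[of y] assms by simp

lemma conj_div_rootD:
  assumes "x \<in> quad_field D"
  shows "x / rootD \<in> quad_field D \<and> quad_conj D (x / rootD) = - (quad_conj D x / rootD)"
proof -
  have i: "1 / rootD = 0 + (1 / real D) * rootD" using rootD_pos D_pos by (simp add: field_simps)
  have "1 / rootD \<in> quad_field D" unfolding i by (rule quad_fieldI) auto
  moreover have "quad_conj D (1 / rootD) = - (1 / rootD)"
    unfolding i by (subst conj_coords) auto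
  ultimately show ?thesis using conj_mult[OF assms, of "1 / rootD"] by simp
qed

lemma gen_in_field [simp]: "gen \<in> quad_field D"
proof -
  have "gen = real D / 2 + (1 / 2) * rootD" unfolding gen_def by (simp add: field_simps)
  then show ?thesis using quad_fieldI[of "real D / 2" "1 / 2"] by simp
qed

lemma conj_gen [simp]: "quad_conj D gen = real D - gen"
proof -
  have e: "gen = real D / 2 + (1 / 2) * rootD" unfolding gen_def by (simp add: field_simps)
  have "quad_conj D (real D / 2 + (1 / 2) * rootD) = real D / 2 - (1 / 2) * rootD"
    by (rule conj_coords) auto
  then have "quad_conj D gen = real D / 2 - (1 / 2) * rootD" by (simp only: e)
  then show ?thesis using e by linarith
qed

lemma gen_sq: "gen * gen = real D * gen - of_int gnorm"
proof -
  have "4 * (gen * gen) = real D * real D + 2 * real D * rootD + real D"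
    unfolding gen_def by (simp add: algebra_simps)
  moreover have "4 * (real D * gen) = 2 * real D * real D + 2 * real D * rootD"
    unfolding gen_def by (simp add: algebra_simps)
  ultimately show ?thesis using gnorm_real by linarith
qed

lemma gen_diff_conj: "2 * gen - real D = rootD"
  using gen_def by (simp add: field_simps)

lemma rat_gen_zero:
  assumes "a \<in> \<rat>" "b \<in> \<rat>" "a + b * gen = 0"
  shows "a = 0 \<and> b = 0"
proof -
  have "(a + b * real D / 2) + (b / 2) * rootD = 0"
    using assms(3) unfolding gen_def by (simp add: field_simps)
  then show ?thesis using rat_coords_zero[of "a + b * real D / 2" "b / 2"] assms by auto
qed

lemma int_gen_unique:
  "of_int m + of_int n * gen = of_int m' + of_int n' * gen \<longleftrightarrow> m = m' \<and> n = n'"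
proof
  assume "of_int m + of_int n * gen = of_int m' + of_int n' * gen"
  then have "of_int (m - m') + of_int (n - n') * gen = 0" by (simp add: algebra_simps)
  then have "real_of_int (m - m') = 0 \<and> real_of_int (n - n') = 0" by (intro rat_gen_zero) auto
  then show "m = m' \<and> n = n'" by linarith
qed auto

definition elt :: "int \<Rightarrow> int \<Rightarrow> real" where "elt m n = of_int m + of_int n * gen"

lemma elt_inject [simp]: "elt m n = elt m' n' \<longleftrightarrow> m = m' \<and> n = n'"
  unfolding elt_def by (rule int_gen_unique)

lemma order_eq: "quad_order D = {elt m n | m n. True}"
  unfolding quad_order_def elt_def gen_def ..

lemma elt_in_order [simp, intro]: "elt m n \<in> quad_order D"
  unfolding order_eq by blast

lemma orderE: assumes "x \<in> quad_order D" obtains m n where "x = elt m n"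
  using assms unfolding order_eq by blast

lemma elt_in_field [simp]: "elt m n \<in> quad_field D"
  unfolding elt_def using conj_add conj_mult by simp

lemma order_sub_field: "x \<in> quad_order D \<Longrightarrow> x \<in> quad_field D"
  by (auto elim: orderE)

lemma elt_add: "elt m n + elt m' n' = elt (m + m') (n + n')"
  unfolding elt_def by (simp add: algebra_simps)

lemma elt_minus: "- elt m n = elt (- m) (- n)"
  unfolding elt_def by (simp add: algebra_simps)

lemma elt_diff: "elt m n - elt m' n' = elt (m - m') (n - n')"
  unfolding elt_def by (simp add: algebra_simps)

lemma elt_mult: "elt m n * elt m' n' = elt (m * m' - n * n' * gnorm) (m * n' + n * m' + n * n' * int D)"
proof -
  have "elt m n * elt m' n' = of_int (m * m') + of_int (m * n' + n * m') * gen + of_int (n * n') * (gen * gen)"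
    unfolding elt_def by (simp add: algebra_simps)
  also have "\<dots> = elt (m * m' - n * n' * gnorm) (m * n' + n * m' + n * n' * int D)"
    unfolding elt_def gen_sq by (simp add: algebra_simps)
  finally show ?thesis .
qed

lemma elt_of_int: "of_int m = elt m 0" unfolding elt_def by simp
lemma elt_0: "0 = elt 0 0" unfolding elt_def by simp
lemma elt_1: "1 = elt 1 0" unfolding elt_def by simp
lemma elt_gen: "gen = elt 0 1" unfolding elt_def by simp

lemma conj_elt: "quad_conj D (elt m n) = elt (m + n * int D) (- n)"
proof -
  have "quad_conj D (elt m n) = of_int m + of_int n * (real D - gen)"
    unfolding elt_def using conj_add[of "of_int m" "of_int n * gen"] conj_mult[of "of_int n" gen] by simp
  then show ?thesis unfolding elt_def by (simp add: algebra_simps)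
qed

lemma tr_elt_div: "quad_tr D (elt m n / rootD) = of_int n"
proof -
  have "quad_tr D (elt m n / rootD) = (elt m n - quad_conj D (elt m n)) / rootD"
    unfolding quad_tr_def using conj_div_rootD[of "elt m n"] by (simp add: diff_divide_distrib)
  also have "elt m n - quad_conj D (elt m n) = of_int n * rootD"
    unfolding conj_elt elt_diff gen_diff_conj[symmetric] unfolding elt_def by (simp add: algebra_simps)
  finally show ?thesis using rootD_pos by simp
qed

lemma genpoly4: "4 * genpoly c = (2 * c + int D)\<^sup>2 - int D"
  using gnorm4 unfolding genpoly_def by (simp add: power2_eq_square algebra_simps)

lemma genpoly_diff: "genpoly c - genpoly c' = (c - c') * (c + c' + int D)"
  unfolding genpoly_def by (simp add: power2_eq_square algebra_simps)

lemma elt_genpoly: "elt c 1 * elt (- int D - c) 1 = elt (- genpoly c) 0"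
  unfolding elt_mult genpoly_def by (simp add: power2_eq_square algebra_simps)

lemma order_add: "x \<in> quad_order D \<Longrightarrow> y \<in> quad_order D \<Longrightarrow> x + y \<in> quad_order D"
  by (auto elim!: orderE simp: elt_add)
lemma order_mult: "x \<in> quad_order D \<Longrightarrow> y \<in> quad_order D \<Longrightarrow> x * y \<in> quad_order D"
  by (auto elim!: orderE simp: elt_mult)
lemma order_minus: "x \<in> quad_order D \<Longrightarrow> - x \<in> quad_order D"
  by (auto elim!: orderE simp: elt_minus)
lemma order_0 [simp]: "0 \<in> quad_order D" and order_1 [simp]: "1 \<in> quad_order D"
  and order_of_int [simp]: "of_int m \<in> quad_order D" and order_gen [simp]: "gen \<in> quad_order D"
  using elt_0 elt_1 elt_of_int elt_gen elt_in_order by metis+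

end

lemma ring_on_simps [simp]:
  "carrier (ring_on R) = R" "x \<otimes>\<^bsub>ring_on R\<^esub> y = x * y" "\<one>\<^bsub>ring_on R\<^esub> = 1"
  "\<zero>\<^bsub>ring_on R\<^esub> = 0" "x \<oplus>\<^bsub>ring_on R\<^esub> y = x + y"
  unfolding ring_on_def by simp_all

lemma cring_ring_on:
  assumes "0 \<in> R" "1 \<in> R" "\<And>x y. x \<in> R \<Longrightarrow> y \<in> R \<Longrightarrow> x + y \<in> R"
    "\<And>x y. x \<in> R \<Longrightarrow> y \<in> R \<Longrightarrow> x * y \<in> R" "\<And>x. x \<in> R \<Longrightarrow> - x \<in> R"
  shows "cring (ring_on R)"
proof (rule cringI)
  show "abelian_group (ring_on R)"
    by (rule abelian_groupI) (auto simp: assms algebra_simps intro!: bexI[of _ "- x" for x] assms)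
  show "comm_monoid (ring_on R)"
    by (rule comm_monoidI) (auto simp: assms algebra_simps)
qed (auto simp: algebra_simps)

context quadratic_discriminant begin

lemma cring_order: "cring (ring_on (quad_order D))"
  by (rule cring_ring_on) (auto intro: order_add order_mult order_minus)

lemma ideal_order_iff:
  "ideal I (ring_on (quad_order D)) \<longleftrightarrow>
     I \<subseteq> quad_order D \<and> 0 \<in> I \<and> (\<forall>x\<in>I. \<forall>y\<in>I. x + y \<in> I) \<and> (\<forall>x\<in>I. \<forall>a\<in>quad_order D. a * x \<in> I)"
    (is "?L \<longleftrightarrow> ?R")
proof
  assume L: ?L
  interpret ideal I "ring_on (quad_order D)" by (rule L)
  show ?R using a_subset additive_subgroup.zero_closed[OF additive_subgroup_axioms]
      additive_subgroup.a_closed[OF additive_subgroup_axioms] I_l_closed by auto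
next
  assume R: ?R
  interpret cring "ring_on (quad_order D)" by (rule cring_order)
  have mi: "- x \<in> I" if "x \<in> I" for x
  proof -
    have "of_int (-1) * x \<in> I" using R that order_of_int by blast
    then show ?thesis by simp
  qed
  show ?L
  proof (rule idealI)
    show "ring (ring_on (quad_order D))" by (rule ring_axioms)
    show "subgroup I (add_monoid (ring_on (quad_order D)))"
    proof (rule add.subgroupI)
      show "I \<subseteq> carrier (ring_on (quad_order D))" using R by auto
      show "I \<noteq> {}" using R by auto
    next
      fix a assume a: "a \<in> I"
      have "\<ominus>\<^bsub>ring_on (quad_order D)\<^esub> a = - a"
        by (rule minus_equality) (use a R mi in \<open>auto intro: order_minus\<close>)
      then show "\<ominus>\<^bsub>ring_on (quad_order D)\<^esub> a \<in> I" using mi a by simp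
    next
      fix a b assume "a \<in> I" "b \<in> I" then show "a \<oplus>\<^bsub>ring_on (quad_order D)\<^esub> b \<in> I" using R by simp
    qed
  qed (use R in \<open>auto simp: mult.commute\<close>)
qed

end

section \<open>Prime ideals above a rational prime\<close>

lemma gcd_prime_mult:
  assumes "prime (p::int)" "\<not> p dvd x" shows "gcd (p * p) (p * x) = p"
proof -
  have "coprime p x" using assms by (simp add: prime_imp_coprime)
  then have "\<bar>p\<bar> * gcd p x = p" using prime_ge_0_int[OF assms(1)] by (simp add: coprime_iff_gcd_eq_1)
  then show ?thesis by (simp only: gcd_mult_distrib_int)
qed

context quadratic_discriminant begin

text \<open>If \<open>p\<close> divides \<open>genpoly c\<close>, this is the kernel of the ring homomorphism to \<open>\<int>/p\<close> that sends
  \<open>\<gamma>\<close> to \<open>- c\<close>; it is spanned by \<open>p\<close> and \<open>\<gamma> + c\<close>. For prime \<open>p\<close> these are the primes above \<open>p\<close>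
  other than \<open>(p)\<close>, for \<open>p = d\<close> the primitive ideals of norm \<open>d\<close>.\<close>

definition root_ideal :: "int \<Rightarrow> int \<Rightarrow> real set" where
  "root_ideal p c = {elt a b | a b. p dvd a - b * c}"

lemma elt_in_root_ideal [simp]: "elt a b \<in> root_ideal p c \<longleftrightarrow> p dvd a - b * c"
  unfolding root_ideal_def by auto

lemma root_ideal_sub: "x \<in> root_ideal p c \<Longrightarrow> x \<in> quad_order D"
  unfolding root_ideal_def by auto

lemma root_ideal_ideal:
  assumes "p dvd genpoly c"
  shows "ideal (root_ideal p c) (ring_on (quad_order D))"
  unfolding ideal_order_iff
proof (intro conjI ballI)
  show "root_ideal p c \<subseteq> quad_order D" using root_ideal_sub by blast
  show "0 \<in> root_ideal p c" unfolding elt_0 elt_in_root_ideal by simp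
next
  fix x y assume "x \<in> root_ideal p c" "y \<in> root_ideal p c"
  then obtain a b a' b' where *: "x = elt a b" "p dvd a - b * c" "y = elt a' b'" "p dvd a' - b' * c"
    unfolding root_ideal_def by blast
  have "a + a' - (b + b') * c = (a - b * c) + (a' - b' * c)" by (simp add: algebra_simps)
  also have "p dvd \<dots>" by (rule dvd_add[OF *(2) *(4)])
  finally have "p dvd a + a' - (b + b') * c" .
  then show "x + y \<in> root_ideal p c" using * by (simp add: elt_add)
next
  fix x y assume "x \<in> root_ideal p c" "y \<in> quad_order D"
  then obtain a b a' b' where *: "x = elt a b" "p dvd a - b * c" "y = elt a' b'"
    unfolding root_ideal_def order_eq by blast
  have "(a' * a - b' * b * gnorm) - (a' * b + b' * a + b' * b * int D) * c
      = (a' - b' * c) * (a - b * c) - b' * b * genpoly c"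
    unfolding genpoly_def by (simp add: algebra_simps power2_eq_square)
  then show "y * x \<in> root_ideal p c" using * assms by (simp add: elt_mult)
qed

lemma root_ideal_prime:
  assumes "p dvd genpoly c" "prime p"
  shows "primeideal (root_ideal p c) (ring_on (quad_order D))"
proof (rule primeidealI)
  show "ideal (root_ideal p c) (ring_on (quad_order D))" by (rule root_ideal_ideal[OF assms(1)])
  show "cring (ring_on (quad_order D))" by (rule cring_order)
  have "\<not> p dvd 1 - 0 * c" using prime_gt_1_int[OF assms(2)] by simp
  then have "elt 1 0 \<notin> root_ideal p c" by simp
  then show "carrier (ring_on (quad_order D)) \<noteq> root_ideal p c"
    using elt_in_order[of 1 0] unfolding ring_on_simps by blast
next
  fix x y assume "x \<in> carrier (ring_on (quad_order D))" "y \<in> carrier (ring_on (quad_order D))"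
    and xy: "x \<otimes>\<^bsub>ring_on (quad_order D)\<^esub> y \<in> root_ideal p c"
  then obtain a b a' b' where *: "x = elt a b" "y = elt a' b'" by (auto elim!: orderE)
  have "(a * a' - b * b' * gnorm) - (a * b' + b * a' + b * b' * int D) * c
      = (a - b * c) * (a' - b' * c) - b * b' * genpoly c"
    unfolding genpoly_def by (simp add: algebra_simps power2_eq_square)
  moreover have "p dvd (a * a' - b * b' * gnorm) - (a * b' + b * a' + b * b' * int D) * c"
    using xy * by (simp add: elt_mult)
  ultimately have "p dvd (a - b * c) * (a' - b' * c) - b * b' * genpoly c" by simp
  then have "p dvd (a - b * c) * (a' - b' * c)"
    using assms(1) by (metis dvd_diff_commute dvd_mult zdvd_zdiffD)
  then show "x \<in> root_ideal p c \<or> y \<in> root_ideal p c"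
    using * assms(2) by (simp add: prime_dvd_mult_iff)
qed

lemma pO_eq: "cgenideal (ring_on (quad_order D)) (of_int p) = {elt (p * a) (p * b) | a b. True}"
proof -
  have "elt a b * of_int p = elt (p * a) (p * b)" for a b
    unfolding elt_of_int elt_mult by (simp add: mult.commute)
  then show ?thesis unfolding cgenideal_def ring_on_simps order_eq by (auto, metis)
qed

lemma elt_in_pO: "elt a b \<in> cgenideal (ring_on (quad_order D)) (of_int p) \<longleftrightarrow> p dvd a \<and> p dvd b"
  unfolding pO_eq by (auto elim!: dvdE)

lemma p_in_pO: "of_int p \<in> cgenideal (ring_on (quad_order D)) (of_int p)"
  unfolding elt_of_int using elt_in_pO[of p 0 p] by (simp add: elt_of_int)

lemma pO_ideal: "ideal (cgenideal (ring_on (quad_order D)) (of_int p)) (ring_on (quad_order D))"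
  by (rule cring.cgenideal_ideal[OF cring_order]) simp

lemma coprime_prime_int:
  assumes "prime (p::int)" "\<not> p dvd b" obtains u v where "b * u = 1 + p * v"
proof -
  have "coprime p b" using assms by (simp add: prime_imp_coprime)
  then obtain x y where "x * p + y * b = 1" using bezout_int[of p b] by (auto simp: coprime_iff_gcd_eq_1)
  then have "b * y = 1 + p * (- x)" by (simp add: algebra_simps)
  then show thesis by (rule that)
qed

lemma prime_above_int:
  assumes P: "primeideal P (ring_on (quad_order D))" and p: "prime p" "of_int p \<in> P"
  shows "elt a 0 \<in> P \<longleftrightarrow> p dvd a"
proof -
  interpret P: primeideal P "ring_on (quad_order D)" by (rule P)
  have id: "ideal P (ring_on (quad_order D))" by (rule P.is_ideal)
  note I = id[unfolded ideal_order_iff]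
  show ?thesis
  proof
    assume a: "elt a 0 \<in> P"
    show "p dvd a"
    proof (rule ccontr)
      assume "\<not> p dvd a"
      then obtain u v where uv: "a * u = 1 + p * v" using coprime_prime_int p by blast
      have "elt u 0 * elt a 0 \<in> P" "elt (- v) 0 * of_int p \<in> P" using I a p by blast+
      then have "elt u 0 * elt a 0 + elt (- v) 0 * of_int p \<in> P" using I by blast
      moreover have "elt u 0 * elt a 0 + elt (- v) 0 * of_int p = elt 1 0"
        unfolding elt_of_int elt_mult elt_add using uv by (simp add: algebra_simps)
      ultimately have one: "1 \<in> P" unfolding elt_1 by simp
      have "quad_order D \<subseteq> P" using I one by (metis mult.right_neutral subsetI)
      then show False using P.I_notcarr I by auto
    qed
  next
    assume "p dvd a"
    then obtain k where "a = p * k" by blast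
    then have "elt a 0 = elt k 0 * of_int p" unfolding elt_of_int elt_mult by (simp add: algebra_simps)
    then show "elt a 0 \<in> P" using I p by auto
  qed
qed

text \<open>An element \<open>a + b \<gamma>\<close> of \<open>P\<close> outside \<open>(p)\<close> has \<open>b\<close> prime to \<open>p\<close>, since \<open>P \<inter> \<int> = p\<int>\<close>. Multiplying by an
  inverse of \<open>b\<close> modulo \<open>p\<close> turns it into an element \<open>\<gamma> + c\<close> of \<open>P\<close>, whose norm is divisible by \<open>p\<close>.\<close>

lemma prime_above_classification:
  assumes P: "primeideal P (ring_on (quad_order D))" and p: "prime p" "of_int p \<in> P"
    and ne: "P \<noteq> cgenideal (ring_on (quad_order D)) (of_int p)"
  shows "\<exists>c. p dvd genpoly c \<and> P = root_ideal p c"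
proof -
  interpret P: primeideal P "ring_on (quad_order D)" by (rule P)
  have id: "ideal P (ring_on (quad_order D))" by (rule P.is_ideal)
  note I = id[unfolded ideal_order_iff]
  note int = prime_above_int[OF P p]
  have sub: "cgenideal (ring_on (quad_order D)) (of_int p) \<subseteq> P"
    unfolding cgenideal_def using I p by auto
  then obtain x where x: "x \<in> P" "x \<notin> cgenideal (ring_on (quad_order D)) (of_int p)" using ne by blast
  then obtain a b where ab: "x = elt a b" using I by (blast elim: orderE)
  have nb: "\<not> p dvd b"
  proof
    assume "p dvd b"
    then obtain k where k: "b = p * k" by blast
    have "elt 0 (- k) * of_int p \<in> P" using I p by blast
    then have "x + elt 0 (- k) * of_int p \<in> P" using I x by blast
    moreover have "x + elt 0 (- k) * of_int p = elt a 0"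
      unfolding ab elt_of_int elt_mult elt_add using k by (simp add: algebra_simps)
    ultimately have "p dvd a" using int by simp
    then show False using x ab \<open>p dvd b\<close> elt_in_pO by simp
  qed
  then obtain u v where uv: "b * u = 1 + p * v" using coprime_prime_int p by blast
  define c where "c = u * a"
  have "elt u 0 * x \<in> P" "elt 0 (- v) * of_int p \<in> P" using I x p by blast+
  then have "elt u 0 * x + elt 0 (- v) * of_int p \<in> P" using I by blast
  moreover have "elt u 0 * x + elt 0 (- v) * of_int p = elt c 1"
    unfolding ab elt_of_int elt_mult elt_add c_def using uv by (simp add: algebra_simps)
  ultimately have c: "elt c 1 \<in> P" by simp
  have "elt (- int D - c) 1 * elt c 1 \<in> P" using I c by blast
  then have "elt (- genpoly c) 0 \<in> P" using elt_genpoly by (metis mult.commute)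
  then have root: "p dvd genpoly c" using int by simp
  have "elt m n \<in> P \<longleftrightarrow> p dvd m - n * c" for m n
  proof -
    have n: "elt n 0 * elt c 1 \<in> P" "elt (- n) 0 * elt c 1 \<in> P" using I c by blast+
    have "elt m n \<in> P \<longleftrightarrow> elt (m - n * c) 0 \<in> P"
    proof
      assume "elt m n \<in> P"
      then have "elt m n + elt (- n) 0 * elt c 1 \<in> P" using I n by blast
      then show "elt (m - n * c) 0 \<in> P" unfolding elt_mult elt_add by (simp add: algebra_simps)
    next
      assume "elt (m - n * c) 0 \<in> P"
      then have "elt (m - n * c) 0 + elt n 0 * elt c 1 \<in> P" using I n by blast
      then show "elt m n \<in> P" unfolding elt_mult elt_add by (simp add: algebra_simps)
    qed
    then show ?thesis using int by simp
  qed
  then have "P = root_ideal p c"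
    using I unfolding root_ideal_def by (auto elim!: orderE)
  then show ?thesis using root by blast
qed

lemma root_ideal_eq_iff:
  assumes "p dvd c - c'" shows "root_ideal p c = root_ideal p c'"
proof -
  have "p dvd a - b * c \<longleftrightarrow> p dvd a - b * c'" for a b
  proof -
    obtain k where k: "c - c' = p * k" using assms by blast
    have "a - b * c = (a - b * c') - b * (c - c')" by (simp add: algebra_simps)
    also have "\<dots> = (a - b * c') + (- (b * k)) * p" unfolding k by (simp add: algebra_simps)
    finally show ?thesis by (simp only: dvd_add_times_triv_right_iff)
  qed
  then show ?thesis unfolding root_ideal_def by simp
qed

lemma root_ideal_eqD: "root_ideal p c = root_ideal p c' \<Longrightarrow> p dvd c - c'"
  using elt_in_root_ideal[of c 1 p c] elt_in_root_ideal[of c 1 p c'] by simp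

text \<open>In the absence of a root the norm form represents zero modulo \<open>p\<close> only trivially, and the norm is
  multiplicative.\<close>

lemma inert_iff_no_root:
  assumes p: "prime p"
  shows "primeideal (cgenideal (ring_on (quad_order D)) (of_int p)) (ring_on (quad_order D))
    \<longleftrightarrow> \<not> (\<exists>c. p dvd genpoly c)" (is "primeideal ?pO _ \<longleftrightarrow> _")
proof
  assume P: "primeideal ?pO (ring_on (quad_order D))"
  interpret P: primeideal ?pO "ring_on (quad_order D)" by (rule P)
  show "\<not> (\<exists>c. p dvd genpoly c)"
  proof
    assume "\<exists>c. p dvd genpoly c"
    then obtain c where c: "p dvd genpoly c" ..
    have "elt c 1 * elt (- int D - c) 1 \<in> ?pO" unfolding elt_genpoly elt_in_pO using c by simp
    then have "elt c 1 \<in> ?pO \<or> elt (- int D - c) 1 \<in> ?pO"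
      using P.I_prime[of "elt c 1" "elt (- int D - c) 1"] by simp
    then show False unfolding elt_in_pO using prime_gt_1_int[OF p] by auto
  qed
next
  assume nr: "\<not> (\<exists>c. p dvd genpoly c)"
  have norm: "p dvd m \<and> p dvd n" if "p dvd m * m + int D * m * n + gnorm * n * n" for m n
  proof -
    have "p dvd n"
    proof (rule ccontr)
      assume "\<not> p dvd n"
      then obtain u v where uv: "n * u = 1 + p * v" using coprime_prime_int p by blast
      have "genpoly (u * m) = u * u * (m * m + int D * m * n + gnorm * n * n)
          - (n * u - 1) * (int D * m * u + gnorm * (n * u + 1))"
        unfolding genpoly_def by (simp add: algebra_simps power2_eq_square)
      then have "p dvd genpoly (u * m)" using that uv by simp
      then show False using nr by blast
    qed
    moreover have "p dvd m * m"
      using that \<open>p dvd n\<close> by (metis dvd_add_left_iff dvd_mult mult.assoc)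
    ultimately show ?thesis using p by (simp add: prime_dvd_mult_iff)
  qed
  show "primeideal ?pO (ring_on (quad_order D))"
  proof (rule primeidealI)
    show "ideal ?pO (ring_on (quad_order D))" by (rule pO_ideal)
    show "cring (ring_on (quad_order D))" by (rule cring_order)
    have "elt 1 0 \<notin> ?pO" unfolding elt_in_pO using prime_gt_1_int[OF p] by simp
    then show "carrier (ring_on (quad_order D)) \<noteq> ?pO" by auto
  next
    fix x y assume "x \<in> carrier (ring_on (quad_order D))" "y \<in> carrier (ring_on (quad_order D))"
      and xy: "x \<otimes>\<^bsub>ring_on (quad_order D)\<^esub> y \<in> ?pO"
    then obtain a b a' b' where *: "x = elt a b" "y = elt a' b'" by (auto elim!: orderE)
    define N where "N m n = m * m + int D * m * n + gnorm * n * n" for m n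
    have d: "p dvd a * a' - b * b' * gnorm" "p dvd a * b' + b * a' + b * b' * int D"
      using xy * by (auto simp: elt_mult elt_in_pO)
    have "N a b * N a' b' = N (a * a' - b * b' * gnorm) (a * b' + b * a' + b * b' * int D)"
      unfolding N_def by (simp add: algebra_simps)
    also have "p dvd \<dots>" unfolding N_def using d by (auto intro!: dvd_add)
    finally have "p dvd N a b \<or> p dvd N a' b'" using p by (simp add: prime_dvd_mult_iff)
    then show "x \<in> ?pO \<or> y \<in> ?pO" using norm unfolding N_def * elt_in_pO by blast
  qed
qed

lemma ideal_prod_sub:
  assumes "ideal K (ring_on (quad_order D))" "\<And>x y. x \<in> I \<Longrightarrow> y \<in> J \<Longrightarrow> x * y \<in> K"
  shows "ideal_prod (ring_on (quad_order D)) I J \<subseteq> K"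
proof
  fix z assume "z \<in> ideal_prod (ring_on (quad_order D)) I J"
  then show "z \<in> K"
    by (induction rule: ideal_prod.induct) (use assms ideal_order_iff in auto)
qed

text \<open>The product contains \<open>p\<^sup>2\<close>, \<open>genpoly c\<close> and \<open>p (2 c + D)\<close>. The square of \<open>2 c + D\<close> is \<open>D\<close> modulo \<open>p\<close>, so
  that the first and the third have greatest common divisor \<open>p\<close> unless \<open>p\<close> divides \<open>D\<close>; in that case
  the first two have.\<close>

lemma root_ideal_conj_prod:
  assumes p: "prime p" and c: "p dvd genpoly c" and h: "\<not> p dvd int D \<or> \<not> p * p dvd genpoly c"
  shows "ideal_prod (ring_on (quad_order D)) (root_ideal p c) (root_ideal p (- int D - c))
    = cgenideal (ring_on (quad_order D)) (of_int p)" (is "?IJ = ?pO")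
proof
  let ?c = "- int D - c"
  have c': "p dvd genpoly ?c" using c genpoly_diff[of ?c c] by (simp add: algebra_simps)
  show "?IJ \<subseteq> ?pO"
  proof (rule ideal_prod_sub[OF pO_ideal])
    fix x y assume "x \<in> root_ideal p c" "y \<in> root_ideal p ?c"
    then obtain a b a' b' k k' where *: "x = elt a b" "a - b * c = p * k" "y = elt a' b'" "a' - b' * ?c = p * k'"
      unfolding root_ideal_def by (blast elim: dvdE)
    then have a: "a = p * k + b * c" "a' = p * k' + b' * ?c" by simp_all
    have "a * a' - b * b' * gnorm = p * (k * p * k' + k * b' * ?c + b * c * k') - b * b' * genpoly c"
      unfolding a genpoly_def by (simp add: algebra_simps power2_eq_square)
    moreover have "a * b' + b * a' + b * b' * int D = p * (k * b' + b * k')"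
      unfolding a by (simp add: algebra_simps)
    ultimately show "x * y \<in> ?pO" unfolding * elt_mult elt_in_pO using c by simp
  qed
  have IJ: "ideal ?IJ (ring_on (quad_order D))"
    using ring.ideal_prod_is_ideal[OF cring.axioms(1)[OF cring_order] root_ideal_ideal[OF c] root_ideal_ideal[OF c']] .
  note I = IJ[unfolded ideal_order_iff]
  have prod: "x * y \<in> ?IJ" if "x \<in> root_ideal p c" "y \<in> root_ideal p ?c" for x y
    using ideal_prod.prod[OF that, of "ring_on (quad_order D)"] by simp
  have 1: "elt (p * p) 0 \<in> ?IJ"
    using prod[of "elt p 0" "elt p 0"] by (simp add: elt_mult)
  have 2: "elt (- genpoly c) 0 \<in> ?IJ"
    using prod[of "elt c 1" "elt ?c 1"] by (simp add: elt_genpoly)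
  have 3: "elt (p * (2 * c + int D)) 0 \<in> ?IJ"
  proof -
    have "elt c 1 * elt p 0 + elt (- 1) 0 * (elt p 0 * elt ?c 1) \<in> ?IJ"
      using I prod[of "elt c 1" "elt p 0"] prod[of "elt p 0" "elt ?c 1"] elt_in_order by simp
    then show ?thesis unfolding elt_mult elt_add by (simp add: algebra_simps)
  qed
  have comb: "elt (gcd m n) 0 \<in> ?IJ" if "elt m 0 \<in> ?IJ" "elt n 0 \<in> ?IJ" for m n
  proof -
    obtain u v where "u * m + v * n = gcd m n" using bezout_int by blast
    moreover have "elt u 0 * elt m 0 + elt v 0 * elt n 0 \<in> ?IJ" using I that elt_in_order by simp
    ultimately show ?thesis unfolding elt_mult elt_add by simp
  qed
  have "elt p 0 \<in> ?IJ"
  proof (cases "p dvd int D")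
    case False
    have "\<not> p dvd 2 * c + int D"
    proof
      assume "p dvd 2 * c + int D"
      then have "p dvd (2 * c + int D)\<^sup>2 - 4 * genpoly c" using c by (simp add: power2_eq_square)
      then show False using False genpoly4[of c] by simp
    qed
    then have "gcd (p * p) (p * (2 * c + int D)) = p" by (rule gcd_prime_mult[OF p])
    then show ?thesis using comb[OF 1 3] by simp
  next
    case True
    then have np: "\<not> p * p dvd genpoly c" using h by simp
    obtain k where k: "genpoly c = p * k" using c by blast
    have "\<not> p dvd - k" using np k by simp
    then have "gcd (p * p) (p * - k) = p" by (rule gcd_prime_mult[OF p])
    moreover have "elt (p * - k) 0 \<in> ?IJ" using 2 k by simp
    ultimately show ?thesis using comb[OF 1] by metis
  qed
  then have "a * elt p 0 \<in> ?IJ" if "a \<in> quad_order D" for a using I that by blast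
  then show "?pO \<subseteq> ?IJ" unfolding cgenideal_def by (auto simp: elt_of_int)
qed

lemma roots_mod_prime:
  assumes "prime p" "p dvd genpoly c" "p dvd genpoly c'"
  shows "p dvd c - c' \<or> p dvd c' - (- int D - c)"
proof -
  have "p dvd (c - c') * (c + c' + int D)" using assms genpoly_diff[of c c'] by (metis dvd_diff)
  then have "p dvd c - c' \<or> p dvd c + c' + int D" using assms(1) by (simp add: prime_dvd_mult_iff)
  then show ?thesis by (simp add: algebra_simps)
qed

lemma root_self_conj_iff:
  assumes "prime p" "p dvd genpoly c"
  shows "p dvd c - (- int D - c) \<longleftrightarrow> p dvd int D"
proof -
  have e: "c - (- int D - c) = 2 * c + int D" by simp
  have "p dvd (2 * c + int D)\<^sup>2 \<longleftrightarrow> p dvd int D"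
    using genpoly4[of c] assms(2)
    by (metis add_diff_cancel_left' diff_add_cancel dvd_add_right_iff dvd_mult)
  then show ?thesis unfolding e using assms(1) by (simp add: prime_dvd_power_iff)
qed

text \<open>The product of \<open>(p)\<close> and \<open>Q\<close> is \<open>p Q\<close>, which contains \<open>p\<close> only if \<open>1 \<in> Q\<close>.\<close>

lemma pO_idempotent_false:
  assumes p: "prime p" and Q: "ideal Q (ring_on (quad_order D))" "1 \<notin> Q"
    and e: "cgenideal (ring_on (quad_order D)) (of_int p) =
      ideal_prod (ring_on (quad_order D)) (cgenideal (ring_on (quad_order D)) (of_int p)) Q \<or>
      cgenideal (ring_on (quad_order D)) (of_int p) =
      ideal_prod (ring_on (quad_order D)) Q (cgenideal (ring_on (quad_order D)) (of_int p))"
  shows False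
proof -
  let ?K = "{of_int p * q | q. q \<in> Q}"
  note IQ = Q(1)[unfolded ideal_order_iff]
  have K: "ideal ?K (ring_on (quad_order D))"
    unfolding ideal_order_iff
  proof (intro conjI ballI)
    show "?K \<subseteq> quad_order D" using IQ order_mult order_of_int by blast
    show "0 \<in> ?K" using IQ by force
    show "x + y \<in> ?K" if xy: "x \<in> ?K" "y \<in> ?K" for x y
    proof -
      obtain q q' where "x = of_int p * q" "y = of_int p * q'" "q \<in> Q" "q' \<in> Q" using xy by blast
      then have "x + y = of_int p * (q + q')" "q + q' \<in> Q" using IQ by (auto simp: algebra_simps)
      then show ?thesis by blast
    qed
    show "a * x \<in> ?K" if xa: "x \<in> ?K" "a \<in> quad_order D" for x a
    proof -
      obtain q where "x = of_int p * q" "q \<in> Q" using xa by blast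
      then have "a * x = of_int p * (a * q)" "a * q \<in> Q" using IQ xa by (auto simp: algebra_simps)
      then show ?thesis by blast
    qed
  qed
  have "x * q \<in> ?K \<and> q * x \<in> ?K" if xq: "x \<in> cgenideal (ring_on (quad_order D)) (of_int p)" "q \<in> Q" for x q
  proof -
    obtain a where "x = a * of_int p" "a \<in> quad_order D" using xq unfolding cgenideal_def by auto
    then have "x * q = of_int p * (a * q)" "q * x = of_int p * (a * q)" "a * q \<in> Q"
      using IQ xq by (auto simp: algebra_simps)
    then show ?thesis by blast
  qed
  then have prods: "\<And>x q. x \<in> cgenideal (ring_on (quad_order D)) (of_int p) \<Longrightarrow> q \<in> Q \<Longrightarrow> x * q \<in> ?K"
    "\<And>q x. q \<in> Q \<Longrightarrow> x \<in> cgenideal (ring_on (quad_order D)) (of_int p) \<Longrightarrow> q * x \<in> ?K" by blast+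
  have "ideal_prod (ring_on (quad_order D)) (cgenideal (ring_on (quad_order D)) (of_int p)) Q \<subseteq> ?K"
    by (rule ideal_prod_sub[OF K prods(1)])
  moreover have "ideal_prod (ring_on (quad_order D)) Q (cgenideal (ring_on (quad_order D)) (of_int p)) \<subseteq> ?K"
    by (rule ideal_prod_sub[OF K prods(2)])
  ultimately have "cgenideal (ring_on (quad_order D)) (of_int p) \<subseteq> ?K"
    using e by (elim disjE) simp_all
  then have "of_int p \<in> ?K" using p_in_pO by blast
  then obtain q where "of_int p = of_int p * q" "q \<in> Q" by blast
  then show False using p Q(2) by simp
qed

text \<open>Both factors contain \<open>p\<close>, and neither is \<open>(p)\<close> itself.\<close>

lemma prime_prod_factors:
  assumes p: "prime p"
    and P: "primeideal P (ring_on (quad_order D))" and Q: "primeideal Q (ring_on (quad_order D))"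
    and e: "cgenideal (ring_on (quad_order D)) (of_int p) = ideal_prod (ring_on (quad_order D)) P Q"
  shows "\<exists>c c'. p dvd genpoly c \<and> p dvd genpoly c' \<and> P = root_ideal p c \<and> Q = root_ideal p c'"
proof -
  have one: "1 \<notin> I" if I: "primeideal I (ring_on (quad_order D))" for I
  proof
    assume "1 \<in> I"
    interpret I: primeideal I "ring_on (quad_order D)" by (rule I)
    have "quad_order D \<subseteq> I" using \<open>1 \<in> I\<close> I.is_ideal[unfolded ideal_order_iff] by (metis mult.right_neutral subsetI)
    then show False using I.I_notcarr I.is_ideal[unfolded ideal_order_iff] by auto
  qed
  have iP: "ideal P (ring_on (quad_order D))" and iQ: "ideal Q (ring_on (quad_order D))"
    using P Q by (simp_all add: primeideal.axioms(1))
  have sP: "ideal_prod (ring_on (quad_order D)) P Q \<subseteq> P"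
  proof (rule ideal_prod_sub[OF iP])
    fix x y assume "x \<in> P" "y \<in> Q"
    then have "y * x \<in> P" using iP iQ unfolding ideal_order_iff by blast
    then show "x * y \<in> P" by (simp add: mult.commute)
  qed
  have sQ: "ideal_prod (ring_on (quad_order D)) P Q \<subseteq> Q"
  proof (rule ideal_prod_sub[OF iQ])
    fix x y assume "x \<in> P" "y \<in> Q"
    then show "x * y \<in> Q" using iP iQ unfolding ideal_order_iff by blast
  qed
  have pP: "of_int p \<in> P" "of_int p \<in> Q" using sP sQ e p_in_pO by blast+
  have "P \<noteq> cgenideal (ring_on (quad_order D)) (of_int p)"
    using pO_idempotent_false[OF p iQ one[OF Q]] e by metis
  moreover have "Q \<noteq> cgenideal (ring_on (quad_order D)) (of_int p)"
    using pO_idempotent_false[OF p iP one[OF P]] e by metis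
  ultimately show ?thesis
    using prime_above_classification[OF P p pP(1)] prime_above_classification[OF Q p pP(2)] by blast
qed

text \<open>The ideals of the roots \<open>c\<close> and \<open>- D - c\<close> are conjugate with product \<open>(p)\<close>, and the two roots agree
  modulo \<open>p\<close> exactly if \<open>p\<close> divides \<open>D\<close>. The hypothesis on \<open>p\<^sup>2\<close> expresses that the order is maximal
  at \<open>p\<close>.\<close>

lemma ramified_iff:
  assumes p: "prime p" and max: "\<And>c. p dvd int D \<Longrightarrow> \<not> p * p dvd genpoly c"
    and root: "p dvd int D \<Longrightarrow> \<exists>c. p dvd genpoly c"
  shows "(\<exists>P. primeideal P (ring_on (quad_order D)) \<and>
      cgenideal (ring_on (quad_order D)) (of_int p) = ideal_prod (ring_on (quad_order D)) P P)
    \<longleftrightarrow> p dvd int D"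
proof
  assume "p dvd int D"
  then obtain c where c: "p dvd genpoly c" using root by blast
  have "root_ideal p (- int D - c) = root_ideal p c"
    using root_ideal_eq_iff root_self_conj_iff[OF p c] \<open>p dvd int D\<close> by metis
  then show "\<exists>P. primeideal P (ring_on (quad_order D)) \<and>
      cgenideal (ring_on (quad_order D)) (of_int p) = ideal_prod (ring_on (quad_order D)) P P"
    using root_ideal_conj_prod[OF p c] root_ideal_prime[OF c p] max \<open>p dvd int D\<close> by metis
next
  assume "\<exists>P. primeideal P (ring_on (quad_order D)) \<and>
      cgenideal (ring_on (quad_order D)) (of_int p) = ideal_prod (ring_on (quad_order D)) P P"
  then obtain P where P: "primeideal P (ring_on (quad_order D))"
    "cgenideal (ring_on (quad_order D)) (of_int p) = ideal_prod (ring_on (quad_order D)) P P" by blast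
  obtain c where c: "p dvd genpoly c" "P = root_ideal p c"
    using prime_prod_factors[OF p P(1) P(1) P(2)] by blast
  show "p dvd int D"
  proof (rule ccontr)
    assume np: "\<not> p dvd int D"
    have "elt c 1 * elt c 1 \<in> ideal_prod (ring_on (quad_order D)) P P"
      using ideal_prod.prod[of "elt c 1" P "elt c 1" P "ring_on (quad_order D)"] c by simp
    then have "p dvd c * 1 + 1 * c + 1 * 1 * int D"
      unfolding P(2)[symmetric] elt_mult elt_in_pO by simp
    then have "p dvd c - (- int D - c)" by (simp add: algebra_simps)
    then show False using root_self_conj_iff[OF p c(1)] np by simp
  qed
qed

lemma split_iff:
  assumes p: "prime p" and max: "\<And>c. p dvd int D \<Longrightarrow> \<not> p * p dvd genpoly c"
  shows "(\<exists>P Q. primeideal P (ring_on (quad_order D)) \<and> primeideal Q (ring_on (quad_order D)) \<and> P \<noteq> Q \<and>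
      cgenideal (ring_on (quad_order D)) (of_int p) = ideal_prod (ring_on (quad_order D)) P Q)
    \<longleftrightarrow> \<not> p dvd int D \<and> (\<exists>c. p dvd genpoly c)" (is "?L \<longleftrightarrow> ?R")
proof
  assume ?R
  then obtain c where c: "p dvd genpoly c" "\<not> p dvd int D" by blast
  have c': "p dvd genpoly (- int D - c)" using c genpoly_diff[of "- int D - c" c] by (simp add: algebra_simps)
  have "root_ideal p c \<noteq> root_ideal p (- int D - c)"
    using root_self_conj_iff[OF p c(1)] c(2) root_ideal_eqD by blast
  then show ?L using root_ideal_conj_prod[OF p c(1)] root_ideal_prime[OF c(1) p] root_ideal_prime[OF c' p] c(2) by metis
next
  assume ?L
  then obtain P Q where PQ: "primeideal P (ring_on (quad_order D))" "primeideal Q (ring_on (quad_order D))" "P \<noteq> Q"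
      "cgenideal (ring_on (quad_order D)) (of_int p) = ideal_prod (ring_on (quad_order D)) P Q" by blast
  obtain c c' where c: "p dvd genpoly c" "p dvd genpoly c'" "P = root_ideal p c" "Q = root_ideal p c'"
    using prime_prod_factors[OF p PQ(1,2,4)] by blast
  have nc: "\<not> p dvd c - c'" using PQ(3) c root_ideal_eq_iff by blast
  have "\<not> p dvd int D"
  proof
    assume d: "p dvd int D"
    have "p dvd c' - (- int D - c)" using roots_mod_prime[OF p c(1,2)] nc by blast
    moreover have "p dvd c - (- int D - c)" using root_self_conj_iff[OF p c(1)] d by simp
    ultimately have "p dvd (c - (- int D - c)) - (c' - (- int D - c))" by (rule dvd_diff[rotated])
    then show False using nc by simp
  qed
  then show ?R using c by blast
qed

end

section \<open>The ring of integers and the conductor\<close>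

text \<open>Gauss's lemma. The primitive part \<open>q\<close> of the quadratic polynomial divides a multiple of a monic
  integral polynomial with root \<open>x\<close>, because the remainder of the pseudo division is linear and \<open>x\<close> is
  irrational. Comparing contents, the leading coefficient of \<open>q\<close> is a unit.\<close>

lemma quadratic_equation_integral:
  fixes x :: real and A B C :: int
  assumes x: "algebraic_int x" and eq: "of_int A * x\<^sup>2 + of_int B * x + of_int C = 0" and A: "A \<noteq> 0"
    and indep: "\<And>u v :: int. of_int u * x + of_int v = 0 \<Longrightarrow> u = 0 \<and> v = 0"
  shows "A dvd B \<and> A dvd C"
proof -
  obtain p :: "int poly" where p: "poly (map_poly of_int p) x = 0" "lead_coeff p = 1"
    using x unfolding algebraic_int_altdef_ipoly by blast
  define q0 where "q0 = [:C, B, A:]"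
  define q where "q = primitive_part q0"
  have q0: "q0 \<noteq> 0" unfolding q0_def using A by simp
  then have q: "q \<noteq> 0" "Polynomial.content q = 1" unfolding q_def by auto
  have sm: "Polynomial.smult (Polynomial.content q0) q = q0" unfolding q_def by simp
  have degq: "degree q = 2" unfolding q_def degree_primitive_part q0_def using A by simp
  have xq0: "poly (map_poly of_int q0) x = 0"
    using eq unfolding q0_def by (simp add: map_poly_pCons algebra_simps power2_eq_square)
  have hom: "map_poly real_of_int (a * b) = map_poly of_int a * map_poly of_int b"
    "map_poly real_of_int (a + b) = map_poly of_int a + map_poly of_int b"
    "map_poly real_of_int (Polynomial.smult c b) = Polynomial.smult (of_int c) (map_poly of_int b)" for a b c
    by (simp_all add: poly_eq_iff coeff_map_poly coeff_mult)
  have c0: "Polynomial.content q0 \<noteq> 0" using q0 by simp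
  have xq: "poly (map_poly of_int q) x = 0"
  proof -
    have "poly (map_poly of_int (Polynomial.smult (Polynomial.content q0) q)) x = 0" using xq0 by (simp only: sm)
    then show ?thesis unfolding hom using c0 by simp
  qed
  obtain a g where ag: "a \<noteq> 0" "Polynomial.smult a p = q * g + pseudo_mod p q"
    and deg: "pseudo_mod p q = 0 \<or> degree (pseudo_mod p q) < degree q"
    using pseudo_mod[OF q(1), of p] by blast
  define r where "r = pseudo_mod p q"
  have "poly (map_poly of_int (Polynomial.smult a p)) x = poly (map_poly of_int (q * g + r)) x"
    unfolding ag(2) r_def ..
  then have xr: "poly (map_poly of_int r) x = 0" unfolding hom using p(1) xq by simp
  have "r = 0"
  proof (rule ccontr)
    assume "r \<noteq> 0"
    then have "degree r \<le> 1" using deg degq unfolding r_def by auto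
    then have "Polynomial.coeff r (Suc (Suc i)) = 0" for i by (intro coeff_eq_0) simp
    then have "r = [:Polynomial.coeff r 0, Polynomial.coeff r 1:]"
      by (intro poly_eqI) (auto simp: coeff_pCons split: nat.split)
    then obtain u v where uv: "r = [:v, u:]" by blast
    then have "of_int u * x + of_int v = 0" using xr by (simp add: map_poly_pCons algebra_simps)
    then have "u = 0 \<and> v = 0" by (rule indep)
    then show False using uv \<open>r \<noteq> 0\<close> by simp
  qed
  then have e: "Polynomial.smult a p = q * g" using ag unfolding r_def by simp
  have "Polynomial.content p dvd 1" using p(2) content_dvd_coeff[of p "degree p"] by simp
  then have cp: "Polynomial.content p = 1" by (simp only: is_unit_content_iff)
  have "Polynomial.content (Polynomial.smult a p) = Polynomial.content q * Polynomial.content g" unfolding e content_mult ..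
  then have cg: "Polynomial.content g = normalize a" using cp q by simp
  have "a dvd Polynomial.coeff g i" for i using content_dvd_coeff[of g i] cg by simp
  then have "a dvd lead_coeff g" by blast
  then obtain h where h: "lead_coeff g = a * h" ..
  have "lead_coeff (Polynomial.smult a p) = lead_coeff q * lead_coeff g" unfolding e by (simp add: lead_coeff_mult)
  moreover have "lead_coeff (Polynomial.smult a p) = a" using ag(1) p(2) by simp
  ultimately have "a = a * (lead_coeff q * h)" using h by (simp only: mult.left_commute)
  then have "lead_coeff q * h = 1" using ag(1) by simp
  then have uq: "lead_coeff q dvd 1" by (metis dvd_triv_left)
  have "A = Polynomial.content q0 * Polynomial.coeff q 2" "B = Polynomial.content q0 * Polynomial.coeff q 1" "C = Polynomial.content q0 * Polynomial.coeff q 0"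
    using arg_cong[OF sm, of "\<lambda>r. Polynomial.coeff r 2"] arg_cong[OF sm, of "\<lambda>r. Polynomial.coeff r 1"] arg_cong[OF sm, of "\<lambda>r. Polynomial.coeff r 0"]
    unfolding q0_def by (simp_all add: numeral_2_eq_2)
  moreover from this have "A dvd Polynomial.content q0"
    using mult_dvd_mono[OF dvd_refl uq, of "Polynomial.content q0"] degq by simp
  ultimately show ?thesis by (metis dvd_trans dvd_triv_left)
qed

context quadratic_discriminant begin

text \<open>The least discriminant that differs from \<open>D\<close> by a square factor has no further square factor of this
  kind.\<close>

lemma exists_fundamental:
  obtains f D0 where "f > 0" "D = f\<^sup>2 * D0" "D0 mod 4 = 0 \<or> D0 mod 4 = 1"
    "\<And>g D1. D0 = g\<^sup>2 * D1 \<Longrightarrow> D1 mod 4 = 0 \<or> D1 mod 4 = 1 \<Longrightarrow> g = 1"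
proof -
  define P where "P n \<longleftrightarrow> (n mod 4 = 0 \<or> n mod 4 = 1) \<and> (\<exists>f. D = f\<^sup>2 * n)" for n
  have "P D" unfolding P_def using disc by (auto intro: exI[of _ 1])
  define D0 where "D0 = (LEAST n. P n)"
  have "P D0" unfolding D0_def by (rule LeastI) (rule \<open>P D\<close>)
  then have d: "D0 mod 4 = 0 \<or> D0 mod 4 = 1" and "\<exists>f. D = f\<^sup>2 * D0"
    unfolding P_def by (rule conjunct1, rule conjunct2)
  then obtain f where f: "D = f\<^sup>2 * D0" by (elim exE)
  have "f\<^sup>2 * D0 > 0" using D_pos by (simp only: f)
  then have fp: "f > 0" "D0 > 0" by simp_all
  have "g = 1" if g: "D0 = g\<^sup>2 * D1" "D1 mod 4 = 0 \<or> D1 mod 4 = 1" for g D1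
  proof -
    have "(f * g)\<^sup>2 * D1 = f\<^sup>2 * (g\<^sup>2 * D1)" by (simp add: power_mult_distrib)
    also have "\<dots> = D" unfolding g(1)[symmetric] by (rule f[symmetric])
    finally have "P D1" unfolding P_def using g(2) by (intro conjI exI[of _ "f * g"]) simp_all
    then have "D0 \<le> D1" unfolding D0_def by (rule Least_le)
    then have "g\<^sup>2 * D1 \<le> 1 * D1" unfolding g(1) by simp
    moreover have "D1 > 0" using fp(2) unfolding g(1) by simp
    ultimately have "g\<^sup>2 \<le> 1" by (simp only: mult_le_cancel2)
    then have "g \<le> 1" by (rule power2_nat_le_imp_le)
    moreover have "g \<noteq> 0" using fp(2) unfolding g(1) by (auto intro: ccontr)
    ultimately show "g = 1" by linarith
  qed
  then show thesis by (rule that[OF fp(1) f d])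
qed

end

locale quadratic_conductor = quadratic_discriminant +
  fixes f D0 :: nat
  assumes D_eq: "D = f\<^sup>2 * D0" and disc0: "D0 mod 4 = 0 \<or> D0 mod 4 = 1"
    and fundamental: "\<And>g D1. D0 = g\<^sup>2 * D1 \<Longrightarrow> D1 mod 4 = 0 \<or> D1 mod 4 = 1 \<Longrightarrow> g = 1"

sublocale quadratic_conductor \<subseteq> F: quadratic_discriminant D0
proof
  show "D0 mod 4 = 0 \<or> D0 mod 4 = 1" by (rule disc0)
  show "\<not> (\<exists>k::nat. D0 = k\<^sup>2)"
  proof
    assume "\<exists>k. D0 = k\<^sup>2"
    then obtain k where "D0 = k\<^sup>2" ..
    then have "D = (f * k)\<^sup>2" using D_eq by (simp add: power_mult_distrib)
    then show False using nonsquare by blast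
  qed
qed

context quadratic_conductor begin

lemma f_pos: "f > 0" using D_eq D_pos by (auto intro!: gr0I)

lemma rootD_eq: "rootD = real f * F.rootD"
  unfolding D_eq by (simp add: real_sqrt_mult)

lemma field_eq: "quad_field D = quad_field D0"
proof
  show "quad_field D \<subseteq> quad_field D0"
  proof
    fix x assume "x \<in> quad_field D"
    then obtain a b where ab: "a \<in> \<rat>" "b \<in> \<rat>" "x = a + b * rootD" by (rule quad_fieldE)
    have "a + (b * real f) * F.rootD \<in> quad_field D0" by (rule F.quad_fieldI) (use ab in auto)
    moreover have "x = a + (b * real f) * F.rootD" unfolding ab(3) rootD_eq by (simp only: mult.assoc)
    ultimately show "x \<in> quad_field D0" by (simp only:)
  qed
  show "quad_field D0 \<subseteq> quad_field D"
  proof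
    fix x assume "x \<in> quad_field D0"
    then obtain a b where ab: "a \<in> \<rat>" "b \<in> \<rat>" "x = a + b * F.rootD" by (rule F.quad_fieldE)
    have "a + (b / real f) * rootD \<in> quad_field D" by (rule quad_fieldI) (use ab in auto)
    moreover have "x = a + (b / real f) * rootD" unfolding ab(3) rootD_eq using f_pos by simp
    ultimately show "x \<in> quad_field D" by (simp only:)
  qed
qed

lemma conj_eq: assumes "x \<in> quad_field D" shows "quad_conj D x = quad_conj D0 x"
proof -
  obtain a b where ab: "a \<in> \<rat>" "b \<in> \<rat>" "x = a + b * rootD" "quad_conj D x = a - b * rootD"
    using quad_fieldE[OF assms] .
  have "quad_conj D0 (a + (b * real f) * F.rootD) = a - (b * real f) * F.rootD"
    by (rule F.conj_coords) (use ab in auto)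
  then show ?thesis using ab unfolding rootD_eq by (simp add: mult.assoc)
qed

lemma order_integral:
  assumes "x \<in> quad_order D0" shows "algebraic_int x"
proof -
  obtain m n where x: "x = F.elt m n" using assms by (rule F.orderE)
  have "F.elt m n * F.elt m n - F.elt (2 * m + n * int D0) 0 * F.elt m n
     + F.elt (m * m + int D0 * m * n + F.gnorm * n * n) 0 = 0"
    unfolding F.elt_mult F.elt_diff F.elt_add F.elt_0 by (simp add: algebra_simps)
  then have e: "x * x - of_int (2 * m + n * int D0) * x + of_int (m * m + int D0 * m * n + F.gnorm * n * n) = 0"
    unfolding x F.elt_of_int .
  define p where "p = [:real_of_int (m * m + int D0 * m * n + F.gnorm * n * n), - real_of_int (2 * m + n * int D0), 1:]"
  have "poly p x = 0" using e unfolding p_def by (simp add: algebra_simps)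
  moreover have "lead_coeff p = 1" unfolding p_def by simp
  moreover have "\<forall>i. Polynomial.coeff p i \<in> \<int>" unfolding p_def
    by (auto simp: coeff_pCons split: nat.splits)
  ultimately show ?thesis by (intro algebraic_int.intros) auto
qed

lemma integral_trace_norm:
  assumes x: "x = a + b * F.rootD" "algebraic_int x" and ab: "a \<in> \<rat>" "b \<in> \<rat>" "b \<noteq> 0"
  shows "2 * a \<in> \<int> \<and> a\<^sup>2 - b\<^sup>2 * real D0 \<in> \<int>"
proof -
  have "2 * a \<in> \<rat>" "a\<^sup>2 - b\<^sup>2 * real D0 \<in> \<rat>" using ab by auto
  then obtain u v w z :: int where uv: "v \<noteq> 0" "2 * a = of_int u / of_int v"
    and wz: "z \<noteq> 0" "a\<^sup>2 - b\<^sup>2 * real D0 = of_int w / of_int z"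
    by (metis Rats_cases' less_int_code(1) order_less_irrefl)
  have q: "x\<^sup>2 - 2 * a * x + (a\<^sup>2 - b\<^sup>2 * real D0) = 0"
    unfolding x(1) using F.rootD_sq by (simp add: power2_eq_square algebra_simps)
  have "of_int (v * z) * x\<^sup>2 + of_int (- u * z) * x + of_int (w * v)
      = of_int (v * z) * (x\<^sup>2 - 2 * a * x + (a\<^sup>2 - b\<^sup>2 * real D0))"
    unfolding uv(2) wz(2) using uv(1) wz(1) by (simp add: field_simps)
  then have eq: "of_int (v * z) * x\<^sup>2 + of_int (- u * z) * x + of_int (w * v) = 0" using q by simp
  have "m = 0 \<and> n = 0" if mn: "of_int m * x + of_int n = 0" for m n :: int
  proof -
    have "(of_int m * a + of_int n) + (of_int m * b) * F.rootD = 0" using mn x by (simp add: algebra_simps)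
    then have "of_int m * a + of_int n = 0 \<and> of_int m * b = 0"
      by (rule F.rat_coords_zero[rotated 2]) (use ab in auto)
    then show ?thesis using ab(3) by auto
  qed
  then have "v * z dvd - u * z \<and> v * z dvd w * v"
    using quadratic_equation_integral[OF x(2) eq] uv wz by simp
  then have "v dvd u" "z dvd w" using uv(1) wz(1) by (auto simp: mult.commute[of w v])
  then obtain k l where "u = v * k" "w = z * l" by (blast elim: dvdE)
  then have "2 * a = of_int k" "a\<^sup>2 - b\<^sup>2 * real D0 = of_int l" using uv wz by simp_all
  then show ?thesis by simp
qed

lemma odd_square_mod_4: "odd (m::int) \<Longrightarrow> m\<^sup>2 mod 4 = 1"
proof -
  assume "odd m"
  then obtain k where "m = 2 * k + 1" by (rule oddE)
  then have "m\<^sup>2 = 1 + 4 * (k\<^sup>2 + k)" by (simp add: power2_eq_square algebra_simps)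
  then have "m\<^sup>2 mod 4 = (1 + 4 * (k\<^sup>2 + k)) mod 4" by (simp only:)
  then show ?thesis by (simp only: mod_mult_self2) simp
qed

lemma square_mod_4: "(t::int)\<^sup>2 mod 4 = 0 \<or> t\<^sup>2 mod 4 = 1"
proof (cases "odd t")
  case False
  then obtain k where "t = 2 * k" by blast
  then have "t\<^sup>2 = 4 * k\<^sup>2" by (simp add: power2_eq_square)
  then show ?thesis by simp
qed (simp add: odd_square_mod_4)

lemma fundamental_int:
  assumes "int D0 = k\<^sup>2 * e" "e mod 4 = 0 \<or> e mod 4 = 1" "k > 0" shows "k = 1"
proof -
  have "int D0 > 0" using F.D_pos by simp
  then have ep: "e > 0" using assms(1) by (metis mult_le_0_iff not_le zero_le_power2)
  have "int D0 = int ((nat k)\<^sup>2 * nat e)" using assms ep by simp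
  then have "D0 = (nat k)\<^sup>2 * nat e" by (simp only: of_nat_eq_iff)
  moreover have "nat e mod 4 = 0 \<or> nat e mod 4 = 1"
    using assms(2) ep nat_mod_distrib[of e 4] by auto
  ultimately have "nat k = 1" by (rule fundamental)
  then show ?thesis using assms(3) by simp
qed

lemma int_disc0: "int D0 mod 4 = 0 \<or> int D0 mod 4 = 1"
  using disc0 by presburger

text \<open>Let \<open>t\<close> and \<open>n\<close> be the trace and the norm of \<open>x\<close>, and \<open>m / k\<close> twice its coefficient at \<open>\<surd>D\<^sub>0\<close> in lowest
  terms. Then \<open>k\<^sup>2 (t\<^sup>2 - 4 n) = m\<^sup>2 D\<^sub>0\<close>, so \<open>k\<^sup>2\<close> divides \<open>D\<^sub>0\<close> and the quotient is again a discriminant;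
  as \<open>D\<^sub>0\<close> is fundamental, \<open>k = 1\<close>.\<close>

lemma integral_order:
  assumes x: "x \<in> quad_field D0" "algebraic_int x" shows "x \<in> quad_order D0"
proof -
  obtain a b where ab: "a \<in> \<rat>" "b \<in> \<rat>" "x = a + b * F.rootD" using x(1) by (rule F.quad_fieldE)
  show ?thesis
  proof (cases "b = 0")
    case True
    then have "x \<in> \<int>" using rational_algebraic_int_is_int x ab by auto
    then obtain m where "x = of_int m" by (rule Ints_cases)
    then show ?thesis by simp
  next
    case False
    then obtain t n where t: "2 * a = of_int t" and n: "a\<^sup>2 - b\<^sup>2 * real D0 = of_int n"
      using integral_trace_norm[OF ab(3) x(2) ab(1,2)] by (auto elim!: Ints_cases)
    have "2 * b \<in> \<rat>" using ab by simp
    then obtain m k :: int where mk: "k > 0" "coprime m k" "2 * b = of_int m / of_int k" by (rule Rats_cases')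
    have "(2 * a)\<^sup>2 - (2 * b)\<^sup>2 * real D0 = 4 * of_int n" using n by (simp add: power_mult_distrib)
    then have "(of_int t)\<^sup>2 - (of_int m / of_int k)\<^sup>2 * real D0 = 4 * of_int n" unfolding t mk(3) .
    then have "of_int k ^ 2 * ((of_int t)\<^sup>2 - (of_int m / of_int k)\<^sup>2 * real D0) = of_int k ^ 2 * (4 * of_int n)" by simp
    then have "of_int k ^ 2 * (of_int t)\<^sup>2 - (of_int m)\<^sup>2 * real D0 = of_int k ^ 2 * (4 * of_int n)"
      using mk(1) by (simp add: power_divide right_diff_distrib)
    then have "real_of_int (k\<^sup>2 * t\<^sup>2 - m\<^sup>2 * int D0) = of_int (k\<^sup>2 * (4 * n))" by simp
    then have i: "k\<^sup>2 * t\<^sup>2 - m\<^sup>2 * int D0 = k\<^sup>2 * (4 * n)" by (simp only: of_int_eq_iff)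
    then have i2: "m\<^sup>2 * int D0 = k\<^sup>2 * (t\<^sup>2 - 4 * n)" by (simp add: algebra_simps)
    have "k\<^sup>2 dvd int D0"
    proof -
      have "k\<^sup>2 dvd m\<^sup>2 * int D0" unfolding i2 by simp
      moreover have "coprime (k\<^sup>2) (m\<^sup>2)" using mk(2) by (simp add: coprime_commute)
      ultimately show ?thesis by (simp add: coprime_dvd_mult_right_iff)
    qed
    then obtain e where e: "int D0 = k\<^sup>2 * e" ..
    have "k\<^sup>2 * (t\<^sup>2 - 4 * n) = k\<^sup>2 * (m\<^sup>2 * e)" unfolding i2[symmetric] e by simp
    then have i3: "t\<^sup>2 - 4 * n = m\<^sup>2 * e" using mk(1) by simp
    have "e mod 4 = 0 \<or> e mod 4 = 1"
    proof (cases "odd m")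
      case True
      have "e mod 4 = ((m\<^sup>2 mod 4) * e) mod 4" using odd_square_mod_4[OF True] by simp
      also have "\<dots> = (t\<^sup>2 - 4 * n) mod 4" unfolding i3 by (simp add: mod_mult_left_eq)
      also have "\<dots> = t\<^sup>2 mod 4" by (metis mod_diff_right_eq mod_mult_self1_is_0 diff_zero)
      finally show ?thesis using square_mod_4[of t] by simp
    next
      case False
      then have "odd k" using mk(2) by (metis coprime_common_divisor odd_one even_zero)
      have "e mod 4 = ((k\<^sup>2 mod 4) * e) mod 4" using odd_square_mod_4[OF \<open>odd k\<close>] by simp
      also have "\<dots> = int D0 mod 4" unfolding e by (simp add: mod_mult_left_eq)
      finally show ?thesis using int_disc0 by simp
    qed
    then have k1: "k = 1" by (rule fundamental_int[OF e _ mk(1)])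
    have "even (t - m * int D0)"
    proof -
      have "t\<^sup>2 - 4 * n = m\<^sup>2 * int D0" using i3 e k1 by simp
      moreover have "even (t\<^sup>2 - 4 * n) \<longleftrightarrow> even (t\<^sup>2)" by simp
      ultimately have "even (t\<^sup>2) \<longleftrightarrow> even (m\<^sup>2 * int D0)" by (simp only:)
      then show ?thesis by (auto simp: even_mult_iff)
    qed
    then obtain h where h: "t - m * int D0 = 2 * h" by blast
    have "2 * x = of_int t + of_int m * F.rootD" using ab(3) t mk(3) k1 by (simp add: algebra_simps)
    also have "\<dots> = of_int (t - m * int D0) + of_int m * (2 * F.gen)"
      unfolding F.gen_diff_conj[symmetric] by (simp add: algebra_simps)
    also have "\<dots> = 2 * F.elt h m" unfolding h F.elt_def by (simp add: algebra_simps)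
    finally have "x = F.elt h m" by simp
    then show ?thesis by simp
  qed
qed

lemma ring_of_integers_eq: "ring_of_integers D = quad_order D0"
  unfolding ring_of_integers_def field_eq using integral_order order_integral F.order_sub_field by blast

text \<open>Two integral bases differ by a matrix of determinant \<open>\<plusminus>1\<close>.\<close>

lemma basis_discriminant:
  assumes B: "int_basis2 b1 b2 (quad_order D0)"
  shows "(b1 * quad_conj D b2 - b2 * quad_conj D b1)\<^sup>2 = real D0"
proof -
  have O: "quad_order D0 = {of_int m * b1 + of_int n * b2 | m n :: int. True}"
    using B unfolding int_basis2_def by blast
  have "b1 = of_int 1 * b1 + of_int 0 * b2" "b2 = of_int 0 * b1 + of_int 1 * b2" by simp_all
  then have "b1 \<in> quad_order D0" "b2 \<in> quad_order D0" unfolding O by blast+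
  then obtain a b c d where ab: "b1 = F.elt a b" "b2 = F.elt c d" by (metis F.orderE)
  have "F.elt 1 0 \<in> quad_order D0" "F.elt 0 1 \<in> quad_order D0" by simp_all
  then obtain m n m' n' :: int where e: "F.elt 1 0 = of_int m * b1 + of_int n * b2"
      "F.elt 0 1 = of_int m' * b1 + of_int n' * b2" unfolding O by blast
  have "F.elt 1 0 = F.elt (m * a + n * c) (m * b + n * d)" "F.elt 0 1 = F.elt (m' * a + n' * c) (m' * b + n' * d)"
    unfolding e ab F.elt_of_int F.elt_mult F.elt_add by simp_all
  then have "m * a + n * c = 1" "m * b + n * d = 0" "m' * a + n' * c = 0" "m' * b + n' * d = 1" by simp_all
  then have "(m * n' - n * m') * (a * d - b * c) = 1"
  proof -
    have "(m * n' - n * m') * (a * d - b * c)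
      = (m * a + n * c) * (m' * b + n' * d) - (m * b + n * d) * (m' * a + n' * c)" by (simp add: algebra_simps)
    then show ?thesis using \<open>m * a + n * c = 1\<close> \<open>m * b + n * d = 0\<close> \<open>m' * b + n' * d = 1\<close> by simp
  qed
  then have "\<bar>a * d - b * c\<bar> = 1" using zmult_eq_1_iff by fastforce
  then have sq: "(a * d - b * c)\<^sup>2 = 1" by (metis power2_abs one_power2)
  have F: "b1 \<in> quad_field D" "b2 \<in> quad_field D" unfolding ab field_eq by simp_all
  have "b1 * quad_conj D0 b2 - b2 * quad_conj D0 b1 = of_int (a * d - b * c) * - F.rootD"
    unfolding ab F.conj_elt F.elt_mult F.elt_diff F.gen_diff_conj[symmetric]
    unfolding F.elt_def by (simp add: algebra_simps)
  then have "(b1 * quad_conj D0 b2 - b2 * quad_conj D0 b1)\<^sup>2 = of_int ((a * d - b * c)\<^sup>2) * real D0"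
    by (simp add: power_mult_distrib)
  then show ?thesis unfolding conj_eq[OF F(1)] conj_eq[OF F(2)] sq by simp
qed

lemma order_basis: "int_basis2 1 F.gen (quad_order D0)"
  unfolding int_basis2_def
proof (intro conjI allI impI)
  show "quad_order D0 = {of_int m * 1 + of_int n * F.gen | m n. True}"
    unfolding F.order_eq F.elt_def by simp
next
  fix m n :: int assume "of_int m * 1 + of_int n * F.gen = 0"
  then have "F.elt m n = F.elt 0 0" unfolding F.elt_def by simp
  then show "m = 0" "n = 0" by simp_all
qed

lemma field_discriminant_eq: "field_discriminant D = int D0"
  unfolding field_discriminant_def ring_of_integers_eq
proof (rule the_equality)
  show "\<exists>b1 b2. int_basis2 b1 b2 (quad_order D0) \<and>
      of_int (int D0) = (b1 * quad_conj D b2 - b2 * quad_conj D b1)\<^sup>2"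
    using order_basis basis_discriminant by (metis of_int_of_nat_eq)
next
  fix \<Delta> assume "\<exists>b1 b2. int_basis2 b1 b2 (quad_order D0) \<and>
      of_int \<Delta> = (b1 * quad_conj D b2 - b2 * quad_conj D b1)\<^sup>2"
  then have "real_of_int \<Delta> = of_int (int D0)" using basis_discriminant by auto
  then show "\<Delta> = int D0" by (simp only: of_int_eq_iff)
qed

lemma conductor_eq: "conductor D = f"
  unfolding conductor_def field_discriminant_eq
proof (rule the_equality)
  show "int D = int (f\<^sup>2) * int D0" unfolding D_eq by simp
next
  fix g assume "int D = int (g\<^sup>2) * int D0"
  then have "int (f\<^sup>2 * D0) = int (g\<^sup>2 * D0)" unfolding D_eq by simp
  then have "f\<^sup>2 * D0 = g\<^sup>2 * D0" by (simp only: of_nat_eq_iff)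
  then show "g = f" using F.D_pos by simp
qed

text \<open>Otherwise \<open>D\<^sub>0 / p\<^sup>2\<close> would be a discriminant.\<close>

lemma square_dvd_genpoly:
  assumes p: "prime (p::int)" "p dvd int D0" shows "\<not> p * p dvd F.genpoly c"
proof
  assume a: "p * p dvd F.genpoly c"
  show False
  proof (cases "p = 2")
    case True
    then have "int D0 mod 4 = 0" using p(2) int_disc0 by presburger
    then obtain m where m: "int D0 = 4 * m" by (metis mod_eq_0_iff_dvd dvdE)
    have "4 * F.genpoly c = 4 * (c\<^sup>2 + 4 * m * c + 4 * m\<^sup>2 - m)"
      unfolding F.genpoly4 m by (simp add: power2_eq_square algebra_simps)
    then have "F.genpoly c = c\<^sup>2 + 4 * m * c + 4 * m\<^sup>2 - m" by simp
    then have "c\<^sup>2 - m = F.genpoly c - 4 * (m * c + m\<^sup>2)" by (simp add: algebra_simps)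
    moreover have "4 dvd F.genpoly c" using a True by simp
    ultimately have "4 dvd c\<^sup>2 - m" by (simp only: dvd_diff dvd_triv_left)
    then have "m mod 4 = c\<^sup>2 mod 4" by (metis mod_eq_dvd_iff)
    then have "m mod 4 = 0 \<or> m mod 4 = 1" using square_mod_4[of c] by simp
    then have "(2::int) = 1" using fundamental_int[of 2 m] m by simp
    then show False by simp
  next
    case False
    then have odd: "odd p" using p(1) by (metis prime_int_iff even_numeral primes_dvd_imp_eq two_is_prime_nat prime_nat_int_transfer of_nat_numeral)
    have "p dvd (2 * c + int D0)\<^sup>2"
      using F.genpoly4[of c] a p(2) by (metis diff_add_cancel dvd_add dvd_mult dvd_mult_left)
    then have "p dvd 2 * c + int D0" using p(1) by (simp add: prime_dvd_power_iff)
    then have "p * p dvd (2 * c + int D0)\<^sup>2" by (simp add: power2_eq_square mult_dvd_mono)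
    then have "p * p dvd (2 * c + int D0)\<^sup>2 - 4 * F.genpoly c" using a by (simp add: dvd_diff)
    then have "p\<^sup>2 dvd int D0" unfolding F.genpoly4 by (simp add: power2_eq_square)
    then obtain e where e: "int D0 = p\<^sup>2 * e" ..
    have "e mod 4 = ((p\<^sup>2 mod 4) * e) mod 4" using odd_square_mod_4[OF odd] by simp
    also have "\<dots> = int D0 mod 4" unfolding e by (simp add: mod_mult_left_eq)
    finally have "e mod 4 = 0 \<or> e mod 4 = 1" using int_disc0 by simp
    then have "p = 1" using fundamental_int[OF e] prime_gt_0_int[OF p(1)] by simp
    then show False using p(1) by simp
  qed
qed

lemma ramified_root:
  assumes p: "prime (p::int)" "p dvd int D0" shows "\<exists>c. p dvd F.genpoly c"
proof (cases "p = 2")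
  case True
  then have "int D0 mod 4 = 0" using p(2) int_disc0 by presburger
  then obtain m where m: "int D0 = 4 * m" by (metis mod_eq_0_iff_dvd dvdE)
  have "4 * F.genpoly m = 4 * (m\<^sup>2 + 4 * m * m + 4 * m\<^sup>2 - m)"
    unfolding F.genpoly4 m by (simp add: power2_eq_square algebra_simps)
  then have "F.genpoly m = m * (m - 1) + 2 * (4 * m\<^sup>2)" by (simp add: power2_eq_square algebra_simps)
  moreover have "2 dvd m * (m - 1)" by auto
  ultimately have "2 dvd F.genpoly m" by (metis dvd_add dvd_triv_left)
  then show ?thesis using True by blast
next
  case False
  then have odd: "odd p" using p(1) by (metis prime_int_iff even_numeral primes_dvd_imp_eq two_is_prime_nat prime_nat_int_transfer of_nat_numeral)
  have "p dvd 4 * F.genpoly 0" unfolding F.genpoly4 using p(2) by (simp add: power2_eq_square)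
  moreover have "\<not> p dvd 4"
  proof
    assume "p dvd 4"
    then have "p dvd 2 * 2" by simp
    then have "p dvd 2" using p(1) by (metis prime_dvd_mult_iff)
    then show False using zdvd_imp_le[of p 2] prime_gt_1_int[OF p(1)] False by simp
  qed
  ultimately show ?thesis using p(1) by (metis prime_dvd_mult_iff)
qed

lemma inert_iff: "prime p \<Longrightarrow> inert_in D p \<longleftrightarrow> \<not> (\<exists>c. int p dvd F.genpoly c)"
  unfolding inert_in_def ring_of_integers_eq using F.inert_iff_no_root[of "int p"] by simp

lemma ramified_in_iff: "prime p \<Longrightarrow> ramified_in D p \<longleftrightarrow> p dvd D0"
  unfolding ramified_in_def ring_of_integers_eq
  using F.ramified_iff[of "int p"] square_dvd_genpoly[of "int p"] ramified_root[of "int p"] by simp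

lemma split_in_iff: "prime p \<Longrightarrow> split_in D p \<longleftrightarrow> \<not> p dvd D0 \<and> (\<exists>c. int p dvd F.genpoly c)"
  unfolding split_in_def ring_of_integers_eq
  using F.split_iff[of "int p"] square_dvd_genpoly[of "int p"] by simp

end

section \<open>Counting roots of the norm polynomial\<close>

context quadratic_discriminant begin

definition roots :: "int \<Rightarrow> int set" where
  "roots m = {c. 0 \<le> c \<and> c < m \<and> m dvd genpoly c}"

lemma finite_roots [simp]: "finite (roots m)"
  by (rule finite_subset[of _ "{0..<m}"]) (auto simp: roots_def)

lemma genpoly_cong:
  assumes "m dvd c - c'" shows "m dvd genpoly c \<longleftrightarrow> m dvd genpoly c'"
proof -
  have "m dvd genpoly c - genpoly c'" unfolding genpoly_diff using assms by simp
  then have "genpoly c mod m = genpoly c' mod m" by (simp only: mod_eq_dvd_iff)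
  then show ?thesis by (simp only: dvd_eq_mod_eq_0)
qed

lemma dvd_mod_diff: "(m::int) dvd c mod m - c"
  by (simp flip: mod_eq_dvd_iff)

lemma genpoly_mod [simp]: "m dvd genpoly (c mod m) \<longleftrightarrow> m dvd genpoly c"
  by (rule genpoly_cong) (rule dvd_mod_diff)

lemma roots_mod: "m > 0 \<Longrightarrow> m dvd genpoly c \<Longrightarrow> c mod m \<in> roots m"
  unfolding roots_def by simp

lemma small_dvd_zero: "(m::int) dvd a - b \<Longrightarrow> 0 \<le> a \<Longrightarrow> a < m \<Longrightarrow> 0 \<le> b \<Longrightarrow> b < m \<Longrightarrow> a = b"
  by (metis mod_eq_dvd_iff mod_pos_pos_trivial)

text \<open>The Chinese remainder theorem.\<close>

lemma card_roots_mult: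
  assumes cop: "coprime m n" and pos: "m > 0" "n > 0"
  shows "card (roots (m * n)) = card (roots m) * card (roots n)"
proof -
  have "bij_betw (\<lambda>c. (c mod m, c mod n)) (roots (m * n)) (roots m \<times> roots n)"
    unfolding bij_betw_def
  proof
    show "inj_on (\<lambda>c. (c mod m, c mod n)) (roots (m * n))"
    proof (rule inj_onI)
      fix c c' assume cc: "c \<in> roots (m * n)" "c' \<in> roots (m * n)" "(c mod m, c mod n) = (c' mod m, c' mod n)"
      then have "m dvd c - c'" "n dvd c - c'" by (simp_all add: mod_eq_dvd_iff)
      then have "m * n dvd c - c'" using cop by (simp add: divides_mult)
      then show "c = c'" using cc small_dvd_zero unfolding roots_def by blast
    qed
    show "(\<lambda>c. (c mod m, c mod n)) ` roots (m * n) = roots m \<times> roots n"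
    proof
      show "(\<lambda>c. (c mod m, c mod n)) ` roots (m * n) \<subseteq> roots m \<times> roots n"
      proof
        fix z assume "z \<in> (\<lambda>c. (c mod m, c mod n)) ` roots (m * n)"
        then obtain c where c: "m * n dvd genpoly c" "z = (c mod m, c mod n)" unfolding roots_def by blast
        have "m dvd genpoly c" "n dvd genpoly c" using dvd_mult_left[OF c(1)] dvd_mult_right[OF c(1)] .
        then show "z \<in> roots m \<times> roots n" using pos roots_mod unfolding c(2) by blast
      qed
      show "roots m \<times> roots n \<subseteq> (\<lambda>c. (c mod m, c mod n)) ` roots (m * n)"
      proof
        fix z assume "z \<in> roots m \<times> roots n"
        then obtain a b where ab: "z = (a, b)" "a \<in> roots m" "b \<in> roots n" by blast
        obtain u v where "u * m + v * n = gcd m n" using bezout_int by blast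
        then have uv: "u * m + v * n = 1" using cop by simp
        define c where "c = a * (v * n) + b * (u * m)"
        have vn: "v * n = 1 - u * m" and um: "u * m = 1 - v * n" using uv by simp_all
        have "c - a = m * (u * (b - a))" unfolding c_def vn by (simp add: algebra_simps)
        then have ca: "m dvd c - a" by simp
        have "c - b = n * (v * (a - b))" unfolding c_def um by (simp add: algebra_simps)
        then have cb: "n dvd c - b" by simp
        have "m dvd genpoly c" "n dvd genpoly c"
          using ab genpoly_cong[OF ca] genpoly_cong[OF cb] unfolding roots_def by simp_all
        then have "m * n dvd genpoly c" using cop by (simp add: divides_mult)
        then have r: "c mod (m * n) \<in> roots (m * n)" using pos by (intro roots_mod) simp_all
        have "c mod (m * n) mod m = c mod m" "c mod (m * n) mod n = c mod n" by (simp_all add: mod_mod_cancel)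
        moreover have "c mod m = a" "c mod n = b"
          using ca cb ab unfolding roots_def by (auto simp flip: mod_eq_dvd_iff)
        ultimately show "z \<in> (\<lambda>c. (c mod m, c mod n)) ` roots (m * n)"
          by (intro image_eqI[OF _ r]) (simp add: ab(1))
      qed
    qed
  qed
  then have "card (roots (m * n)) = card (roots m \<times> roots n)" by (rule bij_betw_same_card)
  then show ?thesis by (simp add: card_cartesian_product)
qed

lemma card_roots_1: "card (roots 1) = 1"
proof -
  have "roots 1 = {0}" unfolding roots_def by auto
  then show ?thesis by simp
qed

lemma card_roots_prod:
  assumes "finite A" "\<And>p. p \<in> A \<Longrightarrow> prime (p::nat)"
  shows "card (roots (int (\<Prod>p\<in>A. p ^ k p))) = (\<Prod>p\<in>A. card (roots (int p ^ k p)))"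
  using assms
proof (induction A rule: finite_induct)
  case empty
  show ?case using card_roots_1 by simp
next
  case (insert q A)
  have "coprime (int q ^ k q) (\<Prod>p\<in>A. int p ^ k p)"
  proof (rule prod_coprime_right)
    fix p assume "p \<in> A"
    then have "coprime q p" using insert by (metis insertCI primes_coprime)
    then show "coprime (int q ^ k q) (int p ^ k p)" by simp
  qed
  moreover have "int q ^ k q > 0" using insert prime_gt_0_nat by simp
  moreover have "(\<Prod>p\<in>A. int p ^ k p) > 0" using insert prime_gt_0_nat by (intro prod_pos) simp
  ultimately have "card (roots (int q ^ k q * (\<Prod>p\<in>A. int p ^ k p)))
      = card (roots (int q ^ k q)) * card (roots (\<Prod>p\<in>A. int p ^ k p))" by (rule card_roots_mult)
  then show ?case using insert by simp
qed

text \<open>The derivative \<open>2 b + D\<close> of the polynomial at a root \<open>b\<close> is invertible modulo \<open>p\<close>, because its square is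
  congruent to \<open>D\<close>.\<close>

lemma hensel:
  assumes p: "prime p" "\<not> p dvd int D" and c: "p dvd genpoly c"
  shows "\<exists>c'. p ^ Suc k dvd genpoly c' \<and> p dvd c' - c"
proof (induction k)
  case 0
  show ?case using c by (intro exI[of _ c]) simp
next
  case (Suc k)
  then obtain b where b: "p ^ Suc k dvd genpoly b" "p dvd b - c" by blast
  then obtain h where h: "genpoly b = p ^ Suc k * h" by blast
  have pb: "p dvd genpoly b" using b(1) by (simp add: dvd_mult_left)
  have "\<not> p dvd 2 * b + int D"
  proof
    assume "p dvd 2 * b + int D"
    then have "p dvd (2 * b + int D)\<^sup>2 - 4 * genpoly b" using pb by (simp add: power2_eq_square)
    then show False using p(2) genpoly4[of b] by simp
  qed
  then obtain u v where uv: "(2 * b + int D) * u = 1 + p * v" using coprime_prime_int[OF p(1)] by blast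
  define t where "t = - u * h"
  define b' where "b' = b + t * p ^ Suc k"
  have "genpoly b' - genpoly b = t * p ^ Suc k * (2 * b + int D + t * p ^ Suc k)"
    unfolding genpoly_diff b'_def by (simp add: algebra_simps)
  then have "genpoly b' = p ^ Suc k * (h + t * (2 * b + int D) + t * t * p ^ Suc k)"
    using h by (simp add: algebra_simps)
  also have "h + t * (2 * b + int D) = h - h * ((2 * b + int D) * u)" unfolding t_def by (simp add: algebra_simps)
  also have "\<dots> = p * (- h * v)" unfolding uv by (simp add: algebra_simps)
  also have "p ^ Suc k * (p * (- h * v) + t * t * p ^ Suc k) = p ^ Suc (Suc k) * (t * t * p ^ k - h * v)"
    by (simp add: algebra_simps)
  finally have "p ^ Suc (Suc k) dvd genpoly b'" by simp
  moreover have "p dvd b' - c"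
  proof -
    have "b' - c = (b - c) + p * (t * p ^ k)" unfolding b'_def by simp
    then show ?thesis using b(2) by (metis dvd_add dvd_triv_left)
  qed
  ultimately show ?case by blast
qed

text \<open>With \<open>b\<close> a root and \<open>b' = - D - b\<close> the polynomial is \<open>(x - b) (x - b')\<close> modulo \<open>p\<^sup>k\<close>, and \<open>p\<close> divides at
  most one of the two factors.\<close>

lemma card_roots_split:
  assumes p: "prime p" "\<not> p dvd int D" and c: "p dvd genpoly c" and k: "k > 0"
  shows "card (roots (p ^ k)) = 2"
proof -
  obtain j where j: "k = Suc j" using k gr0_conv_Suc by blast
  let ?m = "p ^ k"
  have mp: "?m > 0" using prime_gt_0_int[OF p(1)] by simp
  have pm: "p dvd ?m" using k by simp
  obtain b where b: "?m dvd genpoly b" using hensel[OF p c, of j] j by blast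
  define b' where "b' = - int D - b"
  have b': "?m dvd genpoly b'" using b genpoly_diff[of b' b] unfolding b'_def by (simp add: algebra_simps)
  have bb: "\<not> p dvd b - b'"
    unfolding b'_def using root_self_conj_iff[OF p(1), of b] p(2) dvd_trans[OF pm b] by simp
  have "roots ?m = {b mod ?m, b' mod ?m}"
  proof
    show "{b mod ?m, b' mod ?m} \<subseteq> roots ?m" using roots_mod[OF mp b] roots_mod[OF mp b'] by simp
    show "roots ?m \<subseteq> {b mod ?m, b' mod ?m}"
    proof
      fix x assume x: "x \<in> roots ?m"
      then have xr: "?m dvd genpoly x" unfolding roots_def by simp
      have e: "genpoly x - genpoly b = (x - b) * (x - b')" unfolding genpoly_diff b'_def by simp
      have d: "?m dvd (x - b) * (x - b')" unfolding e[symmetric] using xr b by (rule dvd_diff)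
      have "\<not> (p dvd x - b \<and> p dvd x - b')"
      proof
        assume "p dvd x - b \<and> p dvd x - b'"
        then have "p dvd x - b'" "p dvd x - b" by blast+
        then have "p dvd (x - b') - (x - b)" by (rule dvd_diff)
        then show False using bb by simp
      qed
      then have "?m dvd x - b \<or> ?m dvd x - b'"
      proof (elim disjE[OF de_Morgan_conj[THEN iffD1]])
        assume "\<not> p dvd x - b"
        then have "coprime ?m (x - b)" using p(1) by (simp add: prime_imp_coprime)
        then show ?thesis using d by (simp add: coprime_dvd_mult_right_iff)
      next
        assume "\<not> p dvd x - b'"
        then have "coprime ?m (x - b')" using p(1) by (simp add: prime_imp_coprime)
        then show ?thesis using d by (simp add: coprime_dvd_mult_left_iff)
      qed
      then have "x mod ?m = b mod ?m \<or> x mod ?m = b' mod ?m" by (simp add: mod_eq_dvd_iff)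
      moreover have "x mod ?m = x" using x unfolding roots_def by simp
      ultimately show "x \<in> {b mod ?m, b' mod ?m}" by auto
    qed
  qed
  moreover have "b mod ?m \<noteq> b' mod ?m"
    using bb dvd_trans[OF pm] by (auto simp: mod_eq_dvd_iff)
  ultimately show ?thesis by simp
qed

lemma card_roots_ramified:
  assumes p: "prime p" "p dvd int D" and c: "p dvd genpoly c"
  shows "card (roots p) = 1"
proof -
  have pp: "p > 0" using prime_gt_0_int[OF p(1)] .
  have "roots p = {c mod p}"
  proof
    show "{c mod p} \<subseteq> roots p" using roots_mod[OF pp c] by simp
    show "roots p \<subseteq> {c mod p}"
    proof
      fix x assume x: "x \<in> roots p"
      then have xr: "p dvd genpoly x" unfolding roots_def by simp
      have s: "p dvd c - (- int D - c)" using root_self_conj_iff[OF p(1) c] p(2) by simp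
      have "p dvd x - c"
        using roots_mod_prime[OF p(1) c xr]
      proof
        assume "p dvd c - x" then show ?thesis by (simp add: dvd_diff_commute)
      next
        assume "p dvd x - (- int D - c)"
        then have "p dvd (x - (- int D - c)) - (c - (- int D - c))" using s by (rule dvd_diff)
        then show ?thesis by simp
      qed
      then have "x mod p = c mod p" by (simp add: mod_eq_dvd_iff)
      moreover have "x mod p = x" using x unfolding roots_def by simp
      ultimately show "x \<in> {c mod p}" by auto
    qed
  qed
  then show ?thesis by simp
qed

end

context quadratic_conductor begin

text \<open>With \<open>\<gamma>\<^sub>0\<close> the generator of the maximal order, \<open>\<gamma> = f \<gamma>\<^sub>0 + shift\<close>.\<close>

definition shift :: int where "shift = (int D - int f * int D0) div 2"

lemma shift2: "2 * shift = int D - int f * int D0"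
proof -
  have "int D - int f * int D0 = int D0 * (int f * (int f - 1))"
    unfolding D_eq by (simp add: power2_eq_square algebra_simps)
  moreover have "even (int f * (int f - 1))" by simp
  ultimately have "even (int D - int f * int D0)" by (metis dvd_mult)
  then show ?thesis unfolding shift_def by simp
qed

lemma genpoly_transfer: "genpoly (int f * x - shift) = (int f)\<^sup>2 * F.genpoly x"
proof -
  have "2 * (int f * x - shift) + int D = int f * (2 * x + int D0)"
    using shift2 by (simp add: algebra_simps)
  then have "4 * genpoly (int f * x - shift) = (int f * (2 * x + int D0))\<^sup>2 - int D"
    unfolding genpoly4 by simp
  also have "\<dots> = (int f)\<^sup>2 * ((2 * x + int D0)\<^sup>2 - int D0)"
    unfolding D_eq by (simp add: power2_eq_square algebra_simps)
  also have "\<dots> = 4 * ((int f)\<^sup>2 * F.genpoly x)" unfolding F.genpoly4[symmetric] by simp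
  finally show ?thesis by simp
qed

lemma card_roots_transfer:
  assumes d: "coprime d (int f)" "d > 0"
  shows "card (roots d) = card (F.roots d)"
proof -
  have tr: "d dvd genpoly (int f * x - shift) \<longleftrightarrow> d dvd F.genpoly x" for x
    unfolding genpoly_transfer using d(1) by (simp add: coprime_dvd_mult_right_iff)
  have "bij_betw (\<lambda>x. (int f * x - shift) mod d) (F.roots d) (roots d)"
    unfolding bij_betw_def
  proof
    show "inj_on (\<lambda>x. (int f * x - shift) mod d) (F.roots d)"
    proof (rule inj_onI)
      fix x y assume xy: "x \<in> F.roots d" "y \<in> F.roots d" "(int f * x - shift) mod d = (int f * y - shift) mod d"
      then have "d dvd (int f * x - shift) - (int f * y - shift)" by (simp only: mod_eq_dvd_iff)
      then have "d dvd int f * (x - y)" by (simp add: algebra_simps)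
      then have "d dvd x - y" using d(1) by (simp add: coprime_dvd_mult_right_iff)
      then show "x = y" using xy small_dvd_zero unfolding F.roots_def by blast
    qed
    show "(\<lambda>x. (int f * x - shift) mod d) ` F.roots d = roots d"
    proof
      show "(\<lambda>x. (int f * x - shift) mod d) ` F.roots d \<subseteq> roots d"
        using tr roots_mod[OF d(2)] unfolding F.roots_def by auto
      show "roots d \<subseteq> (\<lambda>x. (int f * x - shift) mod d) ` F.roots d"
      proof
        fix c assume c: "c \<in> roots d"
        obtain u v where "u * d + v * int f = gcd d (int f)" using bezout_int by blast
        then have uv: "u * d + v * int f = 1" using d(1) by simp
        define x where "x = v * (c + shift)"
        have "int f * x = (v * int f) * (c + shift)" unfolding x_def by simp
        also have "v * int f = 1 - u * d" using uv by simp
        finally have "int f * x - shift = c + d * (- u * (c + shift))" by (simp add: algebra_simps)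
        then have fx: "d dvd (int f * x - shift) - c" by simp
        have "d dvd genpoly c" using c unfolding roots_def by simp
        then have "d dvd F.genpoly x" using tr[of x] genpoly_cong[OF fx] by simp
        then have xr: "x mod d \<in> F.roots d" using F.roots_mod[OF d(2)] by simp
        have "int f * (x mod d) - shift - c = (int f * x - shift - c) - int f * (x - x mod d)"
          by (simp add: algebra_simps)
        moreover have "d dvd x - x mod d" by (simp add: minus_mod_eq_mult_div)
        ultimately have "d dvd (int f * (x mod d) - shift) - c" using fx by (metis dvd_diff dvd_mult)
        then have "(int f * (x mod d) - shift) mod d = c mod d" by (simp only: mod_eq_dvd_iff)
        also have "c mod d = c" using c unfolding roots_def by simp
        finally show "c \<in> (\<lambda>x. (int f * x - shift) mod d) ` F.roots d" using xr by force
      qed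
    qed
  qed
  then show ?thesis by (simp add: bij_betw_same_card)
qed

lemma card_prime_power_roots:
  assumes p: "prime (p::nat)" and k: "k > 0"
  shows "card (F.roots (int p ^ k)) =
    (if inert_in D p \<or> (ramified_in D p \<and> k \<noteq> 1) then 0 else if split_in D p then 2 else 1)"
proof -
  have ip: "prime (int p)" using p by simp
  consider (inert) "\<not> (\<exists>c. int p dvd F.genpoly c)"
    | (ram) c where "int p dvd F.genpoly c" "p dvd D0"
    | (split) c where "int p dvd F.genpoly c" "\<not> p dvd D0" by blast
  then show ?thesis
  proof cases
    case inert
    have "F.roots (int p ^ k) = {}"
    proof (rule ccontr)
      assume "F.roots (int p ^ k) \<noteq> {}"
      then obtain c where "int p ^ k dvd F.genpoly c" unfolding F.roots_def by blast
      moreover have "int p dvd int p ^ k" using k by simp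
      ultimately show False using inert dvd_trans by blast
    qed
    then show ?thesis using inert inert_iff[OF p] by simp
  next
    case (ram c)
    have ni: "\<not> inert_in D p" "ramified_in D p" "\<not> split_in D p"
      using ram inert_iff[OF p] ramified_in_iff[OF p] split_in_iff[OF p] by blast+
    show ?thesis
    proof (cases "k = 1")
      case True
      then show ?thesis using F.card_roots_ramified[OF ip _ ram(1)] ram(2) ni by simp
    next
      case False
      then obtain j where j: "k = Suc (Suc j)" using k by (metis One_nat_def not0_implies_Suc not_gr_zero)
      have "F.roots (int p ^ k) = {}"
      proof (rule ccontr)
        assume "F.roots (int p ^ k) \<noteq> {}"
        then obtain b where "int p ^ k dvd F.genpoly b" unfolding F.roots_def by blast
        moreover have "int p * int p dvd int p ^ k" unfolding j by simp
        ultimately have "int p * int p dvd F.genpoly b" by (rule dvd_trans[rotated])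
        then show False using square_dvd_genpoly[OF ip] ram(2) by simp
      qed
      then show ?thesis using ni False by simp
    qed
  next
    case (split c)
    have "\<not> inert_in D p" "\<not> ramified_in D p" "split_in D p"
      using split inert_iff[OF p] ramified_in_iff[OF p] split_in_iff[OF p] by blast+
    then show ?thesis using F.card_roots_split[OF ip _ split(1) k] split(2) by simp
  qed
qed

theorem card_roots:
  assumes d: "d > 0" "coprime d f"
  shows "card (roots (int d)) = (if prime_factor_condition D d then 2 ^ card (splitting_primes D d) else 0)"
proof -
  define m where "m p = multiplicity p d" for p
  have dprod: "d = (\<Prod>p\<in>prime_factors d. p ^ m p)"
    using d(1) prod_prime_factors[of d] unfolding m_def by simp
  have pf: "prime p" "m p > 0" if "p \<in> prime_factors d" for p
    using that unfolding m_def by (auto simp: prime_factors_multiplicity)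
  have "card (roots (int d)) = card (F.roots (int d))"
    by (rule card_roots_transfer) (use d in simp_all)
  also have "\<dots> = card (F.roots (int (\<Prod>p\<in>prime_factors d. p ^ m p)))" using dprod by simp
  also have "\<dots> = (\<Prod>p\<in>prime_factors d. card (F.roots (int p ^ m p)))"
    by (rule F.card_roots_prod) (use pf in auto)
  also have "\<dots> = (\<Prod>p\<in>prime_factors d.
    (if inert_in D p \<or> (ramified_in D p \<and> m p \<noteq> 1) then 0 else if split_in D p then 2 else 1))"
    by (rule prod.cong[OF refl], rule card_prime_power_roots) (use pf in auto)
  also have "\<dots> = (if prime_factor_condition D d then 2 ^ card (splitting_primes D d) else 0)"
  proof (cases "prime_factor_condition D d")
    case True
    have "(\<Prod>p\<in>prime_factors d. (if inert_in D p \<or> (ramified_in D p \<and> m p \<noteq> 1) then 0 else if split_in D p then 2 else 1))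
        = (\<Prod>p\<in>prime_factors d. (if split_in D p then 2 else 1 :: nat))"
      using True unfolding prime_factor_condition_def m_def
      by (intro prod.cong) (auto simp: in_prime_factors_iff)
    also have "\<dots> = (\<Prod>p\<in>prime_factors d \<inter> {p. split_in D p}. 2)"
      by (simp add: prod.If_cases)
    also have "prime_factors d \<inter> {p. split_in D p} = splitting_primes D d"
      unfolding splitting_primes_def using d(1) by (auto simp: in_prime_factors_iff)
    finally show ?thesis using True by simp
  next
    case False
    then obtain p where p: "prime p" "p dvd d" "inert_in D p \<or> (ramified_in D p \<and> m p \<noteq> 1)"
      unfolding prime_factor_condition_def m_def by blast
    then have "p \<in> prime_factors d" using d(1) by (simp add: in_prime_factors_iff)
    then show ?thesis using p False by (subst prod_zero) auto
  qed
  finally show ?thesis .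
qed

end

section \<open>Primitive ideals\<close>

lemma int_subgroup_principal:
  fixes S :: "int set"
  assumes zero: "0 \<in> S" and diff: "\<And>x y. x \<in> S \<Longrightarrow> y \<in> S \<Longrightarrow> x - y \<in> S"
  obtains g where "g \<ge> 0" "\<And>x. x \<in> S \<longleftrightarrow> g dvd x"
proof -
  have neg: "- x \<in> S" if "x \<in> S" for x using diff[OF zero that] by simp
  have add: "x + y \<in> S" if "x \<in> S" "y \<in> S" for x y using diff[OF that(1) neg[OF that(2)]] by simp
  have multn: "int n * x \<in> S" if "x \<in> S" for x n
    by (induction n) (use zero add that in \<open>auto simp: algebra_simps\<close>)
  have mult: "k * x \<in> S" if "x \<in> S" for x k
  proof (cases "k \<ge> 0")
    case True then show ?thesis using multn[OF that, of "nat k"] by simp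
  next
    case False then show ?thesis using neg[OF multn[OF that, of "nat (- k)"]] by simp
  qed
  show thesis
  proof (cases "S = {0}")
    case True
    then show thesis by (intro that[of 0]) auto
  next
    case False
    then obtain y where y: "y \<in> S" "y \<noteq> 0" using zero by blast
    define P where "P n \<longleftrightarrow> n > 0 \<and> int n \<in> S" for n :: nat
    have "P (nat \<bar>y\<bar>)" unfolding P_def using y neg[OF y(1)] by (auto simp: abs_if)
    then have L: "P (Least P)" by (rule LeastI)
    define g where "g = int (Least P)"
    have g: "g > 0" "g \<in> S" using L unfolding P_def g_def by simp_all
    have "x \<in> S \<longleftrightarrow> g dvd x" for x
    proof
      assume "x \<in> S"
      then have r: "x mod g \<in> S" using diff[OF \<open>x \<in> S\<close> mult[OF g(2), of "x div g"]] by (simp add: minus_div_mult_eq_mod)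
      have "x mod g < g" "x mod g \<ge> 0" using g by simp_all
      have "\<not> P (nat (x mod g))"
        by (rule not_less_Least) (use \<open>x mod g < g\<close> \<open>x mod g \<ge> 0\<close> g(1) in \<open>simp add: g_def nat_less_iff\<close>)
      then have "x mod g = 0" using r \<open>x mod g \<ge> 0\<close> unfolding P_def by auto
      then show "g dvd x" by blast
    next
      assume "g dvd x"
      then obtain k where "x = g * k" ..
      then show "x \<in> S" using mult[OF g(2), of k] by (simp add: mult.commute)
    qed
    then show thesis using that[of g] g by simp
  qed
qed

context quadratic_discriminant begin

lemma card_cosets_root_ideal:
  assumes d: "d > 0"
  shows "card (A_RCOSETS (ring_on (quad_order D)) (root_ideal (int d) c)) = d"
proof -
  define K where "K i = {elt x y | x y. int d dvd x - y * c - i}" for i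
  have KI: "elt x y \<in> K i \<longleftrightarrow> int d dvd x - y * c - i" for x y i unfolding K_def by auto
  have K_cong: "K i = K j" if "int d dvd i - j" for i j
  proof -
    have "int d dvd x - y * c - i \<longleftrightarrow> int d dvd x - y * c - j" for x y
    proof -
      have "x - y * c - j = (x - y * c - i) + (i - j)" by simp
      then show ?thesis using that by (metis dvd_add_left_iff)
    qed
    then show ?thesis unfolding K_def by simp
  qed
  have coset: "a_r_coset (ring_on (quad_order D)) (root_ideal (int d) c) (elt a b) = K (a - b * c)" for a b
  proof -
    have "a_r_coset (ring_on (quad_order D)) (root_ideal (int d) c) (elt a b)
        = (\<lambda>h. h + elt a b) ` root_ideal (int d) c"
      unfolding a_r_coset_def' by auto
    also have "\<dots> = K (a - b * c)"
    proof
      show "(\<lambda>h. h + elt a b) ` root_ideal (int d) c \<subseteq> K (a - b * c)"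
      proof
        fix z assume "z \<in> (\<lambda>h. h + elt a b) ` root_ideal (int d) c"
        then obtain x y where "z = elt x y + elt a b" "int d dvd x - y * c" unfolding root_ideal_def by blast
        then show "z \<in> K (a - b * c)" unfolding elt_add by (simp add: KI algebra_simps)
      qed
      show "K (a - b * c) \<subseteq> (\<lambda>h. h + elt a b) ` root_ideal (int d) c"
      proof
        fix z assume "z \<in> K (a - b * c)"
        then obtain x y where z: "z = elt x y" "int d dvd x - y * c - (a - b * c)" unfolding K_def by blast
        have "x - y * c - (a - b * c) = (x - a) - (y - b) * c" by (simp add: algebra_simps)
        then have "int d dvd (x - a) - (y - b) * c" using z(2) by (simp only:)
        then have "elt (x - a) (y - b) \<in> root_ideal (int d) c" by (simp only: elt_in_root_ideal)
        moreover have "z = elt (x - a) (y - b) + elt a b" unfolding z(1) elt_add by simp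
        ultimately show "z \<in> (\<lambda>h. h + elt a b) ` root_ideal (int d) c" by blast
      qed
    qed
    finally show ?thesis .
  qed
  have "A_RCOSETS (ring_on (quad_order D)) (root_ideal (int d) c) = K ` {0..<int d}"
  proof
    show "A_RCOSETS (ring_on (quad_order D)) (root_ideal (int d) c) \<subseteq> K ` {0..<int d}"
    proof
      fix z assume "z \<in> A_RCOSETS (ring_on (quad_order D)) (root_ideal (int d) c)"
      then obtain x where x: "x \<in> quad_order D" "z = a_r_coset (ring_on (quad_order D)) (root_ideal (int d) c) x"
        unfolding A_RCOSETS_def' by auto
      obtain a b where "x = elt a b" using x(1) by (rule orderE)
      then have "z = K (a - b * c)" using x(2) coset by simp
      also have "\<dots> = K ((a - b * c) mod int d)" by (rule K_cong) (simp add: minus_mod_eq_mult_div)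
      finally show "z \<in> K ` {0..<int d}" using d by simp
    qed
    show "K ` {0..<int d} \<subseteq> A_RCOSETS (ring_on (quad_order D)) (root_ideal (int d) c)"
    proof
      fix z assume "z \<in> K ` {0..<int d}"
      then obtain i where "z = K i" by blast
      then have "z = a_r_coset (ring_on (quad_order D)) (root_ideal (int d) c) (elt i 0)" using coset[of i 0] by simp
      then show "z \<in> A_RCOSETS (ring_on (quad_order D)) (root_ideal (int d) c)"
        unfolding A_RCOSETS_def' by (auto intro!: bexI[of _ "elt i 0"])
    qed
  qed
  moreover have "inj_on K {0..<int d}"
  proof (rule inj_onI)
    fix i j assume ij: "i \<in> {0..<int d}" "j \<in> {0..<int d}" "K i = K j"
    have "elt i 0 \<in> K i" by (simp add: KI)
    then have "elt i 0 \<in> K j" using ij by simp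
    then have "int d dvd i - j" by (simp add: KI)
    then show "i = j" using ij by (intro small_dvd_zero) auto
  qed
  ultimately show ?thesis by (simp add: card_image)
qed

lemma genpoly_nonzero: "genpoly c \<noteq> 0"
proof
  assume "genpoly c = 0"
  then have "int D = (2 * c + int D)\<^sup>2" using genpoly4[of c] by simp
  then have "int D = int ((nat \<bar>2 * c + int D\<bar>)\<^sup>2)" by (simp add: power2_eq_square)
  then have "D = (nat \<bar>2 * c + int D\<bar>)\<^sup>2" by (simp only: of_nat_eq_iff)
  then show False using nonsquare by blast
qed

lemma root_ideal_primitive:
  assumes d: "d > 0" "int d dvd genpoly c"
  shows "root_ideal (int d) c \<in> primitive_ideals D d"
proof -
  have "elt (int d) 0 \<in> root_ideal (int d) c" by simp
  moreover have "elt (int d) 0 \<noteq> 0" unfolding elt_0 using d by simp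
  ultimately have "root_ideal (int d) c \<noteq> {0}" by blast
  moreover have "m = 1 \<or> m = -1" if m: "m \<noteq> 0" "(\<lambda>x. x / of_int m) ` root_ideal (int d) c \<subseteq> quad_order D" for m :: int
  proof -
    have "elt c 1 \<in> root_ideal (int d) c" by simp
    then have "elt c 1 / of_int m \<in> quad_order D" using m by blast
    then obtain a b where "elt c 1 / of_int m = elt a b" by (rule orderE)
    then have "elt c 1 = elt a b * of_int m" using m(1) by (simp add: field_simps)
    then have "elt c 1 = elt (a * m) (b * m)" unfolding elt_of_int elt_mult by simp
    then have "b * m = 1" by simp
    then show ?thesis using zmult_eq_1_iff[of b m] by auto
  qed
  ultimately have "primitive_ideal D (root_ideal (int d) c)"
    unfolding primitive_ideal_def using root_ideal_ideal[OF d(2)] by (intro conjI allI impI) simp_all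
  then show ?thesis unfolding primitive_ideals_def ideal_norm_def
    using card_cosets_root_ideal[OF d(1)] by simp
qed

text \<open>The Hermite normal form of \<open>I\<close> with respect to \<open>1, \<gamma>\<close>: it is spanned by \<open>h\<close> and \<open>e + g \<gamma>\<close>. Stability under \<open>\<gamma>\<close>
  implies that \<open>g\<close> divides \<open>h\<close> and \<open>e\<close>, so \<open>g = 1\<close> since \<open>I\<close> is primitive.\<close>

lemma primitive_ideal_root:
  assumes d: "d > 0" and I: "I \<in> primitive_ideals D d"
  shows "\<exists>c. int d dvd genpoly c \<and> I = root_ideal (int d) c"
proof -
  have id: "ideal I (ring_on (quad_order D))" and nz: "I \<noteq> {0}"
    and prim: "\<And>m::int. m \<noteq> 0 \<Longrightarrow> (\<lambda>x. x / of_int m) ` I \<subseteq> quad_order D \<Longrightarrow> m = 1 \<or> m = -1"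
    and norm: "card (A_RCOSETS (ring_on (quad_order D)) I) = d"
    using I unfolding primitive_ideals_def primitive_ideal_def ideal_norm_def by auto
  have sub: "I \<subseteq> quad_order D" and z: "0 \<in> I" and add: "\<And>x y. x \<in> I \<Longrightarrow> y \<in> I \<Longrightarrow> x + y \<in> I"
    and mult: "\<And>x a. x \<in> I \<Longrightarrow> a \<in> quad_order D \<Longrightarrow> a * x \<in> I"
    using id unfolding ideal_order_iff by auto
  have smul: "elt (k * a) (k * b) \<in> I" if ab: "elt a b \<in> I" for k a b
    using mult[OF ab, of "elt k 0"] by (simp add: elt_mult)
  have diff: "elt (a - a') (b - b') \<in> I" if ab: "elt a b \<in> I" "elt a' b' \<in> I" for a b a' b'
    using add[OF ab(1) smul[OF ab(2), of "-1"]] by (simp add: elt_add)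
  obtain h where h: "h \<ge> 0" "\<And>a. elt a 0 \<in> I \<longleftrightarrow> h dvd a"
  proof (rule int_subgroup_principal[of "{a. elt a 0 \<in> I}"])
    show "0 \<in> {a. elt a 0 \<in> I}" using z by (simp add: elt_0)
    show "x - y \<in> {a. elt a 0 \<in> I}" if "x \<in> {a. elt a 0 \<in> I}" "y \<in> {a. elt a 0 \<in> I}" for x y
      using diff[of x 0 y 0] that by simp
  qed (use that in auto)
  obtain g where g: "g \<ge> 0" "\<And>b. (\<exists>a. elt a b \<in> I) \<longleftrightarrow> g dvd b"
  proof (rule int_subgroup_principal[of "{b. \<exists>a. elt a b \<in> I}"])
    show "0 \<in> {b. \<exists>a. elt a b \<in> I}" using z by (auto simp: elt_0)
    show "x - y \<in> {b. \<exists>a. elt a b \<in> I}" if "x \<in> {b. \<exists>a. elt a b \<in> I}" "y \<in> {b. \<exists>a. elt a b \<in> I}" for x y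
      using diff that by blast
  qed (use that in auto)
  obtain e where e: "elt e g \<in> I" using g(2)[of g] by auto
  have "elt 0 1 * elt h 0 \<in> I" using h(2)[of h] mult by simp
  then have "elt 0 h \<in> I" by (simp add: elt_mult)
  then have gh: "g dvd h" using g(2) by blast
  have "elt 0 1 * elt e g \<in> I" using e mult by simp
  then have "elt (- (g * gnorm)) (e + g * int D) \<in> I" by (simp add: elt_mult)
  then have "g dvd e + g * int D" using g(2) by blast
  then have ge: "g dvd e" by (simp add: dvd_add_left_iff)
  have form: "g dvd b \<and> h dvd a - (b div g) * e" if ab: "elt a b \<in> I" for a b
  proof -
    have gb: "g dvd b" using g(2) ab by blast
    have "elt (a - (b div g) * e) (b - (b div g) * g) \<in> I" by (rule diff[OF ab smul[OF e]])
    then have "elt (a - (b div g) * e) 0 \<in> I" using gb by simp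
    then show ?thesis using h(2) gb by simp
  qed
  have "g \<noteq> 0"
  proof
    assume g0: "g = 0"
    then have "h = 0" using gh by simp
    have "x = 0" if x: "x \<in> I" for x
    proof -
      obtain a b where "x = elt a b" using sub x by (blast elim: orderE)
      then show ?thesis using form[of a b] x g0 \<open>h = 0\<close> by (simp add: elt_0)
    qed
    then show False using nz z by blast
  qed
  moreover have "(\<lambda>x. x / of_int g) ` I \<subseteq> quad_order D"
  proof
    fix y assume "y \<in> (\<lambda>x. x / of_int g) ` I"
    then obtain x where x: "x \<in> I" "y = x / of_int g" by blast
    then obtain a b where ab: "x = elt a b" using sub by (blast elim: orderE)
    have "g dvd b" "g dvd a - (b div g) * e" using form[of a b] x ab gh by (auto intro: dvd_trans)
    moreover have "a = (a - (b div g) * e) + (b div g) * e" by simp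
    ultimately have "g dvd a" using ge by (metis dvd_add dvd_mult)
    then obtain k l where kl: "a = g * k" "b = g * l" using \<open>g dvd b\<close> by (blast elim: dvdE)
    have "elt (g * k) (g * l) = of_int g * elt k l" unfolding elt_def by (simp add: algebra_simps)
    then show "y \<in> quad_order D" unfolding x(2) ab kl using \<open>g \<noteq> 0\<close> by simp
  qed
  ultimately have g1: "g = 1" using prim[of g] g(1) by auto
  have I_eq: "I = root_ideal h e"
  proof
    show "I \<subseteq> root_ideal h e"
    proof
      fix x assume x: "x \<in> I"
      then obtain a b where ab: "x = elt a b" using sub by (blast elim: orderE)
      then show "x \<in> root_ideal h e" using form[of a b] x g1 by simp
    qed
    show "root_ideal h e \<subseteq> I"
    proof
      fix x assume "x \<in> root_ideal h e"
      then obtain a b where ab: "x = elt a b" "h dvd a - b * e" unfolding root_ideal_def by blast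
      then have "elt (a - b * e) 0 + elt (b * e) (b * g) \<in> I" using h(2) smul[OF e] add by blast
      then show "x \<in> I" unfolding ab(1) elt_add using g1 by simp
    qed
  qed
  have "elt (- int D - e) 1 * elt e 1 \<in> I" using e g1 mult by simp
  then have "elt (- genpoly e) 0 \<in> I" using elt_genpoly[of e] by (simp add: mult.commute)
  then have hr: "h dvd genpoly e" using h(2) by simp
  then have "h > 0" using h(1) genpoly_nonzero[of e] by (metis dvd_0_left_iff less_le)
  then have "card (A_RCOSETS (ring_on (quad_order D)) (root_ideal (int (nat h)) e)) = nat h"
    by (intro card_cosets_root_ideal) simp
  then have "h = int d" using norm I_eq \<open>h > 0\<close> by simp
  then show ?thesis using hr I_eq by blast
qed

lemma primitive_ideals_roots:
  assumes d: "d > 0"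
  shows "bij_betw (root_ideal (int d)) (roots (int d)) (primitive_ideals D d)"
  unfolding bij_betw_def
proof
  show "inj_on (root_ideal (int d)) (roots (int d))"
  proof (rule inj_onI)
    fix c c' assume c: "c \<in> roots (int d)" "c' \<in> roots (int d)" "root_ideal (int d) c = root_ideal (int d) c'"
    then show "c = c'" using root_ideal_eqD[OF c(3)] unfolding roots_def by (intro small_dvd_zero) auto
  qed
  show "root_ideal (int d) ` roots (int d) = primitive_ideals D d"
  proof
    show "root_ideal (int d) ` roots (int d) \<subseteq> primitive_ideals D d"
      using root_ideal_primitive[OF d] unfolding roots_def by auto
    show "primitive_ideals D d \<subseteq> root_ideal (int d) ` roots (int d)"
    proof
      fix I assume "I \<in> primitive_ideals D d"
      then obtain c where c: "int d dvd genpoly c" "I = root_ideal (int d) c"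
        using primitive_ideal_root[OF d] by blast
      have "int d dvd c - c mod int d" by (simp add: minus_mod_eq_mult_div)
      then have "I = root_ideal (int d) (c mod int d)" unfolding c(2) by (rule root_ideal_eq_iff)
      moreover have "c mod int d \<in> roots (int d)" using d c(1) by (intro roots_mod) simp_all
      ultimately show "I \<in> root_ideal (int d) ` roots (int d)" by blast
    qed
  qed
qed

theorem primitive_ideals_count:
  assumes d: "d > 0" "coprime d (conductor D)"
  shows "finite (primitive_ideals D d)"
    "card (primitive_ideals D d) = (if prime_factor_condition D d then 2 ^ card (splitting_primes D d) else 0)"
proof -
  obtain f D0 where *: "f > 0" "D = f\<^sup>2 * D0" "D0 mod 4 = 0 \<or> D0 mod 4 = 1"
    "\<And>g D1. D0 = g\<^sup>2 * D1 \<Longrightarrow> D1 mod 4 = 0 \<or> D1 mod 4 = 1 \<Longrightarrow> g = 1"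
    by (rule exists_fundamental) (rule that; assumption)
  interpret C: quadratic_conductor D f D0 by unfold_locales (rule *(2), rule *(3), erule (1) *(4))
  have "coprime d f" using d(2) C.conductor_eq by simp
  then have "card (roots (int d)) = (if prime_factor_condition D d then 2 ^ card (splitting_primes D d) else 0)"
    using C.card_roots[OF d(1)] by simp
  then show "card (primitive_ideals D d) = (if prime_factor_condition D d then 2 ^ card (splitting_primes D d) else 0)"
    using bij_betw_same_card[OF primitive_ideals_roots[OF d(1)]] by simp
  show "finite (primitive_ideals D d)"
    using bij_betw_finite[OF primitive_ideals_roots[OF d(1)]] by simp
qed

end

section \<open>Hermitian forms and objects with real multiplication\<close>

lemma of_real_smult: "(of_real r :: complex) *s x = r *\<^sub>R x"
  unfolding vec_eq_iff vector_smult_component vector_scaleR_component by (simp add: scaleR_conv_of_real)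

locale positive_hermitian =
  fixes H :: "complex^'n \<Rightarrow> complex^'n \<Rightarrow> complex"
  assumes hermitian: "pos_hermitian_on UNIV H"
begin

definition E :: "complex^'n \<Rightarrow> complex^'n \<Rightarrow> real" where "E x y = Im (H x y)"

lemma H_add_left: "H (x + y) z = H x z + H y z"
  using hermitian unfolding pos_hermitian_on_def by (elim conjE) blast

lemma H_scale_left: "H (c *s x) y = c * H x y"
  using hermitian unfolding pos_hermitian_on_def by (elim conjE) blast

lemma H_cnj: "H y x = cnj (H x y)"
  using hermitian unfolding pos_hermitian_on_def by (elim conjE) blast

lemma H_pos: "x \<noteq> 0 \<Longrightarrow> Re (H x x) > 0"
  using hermitian unfolding pos_hermitian_on_def by (elim conjE) blast

lemma H_add_right: "H x (y + z) = H x y + H x z"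
proof -
  have "H x (y + z) = cnj (H (y + z) x)" by (rule H_cnj)
  also have "\<dots> = cnj (H y x) + cnj (H z x)" unfolding H_add_left by simp
  finally show ?thesis using H_cnj[where x = y and y = x] H_cnj[where x = z and y = x] by (simp only:)
qed

lemma H_scale_right: "H x (c *s y) = cnj c * H x y"
proof -
  have "H x (c *s y) = cnj (H (c *s y) x)" by (rule H_cnj)
  also have "\<dots> = cnj c * cnj (H y x)" unfolding H_scale_left by simp
  finally show ?thesis using H_cnj[where x = y and y = x] by (simp only:)
qed

lemma H_scaleR_left: "H (r *\<^sub>R x) y = of_real r * H x y"
  unfolding of_real_smult[symmetric] by (rule H_scale_left)

lemma H_scaleR_right: "H x (r *\<^sub>R y) = of_real r * H x y"
  unfolding of_real_smult[symmetric] H_scale_right by simp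

lemma H_zero [simp]: "H 0 x = 0" "H x 0 = 0"
  using H_scaleR_left[of 0 0 x] H_scaleR_right[of x 0 0] by simp_all

lemma H_minus_left: "H (- x) y = - H x y" and H_minus_right: "H x (- y) = - H x y"
  using H_scaleR_left[of "-1" x y] H_scaleR_right[of x "-1" y] by simp_all

lemma H_diff_left: "H (x - y) z = H x z - H y z" and H_diff_right: "H x (y - z) = H x y - H x z"
  using H_add_left[of x "- y" z] H_add_right[of x y "- z"] by (simp_all add: H_minus_left H_minus_right)

lemma E_add_left: "E (x + y) z = E x z + E y z" and E_add_right: "E x (y + z) = E x y + E x z"
  and E_diff_left: "E (x - y) z = E x z - E y z" and E_diff_right: "E x (y - z) = E x y - E x z"
  and E_minus_left: "E (- x) y = - E x y" and E_minus_right: "E x (- y) = - E x y"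
  and E_scaleR_left: "E (r *\<^sub>R x) y = r * E x y" and E_scaleR_right: "E x (r *\<^sub>R y) = r * E x y"
  unfolding E_def H_add_left H_add_right H_diff_left H_diff_right H_minus_left H_minus_right
    H_scaleR_left H_scaleR_right by simp_all

lemma E_zero [simp]: "E 0 x = 0" "E x 0 = 0" unfolding E_def by simp_all

lemma E_swap: "E y x = - E x y" unfolding E_def by (subst H_cnj) simp

lemma E_self [simp]: "E x x = 0" using E_swap[of x x] by simp

lemma E_ii: "E (\<i> *s x) x = Re (H x x)" unfolding E_def H_scale_left by simp

lemmas E_bilinear = E_add_left E_add_right E_diff_left E_diff_right E_minus_left E_minus_right
  E_scaleR_left E_scaleR_right

end

definition zcomb :: "'a::real_vector \<Rightarrow> 'a \<Rightarrow> 'a \<Rightarrow> 'a \<Rightarrow> int \<Rightarrow> int \<Rightarrow> int \<Rightarrow> int \<Rightarrow> 'a" where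
  "zcomb a b a' b' m n k l = real_of_int m *\<^sub>R a + real_of_int n *\<^sub>R b + real_of_int k *\<^sub>R a' + real_of_int l *\<^sub>R b'"

lemma zcomb_add: "zcomb a b a' b' m n k l + zcomb a b a' b' m' n' k' l' = zcomb a b a' b' (m + m') (n + n') (k + k') (l + l')"
  unfolding zcomb_def by (simp add: algebra_simps)

lemma zcomb_scale: "real_of_int z *\<^sub>R zcomb a b a' b' m n k l = zcomb a b a' b' (z * m) (z * n) (z * k) (z * l)"
  unfolding zcomb_def by (simp add: algebra_simps)

lemma zcomb_basis: "zcomb a b a' b' 1 0 0 0 = a" "zcomb a b a' b' 0 1 0 0 = b"
   "zcomb a b a' b' 0 0 1 0 = a'" "zcomb a b a' b' 0 0 0 1 = b'"
  unfolding zcomb_def by simp_all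

lemma zcomb_comp:
  "zcomb (zcomb a b a' b' m1 n1 k1 l1) (zcomb a b a' b' m2 n2 k2 l2) (zcomb a b a' b' m3 n3 k3 l3) (zcomb a b a' b' m4 n4 k4 l4) x y z w
   = zcomb a b a' b' (x * m1 + y * m2 + z * m3 + w * m4) (x * n1 + y * n2 + z * n3 + w * n4)
       (x * k1 + y * k2 + z * k3 + w * k4) (x * l1 + y * l2 + z * l3 + w * l4)"
  unfolding zcomb_def by (simp add: algebra_simps)

locale rm_object = quadratic_discriminant D + positive_hermitian H
  for D :: nat and H :: "complex^3 \<Rightarrow> complex^3 \<Rightarrow> complex" +
  fixes d :: nat and \<Lambda> W :: "(complex^3) set" and \<rho> :: "real \<Rightarrow> complex^3 \<Rightarrow> complex^3"
  assumes object: "(\<Lambda>, H, W, \<rho>) \<in> rm_objects D d"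
begin

lemma W_subspace: "vec.subspace W"
  and Lambda_type: "polarization_type \<Lambda> H [1, 1, 1]"
  and W_type: "polarization_type (W \<inter> \<Lambda>) H [1, d]"
  and Lambda_torus: "complex_torus UNIV \<Lambda>"
  and W_torus: "complex_torus W (W \<inter> \<Lambda>)"
  and W_dim: "vec.dim W = 2"
  and real_mult: "real_multiplication D W (W \<inter> \<Lambda>) H \<rho>"
  and Lambda_int: "\<And>x y. x \<in> \<Lambda> \<Longrightarrow> y \<in> \<Lambda> \<Longrightarrow> E x y \<in> \<int>"
  using object unfolding rm_objects_def complex_torus_def polarization_def E_def by auto

lemma d_pos: "d > 0"
proof -
  have "\<forall>i<length [1, d]. [1, d] ! i > 0" using W_type unfolding polarization_type_def by (rule conjunct1)
  then have "[1, d] ! 1 > 0" by (rule allE[of _ 1]) simp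
  then show ?thesis by simp
qed

lemma W_add [simp, intro]: "x \<in> W \<Longrightarrow> y \<in> W \<Longrightarrow> x + y \<in> W"
  and W_smult [simp, intro]: "x \<in> W \<Longrightarrow> c *s x \<in> W"
  and W_0 [simp]: "0 \<in> W"
  using W_subspace unfolding vec.subspace_def by blast+

lemma W_scaleR [simp, intro]: "x \<in> W \<Longrightarrow> r *\<^sub>R x \<in> W"
  unfolding of_real_smult[symmetric] by (rule W_smult)

lemma W_minus [simp, intro]: "x \<in> W \<Longrightarrow> - x \<in> W" using W_scaleR[of x "-1"] by simp
lemma W_diff [simp, intro]: "x \<in> W \<Longrightarrow> y \<in> W \<Longrightarrow> x - y \<in> W" using W_add[of x "- y"] by simp

lemma zcomb_W: "a \<in> W \<Longrightarrow> b \<in> W \<Longrightarrow> a' \<in> W \<Longrightarrow> b' \<in> W \<Longrightarrow> zcomb a b a' b' m n k l \<in> W"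
  unfolding zcomb_def by auto

lemma W_type_basis:
  obtains a b a' b' where "W \<inter> \<Lambda> = {zcomb a b a' b' m n k l | m n k l. True}"
    "E a b = 1" "E a' b' = real d" "E a a' = 0" "E a b' = 0" "E b a' = 0" "E b b' = 0"
proof -
  obtain a b :: "nat \<Rightarrow> complex^3" where
    L: "W \<inter> \<Lambda> = {\<Sum>i<length [1, d]. real_of_int (m i) *\<^sub>R a i + real_of_int (n i) *\<^sub>R b i | m n. True}"
    and e: "\<forall>i < length [1, d]. \<forall>j < length [1, d].
           Im (H (a i) (a j)) = 0 \<and> Im (H (b i) (b j)) = 0 \<and>
           Im (H (a i) (b j)) = (if i = j then real ([1, d] ! i) else 0)"
    using W_type unfolding polarization_type_def by blast
  have "W \<inter> \<Lambda> = {zcomb (a 0) (b 0) (a 1) (b 1) m n k l | m n k l. True}"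
  proof
    show "W \<inter> \<Lambda> \<subseteq> {zcomb (a 0) (b 0) (a 1) (b 1) m n k l | m n k l. True}"
    proof
      fix x assume "x \<in> W \<inter> \<Lambda>"
      then obtain m n where "x = (\<Sum>i<length [1, d]. real_of_int (m i) *\<^sub>R a i + real_of_int (n i) *\<^sub>R b i)"
        unfolding L by blast
      also have "\<dots> = zcomb (a 0) (b 0) (a 1) (b 1) (m 0) (n 0) (m 1) (n 1)"
        unfolding zcomb_def by (simp add: lessThan_Suc algebra_simps)
      finally show "x \<in> {zcomb (a 0) (b 0) (a 1) (b 1) m n k l | m n k l. True}" by blast
    qed
    show "{zcomb (a 0) (b 0) (a 1) (b 1) m n k l | m n k l. True} \<subseteq> W \<inter> \<Lambda>"
    proof
      fix x assume "x \<in> {zcomb (a 0) (b 0) (a 1) (b 1) m n k l | m n k l. True}"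
      then obtain m n k l where x: "x = zcomb (a 0) (b 0) (a 1) (b 1) m n k l" by blast
      define M where "M i = (if i = 0 then m else k)" for i :: nat
      define N where "N i = (if i = 0 then n else l)" for i :: nat
      have "x = (\<Sum>i<length [1, d]. real_of_int (M i) *\<^sub>R a i + real_of_int (N i) *\<^sub>R b i)"
        unfolding x zcomb_def M_def N_def by (simp add: lessThan_Suc algebra_simps)
      then show "x \<in> W \<inter> \<Lambda>" unfolding L by blast
    qed
  qed
  moreover have "E (a 0) (b 0) = 1" "E (a 1) (b 1) = real d" "E (a 0) (a 1) = 0" "E (a 0) (b 1) = 0" "E (b 0) (b 1) = 0"
    "E (a 1) (b 0) = 0"
    using e unfolding E_def by auto
  moreover from this have "E (b 0) (a 1) = 0" using E_swap[of "b 0" "a 1"] by simp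
  ultimately show thesis by (intro that)
qed

lemma L_add: "x \<in> W \<inter> \<Lambda> \<Longrightarrow> y \<in> W \<inter> \<Lambda> \<Longrightarrow> x + y \<in> W \<inter> \<Lambda>"
  and L_scale: "x \<in> W \<inter> \<Lambda> \<Longrightarrow> real_of_int z *\<^sub>R x \<in> W \<inter> \<Lambda>"
proof -
  obtain a b a' b' where L: "W \<inter> \<Lambda> = {zcomb a b a' b' m n k l | m n k l. True}" by (rule W_type_basis)
  show "x \<in> W \<inter> \<Lambda> \<Longrightarrow> y \<in> W \<inter> \<Lambda> \<Longrightarrow> x + y \<in> W \<inter> \<Lambda>" unfolding L using zcomb_add by fast
  show "x \<in> W \<inter> \<Lambda> \<Longrightarrow> real_of_int z *\<^sub>R x \<in> W \<inter> \<Lambda>" unfolding L using zcomb_scale by fast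
qed

lemma L_zcomb: "a \<in> W \<inter> \<Lambda> \<Longrightarrow> b \<in> W \<inter> \<Lambda> \<Longrightarrow> a' \<in> W \<inter> \<Lambda> \<Longrightarrow> b' \<in> W \<inter> \<Lambda> \<Longrightarrow> zcomb a b a' b' m n k l \<in> W \<inter> \<Lambda>"
  unfolding zcomb_def by (intro L_add L_scale)

lemma rho_hom: "\<rho> \<in> ring_hom (ring_on (quad_order D)) (End_ring W (W \<inter> \<Lambda>))"
  and rho_inj: "inj_on \<rho> (quad_order D)"
  and rho_adj: "\<And>\<alpha> x y. \<alpha> \<in> quad_order D \<Longrightarrow> x \<in> W \<Longrightarrow> y \<in> W \<Longrightarrow> H (\<rho> \<alpha> x) y = H x (\<rho> \<alpha> y)"
  and rho_proper: "\<not> (\<exists>R \<rho>'. is_order D R \<and> quad_order D \<subset> R \<and>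
               \<rho>' \<in> ring_hom (ring_on R) (End_ring W (W \<inter> \<Lambda>)) \<and> inj_on \<rho>' R \<and>
               (\<forall>\<alpha>\<in>quad_order D. \<rho>' \<alpha> = \<rho> \<alpha>))"
  using real_mult unfolding real_multiplication_def by blast+

lemma rho_carrier: "\<alpha> \<in> quad_order D \<Longrightarrow> \<rho> \<alpha> \<in> carrier (End_ring W (W \<inter> \<Lambda>))"
  using ring_hom_closed[OF rho_hom] by simp

lemma rho_W [simp, intro]: "\<alpha> \<in> quad_order D \<Longrightarrow> x \<in> W \<Longrightarrow> \<rho> \<alpha> x \<in> W"
  and rho_ext: "\<alpha> \<in> quad_order D \<Longrightarrow> \<rho> \<alpha> \<in> extensional W"
  and rho_lin: "\<alpha> \<in> quad_order D \<Longrightarrow> x \<in> W \<Longrightarrow> y \<in> W \<Longrightarrow> \<rho> \<alpha> (x + y) = \<rho> \<alpha> x + \<rho> \<alpha> y"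
  and rho_smult: "\<alpha> \<in> quad_order D \<Longrightarrow> x \<in> W \<Longrightarrow> \<rho> \<alpha> (c *s x) = c *s \<rho> \<alpha> x"
  and rho_L: "\<alpha> \<in> quad_order D \<Longrightarrow> x \<in> W \<inter> \<Lambda> \<Longrightarrow> \<rho> \<alpha> x \<in> W \<inter> \<Lambda>"
  using rho_carrier[of \<alpha>] unfolding End_ring_def by (auto simp: PiE_iff)

lemma rho_scaleR: "\<alpha> \<in> quad_order D \<Longrightarrow> x \<in> W \<Longrightarrow> \<rho> \<alpha> (r *\<^sub>R x) = r *\<^sub>R \<rho> \<alpha> x"
  unfolding of_real_smult[symmetric] by (rule rho_smult)

lemma rho_add: "\<alpha> \<in> quad_order D \<Longrightarrow> \<beta> \<in> quad_order D \<Longrightarrow> x \<in> W \<Longrightarrow> \<rho> (\<alpha> + \<beta>) x = \<rho> \<alpha> x + \<rho> \<beta> x"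
  using ring_hom_add[OF rho_hom, of \<alpha> \<beta>] unfolding End_ring_def by simp

lemma rho_mult: "\<alpha> \<in> quad_order D \<Longrightarrow> \<beta> \<in> quad_order D \<Longrightarrow> x \<in> W \<Longrightarrow> \<rho> (\<alpha> * \<beta>) x = \<rho> \<alpha> (\<rho> \<beta> x)"
  using ring_hom_mult[OF rho_hom, of \<alpha> \<beta>] unfolding End_ring_def by (simp add: compose_def)

lemma rho_1: "x \<in> W \<Longrightarrow> \<rho> 1 x = x"
  using ring_hom_one[OF rho_hom] unfolding End_ring_def by simp

lemma rho_0: "x \<in> W \<Longrightarrow> \<rho> 0 x = 0"
  using rho_add[of 0 0 x] by simp

lemma rho_nat: "x \<in> W \<Longrightarrow> \<rho> (of_int (int n)) x = real n *\<^sub>R x"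
proof (induction n)
  case 0 then show ?case by (simp add: rho_0)
next
  case (Suc n)
  have "\<rho> (of_int (int n) + of_int 1) x = \<rho> (of_int (int n)) x + \<rho> (of_int 1) x"
    using Suc.prems by (intro rho_add order_of_int)
  then show ?case using Suc rho_1[of x] by (simp add: algebra_simps)
qed

lemma rho_of_int: assumes x: "x \<in> W" shows "\<rho> (of_int m) x = of_int m *\<^sub>R x"
proof (cases "m \<ge> 0")
  case True then show ?thesis using rho_nat[OF x, of "nat m"] by simp
next
  case False
  then have "\<rho> (of_int (int (nat (- m))) + of_int m) x = \<rho> (of_int (int (nat (- m)))) x + \<rho> (of_int m) x"
    using x by (intro rho_add order_of_int)
  then have "0 = \<rho> (of_int (int (nat (- m)))) x + \<rho> (of_int m) x" using False rho_0[OF x] by simp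
  also have "\<rho> (of_int (int (nat (- m)))) x = - (of_int m *\<^sub>R x)" using rho_nat[OF x, of "nat (- m)"] False by simp
  finally show ?thesis by simp
qed

abbreviation G where "G \<equiv> \<rho> gen"

lemma rho_elt: "x \<in> W \<Longrightarrow> \<rho> (elt m n) x = of_int m *\<^sub>R x + of_int n *\<^sub>R G x"
  unfolding elt_def using rho_add[of "of_int m" "of_int n * gen" x] rho_mult[of "of_int n" gen x]
    order_mult[of "of_int n" gen] by (simp add: rho_of_int)

lemma G_W [simp, intro]: "x \<in> W \<Longrightarrow> G x \<in> W" by simp
lemma G_L: "x \<in> W \<inter> \<Lambda> \<Longrightarrow> G x \<in> W \<inter> \<Lambda>" using rho_L[of gen x] by simp

lemma G_zcomb: "a \<in> W \<Longrightarrow> b \<in> W \<Longrightarrow> a' \<in> W \<Longrightarrow> b' \<in> W \<Longrightarrow>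
    G (zcomb a b a' b' m n k l) = zcomb (G a) (G b) (G a') (G b') m n k l"
  unfolding zcomb_def by (simp add: rho_lin rho_scaleR)

lemma G_sq: assumes "x \<in> W" shows "G (G x) = real D *\<^sub>R G x - of_int gnorm *\<^sub>R x"
proof -
  have "gen * gen = elt (- gnorm) (int D)" unfolding gen_sq elt_def by simp
  then have "\<rho> (elt (- gnorm) (int D)) x = G (G x)" using rho_mult[of gen gen x] assms by simp
  then show ?thesis using rho_elt[OF assms, of "- gnorm" "int D"] by simp
qed

lemma E_adj: "x \<in> W \<Longrightarrow> y \<in> W \<Longrightarrow> E (G x) y = E x (G y)"
  unfolding E_def using rho_adj[of gen x y] by simp

lemma E_G_self [simp]: assumes "x \<in> W" shows "E (G x) x = 0" "E x (G x) = 0"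
  using E_adj[OF assms assms] E_swap[of x "G x"] by simp_all

lemma E_zcomb: "E (zcomb a b a' b' m n k l) (zcomb a b a' b' m' n' k' l') =
   (m * n' - n * m') * E a b + (m * k' - k * m') * E a a' + (m * l' - l * m') * E a b'
   + (n * k' - k * n') * E b a' + (n * l' - l * n') * E b b' + (k * l' - l * k') * E a' b'"
  unfolding zcomb_def E_bilinear
  using E_swap[of a b] E_swap[of a a'] E_swap[of a b'] E_swap[of b a'] E_swap[of b b'] E_swap[of a' b']
  by (simp add: algebra_simps)

text \<open>As \<open>\<gamma>\<close> is self-adjoint, \<open>E (\<gamma> x) y\<close> is an alternating form on the lattice and has six coefficients with
  respect to the basis. Four of the entries are divisible by \<open>d\<close> because the form is of type \<open>(1, d)\<close>.\<close>

lemma structure_coeffs: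
  assumes L: "W \<inter> \<Lambda> = {zcomb a b a' b' m n k l | m n k l. True}"
    and e: "E a b = 1" "E a' b' = real d" "E a a' = 0" "E a b' = 0" "E b a' = 0" "E b b' = 0"
  shows "\<exists>p q s r w t :: int. G a = zcomb a b a' b' p 0 s (- r) \<and> G b = zcomb a b a' b' 0 p w (- t)
     \<and> G a' = zcomb a b a' b' (- (int d * t)) (int d * r) q 0 \<and> G b' = zcomb a b a' b' (- (int d * w)) (int d * s) 0 q"
proof -
  let ?C = "zcomb a b a' b'"
  have sw: "E b a = - 1" "E b' a' = - real d" "E a' a = 0" "E b' a = 0" "E a' b = 0" "E b' b = 0"
    using e E_swap[of a b] E_swap[of a' b'] E_swap[of a a'] E_swap[of a b'] E_swap[of b a'] E_swap[of b b'] by linarith+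
  note ee = e sw
  have inL: "?C m n k l \<in> W \<inter> \<Lambda>" for m n k l unfolding L by blast
  have bL: "a \<in> W \<inter> \<Lambda>" "b \<in> W \<inter> \<Lambda>" "a' \<in> W \<inter> \<Lambda>" "b' \<in> W \<inter> \<Lambda>"
    using inL[of 1 0 0 0] inL[of 0 1 0 0] inL[of 0 0 1 0] inL[of 0 0 0 1] unfolding zcomb_basis by blast+
  then have bW: "a \<in> W" "b \<in> W" "a' \<in> W" "b' \<in> W" by blast+
  have co: "E (?C m n k l) a = - of_int n" "E (?C m n k l) b = of_int m"
     "E (?C m n k l) a' = - (of_int l * real d)" "E (?C m n k l) b' = of_int k * real d" for m n k l
    unfolding zcomb_def E_bilinear using ee by simp_all
  have ex: "\<exists>m n k l. x = ?C m n k l" if "x \<in> W \<inter> \<Lambda>" for x using that unfolding L by blast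
  obtain m1 n1 k1 l1 where 1: "G a = ?C m1 n1 k1 l1" using ex[OF G_L[OF bL(1)]] by blast
  obtain m2 n2 k2 l2 where 2: "G b = ?C m2 n2 k2 l2" using ex[OF G_L[OF bL(2)]] by blast
  obtain m3 n3 k3 l3 where 3: "G a' = ?C m3 n3 k3 l3" using ex[OF G_L[OF bL(3)]] by blast
  obtain m4 n4 k4 l4 where 4: "G b' = ?C m4 n4 k4 l4" using ex[OF G_L[OF bL(4)]] by blast
  have adj: "E (G x) y = - E (G y) x" if "x \<in> W" "y \<in> W" for x y
    using E_adj[OF that] E_swap[of "G y" x] by simp
  have "n1 = 0" using E_G_self(1)[OF bW(1)] unfolding 1 co by simp
  moreover have "m2 = 0" using E_G_self(1)[OF bW(2)] unfolding 2 co by simp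
  moreover have "l3 = 0" using E_G_self(1)[OF bW(3)] d_pos unfolding 3 co by simp
  moreover have "k4 = 0" using E_G_self(1)[OF bW(4)] d_pos unfolding 4 co by simp
  moreover have "n2 = m1" using adj[OF bW(1,2)] unfolding 1 2 co by simp
  moreover have "l4 = k3" using adj[OF bW(3,4)] d_pos unfolding 3 4 co by simp
  moreover have "n3 = - (int d * l1)"
  proof -
    have "real_of_int n3 = of_int (- (int d * l1))" using adj[OF bW(1,3)] unfolding 1 3 co by (simp add: algebra_simps)
    then show ?thesis by (simp only: of_int_eq_iff)
  qed
  moreover have "n4 = int d * k1"
  proof -
    have "real_of_int n4 = of_int (int d * k1)" using adj[OF bW(1,4)] unfolding 1 4 co by (simp add: algebra_simps)
    then show ?thesis by (simp only: of_int_eq_iff)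
  qed
  moreover have "m3 = int d * l2"
  proof -
    have "real_of_int m3 = of_int (int d * l2)" using adj[OF bW(2,3)] unfolding 2 3 co by (simp add: algebra_simps)
    then show ?thesis by (simp only: of_int_eq_iff)
  qed
  moreover have "m4 = - (int d * k2)"
  proof -
    have "real_of_int m4 = of_int (- (int d * k2))" using adj[OF bW(2,4)] unfolding 2 4 co by (simp add: algebra_simps)
    then show ?thesis by (simp only: of_int_eq_iff)
  qed
  ultimately show ?thesis
    using 1 2 3 4 by (intro exI[of _ m1] exI[of _ k3] exI[of _ k1] exI[of _ "- l1"] exI[of _ k2] exI[of _ "- l2"]) simp
qed

lemma zcomb_inject:
  assumes e: "E a b = 1" "E a' b' = real d" "E a a' = 0" "E a b' = 0" "E b a' = 0" "E b b' = 0"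
    and "zcomb a b a' b' m n k l = zcomb a b a' b' m' n' k' l'"
  shows "m = m' \<and> n = n' \<and> k = k' \<and> l = l'"
proof -
  have sw: "E b a = - 1" "E b' a' = - real d" "E a' a = 0" "E b' a = 0" "E a' b = 0" "E b' b = 0"
    using e E_swap[of a b] E_swap[of a' b'] E_swap[of a a'] E_swap[of a b'] E_swap[of b a'] E_swap[of b b'] by linarith+
  note ee = e sw
  have co: "E (zcomb a b a' b' m n k l) a = - of_int n" "E (zcomb a b a' b' m n k l) b = of_int m"
     "E (zcomb a b a' b' m n k l) a' = - (of_int l * real d)" "E (zcomb a b a' b' m n k l) b' = of_int k * real d" for m n k l
    unfolding zcomb_def E_bilinear using ee by simp_all
  show ?thesis using co[of m n k l] co[of m' n' k' l'] assms(7) d_pos by simp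
qed

text \<open>Compare coefficients in \<open>\<gamma>\<^sup>2 = D \<gamma> - N(\<gamma>)\<close>. The numbers \<open>r, s, t, w\<close> do not all vanish, as \<open>\<gamma>\<close> is
  irrational.\<close>

lemma structure_relations:
  assumes L: "W \<inter> \<Lambda> = {zcomb a b a' b' m n k l | m n k l. True}"
    and e: "E a b = 1" "E a' b' = real d" "E a a' = 0" "E a b' = 0" "E b a' = 0" "E b b' = 0"
    and G: "G a = zcomb a b a' b' p 0 s (- r)" "G b = zcomb a b a' b' 0 p w (- t)"
     "G a' = zcomb a b a' b' (- (int d * t)) (int d * r) q 0" "G b' = zcomb a b a' b' (- (int d * w)) (int d * s) 0 q"
  shows "p + q = int D" "gnorm = p * q + int d * (s * t - r * w)"
proof -
  let ?C = "zcomb a b a' b'"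
  have inL: "?C m n k l \<in> W \<inter> \<Lambda>" for m n k l unfolding L by blast
  have bW: "a \<in> W" "b \<in> W" "a' \<in> W" "b' \<in> W"
    using inL[of 1 0 0 0] inL[of 0 1 0 0] inL[of 0 0 1 0] inL[of 0 0 0 1] unfolding zcomb_basis by blast+
  note inj = zcomb_inject[OF e]
  have a1: "G (G a) = ?C (p * p - int d * (s * t - r * w)) 0 ((p + q) * s) (- ((p + q) * r))"
    unfolding G(1) G_zcomb[OF bW] unfolding G zcomb_comp by (intro arg_cong4[where f = "?C"]) (simp_all add: algebra_simps)
  have a2: "G (G a) = ?C (int D * p - gnorm) 0 (int D * s) (- (int D * r))"
  proof -
    have "G (G a) = real_of_int (int D) *\<^sub>R ?C p 0 s (- r) + real_of_int (- gnorm) *\<^sub>R ?C 1 0 0 0"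
      using G_sq[OF bW(1)] unfolding G(1) zcomb_basis by simp
    then show ?thesis unfolding zcomb_scale zcomb_add by simp
  qed
  have b1: "G (G b) = ?C 0 (p * p - int d * (s * t - r * w)) ((p + q) * w) (- ((p + q) * t))"
    unfolding G(2) G_zcomb[OF bW] unfolding G zcomb_comp by (intro arg_cong4[where f = "?C"]) (simp_all add: algebra_simps)
  have b2: "G (G b) = ?C 0 (int D * p - gnorm) (int D * w) (- (int D * t))"
  proof -
    have "G (G b) = real_of_int (int D) *\<^sub>R ?C 0 p w (- t) + real_of_int (- gnorm) *\<^sub>R ?C 0 1 0 0"
      using G_sq[OF bW(2)] unfolding G(2) zcomb_basis by simp
    then show ?thesis unfolding zcomb_scale zcomb_add by simp
  qed
  have ea: "p * p - int d * (s * t - r * w) = int D * p - gnorm" "(p + q) * s = int D * s" "(p + q) * r = int D * r"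
    using inj[OF trans[OF a1[symmetric] a2]] by simp_all
  have eb: "(p + q) * w = int D * w" "(p + q) * t = int D * t"
    using inj[OF trans[OF b1[symmetric] b2]] by simp_all
  have nz: "\<not> (s = 0 \<and> r = 0 \<and> w = 0 \<and> t = 0)"
  proof
    assume z: "s = 0 \<and> r = 0 \<and> w = 0 \<and> t = 0"
    then have "genpoly (- p) = 0" using ea(1) unfolding genpoly_def by (simp add: power2_eq_square)
    then show False using genpoly_nonzero by blast
  qed
  show pq: "p + q = int D" using nz ea(2,3) eb by auto
  show "gnorm = p * q + int d * (s * t - r * w)" using ea(1) unfolding pq[symmetric] by (simp add: algebra_simps)
qed

end

section \<open>Adapted bases\<close>

text \<open>A weak form of the Smith normal form. Let \<open>b\<close> be a nonzero value of \<open>B\<close> of least absolute value on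
  pairs of primitive vectors. When these vectors are completed to bases, the mixed values can be
  reduced modulo \<open>b\<close> and then vanish; once they do, the last value is modulo \<open>b\<close> again a value on a
  pair of primitive vectors, so that \<open>b\<close> divides it.\<close>

lemma bilinear_primitive_value:
  fixes s r w t :: int
  defines "B \<equiv> \<lambda>m1 m2 n1 n2. m1 * n1 * s + m1 * n2 * r + m2 * n1 * w + m2 * n2 * t"
  obtains m1 m2 m3 m4 n1 n2 n3 n4 where "m1 * m4 - m2 * m3 = 1" "n1 * n4 - n2 * n3 = 1"
    "B m1 m2 n1 n2 dvd B m1 m2 n3 n4" "B m1 m2 n1 n2 dvd B m3 m4 n1 n2" "B m1 m2 n1 n2 dvd B m3 m4 n3 n4"
proof (cases "s = 0 \<and> r = 0 \<and> w = 0 \<and> t = 0")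
  case True
  show thesis by (rule that[of 1 1 0 0 1 1 0 0]) (use True in \<open>simp_all add: B_def\<close>)
next
  case False
  define prim :: "int \<Rightarrow> int \<Rightarrow> bool" where "prim m n \<longleftrightarrow> (\<exists>m' n'. m * n' - n * m' = 1)" for m n
  define V where "V k \<longleftrightarrow> (\<exists>m1 m2 n1 n2. prim m1 m2 \<and> prim n1 n2 \<and> B m1 m2 n1 n2 \<noteq> 0 \<and> k = nat \<bar>B m1 m2 n1 n2\<bar>)" for k
  have "prim 1 0" unfolding prim_def by (intro exI[of _ 0] exI[of _ 1]) simp
  moreover have "prim 0 1" unfolding prim_def by (intro exI[of _ "-1"] exI[of _ 0]) simp
  moreover have "B 1 0 1 0 = s" "B 1 0 0 1 = r" "B 0 1 1 0 = w" "B 0 1 0 1 = t" unfolding B_def by simp_all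
  ultimately have "\<exists>k. V k" using False unfolding V_def by metis
  then have "V (Least V)" by (rule LeastI_ex)
  then obtain m1 m2 n1 n2 where mn: "prim m1 m2" "prim n1 n2" "B m1 m2 n1 n2 \<noteq> 0" "Least V = nat \<bar>B m1 m2 n1 n2\<bar>"
    unfolding V_def by blast
  define b where "b = B m1 m2 n1 n2"
  have min: "B x1 x2 y1 y2 = 0" if "prim x1 x2" "prim y1 y2" "\<bar>B x1 x2 y1 y2\<bar> < \<bar>b\<bar>" for x1 x2 y1 y2
  proof (rule ccontr)
    assume "B x1 x2 y1 y2 \<noteq> 0"
    then have "V (nat \<bar>B x1 x2 y1 y2\<bar>)" unfolding V_def using that by blast
    then have "Least V \<le> nat \<bar>B x1 x2 y1 y2\<bar>" by (rule Least_le)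
    then show False using that(3) mn(4) unfolding b_def by simp
  qed
  have shift: "prim (x' + k * x) (y' + k * y)" if "x * y' - y * x' = 1" for x y x' y' k
    unfolding prim_def by (intro exI[of _ "- x"] exI[of _ "- y"]) (use that in \<open>simp add: algebra_simps\<close>)
  obtain m3 m4 where m: "m1 * m4 - m2 * m3 = 1" using mn(1) unfolding prim_def by blast
  obtain n3 n4 where n: "n1 * n4 - n2 * n3 = 1" using mn(2) unfolding prim_def by blast
  define k where "k = - (B m1 m2 n3 n4 div b)"
  define l where "l = - (B m3 m4 n1 n2 div b)"
  have b0: "b \<noteq> 0" using mn(3) unfolding b_def by simp
  have "B m1 m2 (n3 + k * n1) (n4 + k * n2) = B m1 m2 n3 n4 + k * b" unfolding B_def b_def by (simp add: algebra_simps)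
  also have "\<dots> = B m1 m2 n3 n4 mod b" unfolding k_def by (simp add: minus_div_mult_eq_mod)
  finally have r1: "B m1 m2 (n3 + k * n1) (n4 + k * n2) = B m1 m2 n3 n4 mod b" .
  have z1: "B m1 m2 (n3 + k * n1) (n4 + k * n2) = 0"
    by (rule min[OF mn(1) shift[OF n]]) (unfold r1, rule abs_mod_less[OF b0])
  have "B (m3 + l * m1) (m4 + l * m2) n1 n2 = B m3 m4 n1 n2 + l * b" unfolding B_def b_def by (simp add: algebra_simps)
  also have "\<dots> = B m3 m4 n1 n2 mod b" unfolding l_def by (simp add: minus_div_mult_eq_mod)
  finally have r2: "B (m3 + l * m1) (m4 + l * m2) n1 n2 = B m3 m4 n1 n2 mod b" .
  have z2: "B (m3 + l * m1) (m4 + l * m2) n1 n2 = 0"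
    by (rule min[OF shift[OF m] mn(2)]) (unfold r2, rule abs_mod_less[OF b0])
  define M3 where "M3 = m3 + l * m1" define M4 where "M4 = m4 + l * m2"
  define N3 where "N3 = n3 + k * n1" define N4 where "N4 = n4 + k * n2"
  have M: "m1 * M4 - m2 * M3 = 1" and N: "n1 * N4 - n2 * N3 = 1"
    unfolding M3_def M4_def N3_def N4_def using m n by (simp_all add: algebra_simps)
  have z: "B m1 m2 N3 N4 = 0" "B M3 M4 n1 n2 = 0" using z1 z2 unfolding M3_def M4_def N3_def N4_def by simp_all
  define j where "j = - (B M3 M4 N3 N4 div b)"
  have "B (m1 + 1 * M3) (m2 + 1 * M4) (N3 + j * n1) (N4 + j * n2)
      = B m1 m2 N3 N4 + B M3 M4 N3 N4 + j * b + j * B M3 M4 n1 n2"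
    unfolding B_def b_def by (simp add: algebra_simps)
  also have "\<dots> = B M3 M4 N3 N4 mod b" unfolding z j_def by (simp add: minus_div_mult_eq_mod)
  finally have r3: "B (m1 + 1 * M3) (m2 + 1 * M4) (N3 + j * n1) (N4 + j * n2) = B M3 M4 N3 N4 mod b" .
  have "(- M3) * m2 - (- M4) * m1 = 1" using M by (simp add: algebra_simps)
  then have pm: "prim (m1 + (- 1) * (- M3)) (m2 + (- 1) * (- M4))" by (rule shift)
  have "B (m1 + 1 * M3) (m2 + 1 * M4) (N3 + j * n1) (N4 + j * n2) = 0"
    by (rule min[OF _ shift[OF N]]) (use pm in simp, unfold r3, rule abs_mod_less[OF b0])
  then have "b dvd B M3 M4 N3 N4" using r3 by (simp add: dvd_eq_mod_eq_0)
  then show thesis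
    using that[OF M N] z unfolding b_def by simp
qed

context rm_object begin

text \<open>A common divisor \<open>z\<close> makes \<open>\<gamma> - p\<close> divisible by \<open>z\<close> in the endomorphism ring. The quotient acts like
  \<open>\<beta> = (\<gamma> - p) / z\<close>, so that the action extends to the order \<open>\<int> + \<int> \<beta>\<close>. Properness forces this
  order to be \<open>\<O>\<^sub>D\<close>, hence \<open>z = 1\<close>.\<close>

lemma proper_coprime:
  assumes L: "W \<inter> \<Lambda> = {zcomb a b a' b' m n k l | m n k l. True}"
    and e: "E a b = 1" "E a' b' = real d" "E a a' = 0" "E a b' = 0" "E b a' = 0" "E b b' = 0"
    and G: "G a = zcomb a b a' b' p 0 s (- r)" "G b = zcomb a b a' b' 0 p w (- t)"
     "G a' = zcomb a b a' b' (- (int d * t)) (int d * r) q 0" "G b' = zcomb a b a' b' (- (int d * w)) (int d * s) 0 q"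
    and dv: "z dvd p - q" "z dvd s" "z dvd r" "z dvd w" "z dvd t" "z > 0"
  shows "z = 1"
proof (rule ccontr)
  assume z1: "z \<noteq> 1"
  let ?C = "zcomb a b a' b'"
  have inL: "?C m n k l \<in> W \<inter> \<Lambda>" for m n k l unfolding L by blast
  have bL: "a \<in> W \<inter> \<Lambda>" "b \<in> W \<inter> \<Lambda>" "a' \<in> W \<inter> \<Lambda>" "b' \<in> W \<inter> \<Lambda>"
    using inL[of 1 0 0 0] inL[of 0 1 0 0] inL[of 0 0 1 0] inL[of 0 0 0 1] unfolding zcomb_basis by blast+
  then have bW: "a \<in> W" "b \<in> W" "a' \<in> W" "b' \<in> W" by blast+
  note rel = structure_relations[OF L e G]
  obtain e0 where e0: "p - q = z * e0" using dv by blast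
  obtain s0 r0 w0 t0 where srwt: "s = z * s0" "r = z * r0" "w = z * w0" "t = z * t0" using dv by (meson dvdE)
  define \<Delta> where "\<Delta> = s0 * t0 - r0 * w0"
  define \<beta> where "\<beta> = (gen - of_int p) / of_int z"
  have gz: "of_int z * \<beta> = gen - of_int p" unfolding \<beta>_def using dv(6) by simp
  have "of_int z * of_int z * (\<beta> * \<beta>) = (gen - of_int p) * (gen - of_int p)"
    unfolding gz[symmetric] by (simp add: algebra_simps)
  also have "\<dots> = of_int (p + q) * gen - of_int gnorm - 2 * of_int p * gen + of_int p * of_int p"
    using gen_sq rel(1) by (simp add: algebra_simps)
  also have "\<dots> = - (of_int (p - q) * (gen - of_int p)) - of_int (int d * (s * t - r * w))"
    unfolding rel(2) by (simp add: algebra_simps)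
  also have "\<dots> = - (of_int z * of_int e0 * (of_int z * \<beta>)) - of_int (int d * (z * z * \<Delta>))"
    unfolding e0 gz[symmetric] srwt \<Delta>_def by (simp add: algebra_simps)
  also have "\<dots> = of_int z * of_int z * (- (of_int e0 * \<beta>) - of_int (int d * \<Delta>))" by (simp add: algebra_simps)
  finally have bsq: "\<beta> * \<beta> = - (of_int e0 * \<beta>) - of_int (int d * \<Delta>)" using dv(6) by simp
  define elR where "elR m n = of_int m + of_int n * \<beta>" for m n :: int
  define R where "R = {elR m n | m n. True}"
  have R_add: "elR m n + elR m' n' = elR (m + m') (n + n')" for m n m' n'
    unfolding elR_def by (simp add: algebra_simps)
  have R_mult: "elR m n * elR m' n' = elR (m * m' - n * n' * (int d * \<Delta>)) (m * n' + n * m' - n * n' * e0)" for m n m' n'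
  proof -
    have "elR m n * elR m' n' = of_int m * of_int m' + (of_int m * of_int n' + of_int n * of_int m') * \<beta> + of_int n * of_int n' * (\<beta> * \<beta>)"
      unfolding elR_def by (simp add: algebra_simps)
    then show ?thesis unfolding bsq unfolding elR_def by (simp add: algebra_simps)
  qed
  have R_zero: "m = 0 \<and> n = 0" if "elR m n = 0" for m n
  proof -
    have "of_int n * (of_int z * \<beta>) = of_int n * (gen - of_int p)" unfolding gz ..
    then have "of_int z * elR m n = of_int (z * m - n * p) + of_int n * gen"
      unfolding elR_def by (simp add: algebra_simps)
    then have "elt (z * m - n * p) n = elt 0 0" using that unfolding elt_def by simp
    then show ?thesis using dv(6) by auto
  qed
  have R_inj: "elR m n = elR m' n' \<longleftrightarrow> m = m' \<and> n = n'" for m n m' n'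
    using R_zero[of "m - m'" "n - n'"] unfolding elR_def by (auto simp: algebra_simps)
  have elt_R: "elt m n = elR (m + n * p) (n * z)" for m n
  proof -
    have "of_int (n * z) * \<beta> = of_int n * (gen - of_int p)" unfolding gz[symmetric] by simp
    then show ?thesis unfolding elt_def elR_def by (simp add: algebra_simps)
  qed
  have beta_field: "\<beta> \<in> quad_field D"
  proof -
    have "\<beta> = (1 / of_int z) * (gen - of_int p)" unfolding \<beta>_def by simp
    also have "\<dots> \<in> quad_field D"
      using conj_mult[of "1 / of_int z" "gen - of_int p"] conj_diff[of gen "of_int p"] by simp
    finally show ?thesis .
  qed
  have R_field: "R \<subseteq> quad_field D"
    unfolding R_def elR_def using conj_add conj_mult beta_field by auto
  have order: "is_order D R"
    unfolding is_order_def
  proof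
    have fld: "cring (ring_on (quad_field D))"
      by (rule cring_ring_on) (use conj_add conj_mult conj_minus in auto)
    show "subring R (ring_on (quad_field D))"
    proof (rule ring.subringI[OF cring.axioms(1)[OF fld]])
      show "R \<subseteq> carrier (ring_on (quad_field D))" using R_field by simp
      have "1 = elR 1 0" unfolding elR_def by simp
      then show "\<one>\<^bsub>ring_on (quad_field D)\<^esub> \<in> R" unfolding R_def by auto
    next
      fix h assume h: "h \<in> R"
      then obtain m n where mn: "h = elR m n" unfolding R_def by blast
      have "\<ominus>\<^bsub>ring_on (quad_field D)\<^esub> h = - h"
      proof (rule abelian_group.minus_equality[OF ring.is_abelian_group[OF cring.axioms(1)[OF fld]]])
        show "- h \<oplus>\<^bsub>ring_on (quad_field D)\<^esub> h = \<zero>\<^bsub>ring_on (quad_field D)\<^esub>" by simp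
      qed (use h R_field conj_minus in auto)
      also have "\<dots> = elR (- m) (- n)" unfolding mn elR_def by simp
      finally show "\<ominus>\<^bsub>ring_on (quad_field D)\<^esub> h \<in> R" unfolding R_def by blast
    next
      fix h1 h2 assume h: "h1 \<in> R" "h2 \<in> R"
      then obtain m n m' n' where mn: "h1 = elR m n" "h2 = elR m' n'" unfolding R_def by blast
      show "h1 \<otimes>\<^bsub>ring_on (quad_field D)\<^esub> h2 \<in> R" unfolding ring_on_simps mn R_mult unfolding R_def by blast
      show "h1 \<oplus>\<^bsub>ring_on (quad_field D)\<^esub> h2 \<in> R" unfolding ring_on_simps mn R_add unfolding R_def by blast
    qed
    have "int_basis2 1 \<beta> R"
      unfolding int_basis2_def R_def using R_zero unfolding elR_def by simp
    then show "\<exists>b1 b2. int_basis2 b1 b2 R" by blast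
  qed
  have sub: "quad_order D \<subset> R"
  proof
    show "quad_order D \<subseteq> R" unfolding order_eq elt_R R_def by blast
    show "quad_order D \<noteq> R"
    proof
      assume eq: "quad_order D = R"
      have "elR 0 1 \<in> R" unfolding R_def by blast
      then obtain m n where "elR 0 1 = elt m n" using eq by (metis orderE)
      then have "n * z = 1" unfolding elt_R R_inj by simp
      then show False using z1 dv(6) zmult_eq_1_iff[of n z] by auto
    qed
  qed
  \<comment> \<open>The endomorphism by which \<open>\<beta>\<close> acts.\<close>
  define B where "B x = (1 / real_of_int z) *\<^sub>R (G x - of_int p *\<^sub>R x)" for x
  have BG: "of_int z *\<^sub>R B x = G x - of_int p *\<^sub>R x" for x unfolding B_def using dv(6) by simp
  have B_W: "B x \<in> W" if "x \<in> W" for x unfolding B_def using that by simp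
  have B_add: "B (x + y) = B x + B y" if "x \<in> W" "y \<in> W" for x y
    unfolding B_def using that by (simp add: rho_lin algebra_simps)
  have B_smult: "B (c *s x) = c *s B x" if "x \<in> W" for c x
    unfolding B_def of_real_smult[symmetric] using that
    by (simp add: rho_smult vec.scale_right_diff_distrib vec.scale_left_commute)
  have B_scaleR: "B (c *\<^sub>R x) = c *\<^sub>R B x" if "x \<in> W" for c x
    unfolding of_real_smult[symmetric] by (rule B_smult[OF that])
  have B_sq: "B (B x) = - (of_int e0 *\<^sub>R B x) - of_int (int d * \<Delta>) *\<^sub>R x" if x: "x \<in> W" for x
  proof -
    have "of_int z *\<^sub>R of_int z *\<^sub>R B (B x) = B (of_int z *\<^sub>R of_int z *\<^sub>R x) - B (of_int z *\<^sub>R of_int z *\<^sub>R x) + of_int z *\<^sub>R B (of_int z *\<^sub>R B x)"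
      using x B_W B_scaleR by simp
    also have "\<dots> = of_int z *\<^sub>R B (G x - of_int p *\<^sub>R x)" unfolding BG by simp
    also have "\<dots> = G (G x - of_int p *\<^sub>R x) - of_int p *\<^sub>R (G x - of_int p *\<^sub>R x)" unfolding BG ..
    also have "G (G x - of_int p *\<^sub>R x) = G (G x) - of_int p *\<^sub>R G x"
      using x rho_lin[of gen "G x" "(- of_int p) *\<^sub>R x"] rho_scaleR[of gen x "- of_int p"] by simp
    also have "G (G x) = of_int (p + q) *\<^sub>R G x - of_int (p * q + int d * (s * t - r * w)) *\<^sub>R x"
      using G_sq[OF x] rel by simp
    also have "of_int (p + q) *\<^sub>R G x - of_int (p * q + int d * (s * t - r * w)) *\<^sub>R x - of_int p *\<^sub>R G x - of_int p *\<^sub>R (G x - of_int p *\<^sub>R x)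
       = - (of_int (p - q) *\<^sub>R (G x - of_int p *\<^sub>R x)) - of_int (int d * (s * t - r * w)) *\<^sub>R x"
      by (simp add: algebra_simps)
    also have "\<dots> = of_int z *\<^sub>R of_int z *\<^sub>R (- (of_int e0 *\<^sub>R B x) - of_int (int d * \<Delta>) *\<^sub>R x)"
      unfolding e0 BG[symmetric] srwt \<Delta>_def by (simp add: algebra_simps)
    finally show ?thesis using dv(6) by simp
  qed
  have B_L: "B x \<in> W \<inter> \<Lambda>" if x: "x \<in> W \<inter> \<Lambda>" for x
  proof -
    have "B a = ?C 0 0 s0 (- r0)" "B b = ?C 0 0 w0 (- t0)"
      "B a' = ?C (- (int d * t0)) (int d * r0) (- e0) 0" "B b' = ?C (- (int d * w0)) (int d * s0) 0 (- e0)"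
    proof -
      have can: "x = y" if "of_int z *\<^sub>R x = of_int z *\<^sub>R y" for x y :: "complex^3" using that dv(6) by simp
      have q: "q = p - z * e0" using e0 by simp
      show "B a = ?C 0 0 s0 (- r0)" by (rule can) (simp add: BG G srwt zcomb_def algebra_simps)
      show "B b = ?C 0 0 w0 (- t0)" by (rule can) (simp add: BG G srwt zcomb_def algebra_simps)
      show "B a' = ?C (- (int d * t0)) (int d * r0) (- e0) 0" by (rule can) (simp add: BG G srwt q zcomb_def algebra_simps)
      show "B b' = ?C (- (int d * w0)) (int d * s0) 0 (- e0)" by (rule can) (simp add: BG G srwt q zcomb_def algebra_simps)
    qed
    then have Bb: "B a \<in> W \<inter> \<Lambda>" "B b \<in> W \<inter> \<Lambda>" "B a' \<in> W \<inter> \<Lambda>" "B b' \<in> W \<inter> \<Lambda>" using inL by metis+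
    obtain m n k l where "x = ?C m n k l" using x unfolding L by blast
    then have "B x = zcomb (B a) (B b) (B a') (B b') m n k l"
      unfolding zcomb_def using bW by (simp add: B_add B_scaleR)
    then show ?thesis using L_zcomb[OF Bb] by simp
  qed
  define act where "act m n = (\<lambda>x\<in>W. of_int m *\<^sub>R x + of_int n *\<^sub>R B x)" for m n :: int
  define \<rho>' where "\<rho>' \<alpha> = (case (SOME mn. \<alpha> = elR (fst mn) (snd mn)) of (m, n) \<Rightarrow> act m n)" for \<alpha>
  have rho': "\<rho>' (elR m n) = act m n" for m n
  proof -
    have "(SOME mn. elR m n = elR (fst mn) (snd mn)) = (m, n)"
      by (rule some_equality) (auto simp: R_inj)
    then show ?thesis unfolding \<rho>'_def by simp
  qed
  have act_carrier: "act m n \<in> carrier (End_ring W (W \<inter> \<Lambda>))" for m n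
    unfolding End_ring_def partial_object.simps mem_Collect_eq
  proof (intro conjI ballI allI)
    show "act m n \<in> W \<rightarrow>\<^sub>E W" unfolding act_def using B_W by auto
    show "act m n (x + y) = act m n x + act m n y" if "x \<in> W" "y \<in> W" for x y
      unfolding act_def using that by (simp add: B_add algebra_simps)
    show "act m n (c *s x) = c *s act m n x" if "x \<in> W" for c x
      unfolding act_def of_real_smult[symmetric] using that
      by (simp add: B_smult vec.scale_right_distrib mult.commute)
    show "act m n ` (W \<inter> \<Lambda>) \<subseteq> W \<inter> \<Lambda>"
    proof
      fix y assume "y \<in> act m n ` (W \<inter> \<Lambda>)"
      then obtain x where x: "x \<in> W \<inter> \<Lambda>" "y = act m n x" by blast
      then have "y = of_int m *\<^sub>R x + of_int n *\<^sub>R B x" unfolding act_def by simp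
      then show "y \<in> W \<inter> \<Lambda>" using x(1) B_L L_add L_scale by metis
    qed
  qed
  have hom: "\<rho>' \<in> ring_hom (ring_on R) (End_ring W (W \<inter> \<Lambda>))"
  proof (rule ring_hom_memI)
    fix x assume "x \<in> carrier (ring_on R)"
    then obtain m n where "x = elR m n" unfolding R_def by auto
    then show "\<rho>' x \<in> carrier (End_ring W (W \<inter> \<Lambda>))" using act_carrier rho' by simp
  next
    fix x y assume "x \<in> carrier (ring_on R)" "y \<in> carrier (ring_on R)"
    then obtain m n m' n' where xy: "x = elR m n" "y = elR m' n'" unfolding R_def by auto
    show "\<rho>' (x \<otimes>\<^bsub>ring_on R\<^esub> y) = \<rho>' x \<otimes>\<^bsub>End_ring W (W \<inter> \<Lambda>)\<^esub> \<rho>' y"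
    proof -
      have "act (m * m' - n * n' * (int d * \<Delta>)) (m * n' + n * m' - n * n' * e0) v = compose W (act m n) (act m' n') v" for v
      proof (cases "v \<in> W")
        case True
        then show ?thesis unfolding act_def compose_def using B_W[OF True]
          by (simp add: B_add B_scaleR B_sq algebra_simps)
      qed (simp add: act_def compose_def)
      then show ?thesis unfolding ring_on_simps xy R_mult rho' unfolding End_ring_def by auto
    qed
    show "\<rho>' (x \<oplus>\<^bsub>ring_on R\<^esub> y) = \<rho>' x \<oplus>\<^bsub>End_ring W (W \<inter> \<Lambda>)\<^esub> \<rho>' y"
      unfolding ring_on_simps xy R_add rho' End_ring_def act_def by (auto simp: fun_eq_iff algebra_simps)
  next
    have "1 = elR 1 0" unfolding elR_def by simp
    then have "\<rho>' 1 = act 1 0" using rho' by metis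
    then show "\<rho>' \<one>\<^bsub>ring_on R\<^esub> = \<one>\<^bsub>End_ring W (W \<inter> \<Lambda>)\<^esub>"
      unfolding End_ring_def act_def by (auto simp: fun_eq_iff)
  qed
  have act_elt: "act (m + n * p) (n * z) = \<rho> (elt m n)" for m n
  proof
    fix x show "act (m + n * p) (n * z) x = \<rho> (elt m n) x"
    proof (cases "x \<in> W")
      case True
      have "of_int (n * z) *\<^sub>R B x = of_int n *\<^sub>R (G x - of_int p *\<^sub>R x)" using BG[of x] by (simp flip: BG)
      then show ?thesis unfolding act_def using True rho_elt[OF True, of m n] by (simp add: algebra_simps)
    next
      case False
      then show ?thesis unfolding act_def using rho_ext[OF elt_in_order[of m n]] by (simp add: extensional_def)
    qed
  qed
  have ext: "\<rho>' \<alpha> = \<rho> \<alpha>" if al: "\<alpha> \<in> quad_order D" for \<alpha>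
  proof -
    obtain m n where "\<alpha> = elt m n" using al by (rule orderE)
    then show ?thesis using elt_R[of m n] rho'[of "m + n * p" "n * z"] act_elt[of m n] by simp
  qed
  have inj: "inj_on \<rho>' R"
  proof (rule inj_onI)
    fix x y assume "x \<in> R" "y \<in> R" and eq: "\<rho>' x = \<rho>' y"
    then obtain m n m' n' where xy: "x = elR m n" "y = elR m' n'" unfolding R_def by blast
    have aa: "act m n = act m' n'" using eq unfolding xy rho' .
    have ev: "of_int m *\<^sub>R v + of_int n *\<^sub>R B v = of_int m' *\<^sub>R v + of_int n' *\<^sub>R B v" if "v \<in> W" for v
      using that fun_cong[OF aa, of v] unfolding act_def by simp
    have "\<rho> (elt (z * m - n * p) n) = \<rho> (elt (z * m' - n' * p) n')"
    proof
      fix v show "\<rho> (elt (z * m - n * p) n) v = \<rho> (elt (z * m' - n' * p) n') v"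
      proof (cases "v \<in> W")
        case True
        have r: "\<rho> (elt (z * m - n * p) n) v = of_int z *\<^sub>R (of_int m *\<^sub>R v + of_int n *\<^sub>R B v)" for m n
        proof -
          have "of_int z *\<^sub>R (of_int m *\<^sub>R v + of_int n *\<^sub>R B v) = of_int (z * m) *\<^sub>R v + of_int n *\<^sub>R (of_int z *\<^sub>R B v)"
            by (simp add: algebra_simps)
          then show ?thesis unfolding BG rho_elt[OF True] by (simp add: algebra_simps)
        qed
        show ?thesis unfolding r ev[OF True] ..
      next
        case False
        then show ?thesis using rho_ext[OF elt_in_order] by (simp add: extensional_def)
      qed
    qed
    then have "elt (z * m - n * p) n = elt (z * m' - n' * p) n'" by (rule inj_onD[OF rho_inj]) simp_all
    then show "x = y" unfolding xy R_inj using dv(6) by auto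
  qed
  show False using rho_proper order sub hom inj ext by blast
qed

end

section \<open>The module attached to an object\<close>

definition module_type :: "nat \<Rightarrow> real set \<Rightarrow> rm_data \<Rightarrow> bool" where
  "module_type D \<aa> = (\<lambda>(\<Lambda>, H, W, \<rho>).
     \<exists>\<phi>. bij_betw \<phi> (W \<inter> \<Lambda>) (quad_order D \<times> (\<lambda>x. x / sqrt (real D)) ` \<aa>) \<and>
         (\<forall>u\<in>W \<inter> \<Lambda>. \<forall>v\<in>W \<inter> \<Lambda>. \<phi> (u + v) = \<phi> u + \<phi> v) \<and>
         (\<forall>\<alpha>\<in>quad_order D. \<forall>u\<in>W \<inter> \<Lambda>. \<phi> (\<rho> \<alpha> u) = (\<alpha> * fst (\<phi> u), \<alpha> * snd (\<phi> u))) \<and>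
         (\<forall>u\<in>W \<inter> \<Lambda>. \<forall>v\<in>W \<inter> \<Lambda>. trace_pairing D (\<phi> u) (\<phi> v) = Im (H u v)))"

lemma moduli_locus_eq: "moduli_locus D d \<aa> = {C \<in> moduli_space D d. \<exists>q\<in>C. module_type D \<aa> q}"
  unfolding moduli_locus_def module_type_def by auto

lemma times_one_eq: "(e::int) = 1 \<Longrightarrow> x = t * e \<Longrightarrow> x = t"
  by simp

context rm_object begin

text \<open>The relations between the elements \<open>(1, 0)\<close>, \<open>(\<gamma>, 0)\<close>, \<open>(0, d / \<surd>D)\<close> and \<open>(0, (\<gamma> + c) / \<surd>D)\<close> of
  \<open>\<O>\<^sub>D \<oplus> \<aa> / \<surd>D\<close>, where \<open>\<aa>\<close> is spanned by \<open>d\<close> and \<open>\<gamma> + c\<close>.\<close>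

definition adapted :: "int \<Rightarrow> complex^3 \<Rightarrow> complex^3 \<Rightarrow> complex^3 \<Rightarrow> complex^3 \<Rightarrow> bool" where
  "adapted c u v y z \<longleftrightarrow> W \<inter> \<Lambda> = {zcomb u v y z m n k l | m n k l. True} \<and>
     G u = v \<and> G y = real d *\<^sub>R z - of_int c *\<^sub>R y \<and>
     E u v = 0 \<and> E y z = 0 \<and> E y u = 0 \<and> E y v = real d \<and> E z u = 1 \<and> E z v = of_int (int D + c)"

text \<open>Base changes of determinant one in the planes spanned by \<open>a, b\<close> and by \<open>a', b'\<close> transform \<open>r, s, t, w\<close>
  like the matrix of a bilinear form.\<close>

lemma type_basis_divisible:
  obtains a b a' b' p q s r w t where "W \<inter> \<Lambda> = {zcomb a b a' b' m n k l | m n k l. True}"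
    "E a b = 1" "E a' b' = real d" "E a a' = 0" "E a b' = 0" "E b a' = 0" "E b b' = 0"
    "G a = zcomb a b a' b' p 0 s (- r)" "G b = zcomb a b a' b' 0 p w (- t)"
    "G a' = zcomb a b a' b' (- (int d * t)) (int d * r) q 0" "G b' = zcomb a b a' b' (- (int d * w)) (int d * s) 0 q"
    "s dvd r" "s dvd w" "s dvd t"
proof -
  obtain a b a' b' where L: "W \<inter> \<Lambda> = {zcomb a b a' b' m n k l | m n k l. True}"
    and e: "E a b = 1" "E a' b' = real d" "E a a' = 0" "E a b' = 0" "E b a' = 0" "E b b' = 0" by (rule W_type_basis)
  obtain p q s r w t where G: "G a = zcomb a b a' b' p 0 s (- r)" "G b = zcomb a b a' b' 0 p w (- t)"
     "G a' = zcomb a b a' b' (- (int d * t)) (int d * r) q 0" "G b' = zcomb a b a' b' (- (int d * w)) (int d * s) 0 q"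
    using structure_coeffs[OF L e] by blast
  define B where "B m1 m2 n1 n2 = m1 * n1 * r + m1 * n2 * s + m2 * n1 * t + m2 * n2 * w" for m1 m2 n1 n2 :: int
  obtain m1 m2 m3 m4 n1 n2 n3 n4 where m: "m1 * m4 - m2 * m3 = 1" and n: "n1 * n4 - n2 * n3 = 1"
    and dv: "B m1 m2 n1 n2 dvd B m1 m2 n3 n4" "B m1 m2 n1 n2 dvd B m3 m4 n1 n2" "B m1 m2 n1 n2 dvd B m3 m4 n3 n4"
    unfolding B_def by (rule bilinear_primitive_value[of r s t w])
  let ?C = "zcomb a b a' b'"
  have inL: "?C m n k l \<in> W \<inter> \<Lambda>" for m n k l unfolding L by blast
  have bW: "a \<in> W" "b \<in> W" "a' \<in> W" "b' \<in> W"
    using inL[of 1 0 0 0] inL[of 0 1 0 0] inL[of 0 0 1 0] inL[of 0 0 0 1] unfolding zcomb_basis by blast+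
  define a1 where "a1 = ?C m1 m2 0 0" define b1 where "b1 = ?C m3 m4 0 0"
  define a2 where "a2 = ?C 0 0 (- n3) (- n4)" define b2 where "b2 = ?C 0 0 n1 n2"
  note defs = a1_def b1_def a2_def b2_def
  have e': "E a1 b1 = 1" "E a2 b2 = real d" "E a1 a2 = 0" "E a1 b2 = 0" "E b1 a2 = 0" "E b1 b2 = 0"
  proof -
    have "E a1 b1 = of_int (m1 * m4 - m2 * m3)" unfolding defs E_zcomb e by simp
    then show "E a1 b1 = 1" unfolding m by simp
    have "E a2 b2 = of_int (n1 * n4 - n2 * n3) * real d" unfolding defs E_zcomb e by (simp add: algebra_simps)
    then show "E a2 b2 = real d" unfolding n by simp
  qed (unfold defs E_zcomb e, simp_all)
  have L': "W \<inter> \<Lambda> = {zcomb a1 b1 a2 b2 m n k l | m n k l. True}"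
  proof
    show "W \<inter> \<Lambda> \<subseteq> {zcomb a1 b1 a2 b2 m n k l | m n k l. True}"
    proof
      fix x assume "x \<in> W \<inter> \<Lambda>"
      then obtain x1 x2 k l where x: "x = ?C x1 x2 k l" unfolding L by blast
      have "zcomb a1 b1 a2 b2 (x1 * m4 - x2 * m3) (x2 * m1 - x1 * m2) (k * n2 - l * n1) (k * n4 - l * n3) = ?C x1 x2 k l"
        unfolding defs zcomb_comp
      proof (intro arg_cong4[where f = "?C"])
        show "(x1 * m4 - x2 * m3) * m1 + (x2 * m1 - x1 * m2) * m3 + (k * n2 - l * n1) * 0 + (k * n4 - l * n3) * 0 = x1"
          by (rule times_one_eq[OF m]) (simp add: algebra_simps)
        show "(x1 * m4 - x2 * m3) * m2 + (x2 * m1 - x1 * m2) * m4 + (k * n2 - l * n1) * 0 + (k * n4 - l * n3) * 0 = x2"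
          by (rule times_one_eq[OF m]) (simp add: algebra_simps)
        show "(x1 * m4 - x2 * m3) * 0 + (x2 * m1 - x1 * m2) * 0 + (k * n2 - l * n1) * - n3 + (k * n4 - l * n3) * n1 = k"
          by (rule times_one_eq[OF n]) (simp add: algebra_simps)
        show "(x1 * m4 - x2 * m3) * 0 + (x2 * m1 - x1 * m2) * 0 + (k * n2 - l * n1) * - n4 + (k * n4 - l * n3) * n2 = l"
          by (rule times_one_eq[OF n]) (simp add: algebra_simps)
      qed
      then show "x \<in> {zcomb a1 b1 a2 b2 m n k l | m n k l. True}" unfolding x by (metis (mono_tags, lifting) mem_Collect_eq)
    qed
    show "{zcomb a1 b1 a2 b2 m n k l | m n k l. True} \<subseteq> W \<inter> \<Lambda>"
    proof
      fix x assume "x \<in> {zcomb a1 b1 a2 b2 m n k l | m n k l. True}"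
      then obtain m n k l where "x = zcomb a1 b1 a2 b2 m n k l" by blast
      moreover have "a1 \<in> W \<inter> \<Lambda>" "b1 \<in> W \<inter> \<Lambda>" "a2 \<in> W \<inter> \<Lambda>" "b2 \<in> W \<inter> \<Lambda>" unfolding defs by (rule inL)+
      ultimately show "x \<in> W \<inter> \<Lambda>" using L_zcomb by simp
    qed
  qed
  obtain p' q' s' r' w' t' where G': "G a1 = zcomb a1 b1 a2 b2 p' 0 s' (- r')" "G b1 = zcomb a1 b1 a2 b2 0 p' w' (- t')"
     "G a2 = zcomb a1 b1 a2 b2 (- (int d * t')) (int d * r') q' 0" "G b2 = zcomb a1 b1 a2 b2 (- (int d * w')) (int d * s') 0 q'"
    using structure_coeffs[OF L' e'] by blast
  have new: "E (zcomb a1 b1 a2 b2 m n k l) b2 = of_int k * real d" "E (zcomb a1 b1 a2 b2 m n k l) a2 = - (of_int l * real d)" for m n k l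
    unfolding zcomb_def E_bilinear e' using E_swap[of a2 b2] e'(2) by simp_all
  have old: "E (G (?C x1 x2 0 0)) (?C 0 0 k l) = of_int (B x1 x2 k l) * real d" for x1 x2 k l
  proof -
    have "G (?C x1 x2 0 0) = ?C (x1 * p) (x2 * p) (x1 * s + x2 * w) (- (x1 * r + x2 * t))"
      unfolding G_zcomb[OF bW] unfolding G zcomb_comp by (intro arg_cong4[where f = "?C"]) simp_all
    then show ?thesis unfolding B_def by (simp only: E_zcomb e) (simp add: algebra_simps)
  qed
  have can: "x = y" if "of_int x * real d = of_int y * real d" for x y :: int using that d_pos by simp
  have s': "s' = B m1 m2 n1 n2"
    by (rule can) (use old[of m1 m2 n1 n2] new(1)[of p' 0 s' "- r'"] G'(1) in \<open>simp add: a1_def b2_def\<close>)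
  have w': "w' = B m3 m4 n1 n2"
    by (rule can) (use old[of m3 m4 n1 n2] new(1)[of 0 p' w' "- t'"] G'(2) in \<open>simp add: b1_def b2_def\<close>)
  have r': "r' = B m1 m2 (- n3) (- n4)"
    by (rule can) (use old[of m1 m2 "- n3" "- n4"] new(2)[of p' 0 s' "- r'"] G'(1) in \<open>simp add: a1_def a2_def\<close>)
  have t': "t' = B m3 m4 (- n3) (- n4)"
    by (rule can) (use old[of m3 m4 "- n3" "- n4"] new(2)[of 0 p' w' "- t'"] G'(2) in \<open>simp add: b1_def a2_def\<close>)
  have neg: "B x1 x2 (- k) (- l) = - B x1 x2 k l" for x1 x2 k l unfolding B_def by simp
  have "s' dvd r'" "s' dvd w'" "s' dvd t'" unfolding s' r' w' t' neg using dv by simp_all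
  then show thesis by (rule that[OF L' e' G'])
qed

text \<open>For \<open>u = a + b'\<close> the vectors \<open>u\<close> and \<open>\<gamma> u\<close> span an isotropic plane. It is a direct summand because \<open>s\<close> and
  \<open>\<delta> = q - p - r + d w\<close> are coprime: \<open>s\<close> divides \<open>r\<close>, \<open>w\<close> and \<open>t\<close>, so that a common divisor with \<open>\<delta>\<close> also
  divides \<open>p - q\<close>. The vectors \<open>y\<close> and \<open>z\<close> that complete the basis are read off from a Bezout identity
  for \<open>s\<close> and \<open>\<delta>\<close>.\<close>

lemma adapted_exists: "\<exists>c u v y z. int d dvd genpoly c \<and> adapted c u v y z"
proof -
  obtain a b a' b' p q s r w t where L: "W \<inter> \<Lambda> = {zcomb a b a' b' m n k l | m n k l. True}"
    and e: "E a b = 1" "E a' b' = real d" "E a a' = 0" "E a b' = 0" "E b a' = 0" "E b b' = 0"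
    and G: "G a = zcomb a b a' b' p 0 s (- r)" "G b = zcomb a b a' b' 0 p w (- t)"
     "G a' = zcomb a b a' b' (- (int d * t)) (int d * r) q 0" "G b' = zcomb a b a' b' (- (int d * w)) (int d * s) 0 q"
    and dv: "s dvd r" "s dvd w" "s dvd t" by (rule type_basis_divisible)
  let ?C = "zcomb a b a' b'"
  have inL: "?C m n k l \<in> W \<inter> \<Lambda>" for m n k l unfolding L by blast
  have bW: "a \<in> W" "b \<in> W" "a' \<in> W" "b' \<in> W"
    using inL[of 1 0 0 0] inL[of 0 1 0 0] inL[of 0 0 1 0] inL[of 0 0 0 1] unfolding zcomb_basis by blast+
  note rel = structure_relations[OF L e G]
  define \<delta> where "\<delta> = q - p - r + int d * w"
  have "gcd s \<delta> = 1"
  proof -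
    \<comment> \<open>The value 2 keeps \<open>z\<close> positive in case \<open>s\<close> and \<open>\<delta>\<close> both vanish.\<close>
    define z where "z = (if gcd s \<delta> = 0 then 2 else gcd s \<delta>)"
    have zs: "z dvd s" "z dvd \<delta>" unfolding z_def by auto
    then have zz: "z dvd r" "z dvd w" "z dvd t" using dv dvd_trans by blast+
    have "p - q = - \<delta> - r + int d * w" unfolding \<delta>_def by simp
    moreover have "z dvd - \<delta> - r + int d * w" using zs zz by simp
    ultimately have zpq: "z dvd p - q" by simp
    have "z > 0" unfolding z_def using gcd_ge_0_int[of s \<delta>] by auto
    then have "z = 1" by (rule proper_coprime[OF L e G zpq zs(1) zz])
    then show ?thesis unfolding z_def by (auto split: if_splits)
  qed
  then obtain \<alpha> \<beta> where ab: "\<alpha> * s + \<beta> * \<delta> = 1" using bezout_int[of s \<delta>] by auto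
  define \<kappa> where "\<kappa> = \<alpha> * w - \<beta> * t"
  define c where "c = - q - int d * w"
  define u where "u = ?C 1 0 0 1"
  define v where "v = ?C (p - int d * w) (int d * s) s (q - r)"
  define y where "y = ?C 0 (int d * \<beta>) \<beta> (- \<alpha>)"
  define z where "z = ?C \<kappa> (- 1) 0 \<kappa>"
  note defs = u_def v_def y_def z_def
  have cop: "int d dvd genpoly c"
  proof -
    have "genpoly c = int d * (s * t - r * w - w * (p - q - int d * w))"
      unfolding genpoly_def rel(2) rel(1)[symmetric] c_def by (simp add: power2_eq_square algebra_simps)
    then show ?thesis by simp
  qed
  have Gu: "G u = v"
    unfolding defs G_zcomb[OF bW] unfolding G zcomb_comp by (intro arg_cong4[where f = "?C"]) simp_all
  have uW: "u \<in> W" unfolding u_def by (rule zcomb_W[OF bW])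
  have Gy: "G y = real d *\<^sub>R z - of_int c *\<^sub>R y"
  proof -
    have "real d *\<^sub>R z - of_int c *\<^sub>R y = of_int (int d) *\<^sub>R z + of_int (- c) *\<^sub>R y" by simp
    also have "\<dots> = ?C (int d * \<kappa>) (- int d + (q + int d * w) * (int d * \<beta>)) ((q + int d * w) * \<beta>) (int d * \<kappa> - (q + int d * w) * \<alpha>)"
      unfolding defs zcomb_scale zcomb_add c_def by (intro arg_cong4[where f = "?C"]) (simp_all add: algebra_simps)
    also have "\<dots> = G y"
      unfolding y_def G_zcomb[OF bW] unfolding G zcomb_comp
    proof (intro arg_cong4[where f = "?C"])
      show "int d * \<kappa> = 0 * p + int d * \<beta> * 0 + \<beta> * - (int d * t) + - \<alpha> * - (int d * w)"
        unfolding \<kappa>_def by (simp add: algebra_simps)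
      show "- int d + (q + int d * w) * (int d * \<beta>) = 0 * 0 + int d * \<beta> * p + \<beta> * (int d * r) + - \<alpha> * (int d * s)"
      proof -
        have "0 * 0 + int d * \<beta> * p + \<beta> * (int d * r) + - \<alpha> * (int d * s)
            = - int d * (\<alpha> * s + \<beta> * \<delta>) + (q + int d * w) * (int d * \<beta>)"
          unfolding \<delta>_def by (simp add: algebra_simps)
        then show ?thesis unfolding ab by simp
      qed
      show "(q + int d * w) * \<beta> = 0 * s + int d * \<beta> * w + \<beta> * q + - \<alpha> * 0" by (simp add: algebra_simps)
      show "int d * \<kappa> - (q + int d * w) * \<alpha> = 0 * - r + int d * \<beta> * - t + \<beta> * 0 + - \<alpha> * q"
        unfolding \<kappa>_def by (simp add: algebra_simps)
    qed
    finally show ?thesis ..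
  qed
  have Euv: "E u v = 0" using E_G_self(2)[OF uW] Gu by simp
  have Es: "E y z = 0" "E y u = 0" "E z u = 1" "E z v = of_int (int D + c)"
    unfolding defs E_zcomb e c_def rel(1)[symmetric] by (simp_all add: algebra_simps)
  have Eyv: "E y v = real d"
  proof -
    have "E y v = of_int (int d * (\<alpha> * s + \<beta> * \<delta>))"
      unfolding defs E_zcomb e \<delta>_def by (simp add: algebra_simps)
    then show ?thesis unfolding ab by simp
  qed
  have span: "W \<inter> \<Lambda> = {zcomb u v y z m n k l | m n k l. True}"
  proof
    show "{zcomb u v y z m n k l | m n k l. True} \<subseteq> W \<inter> \<Lambda>"
    proof
      fix x assume "x \<in> {zcomb u v y z m n k l | m n k l. True}"
      then obtain m n k l where "x = zcomb u v y z m n k l" by blast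
      moreover have "u \<in> W \<inter> \<Lambda>" "v \<in> W \<inter> \<Lambda>" "y \<in> W \<inter> \<Lambda>" "z \<in> W \<inter> \<Lambda>" unfolding defs by (rule inL)+
      ultimately show "x \<in> W \<inter> \<Lambda>" using L_zcomb by simp
    qed
    show "W \<inter> \<Lambda> \<subseteq> {zcomb u v y z m n k l | m n k l. True}"
    proof
      fix x assume "x \<in> W \<inter> \<Lambda>"
      then obtain x1 x2 x3 x4 where x: "x = ?C x1 x2 x3 x4" unfolding L by blast
      define n where "n = \<alpha> * x3 + \<beta> * (x4 - x1)"
      define l where "l = - x2 + int d * x3"
      define k where "k = x1 * s + x3 * \<delta> - x4 * s"
      define m where "m = x1 - n * (p - int d * w) - l * \<kappa>"
      have i3: "n * s + k * \<beta> = x3" unfolding n_def k_def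
        by (rule times_one_eq[OF ab]) (simp add: algebra_simps)
      have "zcomb u v y z m n k l = ?C x1 x2 x3 x4"
        unfolding defs zcomb_comp
      proof (intro arg_cong4[where f = "?C"])
        show "m * 1 + n * (p - int d * w) + k * 0 + l * \<kappa> = x1" unfolding m_def by simp
        show "m * 0 + n * (int d * s) + k * (int d * \<beta>) + l * - 1 = x2"
          unfolding l_def i3[symmetric] by (simp add: algebra_simps)
        show "m * 0 + n * s + k * \<beta> + l * 0 = x3" using i3 by simp
        show "m * 1 + n * (q - r) + k * - \<alpha> + l * \<kappa> = x4"
        proof -
          have "m * 1 + n * (q - r) + k * - \<alpha> + l * \<kappa> = x1 + (x4 - x1) * (\<alpha> * s + \<beta> * \<delta>)"
            unfolding m_def n_def k_def \<delta>_def by (simp add: algebra_simps)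
          then show ?thesis using ab by simp
        qed
      qed
      then show "x \<in> {zcomb u v y z m n k l | m n k l. True}" unfolding x by (metis (mono_tags, lifting) mem_Collect_eq)
    qed
  qed
  have "adapted c u v y z" unfolding adapted_def using span Gu Gy Euv Es Eyv by simp
  then show ?thesis using cop by blast
qed

lemma adapted_in:
  assumes "adapted c u v y z" shows "u \<in> W \<inter> \<Lambda>" "v \<in> W \<inter> \<Lambda>" "y \<in> W \<inter> \<Lambda>" "z \<in> W \<inter> \<Lambda>"
proof -
  have inL: "zcomb u v y z m n k l \<in> W \<inter> \<Lambda>" for m n k l using assms unfolding adapted_def by blast
  show "u \<in> W \<inter> \<Lambda>" "v \<in> W \<inter> \<Lambda>" "y \<in> W \<inter> \<Lambda>" "z \<in> W \<inter> \<Lambda>"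
    using inL[of 1 0 0 0] inL[of 0 1 0 0] inL[of 0 0 1 0] inL[of 0 0 0 1] unfolding zcomb_basis by blast+
qed

lemma adapted_E:
  assumes "adapted c u v y z"
  shows "E (zcomb u v y z m n k l) (zcomb u v y z m' n' k' l') =
    of_int ((l * m' - m * l') + int d * (k * n' - n * k') + (int D + c) * (l * n' - n * l'))"
proof -
  have e: "E u v = 0" "E y z = 0" "E y u = 0" "E y v = real d" "E z u = 1" "E z v = of_int (int D + c)"
    using assms unfolding adapted_def by simp_all
  have e2: "E u y = 0" "E u z = -1" "E v y = - real d" "E v z = - of_int (int D + c)"
    using e E_swap[of y u] E_swap[of z u] E_swap[of y v] E_swap[of z v] by linarith+
  show ?thesis unfolding E_zcomb e e2 by (simp add: algebra_simps)
qed

lemma adapted_inject: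
  assumes a: "adapted c u v y z" and eq: "zcomb u v y z m n k l = zcomb u v y z m' n' k' l'"
  shows "m = m' \<and> n = n' \<and> k = k' \<and> l = l'"
proof -
  have "E (zcomb u v y z m n k l) (zcomb u v y z x1 x2 x3 x4) = E (zcomb u v y z m' n' k' l') (zcomb u v y z x1 x2 x3 x4)"
    for x1 x2 x3 x4 using eq by simp
  then have h: "(l * x1 - m * x4) + int d * (k * x2 - n * x3) + (int D + c) * (l * x2 - n * x4)
    = (l' * x1 - m' * x4) + int d * (k' * x2 - n' * x3) + (int D + c) * (l' * x2 - n' * x4)" for x1 x2 x3 x4
    unfolding adapted_E[OF a] by (simp only: of_int_eq_iff)
  have "l = l'" using h[of 1 0 0 0] by simp
  moreover have "n = n'" using h[of 0 0 0 1] d_pos by simp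
  moreover have "k = k'" using h[of 0 0 1 0] d_pos \<open>l = l'\<close> by simp
  moreover have "m = m'" using h[of 0 1 0 0] \<open>n = n'\<close> by simp
  ultimately show ?thesis by simp
qed

lemma adapted_G:
  assumes a: "adapted c u v y z" and g: "genpoly c = int d * g"
  shows "G (zcomb u v y z m n k l) =
    zcomb u v y z (- (n * gnorm)) (m + n * int D) (- (k * c) - l * g) (k * int d + l * (int D + c))"
proof -
  have in': "u \<in> W" "v \<in> W" "y \<in> W" "z \<in> W" using adapted_in[OF a] by blast+
  have Gu: "G u = v" and Gy: "G y = real d *\<^sub>R z - of_int c *\<^sub>R y" using a unfolding adapted_def by simp_all
  have Gv: "G v = real D *\<^sub>R v - of_int gnorm *\<^sub>R u" using G_sq[OF in'(1)] unfolding Gu .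
  have dz: "real d *\<^sub>R z = G y + of_int c *\<^sub>R y" using Gy by simp
  have "real d *\<^sub>R G z = G (real d *\<^sub>R z)" using rho_scaleR[of gen z "real d"] in' by simp
  also have "\<dots> = G (G y) + of_int c *\<^sub>R G y" unfolding dz using rho_lin[of gen "G y" "of_int c *\<^sub>R y"] rho_scaleR in' by simp
  also have "\<dots> = of_int (int D + c) *\<^sub>R G y - of_int gnorm *\<^sub>R y" unfolding G_sq[OF in'(3)] by (simp add: algebra_simps)
  also have "\<dots> = real d *\<^sub>R of_int (int D + c) *\<^sub>R z - of_int (genpoly c) *\<^sub>R y"
    unfolding Gy genpoly_def by (simp add: algebra_simps power2_eq_square)
  also have "\<dots> = real d *\<^sub>R (of_int (int D + c) *\<^sub>R z - of_int g *\<^sub>R y)" unfolding g by (simp add: algebra_simps)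
  finally have Gz: "G z = of_int (int D + c) *\<^sub>R z - of_int g *\<^sub>R y" using d_pos by simp
  show ?thesis unfolding G_zcomb[OF in'] Gu Gv Gy Gz unfolding zcomb_def by (simp add: algebra_simps)
qed

lemma adapted_module_type:
  assumes a: "adapted c u v y z" and dc: "int d dvd genpoly c"
  shows "module_type D (root_ideal (int d) c) (\<Lambda>, H, W, \<rho>)"
proof -
  have L: "W \<inter> \<Lambda> = {zcomb u v y z m n k l | m n k l. True}" using a unfolding adapted_def by blast
  obtain g where g: "genpoly c = int d * g" using dc by blast
  let ?C = "zcomb u v y z"
  let ?J = "(\<lambda>x. x / rootD) ` root_ideal (int d) c"
  define f where "f m n k l = (elt m n, elt (k * int d + l * c) l / rootD)" for m n k l
  define \<phi> where "\<phi> x = (case (SOME (m, n, k, l). x = ?C m n k l) of (m, n, k, l) \<Rightarrow> f m n k l)" for x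
  have phi: "\<phi> (?C m n k l) = f m n k l" for m n k l
  proof -
    have "(SOME (m', n', k', l'). ?C m n k l = ?C m' n' k' l') = (m, n, k, l)"
      by (rule some_equality) (auto dest!: adapted_inject[OF a])
    then show ?thesis unfolding \<phi>_def by simp
  qed
  have f_inj: "m = m' \<and> n = n' \<and> k = k' \<and> l = l'" if "f m n k l = f m' n' k' l'" for m n k l m' n' k' l'
  proof -
    have "elt m n = elt m' n'" "elt (k * int d + l * c) l = elt (k' * int d + l' * c) l'"
      using that rootD_pos unfolding f_def by (simp_all del: elt_inject)
    then have s: "m = m'" "n = n'" "l = l'" and "k * int d + l * c = k' * int d + l' * c"
      unfolding elt_inject by blast+
    then have "k = k'" using d_pos by auto
    then show ?thesis using s by simp
  qed
  have bij: "bij_betw \<phi> (W \<inter> \<Lambda>) (quad_order D \<times> ?J)"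
    unfolding bij_betw_def
  proof
    show "inj_on \<phi> (W \<inter> \<Lambda>)"
      unfolding L by (rule inj_onI) (auto simp: phi dest!: f_inj)
    show "\<phi> ` (W \<inter> \<Lambda>) = quad_order D \<times> ?J"
    proof
      show "\<phi> ` (W \<inter> \<Lambda>) \<subseteq> quad_order D \<times> ?J"
        unfolding L by (auto simp: phi f_def)
      show "quad_order D \<times> ?J \<subseteq> \<phi> ` (W \<inter> \<Lambda>)"
      proof
        fix x assume "x \<in> quad_order D \<times> ?J"
        then obtain x1 x2 where x: "x = (x1, x2 / rootD)" "x1 \<in> quad_order D" "x2 \<in> root_ideal (int d) c" by blast
        obtain m n where mn: "x1 = elt m n" using x(2) by (rule orderE)
        obtain i l where il: "x2 = elt i l" "int d dvd i - l * c" using x(3) unfolding root_ideal_def by blast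
        obtain k where "i - l * c = int d * k" using il(2) by blast
        then have "x = f m n k l" unfolding x(1) mn il(1) f_def by (simp add: algebra_simps)
        then have "x = \<phi> (?C m n k l)" using phi by simp
        then show "x \<in> \<phi> ` (W \<inter> \<Lambda>)" unfolding L by blast
      qed
    qed
  qed
  have add: "\<phi> (x + x') = \<phi> x + \<phi> x'" if xx: "x \<in> W \<inter> \<Lambda>" "x' \<in> W \<inter> \<Lambda>" for x x'
  proof -
    obtain m n k l m' n' k' l' where x: "x = ?C m n k l" "x' = ?C m' n' k' l'" using xx unfolding L by blast
    have "f (m + m') (n + n') (k + k') (l + l') = f m n k l + f m' n' k' l'"
      unfolding f_def using elt_add[of "k * int d + l * c" l "k' * int d + l' * c" l']
      by (simp add: elt_add add_divide_distrib[symmetric] algebra_simps)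
    then show ?thesis unfolding x zcomb_add phi .
  qed
  have Gphi: "\<phi> (G x) = (gen * fst (\<phi> x), gen * snd (\<phi> x))" if xx: "x \<in> W \<inter> \<Lambda>" for x
  proof -
    obtain m n k l where x: "x = ?C m n k l" using xx unfolding L by blast
    have 1: "gen * elt m n = elt (- (n * gnorm)) (m + n * int D)" unfolding elt_gen elt_mult by simp
    have "gen * elt (k * int d + l * c) l = elt (- (l * gnorm)) (k * int d + l * c + l * int D)"
      unfolding elt_gen elt_mult by simp
    moreover have "(- (k * c) - l * g) * int d + (k * int d + l * (int D + c)) * c = - (l * gnorm)"
    proof -
      have "(- (k * c) - l * g) * int d + (k * int d + l * (int D + c)) * c = l * (int D * c + c * c - int d * g)"
        by (simp add: algebra_simps)
      then show ?thesis unfolding g[symmetric] genpoly_def by (simp add: power2_eq_square)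
    qed
    ultimately have 2: "gen * elt (k * int d + l * c) l =
        elt ((- (k * c) - l * g) * int d + (k * int d + l * (int D + c)) * c) (k * int d + l * (int D + c))"
      by (simp add: algebra_simps)
    show ?thesis unfolding x adapted_G[OF a g] phi f_def fst_conv snd_conv 1 2[symmetric] by simp
  qed
  have scale: "\<phi> (of_int i *\<^sub>R x) = (of_int i * fst (\<phi> x), of_int i * snd (\<phi> x))" if xx: "x \<in> W \<inter> \<Lambda>" for x i
  proof -
    obtain m n k l where x: "x = ?C m n k l" using xx unfolding L by blast
    have "of_int i * elt m n = elt (i * m) (i * n)" for m n unfolding elt_of_int elt_mult by simp
    then show ?thesis unfolding x zcomb_scale phi f_def by (simp add: algebra_simps)
  qed
  have equi: "\<phi> (\<rho> \<alpha> x) = (\<alpha> * fst (\<phi> x), \<alpha> * snd (\<phi> x))" if al: "\<alpha> \<in> quad_order D" and xx: "x \<in> W \<inter> \<Lambda>" for \<alpha> x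
  proof -
    obtain i j where ij: "\<alpha> = elt i j" using al by (rule orderE)
    have xW: "x \<in> W" using xx by blast
    show ?thesis unfolding ij rho_elt[OF xW] add[OF L_scale[OF xx] L_scale[OF G_L[OF xx]]] scale[OF xx] scale[OF G_L[OF xx]] Gphi[OF xx]
      unfolding elt_def by (simp add: algebra_simps)
  qed
  have pair: "trace_pairing D (\<phi> x) (\<phi> x') = Im (H x x')" if xx: "x \<in> W \<inter> \<Lambda>" "x' \<in> W \<inter> \<Lambda>" for x x'
  proof -
    obtain m n k l m' n' k' l' where x: "x = ?C m n k l" "x' = ?C m' n' k' l'" using xx unfolding L by blast
    have "trace_pairing D (\<phi> x) (\<phi> x')
      = quad_tr D ((elt m' n' * elt (k * int d + l * c) l - elt m n * elt (k' * int d + l' * c) l') / rootD)"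
      unfolding x phi f_def trace_pairing_def by (simp add: diff_divide_distrib)
    also have "\<dots> = of_int ((l * m' - m * l') + int d * (k * n' - n * k') + (int D + c) * (l * n' - n * l'))"
      unfolding elt_mult elt_diff tr_elt_div by (simp add: algebra_simps)
    also have "\<dots> = Im (H x x')" using adapted_E[OF a] unfolding x E_def by simp
    finally show ?thesis .
  qed
  show ?thesis unfolding module_type_def prod.case
    by (intro exI[of _ \<phi>] conjI ballI bij add equi pair)
qed

lemma module_type_adapted:
  assumes "module_type D (root_ideal (int d) c) (\<Lambda>, H, W, \<rho>)"
  shows "\<exists>u v y z. adapted c u v y z"
proof -
  let ?J = "(\<lambda>x. x / rootD) ` root_ideal (int d) c"
  obtain \<phi> where bij: "bij_betw \<phi> (W \<inter> \<Lambda>) (quad_order D \<times> ?J)"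
    and add: "\<And>x x'. x \<in> W \<inter> \<Lambda> \<Longrightarrow> x' \<in> W \<inter> \<Lambda> \<Longrightarrow> \<phi> (x + x') = \<phi> x + \<phi> x'"
    and equi: "\<And>\<alpha> x. \<alpha> \<in> quad_order D \<Longrightarrow> x \<in> W \<inter> \<Lambda> \<Longrightarrow> \<phi> (\<rho> \<alpha> x) = (\<alpha> * fst (\<phi> x), \<alpha> * snd (\<phi> x))"
    and pair: "\<And>x x'. x \<in> W \<inter> \<Lambda> \<Longrightarrow> x' \<in> W \<inter> \<Lambda> \<Longrightarrow> trace_pairing D (\<phi> x) (\<phi> x') = E x x'"
    using assms unfolding module_type_def prod.case E_def by blast
  have inj: "x = x'" if "x \<in> W \<inter> \<Lambda>" "x' \<in> W \<inter> \<Lambda>" "\<phi> x = \<phi> x'" for x x'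
    using bij that unfolding bij_betw_def by (auto dest: inj_onD)
  have surj: "\<exists>x\<in>W \<inter> \<Lambda>. \<phi> x = (s, t / rootD)" if "s \<in> quad_order D" "t \<in> root_ideal (int d) c" for s t
  proof -
    have "(s, t / rootD) \<in> \<phi> ` (W \<inter> \<Lambda>)" using bij that unfolding bij_betw_def by auto
    then show ?thesis by force
  qed
  have z: "elt 0 0 \<in> root_ideal (int d) c" "elt (int d) 0 \<in> root_ideal (int d) c" "elt c 1 \<in> root_ideal (int d) c" by simp_all
  obtain u where u: "u \<in> W \<inter> \<Lambda>" "\<phi> u = (elt 1 0, elt 0 0 / rootD)" using surj[OF elt_in_order z(1)] by blast
  obtain v where v: "v \<in> W \<inter> \<Lambda>" "\<phi> v = (elt 0 1, elt 0 0 / rootD)" using surj[OF elt_in_order z(1)] by blast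
  obtain y where y: "y \<in> W \<inter> \<Lambda>" "\<phi> y = (elt 0 0, elt (int d) 0 / rootD)" using surj[OF elt_in_order z(2)] by blast
  obtain w where w: "w \<in> W \<inter> \<Lambda>" "\<phi> w = (elt 0 0, elt c 1 / rootD)" using surj[OF elt_in_order z(3)] by blast
  have ei: "of_int i * elt m n = elt (i * m) (i * n)" for i m n unfolding elt_of_int elt_mult by simp
  have scale: "\<phi> (of_int i *\<^sub>R x) = (of_int i * fst (\<phi> x), of_int i * snd (\<phi> x))" if "x \<in> W \<inter> \<Lambda>" for i x
    using equi[OF order_of_int that, of i] rho_of_int[of x i] that by simp
  have comb: "\<phi> (zcomb u v y w m n k l) = (elt m n, elt (k * int d + l * c) l / rootD)" for m n k l
  proof -
    have i: "of_int m *\<^sub>R u \<in> W \<inter> \<Lambda>" "of_int n *\<^sub>R v \<in> W \<inter> \<Lambda>" "of_int k *\<^sub>R y \<in> W \<inter> \<Lambda>" "of_int l *\<^sub>R w \<in> W \<inter> \<Lambda>"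
      using L_scale u(1) v(1) y(1) w(1) by blast+
    have "\<phi> (zcomb u v y w m n k l) = \<phi> (of_int m *\<^sub>R u) + \<phi> (of_int n *\<^sub>R v) + \<phi> (of_int k *\<^sub>R y) + \<phi> (of_int l *\<^sub>R w)"
      unfolding zcomb_def using add i L_add by simp
    also have "\<dots> = (elt m n, elt (k * int d + l * c) l / rootD)"
      unfolding scale[OF u(1)] scale[OF v(1)] scale[OF y(1)] scale[OF w(1)] u(2) v(2) y(2) w(2)
      by (simp add: ei elt_add add_divide_distrib[symmetric])
    finally show ?thesis .
  qed
  have zin: "zcomb u v y w m n k l \<in> W \<inter> \<Lambda>" for m n k l using L_zcomb[OF u(1) v(1) y(1) w(1)] .
  have L: "W \<inter> \<Lambda> = {zcomb u v y w m n k l | m n k l. True}"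
  proof
    show "{zcomb u v y w m n k l | m n k l. True} \<subseteq> W \<inter> \<Lambda>" using zin by blast
    show "W \<inter> \<Lambda> \<subseteq> {zcomb u v y w m n k l | m n k l. True}"
    proof
      fix x assume x: "x \<in> W \<inter> \<Lambda>"
      then have "\<phi> x \<in> quad_order D \<times> ?J" using bij unfolding bij_betw_def by blast
      then obtain x1 x2 where x12: "\<phi> x = (x1, x2 / rootD)" "x1 \<in> quad_order D" "x2 \<in> root_ideal (int d) c" by blast
      obtain m n where mn: "x1 = elt m n" using x12(2) by (rule orderE)
      obtain i l where il: "x2 = elt i l" "int d dvd i - l * c" using x12(3) unfolding root_ideal_def by blast
      obtain k where "i - l * c = int d * k" using il(2) by blast
      then have "\<phi> x = \<phi> (zcomb u v y w m n k l)" unfolding comb x12(1) mn il(1) by (simp add: algebra_simps)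
      then have "x = zcomb u v y w m n k l" using inj[OF x zin] by blast
      then show "x \<in> {zcomb u v y w m n k l | m n k l. True}" by blast
    qed
  qed
  have Gu: "G u = v"
  proof (rule inj[OF G_L[OF u(1)] v(1)])
    show "\<phi> (G u) = \<phi> v" unfolding equi[OF order_gen u(1)] u(2) v(2) by (simp add: elt_gen elt_mult elt_0[symmetric])
  qed
  have Gy: "G y = real d *\<^sub>R w - of_int c *\<^sub>R y"
  proof -
    have e: "real d *\<^sub>R w - of_int c *\<^sub>R y = zcomb u v y w 0 0 (- c) (int d)" unfolding zcomb_def by simp
    show ?thesis unfolding e
    proof (rule inj[OF G_L[OF y(1)] zin])
      show "\<phi> (G y) = \<phi> (zcomb u v y w 0 0 (- c) (int d))" unfolding equi[OF order_gen y(1)] comb y(2)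
        by (simp add: elt_gen elt_mult elt_0[symmetric])
    qed
  qed
  have tp: "trace_pairing D (elt m n, elt i j / rootD) (elt m' n', elt i' j' / rootD)
     = of_int (m' * j + n' * i + n' * j * int D - (m * j' + n * i' + n * j' * int D))" for m n i j m' n' i' j'
  proof -
    have "trace_pairing D (elt m n, elt i j / rootD) (elt m' n', elt i' j' / rootD)
      = quad_tr D ((elt m' n' * elt i j - elt m n * elt i' j') / rootD)"
      unfolding trace_pairing_def by (simp add: diff_divide_distrib)
    then show ?thesis unfolding elt_mult elt_diff tr_elt_div .
  qed
  have "E u v = 0" "E y w = 0" "E y u = 0" "E y v = real d" "E w u = 1" "E w v = of_int (int D + c)"
    using pair[OF u(1) v(1)] pair[OF y(1) w(1)] pair[OF y(1) u(1)] pair[OF y(1) v(1)] pair[OF w(1) u(1)] pair[OF w(1) v(1)]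
    unfolding u(2) v(2) y(2) w(2) tp by simp_all
  then show ?thesis using L Gu Gy unfolding adapted_def by blast
qed

end

(* The dollar sign is to denote components of vectors only. *)
no_notation fps_nth (infixl "$" 75)

lemma sum_lessThan_add: "(\<Sum>j<k + n. h j) = (\<Sum>j<k. h j) + (\<Sum>j<n. h (k + j))"
  for h :: "nat \<Rightarrow> 'a::comm_monoid_add"
  by (induction n) (simp_all add: add.assoc)

section \<open>Symplectic lattices\<close>

lemma complex_span_real_span:
  fixes C :: "(complex^'n) set"
  shows "vec.span C \<subseteq> span (C \<union> (\<lambda>x. \<i> *s x) ` C)"
proof
  let ?S = "span (C \<union> (\<lambda>x. \<i> *s x) ` C)"
  have lin: "linear (\<lambda>x::complex^'n. \<i> *s x)"
    by (rule linearI) (simp_all add: vec.scale_right_distrib of_real_smult[symmetric] mult.commute)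
  have ii: "\<i> *s x \<in> ?S" if "x \<in> ?S" for x
  proof -
    have "(\<lambda>x. \<i> *s x) ` (C \<union> (\<lambda>x. \<i> *s x) ` C) \<subseteq> ?S"
    proof -
      have "\<i> *s (\<i> *s x) = - x" for x :: "complex^'n" by simp
      moreover have "- x \<in> ?S" if "x \<in> C" for x using that by (intro span_neg span_base) blast
      ultimately show ?thesis by (auto intro: span_base)
    qed
    then have "span ((\<lambda>x. \<i> *s x) ` (C \<union> (\<lambda>x. \<i> *s x) ` C)) \<subseteq> ?S" by (simp add: span_minimal)
    then show ?thesis using that linear_span_image[OF lin] by blast
  qed
  fix x assume "x \<in> vec.span C"
  then show "x \<in> ?S"
  proof (induction rule: vec.span_induct_alt)
    case base then show ?case by (rule span_zero)
  next
    case (step c x y)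
    have "c *s x = (Re c) *\<^sub>R x + (Im c) *\<^sub>R (\<i> *s x)"
    proof -
      have "c = of_real (Re c) + of_real (Im c) * \<i>" by (simp add: complex_eq_iff)
      then have "c *s x = of_real (Re c) *s x + (of_real (Im c) * \<i>) *s x" by (metis vec.scale_left_distrib)
      then show ?thesis unfolding of_real_smult[symmetric] by simp
    qed
    moreover have "x \<in> ?S" using step(1) by (simp add: span_base)
    ultimately show ?case using ii step(2) by (simp add: span_add span_scale)
  qed
qed

lemma real_span_eq_complex_subspace:
  fixes V :: "(complex^'n) set"
  assumes V: "vec.subspace V" "vec.dim V = k" and B: "B \<subseteq> V" "independent B" "card B = 2 * k"
  shows "span B = V"
proof
  have V0: "0 \<in> V" "\<And>x y. x \<in> V \<Longrightarrow> y \<in> V \<Longrightarrow> x + y \<in> V" "\<And>c x. x \<in> V \<Longrightarrow> c *s x \<in> V"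
    using V(1) unfolding vec.subspace_def by blast+
  have "subspace V"
    unfolding subspace_def using V0(1,2) V0(3)[of _ "of_real r" for r] unfolding of_real_smult by blast
  then show "span B \<subseteq> V" using B(1) by (simp add: span_minimal)
  obtain C where C: "C \<subseteq> V" "vec.independent C" "V \<subseteq> vec.span C" "card C = vec.dim V"
    by (rule vec.basis_exists)
  have fC: "finite C" using C(2) by (rule vec.finiteI_independent)
  have "V \<subseteq> span (C \<union> (\<lambda>x. \<i> *s x) ` C)" using C(3) complex_span_real_span[of C] by blast
  then have "dim V \<le> card (C \<union> (\<lambda>x. \<i> *s x) ` C)" using fC by (intro dim_le_card) auto
  also have "\<dots> \<le> card C + card ((\<lambda>x. \<i> *s x) ` C)" by (rule card_Un_le)
  also have "\<dots> \<le> card C + card C" using card_image_le[OF fC] by simp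
  also have "\<dots> = card B" using C(4) V(2) B(3) by simp
  finally have "dim V \<le> card B" .
  then show "V \<subseteq> span B" using B by (intro card_ge_dim_independent)
qed

context positive_hermitian begin

text \<open>Pairing with the vectors themselves shows that the \<open>2 k\<close> vectors are linearly independent over the
  reals, and \<open>2 k\<close> is the real dimension of \<open>V\<close>.\<close>

lemma symplectic_is_lattice:
  fixes a b :: "nat \<Rightarrow> complex^'n"
  assumes V: "vec.subspace V" "vec.dim V = k"
    and inV: "\<And>i. i < k \<Longrightarrow> a i \<in> V" "\<And>i. i < k \<Longrightarrow> b i \<in> V"
    and e: "\<And>i j. i < k \<Longrightarrow> j < k \<Longrightarrow> E (a i) (a j) = 0" "\<And>i j. i < k \<Longrightarrow> j < k \<Longrightarrow> E (b i) (b j) = 0"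
      "\<And>i j. i < k \<Longrightarrow> j < k \<Longrightarrow> E (a i) (b j) = (if i = j then \<delta> i else 0)"
    and pos: "\<And>i. i < k \<Longrightarrow> \<delta> i > 0"
  shows "is_lattice V {\<Sum>i<k. real_of_int (m i) *\<^sub>R a i + real_of_int (n i) *\<^sub>R b i | m n. True}"
proof -
  define g where "g j = (if j < k then a j else b (j - k))" for j
  have split: "(\<Sum>j<2 * k. x j *\<^sub>R g j) = (\<Sum>i<k. x i *\<^sub>R a i + x (k + i) *\<^sub>R b i)" for x :: "nat \<Rightarrow> real"
  proof -
    have "(\<Sum>j<k + k. x j *\<^sub>R g j) = (\<Sum>j<k. x j *\<^sub>R g j) + (\<Sum>j<k. x (k + j) *\<^sub>R g (k + j))"
      by (rule sum_lessThan_add)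
    also have "(\<Sum>j<k. x j *\<^sub>R g j) = (\<Sum>j<k. x j *\<^sub>R a j)" unfolding g_def by simp
    also have "(\<Sum>j<k. x (k + j) *\<^sub>R g (k + j)) = (\<Sum>j<k. x (k + j) *\<^sub>R b j)" unfolding g_def by simp
    finally show ?thesis by (simp add: sum.distrib mult_2)
  qed
  have E_sum: "E (\<Sum>i<k. f i) y = (\<Sum>i<k. E (f i) y)" for f :: "nat \<Rightarrow> complex^'n" and y
    by (induction k) (simp_all add: E_add_left)
  have ba: "E (b i) (a j) = (if i = j then - \<delta> i else 0)" if "i < k" "j < k" for i j
    using e(3)[OF that(2,1)] E_swap[of "b i" "a j"] by auto
  have zero: "x j = 0" if s: "(\<Sum>j<2 * k. x j *\<^sub>R g j) = 0" and j: "j < 2 * k" for x :: "nat \<Rightarrow> real" and j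
  proof -
    have z: "(\<Sum>i<k. x i *\<^sub>R a i + x (k + i) *\<^sub>R b i) = 0" using s unfolding split .
    have l: "x l = 0" "x (k + l) = 0" if l: "l < k" for l
    proof -
      have "0 = E (\<Sum>i<k. x i *\<^sub>R a i + x (k + i) *\<^sub>R b i) (b l)" unfolding z by simp
      also have "\<dots> = (\<Sum>i<k. if i = l then x i * \<delta> i else 0)"
        unfolding E_sum by (rule sum.cong) (use e l in \<open>auto simp: E_bilinear\<close>)
      also have "\<dots> = x l * \<delta> l" using l by simp
      finally show "x l = 0" using pos[OF l] by simp
      have "0 = E (\<Sum>i<k. x i *\<^sub>R a i + x (k + i) *\<^sub>R b i) (a l)" unfolding z by simp
      also have "\<dots> = (\<Sum>i<k. if i = l then - (x (k + i) * \<delta> i) else 0)"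
        unfolding E_sum by (rule sum.cong) (use e ba l in \<open>auto simp: E_bilinear\<close>)
      also have "\<dots> = - (x (k + l) * \<delta> l)" using l by simp
      finally show "x (k + l) = 0" using pos[OF l] by simp
    qed
    show "x j = 0"
    proof (cases "j < k")
      case True then show ?thesis by (rule l(1))
    next
      case False
      then have "x (k + (j - k)) = 0" using j by (intro l(2)) simp
      then show ?thesis using False by simp
    qed
  qed
  have inj: "inj_on g {..<2 * k}"
  proof (rule inj_onI)
    fix i j assume ij: "i \<in> {..<2 * k}" "j \<in> {..<2 * k}" "g i = g j"
    show "i = j"
    proof (rule ccontr)
      assume ne: "i \<noteq> j"
      define x where "x l = (if l = i then 1 else if l = j then -1 else 0 :: real)" for l
      have "(\<Sum>l<2 * k. x l *\<^sub>R g l) = (\<Sum>l\<in>{i, j}. x l *\<^sub>R g l)"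
        by (rule sum.mono_neutral_right) (use ij in \<open>auto simp: x_def\<close>)
      also have "\<dots> = 0" using ne ij(3) unfolding x_def by simp
      finally have "x i = 0" using zero ij(1) by simp
      then show False unfolding x_def by simp
    qed
  qed
  define B where "B = g ` {..<2 * k}"
  have cardB: "card B = 2 * k" unfolding B_def using card_image[OF inj] by simp
  have sumB: "(\<Sum>v\<in>B. c v *\<^sub>R v) = (\<Sum>j<2 * k. c (g j) *\<^sub>R g j)" for c :: "complex^'n \<Rightarrow> real"
    unfolding B_def by (rule sum.reindex_cong[OF inj]) simp_all
  have indep: "independent B"
    unfolding independent_explicit
  proof (intro conjI allI impI ballI)
    show "finite B" unfolding B_def by simp
  next
    fix c v assume "(\<Sum>v\<in>B. c v *\<^sub>R v) = 0" "v \<in> B"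
    then show "c v = 0" using zero[of "\<lambda>j. c (g j)"] unfolding sumB unfolding B_def by auto
  qed
  have BV: "B \<subseteq> V" unfolding B_def g_def using inV by auto
  have "span B = V" by (rule real_span_eq_complex_subspace[OF V BV indep cardB])
  moreover have "{\<Sum>i<k. real_of_int (m i) *\<^sub>R a i + real_of_int (n i) *\<^sub>R b i | m n. True}
      = {\<Sum>b\<in>B. real_of_int (c b) *\<^sub>R b | c. True}" (is "?L = ?R")
  proof
    show "?R \<subseteq> ?L"
    proof
      fix x assume "x \<in> ?R"
      then obtain c where "x = (\<Sum>b\<in>B. real_of_int (c b) *\<^sub>R b)" by blast
      then have "x = (\<Sum>i<k. real_of_int (c (g i)) *\<^sub>R a i + real_of_int (c (g (k + i))) *\<^sub>R b i)"
        unfolding sumB split .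
      then show "x \<in> ?L" by (intro CollectI exI[of _ "\<lambda>i. c (g i)"] exI[of _ "\<lambda>i. c (g (k + i))"]) simp
    qed
    show "?L \<subseteq> ?R"
    proof
      fix x assume "x \<in> ?L"
      then obtain m n where x: "x = (\<Sum>i<k. real_of_int (m i) *\<^sub>R a i + real_of_int (n i) *\<^sub>R b i)" by blast
      define h where "h j = (if j < k then m j else n (j - k))" for j
      define c where "c v = h (inv_into {..<2 * k} g v)" for v
      have "c (g j) = h j" if "j < 2 * k" for j unfolding c_def using inj that by simp
      then have "(\<Sum>v\<in>B. real_of_int (c v) *\<^sub>R v) = (\<Sum>j<2 * k. real_of_int (h j) *\<^sub>R g j)"
        unfolding sumB by simp
      also have "\<dots> = x" unfolding split x h_def by simp
      finally show "x \<in> ?R" by (intro CollectI exI[of _ c]) simp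
    qed
  qed
  ultimately show ?thesis unfolding is_lattice_def using indep by blast
qed

end

section \<open>Siegel space\<close>

definition re_vec :: "complex^'n \<Rightarrow> real^'n" where "re_vec x = (\<chi> i. Re (x $ i))"
definition im_vec :: "complex^'n \<Rightarrow> real^'n" where "im_vec x = (\<chi> i. Im (x $ i))"
definition int_vec :: "int^'n \<Rightarrow> real^'n" where "int_vec m = (\<chi> i. of_int (m $ i))"
definition Re_matrix :: "complex^3^3 \<Rightarrow> real^3^3" where "Re_matrix Z = (\<chi> i j. Re (Z $ i $ j))"

lemma re_im_vec_period:
  "re_vec (period_vec Z (m, n)) = Re_matrix Z *v int_vec m + int_vec n"
  "im_vec (period_vec Z (m, n)) = Im_matrix Z *v int_vec m"
  unfolding re_vec_def im_vec_def period_vec_def Re_matrix_def Im_matrix_def int_vec_def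
  by (simp_all add: vec_eq_iff matrix_vector_mult_def)

lemma symmetric_inner:
  fixes A :: "real^'n^'n"
  assumes "transpose A = A" shows "(A *v x) \<bullet> y = x \<bullet> (A *v y)"
  using dot_lmul_matrix[of x A y] assms by (metis transpose_matrix_vector)

lemma matrix_inv_unique:
  fixes A B :: "real^'n^'n"
  assumes "A ** B = mat 1" shows "matrix_inv A = B"
proof -
  have BA: "B ** A = mat 1" using assms matrix_left_right_inverse by blast
  have "A ** matrix_inv A = mat 1 \<and> matrix_inv A ** A = mat 1"
    unfolding matrix_inv_def by (rule someI[of _ B]) (use assms BA in simp)
  then have "matrix_inv A = matrix_inv A ** (A ** B)" "matrix_inv A ** A = mat 1" using assms by simp_all
  then show ?thesis by (metis matrix_mul_assoc matrix_mul_lid)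
qed

locale siegel =
  fixes Z :: "complex^3^3"
  assumes siegel: "Z \<in> siegel_space"
begin

abbreviation Y where "Y \<equiv> Im_matrix Z"
abbreviation Yi where "Yi \<equiv> matrix_inv Y"

lemma Z_sym: "Z $ i $ j = Z $ j $ i"
proof -
  have "transpose Z = Z" using siegel unfolding siegel_space_def by blast
  then have "transpose Z $ i $ j = Z $ i $ j" by simp
  then show ?thesis unfolding transpose_def by simp
qed

lemma Y_sym: "transpose Y = Y" and X_sym: "transpose (Re_matrix Z) = Re_matrix Z"
  unfolding transpose_def Im_matrix_def Re_matrix_def by (simp_all add: vec_eq_iff Z_sym)

lemma Y_pos: "v \<noteq> 0 \<Longrightarrow> v \<bullet> (Y *v v) > 0"
  using siegel unfolding siegel_space_def by blast

lemma Y_inv: "Y ** Yi = mat 1" "Yi ** Y = mat 1"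
proof -
  have "v = 0" if "Y *v v = 0" for v using Y_pos[of v] that by (cases "v = 0") auto
  then obtain B where B: "B ** Y = mat 1" using matrix_left_invertible_ker by blast
  then have BY: "Y ** B = mat 1" using matrix_left_right_inverse by blast
  then have "Yi = B" by (rule matrix_inv_unique)
  then show "Y ** Yi = mat 1" "Yi ** Y = mat 1" using B BY by simp_all
qed

lemma Y_Yi: "Y *v (Yi *v v) = v" "Yi *v (Y *v v) = v"
  by (simp_all add: matrix_vector_mul_assoc Y_inv)

lemma Yi_inner: "(Yi *v x) \<bullet> y = x \<bullet> (Yi *v y)"
proof -
  have "(Yi *v x) \<bullet> y = (Yi *v x) \<bullet> (Y *v (Yi *v y))" by (simp only: Y_Yi)
  also have "\<dots> = (Y *v (Yi *v x)) \<bullet> (Yi *v y)" by (rule symmetric_inner[OF Y_sym, symmetric])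
  finally show ?thesis by (simp only: Y_Yi)
qed

lemma form_expand:
  "Im (siegel_form Z x y) = im_vec x \<bullet> (Yi *v re_vec y) - re_vec x \<bullet> (Yi *v im_vec y)"
  "Re (siegel_form Z x y) = re_vec x \<bullet> (Yi *v re_vec y) + im_vec x \<bullet> (Yi *v im_vec y)"
proof -
  have "Im (siegel_form Z x y) = (\<Sum>i\<in>UNIV. \<Sum>j\<in>UNIV. Im (x $ i) * (Yi $ i $ j * Re (y $ j)) - Re (x $ i) * (Yi $ i $ j * Im (y $ j)))"
    unfolding siegel_form_def Im_sum by (intro sum.cong refl) (simp add: algebra_simps)
  then show "Im (siegel_form Z x y) = im_vec x \<bullet> (Yi *v re_vec y) - re_vec x \<bullet> (Yi *v im_vec y)"
    unfolding inner_vec_def matrix_vector_mult_def re_vec_def im_vec_def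
    by (simp add: sum_subtractf sum_distrib_left)
  have "Re (siegel_form Z x y) = (\<Sum>i\<in>UNIV. \<Sum>j\<in>UNIV. Re (x $ i) * (Yi $ i $ j * Re (y $ j)) + Im (x $ i) * (Yi $ i $ j * Im (y $ j)))"
    unfolding siegel_form_def Re_sum by (intro sum.cong refl) (simp add: algebra_simps)
  then show "Re (siegel_form Z x y) = re_vec x \<bullet> (Yi *v re_vec y) + im_vec x \<bullet> (Yi *v im_vec y)"
    unfolding inner_vec_def matrix_vector_mult_def re_vec_def im_vec_def
    by (simp add: sum.distrib sum_distrib_left)
qed

lemma Yi_pos: assumes "v \<noteq> 0" shows "v \<bullet> (Yi *v v) > 0"
proof -
  have "Yi *v v \<noteq> 0" using Y_Yi(1)[of v] assms by (metis matrix_vector_mult_0_right)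
  then have "(Yi *v v) \<bullet> (Y *v (Yi *v v)) > 0" by (rule Y_pos)
  then show ?thesis by (simp only: Y_Yi inner_commute)
qed

lemma pos_hermitian: "pos_hermitian_on UNIV (siegel_form Z)"
  unfolding pos_hermitian_on_def
proof (intro conjI ballI allI impI)
  show "siegel_form Z (x + y) z = siegel_form Z x z + siegel_form Z y z" for x y z
    unfolding siegel_form_def by (simp add: distrib_right sum.distrib)
  show "siegel_form Z (c *s x) y = c * siegel_form Z x y" for c x y
    unfolding siegel_form_def by (simp add: sum_distrib_left mult.assoc)
  show "siegel_form Z y x = cnj (siegel_form Z x y)" for x y
  proof (rule complex_eqI)
    have sym: "v \<bullet> (Yi *v w) = w \<bullet> (Yi *v v)" for v w
      using Yi_inner[of v w] inner_commute[of "Yi *v v" w] by simp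
    show "Re (siegel_form Z y x) = Re (cnj (siegel_form Z x y))"
      unfolding cnj.simps form_expand
      using sym[of "re_vec x" "re_vec y"] sym[of "im_vec x" "im_vec y"] by linarith
    show "Im (siegel_form Z y x) = Im (cnj (siegel_form Z x y))"
      unfolding cnj.simps form_expand
      using sym[of "im_vec x" "re_vec y"] sym[of "re_vec x" "im_vec y"] by linarith
  qed
  show "Re (siegel_form Z x x) > 0" if "x \<noteq> 0" for x
  proof -
    have "re_vec x \<noteq> 0 \<or> im_vec x \<noteq> 0"
      using that unfolding re_vec_def im_vec_def by (auto simp: vec_eq_iff complex_eq_iff)
    moreover have "v \<bullet> (Yi *v v) \<ge> 0" for v using Yi_pos[of v] by (cases "v = 0") auto
    ultimately show ?thesis unfolding form_expand
      using Yi_pos[of "re_vec x"] Yi_pos[of "im_vec x"] by (auto intro: add_nonneg_pos add_pos_nonneg)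
  qed
qed

sublocale H: positive_hermitian "siegel_form Z" by unfold_locales (rule pos_hermitian)

lemma E_period:
  "H.E (period_vec Z (m, n)) (period_vec Z (m', n')) = of_int (\<Sum>i\<in>UNIV. m $ i * n' $ i - n $ i * m' $ i)"
proof -
  let ?X = "Re_matrix Z"
  have "H.E (period_vec Z (m, n)) (period_vec Z (m', n'))
      = (Y *v int_vec m) \<bullet> (Yi *v (?X *v int_vec m' + int_vec n')) - (?X *v int_vec m + int_vec n) \<bullet> int_vec m'"
    unfolding H.E_def form_expand re_im_vec_period Y_Yi ..
  also have "(Y *v int_vec m) \<bullet> (Yi *v (?X *v int_vec m' + int_vec n')) = int_vec m \<bullet> (?X *v int_vec m' + int_vec n')"
    unfolding symmetric_inner[OF Y_sym] Y_Yi ..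
  also have "int_vec m \<bullet> (?X *v int_vec m' + int_vec n') - (?X *v int_vec m + int_vec n) \<bullet> int_vec m'
      = int_vec m \<bullet> int_vec n' - int_vec n \<bullet> int_vec m'"
    using symmetric_inner[OF X_sym] by (simp add: inner_add_left inner_add_right)
  also have "\<dots> = of_int (\<Sum>i\<in>UNIV. m $ i * n' $ i - n $ i * m' $ i)"
    unfolding inner_vec_def int_vec_def by (simp add: sum_subtractf)
  finally show ?thesis .
qed

lemma period_inject:
  assumes "period_vec Z (m, n) = period_vec Z (m', n')" shows "m = m' \<and> n = n'"
proof -
  have "(\<Sum>i\<in>UNIV. m $ i * l $ i - n $ i * k $ i) = (\<Sum>i\<in>UNIV. m' $ i * l $ i - n' $ i * k $ i)" for k l
    using arg_cong[OF assms, of "\<lambda>x. H.E x (period_vec Z (k, l))"] unfolding E_period by (simp only: of_int_eq_iff)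
  note h = this
  have delta: "(\<Sum>i\<in>UNIV. f i * (if i = j then 1 else 0)) = f j" for f :: "3 \<Rightarrow> int" and j
    by (simp add: mult_delta_right)
  have "m $ j = m' $ j" for j
    using h[where l = "\<chi> i. if i = j then 1 else 0" and k = 0] delta[of "\<lambda>i. m $ i" j] delta[of "\<lambda>i. m' $ i" j]
    by (simp only: vec_lambda_beta zero_index mult_zero_right diff_zero)
  moreover have "n $ j = n' $ j" for j
    using h[where k = "\<chi> i. if i = j then 1 else 0" and l = 0] delta[of "\<lambda>i. n $ i" j] delta[of "\<lambda>i. n' $ i" j]
    by (simp only: vec_lambda_beta zero_index mult_zero_right diff_0 sum_negf neg_equal_iff_equal)
  ultimately show ?thesis by (simp add: vec_eq_iff)
qed

lemma period_add: "period_vec Z (m, n) + period_vec Z (m', n') = period_vec Z (m + m', n + n')"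
  unfolding period_vec_def by (simp add: vec_eq_iff matrix_vector_mult_def sum.distrib algebra_simps)

end

section \<open>A family of abelian threefolds over a product of three upper half planes\<close>

definition pv :: "complex^3^3 \<Rightarrow> int \<Rightarrow> int \<Rightarrow> int \<Rightarrow> int \<Rightarrow> int \<Rightarrow> int \<Rightarrow> complex^3" where
  "pv Z x1 x2 x3 y1 y2 y3 = period_vec Z (vector [x1, x2, x3], vector [y1, y2, y3])"

lemma vector_components: "m = vector [m $ 1, m $ 2, m $ 3]" for m :: "'a::zero^3"
  by (simp add: vec_eq_iff forall_3)

lemma period_vec_pv: "period_vec Z (m, n) = pv Z (m $ 1) (m $ 2) (m $ 3) (n $ 1) (n $ 2) (n $ 3)"
  unfolding pv_def vector_components[symmetric] ..

lemma pv_nth: "pv Z x1 x2 x3 y1 y2 y3 $ i = Z $ i $ 1 * of_int x1 + Z $ i $ 2 * of_int x2 + Z $ i $ 3 * of_int x3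
    + of_int (vector [y1, y2, y3] $ i)"
  unfolding pv_def period_vec_def by (simp add: matrix_vector_mult_def sum_3)

lemma vector3_add: "vector [a, b, c] $ i + vector [a', b', c'] $ i = vector [a + a', b + b', c + c'] $ (i::3)" for a :: int
  using exhaust_3[of i] by auto

lemma vector3_scale: "k * vector [a, b, c] $ i = vector [k * a, k * b, k * c] $ (i::3)" for a :: int
  using exhaust_3[of i] by auto

lemma pv_add: "pv Z x1 x2 x3 y1 y2 y3 + pv Z x1' x2' x3' y1' y2' y3' =
    pv Z (x1 + x1') (x2 + x2') (x3 + x3') (y1 + y1') (y2 + y2') (y3 + y3')"
  unfolding vec_eq_iff vector_add_component pv_nth vector3_add[symmetric] by (simp add: algebra_simps)

lemma pv_scale: "real_of_int k *\<^sub>R pv Z x1 x2 x3 y1 y2 y3 = pv Z (k * x1) (k * x2) (k * x3) (k * y1) (k * y2) (k * y3)"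
  unfolding vec_eq_iff vector_scaleR_component pv_nth vector3_scale[symmetric]
  by (simp add: algebra_simps scaleR_conv_of_real)

lemma range_period_pv: "range (period_vec Z) = {pv Z x1 x2 x3 y1 y2 y3 | x1 x2 x3 y1 y2 y3. True}"
proof
  show "range (period_vec Z) \<subseteq> {pv Z x1 x2 x3 y1 y2 y3 | x1 x2 x3 y1 y2 y3. True}"
    using period_vec_pv[of Z] by clarsimp (intro exI, rule refl)
  show "{pv Z x1 x2 x3 y1 y2 y3 | x1 x2 x3 y1 y2 y3. True} \<subseteq> range (period_vec Z)"
    unfolding pv_def by auto
qed

context siegel begin

lemma E_pv: "H.E (pv Z x1 x2 x3 y1 y2 y3) (pv Z x1' x2' x3' y1' y2' y3') =
    of_int (x1 * y1' + x2 * y2' + x3 * y3' - (y1 * x1' + y2 * x2' + y3 * x3'))"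
  unfolding pv_def E_period by (simp add: sum_3)

lemma ppav:
  "complex_torus UNIV (range (period_vec Z))" "polarization UNIV (range (period_vec Z)) (siegel_form Z)"
  "polarization_type (range (period_vec Z)) (siegel_form Z) [1, 1, 1]"
proof -
  define a where "a i = (if i = 0 then pv Z 1 0 0 0 0 0 else if i = 1 then pv Z 0 1 0 0 0 0 else pv Z 0 0 1 0 0 0)" for i :: nat
  define b where "b i = (if i = 0 then pv Z 0 0 0 1 0 0 else if i = 1 then pv Z 0 0 0 0 1 0 else pv Z 0 0 0 0 0 1)" for i :: nat
  have sum: "(\<Sum>i<3. real_of_int (m i) *\<^sub>R a i + real_of_int (n i) *\<^sub>R b i) = pv Z (m 0) (m 1) (m 2) (n 0) (n 1) (n 2)" for m n
    unfolding a_def b_def by (simp add: numeral_3_eq_3 lessThan_Suc pv_scale pv_add numeral_2_eq_2)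
  have L: "range (period_vec Z) = {\<Sum>i<3. real_of_int (m i) *\<^sub>R a i + real_of_int (n i) *\<^sub>R b i | m n. True}"
  proof
    show "range (period_vec Z) \<subseteq> {\<Sum>i<3. real_of_int (m i) *\<^sub>R a i + real_of_int (n i) *\<^sub>R b i | m n. True}"
    proof
      fix x assume "x \<in> range (period_vec Z)"
      then obtain x1 x2 x3 y1 y2 y3 where x: "x = pv Z x1 x2 x3 y1 y2 y3" unfolding range_period_pv by blast
      define m n where "m i = (if i = 0 then x1 else if i = 1 then x2 else x3)"
        and "n i = (if i = 0 then y1 else if i = 1 then y2 else y3)" for i :: nat
      have "x = (\<Sum>i<3. real_of_int (m i) *\<^sub>R a i + real_of_int (n i) *\<^sub>R b i)" unfolding sum x m_def n_def by simp
      then show "x \<in> {\<Sum>i<3. real_of_int (m i) *\<^sub>R a i + real_of_int (n i) *\<^sub>R b i | m n. True}" by blast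
    qed
    show "{\<Sum>i<3. real_of_int (m i) *\<^sub>R a i + real_of_int (n i) *\<^sub>R b i | m n. True} \<subseteq> range (period_vec Z)"
      unfolding sum range_period_pv by blast
  qed
  have e: "H.E (a i) (a j) = 0" "H.E (b i) (b j) = 0" "H.E (a i) (b j) = (if i = j then 1 else 0)" if "i < 3" "j < 3" for i j
  proof -
    have ij: "i = 0 \<or> i = 1 \<or> i = 2" "j = 0 \<or> j = 1 \<or> j = 2" using that by auto
    show "H.E (a i) (a j) = 0" "H.E (b i) (b j) = 0" unfolding a_def b_def by (simp_all add: E_pv)
    show "H.E (a i) (b j) = (if i = j then 1 else 0)" using ij unfolding a_def b_def by (elim disjE) (simp_all add: E_pv)
  qed
  have "is_lattice UNIV (range (period_vec Z))"
    unfolding L by (rule H.symplectic_is_lattice[where \<delta> = "\<lambda>_. 1"]) (use e in \<open>simp_all add: vec_dim_card del: vec.dim_UNIV\<close>)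
  then show "complex_torus UNIV (range (period_vec Z))" unfolding complex_torus_def by simp
  show "polarization UNIV (range (period_vec Z)) (siegel_form Z)"
    unfolding polarization_def range_period_pv
    using pos_hermitian E_pv by (auto simp: H.E_def)
  show "polarization_type (range (period_vec Z)) (siegel_form Z) [1, 1, 1]"
    unfolding polarization_type_def
  proof (intro conjI)
    show "\<forall>i<length [1, 1, 1::nat]. [1, 1, 1] ! i > (0::nat)" by (auto simp: nth_Cons split: nat.splits)
    show "\<forall>i. Suc i < length [1, 1, 1::nat] \<longrightarrow> [1, 1, 1::nat] ! i dvd [1, 1, 1] ! Suc i" by (auto simp: nth_Cons split: nat.splits)
    have one: "real ([1, 1, 1] ! i) = 1" if "i < 3" for i using that by (auto simp: nth_Cons split: nat.splits)
    have "length [1, 1, 1::nat] = 3" by simp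
    then show "\<exists>a b. range (period_vec Z) = {\<Sum>i<length [1, 1, 1::nat]. real_of_int (m i) *\<^sub>R a i + real_of_int (n i) *\<^sub>R b i |m n. True} \<and>
      (\<forall>i<length [1, 1, 1::nat]. \<forall>j<length [1, 1, 1::nat]. Im (siegel_form Z (a i) (a j)) = 0 \<and> Im (siegel_form Z (b i) (b j)) = 0 \<and>
        Im (siegel_form Z (a i) (b j)) = (if i = j then real ([1, 1, 1] ! i) else 0))"
      using L e one unfolding H.E_def by (intro exI[of _ a] exI[of _ b]) (simp only:, simp)
  qed
qed

end

locale rm_family_data = quadratic_discriminant +
  fixes d :: nat and c :: int
  assumes d_pos: "d > 0" and root: "int d dvd genpoly c"
begin

definition gen' :: real where "gen' = real D - gen"

lemma gen'_sq: "gen' * gen' = real D * gen' - of_int gnorm"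
  unfolding gen'_def using gen_sq by (simp add: algebra_simps)

lemma gen_gen': "gen - gen' = rootD" "gen + gen' = real D"
  unfolding gen'_def using gen_diff_conj by simp_all

text \<open>The rows of \<open>M\<close> are the vectors \<open>(0, (\<gamma> + c) / \<surd>D)\<close> and \<open>(0, d / \<surd>D)\<close> of the second summand under the two
  real embeddings, and a vector completing them. The columns of the inverse matrix \<open>N\<close> are the
  coordinates of the standard basis vectors \<open>n\<^sub>1, n\<^sub>2, n\<^sub>3\<close> of \<open>\<int>\<^sup>3\<close>; among their combinations,
  \<open>n\<^sub>1\<close> is \<open>(1, 0)\<close> and \<open>d n\<^sub>2 - n\<^sub>3\<close> is \<open>(\<gamma> - D - c, 0)\<close> in the first summand.\<close>

definition M :: "real^3^3" where
  "M = vector [vector [(gen + of_int c) / rootD, - (gen' + of_int c) / rootD, 0],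
               vector [real d / rootD, - real d / rootD, 0],
               vector [- 1 / rootD, 1 / rootD, 1]]"

definition N :: "real^3^3" where
  "N = vector [vector [1, (gen - real D - of_int c) / real d, 0],
               vector [1, (gen' - real D - of_int c) / real d, 0],
               vector [0, 1 / real d, 1]]"

lemma M_nth [simp]:
  "M $ 1 $ 1 = (gen + of_int c) / rootD" "M $ 1 $ 2 = - (gen' + of_int c) / rootD" "M $ 1 $ 3 = 0"
  "M $ 2 $ 1 = real d / rootD" "M $ 2 $ 2 = - real d / rootD" "M $ 2 $ 3 = 0"
  "M $ 3 $ 1 = - 1 / rootD" "M $ 3 $ 2 = 1 / rootD" "M $ 3 $ 3 = 1"
  unfolding M_def by simp_all

lemma N_nth [simp]:
  "N $ 1 $ 1 = 1" "N $ 1 $ 2 = (gen - real D - of_int c) / real d" "N $ 1 $ 3 = 0"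
  "N $ 2 $ 1 = 1" "N $ 2 $ 2 = (gen' - real D - of_int c) / real d" "N $ 2 $ 3 = 0"
  "N $ 3 $ 1 = 0" "N $ 3 $ 2 = 1 / real d" "N $ 3 $ 3 = 1"
  unfolding N_def by simp_all

lemma N_M: "N ** M = mat 1"
proof -
  have r: "rootD \<noteq> 0" "real d \<noteq> 0" using rootD_pos d_pos by simp_all
  have k: "y / real d * (real d / rootD) = y / rootD" "y / real d * (- real d / rootD) = - y / rootD" for y
    using r by simp_all
  have s: "x / rootD + y / rootD = 1" if "x + y = rootD" for x y
    using that r by (simp add: add_divide_distrib[symmetric])
  have z: "x / rootD + y / rootD = 0" if "x + y = 0" for x y
    using that by (simp add: add_divide_distrib[symmetric])
  have 11: "(gen + of_int c) / rootD + (gen - real D - of_int c) / real d * (real d / rootD) = 1"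
    unfolding k by (rule s) (use gen_gen' in linarith)
  have 12: "- (gen' + of_int c) / rootD + (gen - real D - of_int c) / real d * (- real d / rootD) = 0"
    unfolding k by (rule z) (use gen_gen' in linarith)
  have 21: "(gen + of_int c) / rootD + (gen' - real D - of_int c) / real d * (real d / rootD) = 0"
    unfolding k by (rule z) (use gen_gen' in linarith)
  have 22: "- (gen' + of_int c) / rootD + (gen' - real D - of_int c) / real d * (- real d / rootD) = 1"
    unfolding k by (rule s) (use gen_gen' in linarith)
  have 31: "1 / real d * (real d / rootD) + - 1 / rootD = 0" "1 / real d * (- real d / rootD) + 1 / rootD = 0"
    unfolding k by simp_all
  show ?thesis
    unfolding vec_eq_iff forall_3 matrix_matrix_mult_def mat_def vec_lambda_beta sum_3 N_nth M_nth
      mult_1_left mult_zero_left mult_zero_right mult_1_right add_0_right add_0_left 11 12 21 22 31 by simp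
qed

lemma M_N: "M ** N = mat 1"
  using N_M matrix_left_right_inverse by blast

definition P :: "complex^3 \<Rightarrow> complex^3" where "P w = (\<chi> i. \<Sum>k\<in>UNIV. of_real (M $ i $ k) * w $ k)"
definition Q :: "complex^3 \<Rightarrow> complex^3" where "Q z = (\<chi> k. \<Sum>i\<in>UNIV. of_real (N $ k $ i) * z $ i)"

lemma mat_id: "A ** B = mat 1 \<Longrightarrow> (\<Sum>k\<in>UNIV. A $ i $ k * B $ k $ j) = (if i = j then 1 else 0)" for A B :: "real^3^3"
  by (simp add: vec_eq_iff matrix_matrix_mult_def mat_def)

lemma mat_id_complex:
  fixes A B :: "real^3^3" and z :: "complex^3"
  assumes "A ** B = mat 1"
  shows "(\<Sum>k\<in>UNIV. of_real (A $ i $ k) * (\<Sum>j\<in>UNIV. of_real (B $ k $ j) * z $ j)) = (z $ i :: complex)"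
proof -
  have "(\<Sum>k\<in>UNIV. of_real (A $ i $ k) * (\<Sum>j\<in>UNIV. of_real (B $ k $ j) * z $ j))
      = (\<Sum>k\<in>UNIV. \<Sum>j\<in>UNIV. of_real (A $ i $ k * B $ k $ j) * z $ j)"
    by (simp add: sum_distrib_left mult.assoc)
  also have "\<dots> = (\<Sum>j\<in>UNIV. \<Sum>k\<in>UNIV. of_real (A $ i $ k * B $ k $ j) * z $ j)" by (rule sum.swap)
  also have "\<dots> = (\<Sum>j\<in>UNIV. of_real (\<Sum>k\<in>UNIV. A $ i $ k * B $ k $ j) * z $ j)"
    by (simp only: of_real_sum sum_distrib_right)
  also have "\<dots> = z $ i" unfolding mat_id[OF assms] using exhaust_3[of i] by (auto simp: sum_3)
  finally show ?thesis .
qed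

lemma P_Q [simp]: "P (Q z) = z" and Q_P [simp]: "Q (P w) = w"
  unfolding P_def Q_def by (simp_all add: vec_eq_iff mat_id_complex[OF M_N] mat_id_complex[OF N_M])

lemma Q_add: "Q (x + y) = Q x + Q y" and Q_smult: "Q (k *s x) = k *s Q x"
  and P_add: "P (x + y) = P x + P y" and P_smult: "P (k *s x) = k *s P x"
  unfolding Q_def P_def by (simp_all add: vec_eq_iff sum_3 algebra_simps)

lemma Q_scaleR: "Q (r *\<^sub>R x) = r *\<^sub>R Q x" and P_scaleR: "P (r *\<^sub>R x) = r *\<^sub>R P x"
  unfolding of_real_smult[symmetric] by (rule Q_smult P_smult)+

lemma Q_inject: "Q x = Q y \<longleftrightarrow> x = y" by (metis P_Q)

definition W0 :: "(complex^3) set" where "W0 = {z. Q z $ 3 = 0}"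

lemma W0_subspace: "vec.subspace W0"
  unfolding W0_def vec.subspace_def by (simp add: Q_add Q_smult) (simp add: Q_def)

lemma W0_closed: "x \<in> W0 \<Longrightarrow> y \<in> W0 \<Longrightarrow> x + y \<in> W0" "x \<in> W0 \<Longrightarrow> k *s x \<in> W0" "x \<in> W0 \<Longrightarrow> r *\<^sub>R x \<in> W0"
  unfolding W0_def by (simp_all add: Q_add Q_smult Q_scaleR)

lemma W0_dim: "vec.dim W0 = 2"
proof -
  define p q :: "complex^3" where "p = P (vector [1, 0, 0])" and "q = P (vector [0, 1, 0])"
  have pq: "Q p = vector [1, 0, 0]" "Q q = vector [0, 1, 0]" unfolding p_def q_def by simp_all
  have "vec.independent {p, q}"
  proof -
    have "q \<noteq> 0"
    proof
      assume "q = 0"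
      then have "Q q = Q 0" by simp
      then have "Q q $ 2 = Q 0 $ 2" by simp
      then show False unfolding pq by (simp add: Q_def)
    qed
    moreover have "p \<notin> vec.span {q}"
    proof
      assume "p \<in> vec.span {q}"
      then obtain k where "p = k *s q" unfolding vec.span_singleton by blast
      then have "Q p $ 1 = (k *s Q q) $ 1" by (simp add: Q_smult)
      then show False unfolding pq by simp
    qed
    moreover from this have "p \<noteq> q" using vec.span_base[of q "{q}"] by auto
    ultimately show ?thesis by (simp add: vec.independent_insert)
  qed
  moreover have "p \<noteq> q"
  proof
    assume "p = q"
    then have "Q p $ 1 = Q q $ 1" by simp
    then show False unfolding pq by simp
  qed
  moreover have "vec.span {p, q} = vec.span W0"
  proof
    have "{p, q} \<subseteq> W0" unfolding W0_def using pq by simp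
    then show "vec.span {p, q} \<subseteq> vec.span W0" by (rule vec.span_mono)
    have "W0 \<subseteq> vec.span {p, q}"
    proof
      fix z assume "z \<in> W0"
      then have "Q z $ 3 = 0" unfolding W0_def by simp
      then have "Q z = Q ((Q z $ 1) *s p + (Q z $ 2) *s q)"
        unfolding Q_add Q_smult pq by (simp add: vec_eq_iff forall_3)
      then have "z = (Q z $ 1) *s p + (Q z $ 2) *s q" unfolding Q_inject .
      moreover have "(Q z $ 1) *s p + (Q z $ 2) *s q \<in> vec.span {p, q}"
        by (intro vec.span_add vec.span_scale vec.span_base) simp_all
      ultimately show "z \<in> vec.span {p, q}" by simp
    qed
    then show "vec.span W0 \<subseteq> vec.span {p, q}" using vec.span_minimal vec.subspace_span by blast
  qed
  ultimately show ?thesis using vec.dim_eq_card[of "{p, q}" W0] by simp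
qed

definition rho0 :: "real \<Rightarrow> complex^3 \<Rightarrow> complex^3" where
  "rho0 \<alpha> = (\<lambda>z\<in>W0. P (vector [of_real \<alpha> * Q z $ 1, of_real (quad_conj D \<alpha>) * Q z $ 2, 0]))"

lemma Q_rho0: "z \<in> W0 \<Longrightarrow> Q (rho0 \<alpha> z) = vector [of_real \<alpha> * Q z $ 1, of_real (quad_conj D \<alpha>) * Q z $ 2, 0]"
  unfolding rho0_def by simp

lemma rho0_W0: "z \<in> W0 \<Longrightarrow> rho0 \<alpha> z \<in> W0"
  using Q_rho0[of z \<alpha>] unfolding W0_def by simp

lemma W0_eqI: "x \<in> W0 \<Longrightarrow> y \<in> W0 \<Longrightarrow> Q x $ 1 = Q y $ 1 \<Longrightarrow> Q x $ 2 = Q y $ 2 \<Longrightarrow> x = y"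
  by (rule Q_inject[THEN iffD1]) (simp add: vec_eq_iff forall_3 W0_def)

lemma rho0_add:
  assumes "x \<in> W0" "y \<in> W0" shows "rho0 \<alpha> (x + y) = rho0 \<alpha> x + rho0 \<alpha> y"
proof -
  note xy = W0_closed(1)[OF assms]
  show ?thesis
    by (rule W0_eqI[OF rho0_W0[OF xy] W0_closed(1)[OF rho0_W0[OF assms(1)] rho0_W0[OF assms(2)]]];
        unfold Q_add Q_rho0[OF xy] Q_rho0[OF assms(1)] Q_rho0[OF assms(2)] vector_3 vector_add_component; simp add: distrib_left)
qed

lemma rho0_smult:
  assumes "x \<in> W0" shows "rho0 \<alpha> (k *s x) = k *s rho0 \<alpha> x"
proof -
  note kx = W0_closed(2)[OF assms, of k]
  show ?thesis
    by (rule W0_eqI[OF rho0_W0[OF kx] W0_closed(2)[OF rho0_W0[OF assms]]];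
        unfold Q_smult Q_rho0[OF kx] Q_rho0[OF assms] vector_3 vector_smult_component; simp)
qed

lemma rho0_elt: assumes x: "x \<in> W0" shows "rho0 (elt i j) x = of_int i *\<^sub>R x + of_int j *\<^sub>R rho0 gen x"
proof -
  have "elt (i + j * int D) (- j) = of_int i + of_int j * gen'"
    unfolding elt_def gen'_def by (simp add: algebra_simps)
  then have cj: "quad_conj D (elt i j) = of_int i + of_int j * gen'" unfolding conj_elt .
  have cg: "quad_conj D gen = gen'" unfolding gen'_def by simp
  have el: "complex_of_real (elt i j) = of_int i + of_int j * of_real gen" unfolding elt_def by simp
  have cj': "complex_of_real (quad_conj D (elt i j)) = of_int i + of_int j * of_real gen'" unfolding cj by simp
  have l: "Q (rho0 (elt i j) x) $ 1 = (of_int i + of_int j * of_real gen) * Q x $ 1"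
    "Q (rho0 (elt i j) x) $ 2 = (of_int i + of_int j * of_real gen') * Q x $ 2"
    unfolding Q_rho0[OF x] vector_3 el cj' by (rule refl)+
  have g: "Q (rho0 gen x) $ 1 = of_real gen * Q x $ 1" "Q (rho0 gen x) $ 2 = of_real gen' * Q x $ 2"
    unfolding Q_rho0[OF x] vector_3 cg by (rule refl)+
  have sc: "(of_int k *\<^sub>R w :: complex) = of_int k * w" for k w by (simp add: scaleR_conv_of_real)
  show ?thesis
  proof (rule W0_eqI)
    show "rho0 (elt i j) x \<in> W0" by (rule rho0_W0[OF x])
    show "of_int i *\<^sub>R x + of_int j *\<^sub>R rho0 gen x \<in> W0" by (intro W0_closed rho0_W0 x)
    show "Q (rho0 (elt i j) x) $ 1 = Q (of_int i *\<^sub>R x + of_int j *\<^sub>R rho0 gen x) $ 1"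
      unfolding l Q_add Q_scaleR vector_add_component vector_scaleR_component g sc by (simp add: distrib_right)
    show "Q (rho0 (elt i j) x) $ 2 = Q (of_int i *\<^sub>R x + of_int j *\<^sub>R rho0 gen x) $ 2"
      unfolding l Q_add Q_scaleR vector_add_component vector_scaleR_component g sc by (simp add: distrib_right)
  qed
qed

text \<open>The sublattice belonging to the subvariety is spanned by the first two vectors of the first copy of
  \<open>\<int>\<^sup>3\<close> and, in the second copy, by \<open>n\<^sub>1\<close> and \<open>d n\<^sub>2 - n\<^sub>3\<close>.\<close>

definition L0 :: "((int^3) \<times> (int^3)) set" where "L0 = {(m, n). m $ 3 = 0 \<and> n $ 2 = - int d * n $ 3}"

definition period_matrix :: "complex^3 \<Rightarrow> complex^3^3" where
  "period_matrix \<tau> = (\<chi> i j. \<Sum>k\<in>UNIV. of_real (M $ i $ k) * \<tau> $ k * of_real (M $ j $ k))"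

abbreviation pl where "pl Z x1 x2 y1 y3 \<equiv> pv Z x1 x2 0 y1 (- int d * y3) y3"

lemma Q_period:
  "Q (pv (period_matrix \<tau>) x1 x2 x3 y1 y2 y3) $ 1 = \<tau> $ 1 * of_real (((gen + of_int c) * of_int x1 + real d * of_int x2 - of_int x3) / rootD)
     + of_real (of_int y1 + (gen - real D - of_int c) / real d * of_int y2)"
  "Q (pv (period_matrix \<tau>) x1 x2 x3 y1 y2 y3) $ 2 = \<tau> $ 2 * of_real (- ((gen' + of_int c) * of_int x1 + real d * of_int x2 - of_int x3) / rootD)
     + of_real (of_int y1 + (gen' - real D - of_int c) / real d * of_int y2)"
  "Q (pv (period_matrix \<tau>) x1 x2 x3 y1 y2 y3) $ 3 = \<tau> $ 3 * of_int x3 + of_real (of_int y2 / real d + of_int y3)"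
proof -
  define x :: "real^3" where "x = vector [of_int x1, of_int x2, of_int x3]"
  define y :: "complex^3" where "y = (\<chi> i. of_int (vector [y1, y2, y3] $ i))"
  define s where "s k = (\<Sum>j\<in>UNIV. M $ j $ k * x $ j)" for k
  have "pv (period_matrix \<tau>) x1 x2 x3 y1 y2 y3 = P (\<chi> k. \<tau> $ k * of_real (s k)) + y"
    unfolding vec_eq_iff vector_add_component pv_nth period_matrix_def P_def s_def x_def y_def
    by (simp add: sum_3 algebra_simps del: M_nth)
  then have q: "Q (pv (period_matrix \<tau>) x1 x2 x3 y1 y2 y3) = (\<chi> k. \<tau> $ k * of_real (s k)) + Q y" by (simp add: Q_add)
  have fr: "x / rootD * a + y / rootD * b + z / rootD * e = (x * a + y * b + z * e) / rootD" for x y z a b e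
    by (simp add: add_divide_distrib)
  have s1: "s 1 = ((gen + of_int c) * of_int x1 + real d * of_int x2 - of_int x3) / rootD"
  proof -
    have "s 1 = ((gen + of_int c) * of_int x1 + real d * of_int x2 + - 1 * of_int x3) / rootD"
      unfolding s_def x_def sum_3 vector_3 M_nth fr by (rule refl)
    then show ?thesis by (simp only: mult_minus1 add_uminus_conv_diff)
  qed
  have s2: "s 2 = - ((gen' + of_int c) * of_int x1 + real d * of_int x2 - of_int x3) / rootD"
  proof -
    have "s 2 = (- (gen' + of_int c) * of_int x1 + - real d * of_int x2 + 1 * of_int x3) / rootD"
      unfolding s_def x_def sum_3 vector_3 M_nth fr by (rule refl)
    also have "- (gen' + of_int c) * of_int x1 + - real d * of_int x2 + 1 * of_int x3
      = - ((gen' + of_int c) * of_int x1 + real d * of_int x2 - of_int x3)" by (simp add: algebra_simps)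
    finally show ?thesis .
  qed
  have s3: "s 3 = of_int x3"
    unfolding s_def x_def sum_3 vector_3 M_nth by (simp only: mult_zero_left mult_1_left add_0_left)
  have yq: "Q y $ 1 = of_real (of_int y1 + (gen - real D - of_int c) / real d * of_int y2)"
    "Q y $ 2 = of_real (of_int y1 + (gen' - real D - of_int c) / real d * of_int y2)"
    "Q y $ 3 = of_real (of_int y2 / real d + of_int y3)"
    unfolding Q_def y_def by (simp_all add: sum_3)
  show "Q (pv (period_matrix \<tau>) x1 x2 x3 y1 y2 y3) $ 1 = \<tau> $ 1 * of_real (((gen + of_int c) * of_int x1 + real d * of_int x2 - of_int x3) / rootD)
     + of_real (of_int y1 + (gen - real D - of_int c) / real d * of_int y2)"
    unfolding q vector_add_component yq vec_lambda_beta s1 ..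
  show "Q (pv (period_matrix \<tau>) x1 x2 x3 y1 y2 y3) $ 2 = \<tau> $ 2 * of_real (- ((gen' + of_int c) * of_int x1 + real d * of_int x2 - of_int x3) / rootD)
     + of_real (of_int y1 + (gen' - real D - of_int c) / real d * of_int y2)"
    unfolding q vector_add_component yq vec_lambda_beta s2 ..
  show "Q (pv (period_matrix \<tau>) x1 x2 x3 y1 y2 y3) $ 3 = \<tau> $ 3 * of_int x3 + of_real (of_int y2 / real d + of_int y3)"
    unfolding q vector_add_component yq vec_lambda_beta s3 by (simp only: of_real_of_int_eq)
qed

end

locale rm_family = rm_family_data +
  fixes \<tau> :: "complex^3"
  assumes tau: "\<And>k. Im (\<tau> $ k) > 0"
begin

abbreviation Z where "Z \<equiv> period_matrix \<tau>"

definition diag :: "(3 \<Rightarrow> real) \<Rightarrow> real^3^3" where "diag t = (\<chi> i j. if i = j then t i else 0)"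

lemma Im_Z: "Im_matrix Z = M ** diag (\<lambda>k. Im (\<tau> $ k)) ** transpose M"
  unfolding vec_eq_iff Im_matrix_def period_matrix_def diag_def matrix_matrix_mult_def transpose_def
  by (simp add: sum_3 forall_3 del: M_nth)

lemma diag_inv: "diag (\<lambda>k. Im (\<tau> $ k)) ** diag (\<lambda>k. 1 / Im (\<tau> $ k)) = mat 1"
  using tau[of 1] tau[of 2] tau[of 3]
  unfolding vec_eq_iff diag_def matrix_matrix_mult_def mat_def by (simp add: sum_3 forall_3)

lemma Im_Z_inv: "matrix_inv (Im_matrix Z) = transpose N ** diag (\<lambda>k. 1 / Im (\<tau> $ k)) ** N"
proof (rule matrix_inv_unique)
  let ?T = "diag (\<lambda>k. Im (\<tau> $ k))" and ?S = "diag (\<lambda>k. 1 / Im (\<tau> $ k))"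
  have t: "transpose M ** transpose N = mat 1" by (metis N_M matrix_transpose_mul transpose_mat)
  have "Im_matrix Z ** (transpose N ** ?S ** N) = M ** (?T ** ((transpose M ** transpose N) ** (?S ** N)))"
    unfolding Im_Z by (simp only: matrix_mul_assoc)
  also have "\<dots> = M ** ((?T ** ?S) ** N)" unfolding t by (simp only: matrix_mul_lid matrix_mul_assoc)
  also have "\<dots> = mat 1" unfolding diag_inv by (simp add: M_N)
  finally show "Im_matrix Z ** (transpose N ** ?S ** N) = mat 1" .
qed

lemma Z_siegel: "Z \<in> siegel_space"
proof -
  have "transpose Z = Z" unfolding vec_eq_iff transpose_def period_matrix_def by (simp add: mult_ac)
  moreover have "v \<bullet> (Im_matrix Z *v v) > 0" if "v \<noteq> 0" for v
  proof -
    let ?u = "transpose M *v v"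
    have "?u \<noteq> 0"
    proof
      assume "?u = 0"
      then have "transpose N *v (transpose M *v v) = 0" by simp
      then have "(transpose N ** transpose M) *v v = 0" by (simp only: matrix_vector_mul_assoc)
      moreover have "transpose N ** transpose M = mat 1" by (metis M_N matrix_transpose_mul transpose_mat)
      ultimately show False using that by simp
    qed
    then obtain k where k: "?u $ k \<noteq> 0" by (auto simp: vec_eq_iff)
    have "v \<bullet> (Im_matrix Z *v v) = ?u \<bullet> (diag (\<lambda>k. Im (\<tau> $ k)) *v ?u)"
    proof -
      have "Im_matrix Z *v v = M *v (diag (\<lambda>k. Im (\<tau> $ k)) *v ?u)" unfolding Im_Z by (simp only: matrix_vector_mul_assoc matrix_mul_assoc)
      then have "v \<bullet> (Im_matrix Z *v v) = (v v* M) \<bullet> (diag (\<lambda>k. Im (\<tau> $ k)) *v ?u)" by (simp only: dot_lmul_matrix)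
      then show ?thesis by (simp only: transpose_matrix_vector)
    qed
    also have "\<dots> = (\<Sum>k\<in>UNIV. Im (\<tau> $ k) * (?u $ k)\<^sup>2)"
      unfolding inner_vec_def diag_def matrix_vector_mult_def[of "vec_lambda _"]
      by (simp add: sum_3 power2_eq_square del: transpose_matrix_vector)
    also have "\<dots> > 0"
      by (rule sum_pos2[of _ k]) (use k tau in \<open>auto simp: less_imp_le simp del: transpose_matrix_vector intro!: mult_pos_pos mult_nonneg_nonneg\<close>)
    finally show ?thesis .
  qed
  ultimately show ?thesis unfolding siegel_space_def by blast
qed

sublocale siegel Z by unfold_locales (rule Z_siegel)

text \<open>In the coordinates \<open>Q\<close> the form is diagonal; so the action of the order, which is diagonal as well with
  real entries, is self-adjoint.\<close>

lemma form_Q: "siegel_form Z x y = (\<Sum>k\<in>UNIV. Q x $ k * cnj (Q y $ k) / of_real (Im (\<tau> $ k)))"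
proof -
  have inv: "matrix_inv (Im_matrix Z) $ i $ j = (\<Sum>k\<in>UNIV. N $ k $ i * N $ k $ j / Im (\<tau> $ k))" for i j
    unfolding Im_Z_inv diag_def matrix_matrix_mult_def transpose_def by (simp add: sum_3 forall_3 del: N_nth)
  define h where "h k i j = x $ i * of_real (N $ k $ i * N $ k $ j / Im (\<tau> $ k)) * cnj (y $ j)" for k i j
  have "siegel_form Z x y = (\<Sum>i\<in>UNIV. \<Sum>j\<in>UNIV. \<Sum>k\<in>UNIV. h k i j)"
    unfolding siegel_form_def inv h_def by (simp only: of_real_sum sum_distrib_left sum_distrib_right)
  also have "\<dots> = (\<Sum>i\<in>UNIV. \<Sum>k\<in>UNIV. \<Sum>j\<in>UNIV. h k i j)" by (intro sum.cong refl sum.swap)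
  also have "\<dots> = (\<Sum>k\<in>UNIV. \<Sum>i\<in>UNIV. \<Sum>j\<in>UNIV. h k i j)" by (rule sum.swap)
  also have "\<dots> = (\<Sum>k\<in>UNIV. Q x $ k * cnj (Q y $ k) / of_real (Im (\<tau> $ k)))"
  proof (rule sum.cong[OF refl])
    fix k
    have "Q x $ k * cnj (Q y $ k) = (\<Sum>i\<in>UNIV. \<Sum>j\<in>UNIV. (of_real (N $ k $ i) * x $ i) * (of_real (N $ k $ j) * cnj (y $ j)))"
      unfolding Q_def vec_lambda_beta cnj_sum by (simp only: sum_product complex_cnj_mult complex_cnj_complex_of_real)
    then have "Q x $ k * cnj (Q y $ k) / of_real (Im (\<tau> $ k))
      = (\<Sum>i\<in>UNIV. \<Sum>j\<in>UNIV. (of_real (N $ k $ i) * x $ i) * (of_real (N $ k $ j) * cnj (y $ j)) / of_real (Im (\<tau> $ k)))"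
      by (simp only: sum_divide_distrib)
    also have "\<dots> = (\<Sum>i\<in>UNIV. \<Sum>j\<in>UNIV. h k i j)"
      unfolding h_def of_real_mult of_real_divide by (intro sum.cong refl) (simp add: mult_ac del: N_nth)
    finally show "(\<Sum>i\<in>UNIV. \<Sum>j\<in>UNIV. h k i j) = Q x $ k * cnj (Q y $ k) / of_real (Im (\<tau> $ k))" by (rule sym)
  qed
  finally show ?thesis .
qed

end

context rm_family_data begin

lemma Q_pl:
  "Q (pl (period_matrix \<tau>) x1 x2 y1 y3) $ 1 = \<tau> $ 1 * of_real (((gen + of_int c) * of_int x1 + real d * of_int x2) / rootD)
     + of_real (of_int y1 - (gen - real D - of_int c) * of_int y3)"
  "Q (pl (period_matrix \<tau>) x1 x2 y1 y3) $ 2 = \<tau> $ 2 * of_real (- ((gen' + of_int c) * of_int x1 + real d * of_int x2) / rootD)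
     + of_real (of_int y1 - (gen' - real D - of_int c) * of_int y3)"
proof -
  have cancel: "t / real d * of_int (- int d * y3) = - (t * of_int y3)" for t
    using d_pos by simp
  show "Q (pl (period_matrix \<tau>) x1 x2 y1 y3) $ 1 = \<tau> $ 1 * of_real (((gen + of_int c) * of_int x1 + real d * of_int x2) / rootD)
     + of_real (of_int y1 - (gen - real D - of_int c) * of_int y3)"
    unfolding Q_period cancel by simp
  show "Q (pl (period_matrix \<tau>) x1 x2 y1 y3) $ 2 = \<tau> $ 2 * of_real (- ((gen' + of_int c) * of_int x1 + real d * of_int x2) / rootD)
     + of_real (of_int y1 - (gen' - real D - of_int c) * of_int y3)"
    unfolding Q_period cancel by simp
qed

lemma pl_W0: "pl (period_matrix \<tau>) x1 x2 y1 y3 \<in> W0"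
  unfolding W0_def mem_Collect_eq Q_period using d_pos by simp

text \<open>For \<open>\<theta>\<close> equal to \<open>\<gamma>\<close> or its conjugate this is multiplication by \<open>\<theta>\<close> in lattice coordinates.\<close>

lemma root_identities:
  fixes \<theta> :: real
  assumes sq: "\<theta> * \<theta> = real D * \<theta> - of_int gnorm" and g: "genpoly c = int d * g"
  shows "\<theta> * ((\<theta> + of_int c) * of_int x1 + real d * of_int x2)
      = (\<theta> + of_int c) * of_int (x1 * (int D + c) + x2 * int d) + real d * of_int (- x2 * c - x1 * g)"
    "\<theta> * (of_int y1 - (\<theta> - real D - of_int c) * of_int y3)
      = of_int (y3 * gnorm + (y1 + y3 * c) * (int D + c)) - (\<theta> - real D - of_int c) * of_int (- (y1 + y3 * c))"
proof -
  have N: "real_of_int gnorm = real d * of_int g - of_int c * of_int c - real D * of_int c"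
  proof -
    have "real_of_int (genpoly c) = of_int (int d * g)" using g by simp
    then show ?thesis unfolding genpoly_def by (simp add: power2_eq_square algebra_simps)
  qed
  have "\<theta> * ((\<theta> + of_int c) * of_int x1 + real d * of_int x2)
      = (\<theta> * \<theta>) * of_int x1 + \<theta> * of_int c * of_int x1 + \<theta> * real d * of_int x2" by (simp add: algebra_simps)
  also have "\<dots> = (\<theta> + of_int c) * of_int (x1 * (int D + c) + x2 * int d) + real d * of_int (- x2 * c - x1 * g)"
    unfolding sq N by (simp add: algebra_simps)
  finally show "\<theta> * ((\<theta> + of_int c) * of_int x1 + real d * of_int x2)
      = (\<theta> + of_int c) * of_int (x1 * (int D + c) + x2 * int d) + real d * of_int (- x2 * c - x1 * g)" .
  have "\<theta> * (of_int y1 - (\<theta> - real D - of_int c) * of_int y3)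
      = \<theta> * of_int y1 - (\<theta> * \<theta>) * of_int y3 + \<theta> * (real D + of_int c) * of_int y3" by (simp add: algebra_simps)
  also have "\<dots> = of_int (y3 * gnorm + (y1 + y3 * c) * (int D + c)) - (\<theta> - real D - of_int c) * of_int (- (y1 + y3 * c))"
    unfolding sq by (simp add: algebra_simps)
  finally show "\<theta> * (of_int y1 - (\<theta> - real D - of_int c) * of_int y3)
      = of_int (y3 * gnorm + (y1 + y3 * c) * (int D + c)) - (\<theta> - real D - of_int c) * of_int (- (y1 + y3 * c))" .
qed

lemma rho0_gen_pl:
  assumes g: "genpoly c = int d * g"
  shows "rho0 gen (pl (period_matrix \<tau>) x1 x2 y1 y3) =
    pl (period_matrix \<tau>) (x1 * (int D + c) + x2 * int d) (- x2 * c - x1 * g)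
      (y3 * gnorm + (y1 + y3 * c) * (int D + c)) (- (y1 + y3 * c))"
proof (rule W0_eqI[OF rho0_W0[OF pl_W0] pl_W0])
  have mul: "of_real \<theta> * (t * of_real (a / r) + of_real b) = t * of_real ((\<theta> * a) / r) + of_real (\<theta> * b)"
    for \<theta> a r b :: real and t :: complex by (simp add: algebra_simps)
  show "Q (rho0 gen (pl (period_matrix \<tau>) x1 x2 y1 y3)) $ 1 =
    Q (pl (period_matrix \<tau>) (x1 * (int D + c) + x2 * int d) (- x2 * c - x1 * g) (y3 * gnorm + (y1 + y3 * c) * (int D + c)) (- (y1 + y3 * c))) $ 1"
    unfolding Q_rho0[OF pl_W0] vector_3 Q_pl mul root_identities[OF gen_sq g] ..
  have mul': "of_real \<theta> * (t * of_real (- a / r) + of_real b) = t * of_real (- (\<theta> * a) / r) + of_real (\<theta> * b)"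
    for \<theta> a r b :: real and t :: complex by (simp add: algebra_simps)
  have cg: "quad_conj D gen = gen'" unfolding gen'_def by simp
  show "Q (rho0 gen (pl (period_matrix \<tau>) x1 x2 y1 y3)) $ 2 =
    Q (pl (period_matrix \<tau>) (x1 * (int D + c) + x2 * int d) (- x2 * c - x1 * g) (y3 * gnorm + (y1 + y3 * c) * (int D + c)) (- (y1 + y3 * c))) $ 2"
    unfolding Q_rho0[OF pl_W0] vector_3 cg Q_pl mul' root_identities[OF gen'_sq g] ..
qed

lemma pl_add: "pl Z x1 x2 y1 y3 + pl Z x1' x2' y1' y3' = pl Z (x1 + x1') (x2 + x2') (y1 + y1') (y3 + y3')"
  unfolding pv_add by (simp add: algebra_simps)

lemma pl_scale: "real_of_int k *\<^sub>R pl Z x1 x2 y1 y3 = pl Z (k * x1) (k * x2) (k * y1) (k * y3)"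
  unfolding pv_scale by (simp add: algebra_simps)

lemma rho0_pl:
  assumes "\<alpha> \<in> quad_order D"
  shows "\<exists>x1' x2' y1' y3'. \<forall>\<tau>. rho0 \<alpha> (pl (period_matrix \<tau>) x1 x2 y1 y3) = pl (period_matrix \<tau>) x1' x2' y1' y3'"
proof -
  obtain i j where ij: "\<alpha> = elt i j" using assms by (rule orderE)
  obtain g where g: "genpoly c = int d * g" using root by blast
  have "rho0 \<alpha> (pl (period_matrix \<tau>) x1 x2 y1 y3) =
     pl (period_matrix \<tau>) (i * x1 + j * (x1 * (int D + c) + x2 * int d)) (i * x2 + j * (- x2 * c - x1 * g))
      (i * y1 + j * (y3 * gnorm + (y1 + y3 * c) * (int D + c))) (i * y3 + j * (- (y1 + y3 * c)))" for \<tau>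
    unfolding ij rho0_elt[OF pl_W0] rho0_gen_pl[OF g] pl_scale pl_add ..
  then show ?thesis by blast
qed

end

context rm_family begin

abbreviation \<Lambda> where "\<Lambda> \<equiv> range (period_vec Z)"

lemma pv_W0: "pv Z x1 x2 x3 y1 y2 y3 \<in> W0 \<longleftrightarrow> x3 = 0 \<and> y2 = - int d * y3"
proof
  assume "pv Z x1 x2 x3 y1 y2 y3 \<in> W0"
  then have z: "\<tau> $ 3 * of_int x3 + of_real (of_int y2 / real d + of_int y3) = 0"
    unfolding W0_def mem_Collect_eq Q_period .
  have "Im (\<tau> $ 3) * of_int x3 = 0" using arg_cong[OF z, of Im] by simp
  then have x3: "x3 = 0" using tau[of 3] by simp
  then have "of_real (of_int y2 / real d + of_int y3) = (0::complex)" using z by simp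
  then have "of_int y2 / real d + of_int y3 = 0" by (simp only: of_real_eq_0_iff)
  then have "of_int y2 = real_of_int (- int d * y3)" using d_pos by (simp add: field_simps)
  then show "x3 = 0 \<and> y2 = - int d * y3" using x3 by (simp only: of_int_eq_iff)
next
  assume "x3 = 0 \<and> y2 = - int d * y3"
  then show "pv Z x1 x2 x3 y1 y2 y3 \<in> W0" using pl_W0[of \<tau> x1 x2 y1 y3] by simp
qed

lemma W0_Lambda: "W0 \<inter> \<Lambda> = {pl Z x1 x2 y1 y3 | x1 x2 y1 y3. True}"
proof
  show "W0 \<inter> \<Lambda> \<subseteq> {pl Z x1 x2 y1 y3 | x1 x2 y1 y3. True}"
  proof
    fix x assume "x \<in> W0 \<inter> \<Lambda>"
    then obtain x1 x2 x3 y1 y2 y3 where x: "x = pv Z x1 x2 x3 y1 y2 y3" "x \<in> W0" unfolding range_period_pv by blast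
    then have "x3 = 0" "y2 = - int d * y3" using pv_W0[of x1 x2 x3 y1 y2 y3] by simp_all
    then have "x = pl Z x1 x2 y1 y3" unfolding x(1) by simp
    then show "x \<in> {pl Z x1 x2 y1 y3 | x1 x2 y1 y3. True}" by blast
  qed
  show "{pl Z x1 x2 y1 y3 | x1 x2 y1 y3. True} \<subseteq> W0 \<inter> \<Lambda>"
    unfolding range_period_pv using pl_W0 by blast
qed

lemma E_pl: "H.E (pl Z x1 x2 y1 y3) (pl Z x1' x2' y1' y3') =
   of_int (x1 * y1' - int d * x2 * y3' - (y1 * x1' - int d * y3 * x2'))"
  unfolding E_pv by (simp add: algebra_simps)

lemma rho0_Lambda: "\<alpha> \<in> quad_order D \<Longrightarrow> x \<in> W0 \<inter> \<Lambda> \<Longrightarrow> rho0 \<alpha> x \<in> W0 \<inter> \<Lambda>"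
  unfolding W0_Lambda using rho0_pl[of \<alpha>] by blast

lemma W0_type: "polarization_type (W0 \<inter> \<Lambda>) (siegel_form Z) [1, d]"
  and W0_torus: "complex_torus W0 (W0 \<inter> \<Lambda>)"
proof -
  define a where "a i = (if i = 0 then pl Z 1 0 0 0 else pl Z 0 1 0 0)" for i :: nat
  define b where "b i = (if i = 0 then pl Z 0 0 1 0 else pl Z 0 0 0 (- 1))" for i :: nat
  have sum: "(\<Sum>i<2. real_of_int (m i) *\<^sub>R a i + real_of_int (n i) *\<^sub>R b i) = pl Z (m 0) (m 1) (n 0) (- n 1)" for m n
    unfolding a_def b_def numeral_2_eq_2 lessThan_Suc lessThan_0 pl_scale pl_add
    by (simp add: pv_scale pv_add mult.commute)
  have L: "W0 \<inter> \<Lambda> = {\<Sum>i<2. real_of_int (m i) *\<^sub>R a i + real_of_int (n i) *\<^sub>R b i | m n. True}"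
  proof
    show "W0 \<inter> \<Lambda> \<subseteq> {\<Sum>i<2. real_of_int (m i) *\<^sub>R a i + real_of_int (n i) *\<^sub>R b i | m n. True}"
    proof
      fix x assume "x \<in> W0 \<inter> \<Lambda>"
      then obtain x1 x2 y1 y3 where x: "x = pl Z x1 x2 y1 y3" unfolding W0_Lambda by blast
      define m n where "m i = (if i = 0 then x1 else x2)" and "n i = (if i = 0 then y1 else - y3)" for i :: nat
      have "x = (\<Sum>i<2. real_of_int (m i) *\<^sub>R a i + real_of_int (n i) *\<^sub>R b i)" unfolding sum x m_def n_def by simp
      then show "x \<in> {\<Sum>i<2. real_of_int (m i) *\<^sub>R a i + real_of_int (n i) *\<^sub>R b i | m n. True}" by blast
    qed
    show "{\<Sum>i<2. real_of_int (m i) *\<^sub>R a i + real_of_int (n i) *\<^sub>R b i | m n. True} \<subseteq> W0 \<inter> \<Lambda>"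
      unfolding sum W0_Lambda by blast
  qed
  have e: "H.E (a i) (a j) = 0" "H.E (b i) (b j) = 0" "H.E (a i) (b j) = (if i = j then real ([1, d] ! i) else 0)"
    if "i < 2" "j < 2" for i j
  proof -
    have ij: "i = 0 \<or> i = 1" "j = 0 \<or> j = 1" using that by auto
    show "H.E (a i) (a j) = 0" "H.E (b i) (b j) = 0" unfolding a_def b_def by (simp_all add: E_pv)
    show "H.E (a i) (b j) = (if i = j then real ([1, d] ! i) else 0)" using ij unfolding a_def b_def
      by (elim disjE) (simp_all add: E_pv)
  qed
  have inW: "a i \<in> W0" "b i \<in> W0" for i unfolding a_def b_def by (simp_all add: pv_W0)
  have pos: "real ([1, d] ! i) > 0" if "i < 2" for i
  proof -
    have "i = 0 \<or> i = 1" using that by auto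
    then show ?thesis using d_pos by auto
  qed
  have "is_lattice W0 (W0 \<inter> \<Lambda>)"
    unfolding L by (rule H.symplectic_is_lattice[OF W0_subspace W0_dim inW e pos])
  then show "complex_torus W0 (W0 \<inter> \<Lambda>)" unfolding complex_torus_def using W0_subspace by simp
  show "polarization_type (W0 \<inter> \<Lambda>) (siegel_form Z) [1, d]"
    unfolding polarization_type_def
  proof (intro conjI)
    show "\<forall>i<length [1, d]. [1, d] ! i > 0" using d_pos by (auto simp: nth_Cons split: nat.splits)
    show "\<forall>i. Suc i < length [1, d] \<longrightarrow> [1, d] ! i dvd [1, d] ! Suc i" by (auto simp: nth_Cons split: nat.splits)
    have "length [1, d] = 2" by simp
    then show "\<exists>a b. W0 \<inter> \<Lambda> = {\<Sum>i<length [1, d]. real_of_int (m i) *\<^sub>R a i + real_of_int (n i) *\<^sub>R b i |m n. True} \<and>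
      (\<forall>i<length [1, d]. \<forall>j<length [1, d]. Im (siegel_form Z (a i) (a j)) = 0 \<and> Im (siegel_form Z (b i) (b j)) = 0 \<and>
        Im (siegel_form Z (a i) (b j)) = (if i = j then real ([1, d] ! i) else 0))"
      using L e unfolding H.E_def by (intro exI[of _ a] exI[of _ b]) (simp only:, simp)
  qed
qed

lemma rho0_hom: "rho0 \<in> ring_hom (ring_on (quad_order D)) (End_ring W0 (W0 \<inter> \<Lambda>))"
proof (rule ring_hom_memI)
  fix \<alpha> assume "\<alpha> \<in> carrier (ring_on (quad_order D))"
  then have al: "\<alpha> \<in> quad_order D" by simp
  show "rho0 \<alpha> \<in> carrier (End_ring W0 (W0 \<inter> \<Lambda>))"
    unfolding End_ring_def partial_object.simps mem_Collect_eq
  proof (intro conjI ballI allI)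
    have "rho0 \<alpha> \<in> extensional W0" unfolding rho0_def by simp
    then show "rho0 \<alpha> \<in> W0 \<rightarrow>\<^sub>E W0" using rho0_W0 by (auto simp: PiE_iff)
    show "rho0 \<alpha> ` (W0 \<inter> \<Lambda>) \<subseteq> W0 \<inter> \<Lambda>" using rho0_Lambda[OF al] by blast
  qed (rule rho0_add rho0_smult; assumption)+
next
  fix \<alpha> \<beta> assume "\<alpha> \<in> carrier (ring_on (quad_order D))" "\<beta> \<in> carrier (ring_on (quad_order D))"
  then have K: "\<alpha> \<in> quad_field D" "\<beta> \<in> quad_field D" using order_sub_field by simp_all
  have "rho0 (\<alpha> * \<beta>) z = compose W0 (rho0 \<alpha>) (rho0 \<beta>) z" for z
  proof (cases "z \<in> W0")
    case True
    have "rho0 (\<alpha> * \<beta>) z = rho0 \<alpha> (rho0 \<beta> z)"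
      by (rule W0_eqI) (use True K in \<open>simp_all add: rho0_W0 Q_rho0 conj_mult\<close>)
    then show ?thesis using True by (simp add: compose_def)
  qed (simp add: compose_def rho0_def)
  then show "rho0 (\<alpha> \<otimes>\<^bsub>ring_on (quad_order D)\<^esub> \<beta>) = rho0 \<alpha> \<otimes>\<^bsub>End_ring W0 (W0 \<inter> \<Lambda>)\<^esub> rho0 \<beta>"
    unfolding End_ring_def by auto
  have "rho0 (\<alpha> + \<beta>) z = (\<lambda>x\<in>W0. rho0 \<alpha> x + rho0 \<beta> x) z" for z
  proof (cases "z \<in> W0")
    case True
    have "rho0 (\<alpha> + \<beta>) z = rho0 \<alpha> z + rho0 \<beta> z"
      by (rule W0_eqI) (use True K in \<open>simp_all add: rho0_W0 Q_rho0 conj_add W0_closed Q_add distrib_right\<close>)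
    then show ?thesis using True by simp
  qed (simp add: rho0_def)
  then show "rho0 (\<alpha> \<oplus>\<^bsub>ring_on (quad_order D)\<^esub> \<beta>) = rho0 \<alpha> \<oplus>\<^bsub>End_ring W0 (W0 \<inter> \<Lambda>)\<^esub> rho0 \<beta>"
    unfolding End_ring_def by auto
next
  have "rho0 1 z = (\<lambda>x\<in>W0. x) z" for z
  proof (cases "z \<in> W0")
    case True
    have "rho0 1 z = z" by (rule W0_eqI) (use True in \<open>simp_all add: rho0_W0 Q_rho0\<close>)
    then show ?thesis using True by simp
  qed (simp add: rho0_def)
  then show "rho0 \<one>\<^bsub>ring_on (quad_order D)\<^esub> = \<one>\<^bsub>End_ring W0 (W0 \<inter> \<Lambda>)\<^esub>"
    unfolding End_ring_def by auto
qed

lemma Q_v0: "Q (pl Z 0 0 1 0) $ 1 = 1"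
  unfolding Q_pl by simp

lemma rho0_inj: "inj_on rho0 A"
proof (rule inj_onI)
  fix \<alpha> \<beta> assume "rho0 \<alpha> = rho0 \<beta>"
  then have "Q (rho0 \<alpha> (pl Z 0 0 1 0)) $ 1 = Q (rho0 \<beta> (pl Z 0 0 1 0)) $ 1" by simp
  then have "complex_of_real \<alpha> = complex_of_real \<beta>" unfolding Q_rho0[OF pl_W0] vector_3 Q_v0 by simp
  then show "\<alpha> = \<beta>" by simp
qed

lemma rho0_adjoint:
  assumes "x \<in> W0" "y \<in> W0" shows "siegel_form Z (rho0 \<alpha> x) y = siegel_form Z x (rho0 \<alpha> y)"
  unfolding form_Q sum_3 Q_rho0[OF assms(1)] Q_rho0[OF assms(2)] vector_3 by (simp add: mult_ac)

lemma denominators: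
  assumes "x \<in> quad_field D" obtains n :: int where "n > 0" "of_int n * x \<in> quad_order D"
proof -
  obtain a b where ab: "a \<in> \<rat>" "b \<in> \<rat>" "x = a + b * rootD" using assms by (rule quad_fieldE)
  obtain p q where pq: "q > 0" "a = of_int p / of_int q" using ab(1) by (rule Rats_cases')
  obtain p' q' where pq': "q' > 0" "b = of_int p' / of_int q'" using ab(2) by (rule Rats_cases')
  have "of_int (q * q') * x = of_int (p * q') + of_int (p' * q) * rootD"
    unfolding ab(3) pq(2) pq'(2) using pq(1) pq'(1) by (simp add: field_simps)
  also have "\<dots> = elt (p * q' - p' * q * int D) (2 * (p' * q))"
    unfolding gen_diff_conj[symmetric] elt_def by (simp add: algebra_simps)
  finally have "of_int (q * q') * x \<in> quad_order D" by simp
  then show thesis using pq(1) pq'(1) by (intro that[of "q * q'"]) simp_all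
qed

text \<open>An element \<open>x\<close> of a larger order sends the period vector of \<open>(1, 0)\<close> to a period vector whose first
  coordinate is \<open>x\<close>. That coordinate is \<open>\<tau>\<^sub>1 s + t\<close> with \<open>s\<close> real and \<open>t\<close> in \<open>\<O>\<^sub>D\<close>; as \<open>x\<close> is real,
  \<open>s = 0\<close> and \<open>x = t\<close>.\<close>

lemma rho0_proper:
  assumes R: "is_order D R" "quad_order D \<subset> R"
    and h: "\<rho>' \<in> ring_hom (ring_on R) (End_ring W0 (W0 \<inter> \<Lambda>))" and ext: "\<forall>\<alpha>\<in>quad_order D. \<rho>' \<alpha> = rho0 \<alpha>"
  shows False
proof -
  obtain x where x: "x \<in> R" "x \<notin> quad_order D" using R(2) by blast
  have "subring R (ring_on (quad_field D))" using R(1) unfolding is_order_def by blast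
  then have "R \<subseteq> quad_field D" using subringE(1) by fastforce
  then obtain n :: int where n: "n > 0" "of_int n * x \<in> quad_order D" using denominators x(1) by blast
  let ?v = "pl Z 0 0 1 0"
  have nR: "of_int n \<in> R" using R(2) order_of_int by blast
  have v: "?v \<in> W0 \<inter> \<Lambda>" unfolding W0_Lambda by blast
  have "\<rho>' x \<in> carrier (End_ring W0 (W0 \<inter> \<Lambda>))" using ring_hom_closed[OF h] x(1) by simp
  then have "\<rho>' x ?v \<in> W0 \<inter> \<Lambda>" using v unfolding End_ring_def by auto
  then obtain x1 x2 y1 y3 where y: "\<rho>' x ?v = pl Z x1 x2 y1 y3" unfolding W0_Lambda by blast
  have "\<rho>' (of_int n * x) ?v = \<rho>' (of_int n) (\<rho>' x ?v)"
    using ring_hom_mult[OF h, of "of_int n" x] nR x(1) pl_W0[of \<tau> 0 0 1 0] unfolding End_ring_def by (simp add: compose_def)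
  then have "rho0 (of_int n * x) ?v = rho0 (of_int n) (pl Z x1 x2 y1 y3)"
    using ext n(2) order_of_int y by simp
  then have "Q (rho0 (of_int n * x) ?v) $ 1 = Q (rho0 (of_int n) (pl Z x1 x2 y1 y3)) $ 1" by simp
  then have "of_real (of_int n * x) = complex_of_real (of_int n) * Q (pl Z x1 x2 y1 y3) $ 1"
    unfolding Q_rho0[OF pl_W0] vector_3 Q_v0 by simp
  then have qx: "complex_of_real x = Q (pl Z x1 x2 y1 y3) $ 1" using n(1) by simp
  define s where "s = ((gen + of_int c) * of_int x1 + real d * of_int x2) / rootD"
  define t where "t = of_int y1 - (gen - real D - of_int c) * of_int y3"
  have q: "complex_of_real x = \<tau> $ 1 * of_real s + of_real t" using qx unfolding Q_pl s_def t_def .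
  have "Im (\<tau> $ 1) * s = 0" using arg_cong[OF q, of Im] by simp
  then have "s = 0" using tau[of 1] by simp
  then have "complex_of_real x = of_real t" using q by simp
  then have "x = t" by (simp only: of_real_eq_iff)
  also have "t = elt (y1 + (int D + c) * y3) (- y3)" unfolding t_def elt_def by (simp add: algebra_simps)
  finally show False using x(2) by simp
qed

theorem family_object: "(\<Lambda>, siegel_form Z, W0, rho0) \<in> rm_objects D d"
proof -
  have "real_multiplication D W0 (W0 \<inter> \<Lambda>) (siegel_form Z) rho0"
    unfolding real_multiplication_def
    using rho0_hom rho0_inj rho0_adjoint rho0_proper by (intro conjI ballI notI) (auto, blast)
  then show ?thesis
    unfolding rm_objects_def using ppav W0_type W0_torus W0_dim by simp
qed

theorem family_module_type: "module_type D (root_ideal (int d) c) (\<Lambda>, siegel_form Z, W0, rho0)"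
proof -
  interpret O: rm_object D "siegel_form Z" d \<Lambda> W0 rho0
    by unfold_locales (rule family_object)
  obtain g where g: "genpoly c = int d * g" using root by blast
  have "O.adapted c (pl Z 0 0 1 0) (pl Z 0 0 (int D + c) (- 1)) (pl Z 0 1 0 0) (pl Z 1 0 0 0)"
    unfolding O.adapted_def
  proof (intro conjI)
    have z: "zcomb (pl Z 0 0 1 0) (pl Z 0 0 (int D + c) (- 1)) (pl Z 0 1 0 0) (pl Z 1 0 0 0) m n k l
        = pl Z l k (m + n * (int D + c)) (- n)" for m n k l
      unfolding zcomb_def pl_scale pl_add by simp
    show "W0 \<inter> \<Lambda> = {zcomb (pl Z 0 0 1 0) (pl Z 0 0 (int D + c) (- 1)) (pl Z 0 1 0 0) (pl Z 1 0 0 0) m n k l | m n k l. True}"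
      unfolding W0_Lambda z
    proof (intro subset_antisym subsetI)
      fix x assume "x \<in> {pl Z x1 x2 y1 y3 |x1 x2 y1 y3. True}"
      then obtain x1 x2 y1 y3 where x: "x = pl Z x1 x2 y1 y3" by blast
      have "x = pl Z x1 x2 ((y1 + y3 * (int D + c)) + (- y3) * (int D + c)) (- (- y3))" unfolding x by simp
      then show "x \<in> {pl Z l k (m + n * (int D + c)) (- n) |m n k l. True}" by blast
    qed blast
    show "rho0 gen (pl Z 0 0 1 0) = pl Z 0 0 (int D + c) (- 1)" unfolding rho0_gen_pl[OF g] by simp
    have "real d *\<^sub>R pl Z 1 0 0 0 - of_int c *\<^sub>R pl Z 0 1 0 0 = of_int (int d) *\<^sub>R pl Z 1 0 0 0 + of_int (- c) *\<^sub>R pl Z 0 1 0 0"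
      by simp
    then show "rho0 gen (pl Z 0 1 0 0) = real d *\<^sub>R pl Z 1 0 0 0 - of_int c *\<^sub>R pl Z 0 1 0 0"
      unfolding rho0_gen_pl[OF g] pl_scale pl_add by simp
  qed (simp_all only: E_pl, simp_all)
  then show ?thesis using O.adapted_module_type root by blast
qed

end

section \<open>Every object is isomorphic to a member of the family\<close>

lemma lattice_span:
  assumes "is_lattice V L" shows "span L = V"
proof -
  obtain B where B: "independent B" "span B = V" "L = {\<Sum>b\<in>B. real_of_int (c b) *\<^sub>R b | c. True}"
    using assms unfolding is_lattice_def by blast
  have fB: "finite B" using B(1) by (rule independent_imp_finite)
  have "B \<subseteq> L"
  proof
    fix b assume b: "b \<in> B"
    have "(\<Sum>x\<in>B. real_of_int (if x = b then 1 else 0) *\<^sub>R x) = (\<Sum>x\<in>B. if x = b then x else 0)"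
      by (rule sum.cong) auto
    also have "\<dots> = b" using fB b by simp
    finally show "b \<in> L" unfolding B(3) by (intro CollectI exI[of _ "\<lambda>x. if x = b then 1 else 0"]) simp
  qed
  moreover have "L \<subseteq> span B" unfolding B(3) by (clarify, intro span_sum span_scale span_base)
  ultimately show ?thesis using B(2) by (metis span_eq subset_trans span_superset)
qed

context positive_hermitian begin

lemma E_sum_left: "E (\<Sum>i<k. f i) y = (\<Sum>i<k. E (f i) y)" for f :: "nat \<Rightarrow> complex^'n" and k :: nat
  by (induction k) (simp_all add: E_add_left)

lemma E_zero_span:
  assumes "\<And>y. y \<in> S \<Longrightarrow> E x y = 0" "y \<in> span S" shows "E x y = 0"
  using assms(2)
proof (induction rule: span_induct_alt)
  case (step c a b) then show ?case using assms(1) by (simp add: E_bilinear)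
qed simp

lemma E_nondegenerate:
  assumes "\<And>y. E x y = 0" shows "x = 0"
proof (rule ccontr)
  assume "x \<noteq> 0"
  then have "Re (H x x) > 0" by (rule H_pos)
  moreover have "E x (\<i> *s x) = - Re (H x x)" using E_ii[of x] E_swap[of "\<i> *s x" x] by linarith
  ultimately show False using assms[of "\<i> *s x"] by simp
qed

lemma H_real: "H x x = of_real (Re (H x x))"
  using H_cnj[of x x] by (simp add: complex_eq_iff)

end

context rm_object begin

lemma Lambda_basis:
  obtains a b :: "nat \<Rightarrow> complex^3" where
    "\<Lambda> = {\<Sum>i<3. real_of_int (m i) *\<^sub>R a i + real_of_int (n i) *\<^sub>R b i | m n. True}"
    "\<And>i j. i < 3 \<Longrightarrow> j < 3 \<Longrightarrow> E (a i) (a j) = 0" "\<And>i j. i < 3 \<Longrightarrow> j < 3 \<Longrightarrow> E (b i) (b j) = 0"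
    "\<And>i j. i < 3 \<Longrightarrow> j < 3 \<Longrightarrow> E (a i) (b j) = (if i = j then 1 else 0)"
proof -
  have l: "length [1, 1, 1::nat] = 3" by simp
  have one: "real ([1, 1, 1] ! i) = 1" if "i < 3" for i using that by (auto simp: nth_Cons split: nat.splits)
  show thesis using Lambda_type unfolding polarization_type_def l E_def[symmetric] using that one by auto
qed

lemma Lambda_add: "x \<in> \<Lambda> \<Longrightarrow> y \<in> \<Lambda> \<Longrightarrow> x + y \<in> \<Lambda>"
  and Lambda_scale: "x \<in> \<Lambda> \<Longrightarrow> real_of_int k *\<^sub>R x \<in> \<Lambda>"
proof -
  obtain a b :: "nat \<Rightarrow> complex^3" where
    L: "\<Lambda> = {\<Sum>i<3. real_of_int (m i) *\<^sub>R a i + real_of_int (n i) *\<^sub>R b i | m n. True}" by (rule Lambda_basis)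
  have inL: "(\<Sum>i<3. real_of_int (m i) *\<^sub>R a i + real_of_int (n i) *\<^sub>R b i) \<in> \<Lambda>" for m n unfolding L by blast
  show "x + y \<in> \<Lambda>" if xy: "x \<in> \<Lambda>" "y \<in> \<Lambda>"
  proof -
    obtain m n m' n' where "x = (\<Sum>i<3. real_of_int (m i) *\<^sub>R a i + real_of_int (n i) *\<^sub>R b i)"
      "y = (\<Sum>i<3. real_of_int (m' i) *\<^sub>R a i + real_of_int (n' i) *\<^sub>R b i)" using xy unfolding L by blast
    then have "x + y = (\<Sum>i<3. real_of_int (m i + m' i) *\<^sub>R a i + real_of_int (n i + n' i) *\<^sub>R b i)"
      by (simp add: sum.distrib scaleR_add_left)
    then show ?thesis using inL[of "\<lambda>i. m i + m' i" "\<lambda>i. n i + n' i"] by simp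
  qed
  show "real_of_int k *\<^sub>R x \<in> \<Lambda>" if x: "x \<in> \<Lambda>"
  proof -
    obtain m n where "x = (\<Sum>i<3. real_of_int (m i) *\<^sub>R a i + real_of_int (n i) *\<^sub>R b i)" using x unfolding L by blast
    then have "real_of_int k *\<^sub>R x = (\<Sum>i<3. real_of_int (k * m i) *\<^sub>R a i + real_of_int (k * n i) *\<^sub>R b i)"
      by (simp add: scaleR_sum_right scaleR_add_right)
    then show ?thesis using inL[of "\<lambda>i. k * m i" "\<lambda>i. k * n i"] by simp
  qed
qed

lemma Lambda_minus: "x \<in> \<Lambda> \<Longrightarrow> - x \<in> \<Lambda>" using Lambda_scale[of x "-1"] by simp
lemma Lambda_diff: "x \<in> \<Lambda> \<Longrightarrow> y \<in> \<Lambda> \<Longrightarrow> x - y \<in> \<Lambda>" using Lambda_add[of x "- y"] Lambda_minus by simp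

lemma Lambda_E_int: "x \<in> \<Lambda> \<Longrightarrow> y \<in> \<Lambda> \<Longrightarrow> \<exists>k::int. E x y = of_int k"
  using Lambda_int by (metis Ints_cases)

text \<open>In a unimodular lattice the values \<open>E P v\<close> are the multiples of the greatest integer that divides
  \<open>P\<close>.\<close>

lemma Lambda_primitive:
  assumes P: "P \<in> \<Lambda>" "P \<noteq> 0"
  shows "\<exists>e::int. \<exists>P0\<in>\<Lambda>. \<exists>Q\<in>\<Lambda>. e > 0 \<and> P = of_int e *\<^sub>R P0 \<and> E P0 Q = 1"
proof -
  obtain a b :: "nat \<Rightarrow> complex^3" where
    L: "\<Lambda> = {\<Sum>i<3. real_of_int (m i) *\<^sub>R a i + real_of_int (n i) *\<^sub>R b i | m n. True}"
    and e: "\<And>i j. i < 3 \<Longrightarrow> j < 3 \<Longrightarrow> E (a i) (a j) = 0" "\<And>i j. i < 3 \<Longrightarrow> j < 3 \<Longrightarrow> E (b i) (b j) = 0"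
      "\<And>i j. i < 3 \<Longrightarrow> j < 3 \<Longrightarrow> E (a i) (b j) = (if i = j then 1 else 0)" by (rule Lambda_basis) blast
  have ba: "E (b i) (a j) = (if i = j then - 1 else 0)" if "i < 3" "j < 3" for i j
    using e(3)[OF that(2,1)] E_swap[of "b i" "a j"] by auto
  obtain m n where mn: "P = (\<Sum>i<3. real_of_int (m i) *\<^sub>R a i + real_of_int (n i) *\<^sub>R b i)" using P(1) unfolding L by blast
  have inSum: "(\<Sum>i<3. real_of_int (m i) *\<^sub>R a i + real_of_int (n i) *\<^sub>R b i) \<in> \<Lambda>" for m n unfolding L by blast
  have inL: "a j \<in> \<Lambda>" "b j \<in> \<Lambda>" if j: "j < 3" for j
  proof -
    have "(\<Sum>i<3. real_of_int (if i = j then 1 else 0) *\<^sub>R a i + real_of_int 0 *\<^sub>R b i) = (\<Sum>i<3. if i = j then a i else 0)"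
      by (rule sum.cong) auto
    also have "\<dots> = a j" using j by simp
    finally have "a j = (\<Sum>i<3. real_of_int (if i = j then 1 else 0) *\<^sub>R a i + real_of_int 0 *\<^sub>R b i)" by (rule sym)
    then show "a j \<in> \<Lambda>" using inSum[of "\<lambda>i. if i = j then 1 else 0" "\<lambda>_. 0"] by simp
    have "(\<Sum>i<3. real_of_int 0 *\<^sub>R a i + real_of_int (if i = j then 1 else 0) *\<^sub>R b i) = (\<Sum>i<3. if i = j then b i else 0)"
      by (rule sum.cong) auto
    also have "\<dots> = b j" using j by simp
    finally have "b j = (\<Sum>i<3. real_of_int 0 *\<^sub>R a i + real_of_int (if i = j then 1 else 0) *\<^sub>R b i)" by (rule sym)
    then show "b j \<in> \<Lambda>" using inSum[of "\<lambda>_. 0" "\<lambda>i. if i = j then 1 else 0"] by simp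
  qed
  have Pb: "E P (b j) = of_int (m j)" and Pa: "E P (a j) = - of_int (n j)" if j: "j < 3" for j
  proof -
    have "E P (b j) = (\<Sum>i<3. if i = j then of_int (m i) else 0)"
      unfolding mn E_sum_left by (rule sum.cong) (use e j in \<open>auto simp: E_bilinear\<close>)
    then show "E P (b j) = of_int (m j)" using j by simp
    have "E P (a j) = (\<Sum>i<3. if i = j then - of_int (n i) else 0)"
      unfolding mn E_sum_left by (rule sum.cong) (use e ba j in \<open>auto simp: E_bilinear\<close>)
    then show "E P (a j) = - of_int (n j)" using j by simp
  qed
  obtain g where g: "g \<ge> 0" "\<And>k::int. (\<exists>v\<in>\<Lambda>. E P v = of_int k) \<longleftrightarrow> g dvd k"
  proof (rule int_subgroup_principal[of "{k. \<exists>v\<in>\<Lambda>. E P v = of_int k}"])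
    have "0 \<in> \<Lambda>" using Lambda_scale[OF P(1), of 0] by simp
    then show "0 \<in> {k::int. \<exists>v\<in>\<Lambda>. E P v = of_int k}" by (auto intro: bexI[of _ 0])
    show "x - y \<in> {k. \<exists>v\<in>\<Lambda>. E P v = of_int k}"
      if xy: "x \<in> {k. \<exists>v\<in>\<Lambda>. E P v = of_int k}" "y \<in> {k. \<exists>v\<in>\<Lambda>. E P v = of_int k}" for x y
    proof -
      obtain v w where "v \<in> \<Lambda>" "w \<in> \<Lambda>" "E P v = of_int x" "E P w = of_int y" using xy by blast
      then show ?thesis using Lambda_diff[of v w] by (auto intro!: bexI[of _ "v - w"] simp: E_diff_right)
    qed
  qed (use that in auto)
  have dm: "g dvd m j" "g dvd n j" if j: "j < 3" for j
  proof -
    show "g dvd m j" using g(2)[of "m j"] Pb[OF j] inL(2)[OF j] by blast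
    have "E P (a j) = of_int (- n j)" using Pa[OF j] by simp
    then have "g dvd - n j" using g(2)[of "- n j"] inL(1)[OF j] by blast
    then show "g dvd n j" by simp
  qed
  have g0: "g \<noteq> 0"
  proof
    assume "g = 0"
    then have "m i = 0" "n i = 0" if "i < 3" for i using dm[OF that] by simp_all
    then have "P = 0" unfolding mn by (intro sum.neutral) simp
    then show False using P(2) by simp
  qed
  define P0 where "P0 = (\<Sum>i<3. real_of_int (m i div g) *\<^sub>R a i + real_of_int (n i div g) *\<^sub>R b i)"
  have "P0 \<in> \<Lambda>" unfolding P0_def by (rule inSum)
  have gP: "P = of_int g *\<^sub>R P0"
    unfolding mn P0_def scaleR_sum_right
  proof (rule sum.cong[OF refl])
    fix i assume "i \<in> {..<3::nat}"
    then have "g dvd m i" "g dvd n i" using dm by simp_all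
    then have "m i = g * (m i div g)" "n i = g * (n i div g)" by simp_all
    then have "real_of_int (m i) = of_int g * of_int (m i div g)" "real_of_int (n i) = of_int g * of_int (n i div g)"
      by (metis of_int_mult)+
    then show "real_of_int (m i) *\<^sub>R a i + real_of_int (n i) *\<^sub>R b i
        = of_int g *\<^sub>R (real_of_int (m i div g) *\<^sub>R a i + real_of_int (n i div g) *\<^sub>R b i)"
      by (simp add: scaleR_add_right)
  qed
  obtain Q where Q: "Q \<in> \<Lambda>" "E P Q = of_int g" using g(2)[of g] by auto
  have "of_int g * E P0 Q = of_int g" using Q(2) unfolding gP E_scaleR_left .
  then have "E P0 Q = 1" using g0 by simp
  moreover have "g > 0" using g(1) g0 by simp
  ultimately show ?thesis using gP \<open>P0 \<in> \<Lambda>\<close> Q(1) by blast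
qed

lemma Lambda_not_in_W: "\<exists>x\<in>\<Lambda>. x \<notin> W"
proof (rule ccontr)
  assume "\<not> ?thesis"
  then have "\<Lambda> \<subseteq> W" by blast
  moreover have "subspace W" unfolding subspace_def by auto
  ultimately have "span \<Lambda> \<subseteq> W" by (simp add: span_minimal)
  moreover have "span \<Lambda> = UNIV" using Lambda_torus unfolding complex_torus_def by (intro lattice_span) simp
  ultimately have "W = UNIV" by blast
  then show False using W_dim vec_dim_card[where 'a = complex and 'n = 3] by simp
qed

text \<open>A hyperbolic plane in a lattice with integral form is an orthogonal direct summand.\<close>

lemma plane_projection:
  assumes p: "p \<in> \<Lambda>" "q \<in> \<Lambda>" "E p q = 1" and x: "x \<in> \<Lambda>"
  shows "\<exists>k l :: int. E p (x + of_int k *\<^sub>R p + of_int l *\<^sub>R q) = 0 \<and> E q (x + of_int k *\<^sub>R p + of_int l *\<^sub>R q) = 0"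
proof -
  obtain k l :: int where kl: "E q x = of_int k" "E p x = of_int l" using Lambda_E_int p x by metis
  have qp: "E q p = - 1" using p(3) E_swap[of p q] by linarith
  show ?thesis
    by (rule exI[of _ k], rule exI[of _ "- l"]) (simp add: E_bilinear kl qp p(3))
qed

text \<open>The pairs \<open>(z, u)\<close>, \<open>(y, N2)\<close> and \<open>(M3, N3)\<close> form a symplectic basis of \<open>\<Lambda>\<close> in which the vector
  \<open>\<xi> = \<gamma> u - (D + c) u\<close> of \<open>W \<inter> \<Lambda>\<close> is \<open>d N2 - N3\<close>, as it is in the family. First \<open>y\<close> is
  completed by some \<open>g\<close>; then \<open>\<xi> - d g\<close> is, up to a multiple of \<open>y\<close>, a multiple \<open>e' P\<close> of a primitive
  vector \<open>P\<close> orthogonal to all four vectors. As \<open>e'\<close> and \<open>d\<close> are coprime, \<open>g\<close> can be modified such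
  that \<open>d g - \<xi>\<close> becomes primitive and orthogonal to \<open>g\<close>.\<close>

lemma symplectic_extension:
  assumes a: "adapted c u v y z"
  defines "\<xi> \<equiv> v - of_int (int D + c) *\<^sub>R u"
  shows "\<exists>N2\<in>\<Lambda>. \<exists>M3\<in>\<Lambda>. \<exists>N3\<in>\<Lambda>. N3 = real d *\<^sub>R N2 - \<xi> \<and> E z N2 = 0 \<and> E u N2 = 0 \<and> E y N2 = 1 \<and> E N2 N3 = 0 \<and>
    E M3 z = 0 \<and> E M3 u = 0 \<and> E M3 y = 0 \<and> E M3 N2 = 0 \<and> E M3 N3 = 1"
proof -
  have e: "E u v = 0" "E y z = 0" "E y u = 0" "E y v = real d" "E z u = 1" "E z v = of_int (int D + c)"
    using a unfolding adapted_def by simp_all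
  note inL = adapted_in[OF a]
  then have inLam: "u \<in> \<Lambda>" "v \<in> \<Lambda>" "y \<in> \<Lambda>" "z \<in> \<Lambda>" by blast+
  have \<xi>L: "\<xi> \<in> \<Lambda>" unfolding \<xi>_def by (intro Lambda_diff Lambda_scale inLam)
  have ex: "E y \<xi> = real d" "E z \<xi> = 0" "E u \<xi> = 0" unfolding \<xi>_def E_bilinear e by simp_all
  have sw: "E u y = 0" "E z y = 0" "E u z = - 1" using e E_swap[of y u] E_swap[of y z] E_swap[of z u] by linarith+
  have divide: "\<exists>m n k l. w = zcomb u v y z m n k l" if "w \<in> W" "w \<in> \<Lambda>" for w
    using a that unfolding adapted_def by blast
  have in_W: "u \<in> W" "v \<in> W" "y \<in> W" "z \<in> W" using inL by blast+
  have \<xi>W: "\<xi> \<in> W" unfolding \<xi>_def using in_W by auto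
  have quot: "x \<in> W" if "of_int e *\<^sub>R x \<in> W" "e \<noteq> 0" for e :: int and x
    using W_scaleR[OF that(1), of "1 / of_int e"] that(2) by simp
  \<comment> \<open>\<open>y\<close> is primitive, so it pairs to \<open>1\<close> with a lattice vector orthogonal to \<open>z\<close> and \<open>u\<close>.\<close>
  have "y \<noteq> 0" using e(4) d_pos by auto
  then obtain e0 :: int and P0 q0 where P0: "P0 \<in> \<Lambda>" "q0 \<in> \<Lambda>" "e0 > 0" "y = of_int e0 *\<^sub>R P0" "E P0 q0 = 1"
    using Lambda_primitive[OF inLam(3)] by blast
  have "e0 = 1"
  proof -
    have "P0 \<in> W" using quot[of e0 P0] P0(3,4) in_W(3) by simp
    then obtain m n k l where "P0 = zcomb u v y z m n k l" using divide P0(1) by blast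
    then have "zcomb u v y z 0 0 1 0 = zcomb u v y z (e0 * m) (e0 * n) (e0 * k) (e0 * l)"
      using P0(4) unfolding zcomb_basis zcomb_scale[symmetric] by simp
    then have "1 = e0 * k" using adapted_inject[OF a] by blast
    then show ?thesis using P0(3) by (metis pos_zmult_eq_1_iff)
  qed
  then have yq: "E y q0 = 1" using P0 by simp
  obtain k1 l1 :: int where kl1: "E z (q0 + of_int k1 *\<^sub>R z + of_int l1 *\<^sub>R u) = 0" "E u (q0 + of_int k1 *\<^sub>R z + of_int l1 *\<^sub>R u) = 0"
    using plane_projection[OF inLam(4,1) e(5) P0(2)] by blast
  define g where "g = q0 + of_int k1 *\<^sub>R z + of_int l1 *\<^sub>R u"
  have g: "g \<in> \<Lambda>" "E z g = 0" "E u g = 0" "E y g = 1"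
    using kl1 unfolding g_def by (simp_all add: Lambda_add Lambda_scale P0(2) inLam E_bilinear yq e)
  have gs: "E g z = 0" "E g u = 0" "E g y = - 1" using g E_swap[of z g] E_swap[of u g] E_swap[of y g] by linarith+
  have project: "\<exists>x'\<in>\<Lambda>. E z x' = 0 \<and> E u x' = 0 \<and> E y x' = 0 \<and> E g x' = 0 \<and>
      (\<exists>k l m n :: int. x' = x + of_int k *\<^sub>R z + of_int l *\<^sub>R u + of_int m *\<^sub>R y + of_int n *\<^sub>R g)" if x: "x \<in> \<Lambda>" for x
  proof -
    obtain k l :: int where kl: "E z (x + of_int k *\<^sub>R z + of_int l *\<^sub>R u) = 0" "E u (x + of_int k *\<^sub>R z + of_int l *\<^sub>R u) = 0"
      using plane_projection[OF inLam(4,1) e(5) x] by blast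
    define x1 where "x1 = x + of_int k *\<^sub>R z + of_int l *\<^sub>R u"
    have x1: "x1 \<in> \<Lambda>" unfolding x1_def by (intro Lambda_add Lambda_scale x inLam)
    obtain m n :: int where mn: "E y (x1 + of_int m *\<^sub>R y + of_int n *\<^sub>R g) = 0" "E g (x1 + of_int m *\<^sub>R y + of_int n *\<^sub>R g) = 0"
      using plane_projection[OF inLam(3) g(1,4) x1] by blast
    have "E z (x1 + of_int m *\<^sub>R y + of_int n *\<^sub>R g) = 0" "E u (x1 + of_int m *\<^sub>R y + of_int n *\<^sub>R g) = 0"
      using kl unfolding x1_def[symmetric] by (simp_all add: E_bilinear sw g)
    moreover have "x1 + of_int m *\<^sub>R y + of_int n *\<^sub>R g \<in> \<Lambda>" by (intro Lambda_add Lambda_scale x1 inLam g)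
    ultimately show ?thesis using mn x1_def by blast
  qed
  obtain k :: int where k: "E \<xi> g = of_int k" using Lambda_E_int \<xi>L g(1) by blast
  \<comment> \<open>The component of \<open>\<xi>\<close> in the orthogonal complement of the planes \<open>(z, u)\<close> and \<open>(y, g)\<close>.\<close>
  define R where "R = \<xi> - real d *\<^sub>R g - of_int k *\<^sub>R y"
  have RL: "R \<in> \<Lambda>"
    unfolding R_def using Lambda_diff[OF Lambda_diff[OF \<xi>L Lambda_scale[OF g(1), of "int d"]] Lambda_scale[OF inLam(3), of k]] by simp
  have R0: "E z R = 0" "E u R = 0" "E y R = 0" "E g R = 0"
    unfolding R_def E_bilinear using ex g gs sw k E_swap[of \<xi> g] by simp_all
  have "\<exists>e::int. \<exists>P\<in>\<Lambda>. \<exists>Q\<in>\<Lambda>. R = of_int e *\<^sub>R P \<and> E P Q = 1 \<and> E z P = 0 \<and> E u P = 0 \<and> E y P = 0 \<and> E g P = 0"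
  proof (cases "R = 0")
    case False
    then obtain e :: int and P Q where P: "P \<in> \<Lambda>" "Q \<in> \<Lambda>" "e > 0" "R = of_int e *\<^sub>R P" "E P Q = 1"
      using Lambda_primitive[OF RL] by blast
    then have "E z P = 0 \<and> E u P = 0 \<and> E y P = 0 \<and> E g P = 0" using R0 by (simp add: E_bilinear)
    then show ?thesis using P by blast
  next
    case True
    have gW: "g \<in> W"
    proof (rule quot[of "int d"])
      have "of_int (int d) *\<^sub>R g = \<xi> - of_int k *\<^sub>R y" using True unfolding R_def by (simp add: algebra_simps)
      then show "of_int (int d) *\<^sub>R g \<in> W" using \<xi>W in_W by simp
    qed (use d_pos in simp)
    \<comment> \<open>Now \<open>P\<close> may be any primitive vector of the orthogonal complement, which is nonzero as \<open>\<Lambda>\<close> is not contained in \<open>W\<close>.\<close>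
    obtain x where x: "x \<in> \<Lambda>" "x \<notin> W" using Lambda_not_in_W by blast
    obtain x' and k l m n :: int where x': "x' \<in> \<Lambda>" "E z x' = 0" "E u x' = 0" "E y x' = 0" "E g x' = 0"
      "x' = x + of_int k *\<^sub>R z + of_int l *\<^sub>R u + of_int m *\<^sub>R y + of_int n *\<^sub>R g"
      using project[OF x(1)] by blast
    have "x = x' - (of_int k *\<^sub>R z + of_int l *\<^sub>R u + of_int m *\<^sub>R y + of_int n *\<^sub>R g)" using x'(6) by simp
    then have "x' \<notin> W" using x(2) in_W gW by auto
    then have "x' \<noteq> 0" by auto
    then obtain e :: int and P Q where P: "P \<in> \<Lambda>" "Q \<in> \<Lambda>" "e > 0" "x' = of_int e *\<^sub>R P" "E P Q = 1"
      using Lambda_primitive[OF x'(1)] by blast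
    then have "E z P = 0 \<and> E u P = 0 \<and> E y P = 0 \<and> E g P = 0" using x' by (simp add: E_bilinear)
    then show ?thesis using P True by (intro exI[of _ 0] bexI[of _ P] bexI[of _ Q]) simp_all
  qed
  then obtain e' :: int and P q1 where P: "P \<in> \<Lambda>" "q1 \<in> \<Lambda>" "R = of_int e' *\<^sub>R P" "E P q1 = 1"
    "E z P = 0" "E u P = 0" "E y P = 0" "E g P = 0" by blast
  have Ps: "E P z = 0" "E P u = 0" "E P y = 0" "E P g = 0"
    using P E_swap[of z P] E_swap[of u P] E_swap[of y P] E_swap[of g P] by linarith+
  obtain q and k' l' m' n' :: int where q': "q \<in> \<Lambda>" "E z q = 0" "E u q = 0" "E y q = 0" "E g q = 0"
    "q = q1 + of_int k' *\<^sub>R z + of_int l' *\<^sub>R u + of_int m' *\<^sub>R y + of_int n' *\<^sub>R g"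
    using project[OF P(2)] by blast
  have Pq: "E P q = 1" unfolding q'(6) by (simp add: E_bilinear P Ps)
  have qs: "E q z = 0" "E q u = 0" "E q y = 0" "E q g = 0" "E q P = - 1"
    using q' Pq E_swap[of z q] E_swap[of u q] E_swap[of y q] E_swap[of g q] E_swap[of P q] by linarith+
  have \<xi>_eq: "\<xi> = real d *\<^sub>R g + of_int k *\<^sub>R y + of_int e' *\<^sub>R P" using P(3) unfolding R_def by (simp add: algebra_simps)
  \<comment> \<open>A common divisor of \<open>d\<close> and \<open>e'\<close> would divide \<open>\<xi>\<close> modulo \<open>y\<close>.\<close>
  have "gcd (int d) e' = 1"
  proof -
    define l where "l = gcd (int d) e'"
    have l0: "l > 0" unfolding l_def using d_pos by simp
    obtain d' e'' where de: "int d = l * d'" "e' = l * e''" unfolding l_def by (meson dvdE gcd_dvd1 gcd_dvd2)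
    define w where "w = of_int d' *\<^sub>R g + of_int e'' *\<^sub>R P"
    have wL: "w \<in> \<Lambda>" unfolding w_def by (intro Lambda_add Lambda_scale g P)
    have dl: "real d = of_int l * of_int d'" using de(1) by (metis of_int_mult of_int_of_nat_eq)
    have lw: "of_int l *\<^sub>R w = \<xi> - of_int k *\<^sub>R y" unfolding \<xi>_eq w_def dl de(2) by (simp add: algebra_simps)
    have "w \<in> W" by (rule quot[of l]) (use lw \<xi>W in_W l0 in simp_all)
    then obtain m n k2 l2 where "w = zcomb u v y z m n k2 l2" using divide wL by blast
    moreover have "\<xi> - of_int k *\<^sub>R y = zcomb u v y z (- (int D + c)) 1 (- k) 0" unfolding \<xi>_def zcomb_def by (simp add: algebra_simps)
    ultimately have "zcomb u v y z (- (int D + c)) 1 (- k) 0 = zcomb u v y z (l * m) (l * n) (l * k2) (l * l2)"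
      using lw unfolding zcomb_scale[symmetric] by simp
    then have "1 = l * n" using adapted_inject[OF a] by blast
    then show ?thesis using l0 unfolding l_def[symmetric] by (metis pos_zmult_eq_1_iff)
  qed
  then obtain s t where st: "s * int d + t * e' = 1" using bezout_int[of "int d" e'] by auto
  \<comment> \<open>\<open>Y\<close> is a solution of the congruences \<open>e' Y = -k (mod d)\<close> and \<open>Y = 1 (mod e')\<close>.\<close>
  define Y where "Y = 1 - e' * (t + k * t * t)"
  define X where "X = e' * s + 2 * k * s - k * s * s * int d"
  have te: "t * e' = 1 - s * int d" using st by simp
  have dX: "int d * X = k + e' * Y"
  proof -
    have "e' * Y = e' - e' * (t * e') - k * (t * e') * (t * e')" unfolding Y_def by (simp add: algebra_simps)
    then show ?thesis unfolding te X_def by (simp add: algebra_simps)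
  qed
  define \<beta> where "\<beta> = t + (t + k * t * t) - t * e' * (t + k * t * t)"
  have ab: "s * (int d * Y) + \<beta> * e' = 1"
  proof -
    have "s * (int d * Y) = (s * int d) * Y" by simp
    also have "s * int d = 1 - t * e'" using st by simp
    finally show ?thesis unfolding Y_def \<beta>_def by (simp add: algebra_simps)
  qed
  define N2 where "N2 = g + of_int X *\<^sub>R y + of_int Y *\<^sub>R q"
  define N3 where "N3 = real d *\<^sub>R N2 - \<xi>"
  define M3 where "M3 = of_int s *\<^sub>R P + of_int \<beta> *\<^sub>R q + of_int (- (s * Y)) *\<^sub>R y"
  have inL3: "N2 \<in> \<Lambda>" "M3 \<in> \<Lambda>" unfolding N2_def M3_def by (intro Lambda_add Lambda_scale g inLam q'(1) P)+
  have N3L: "N3 \<in> \<Lambda>" unfolding N3_def using Lambda_diff[OF Lambda_scale[OF inL3(1), of "int d"] \<xi>L] by simp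
  have dXr: "real d * of_int X = of_int k + of_int e' * of_int Y"
    using arg_cong[OF dX, of real_of_int] by simp
  have N3_eq: "N3 = of_int (e' * Y) *\<^sub>R y + of_int (int d * Y) *\<^sub>R q - of_int e' *\<^sub>R P"
  proof -
    have "N3 = (real d * of_int X - of_int k) *\<^sub>R y + of_int (int d * Y) *\<^sub>R q - of_int e' *\<^sub>R P"
      unfolding N3_def N2_def \<xi>_eq by (simp add: algebra_simps)
    then show ?thesis unfolding dXr by simp
  qed
  have r1: "E z N2 = 0" "E u N2 = 0" "E y N2 = 1" unfolding N2_def by (simp_all add: E_bilinear g q'(2-5) sw)
  have r2: "E N2 N3 = 0" unfolding N3_eq N2_def
    by (simp add: E_bilinear g gs q'(2-5) qs Ps P(5-8) sw)
  have r3: "E M3 z = 0" "E M3 u = 0" "E M3 y = 0" unfolding M3_def by (simp_all add: E_bilinear Ps qs e)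
  have r4: "E M3 N2 = 0" unfolding M3_def N2_def by (simp add: E_bilinear Ps qs e g q'(2-5) Pq)
  have "E M3 N3 = of_int (s * (int d * Y) + \<beta> * e')"
    unfolding M3_def N3_eq by (simp add: E_bilinear Ps qs e g q'(2-5) P(5-8) Pq algebra_simps)
  then have r5: "E M3 N3 = 1" unfolding ab by simp
  show ?thesis
    using inL3 N3L r1 r2 r3 r4 r5 N3_def by blast
qed

end

context positive_hermitian begin

lemma orthogonal_independent:
  assumes "\<And>x y. x \<in> B \<Longrightarrow> y \<in> B \<Longrightarrow> x \<noteq> y \<Longrightarrow> H x y = 0" "0 \<notin> B"
  shows "vec.independent B"
  unfolding vec.dependent_def
proof
  assume "\<exists>a\<in>B. a \<in> vec.span (B - {a})"
  then obtain a where a: "a \<in> B" "a \<in> vec.span (B - {a})" by blast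
  have "H x a = 0" if "x \<in> vec.span (B - {a})" for x
    using that
  proof (induction rule: vec.span_induct_alt)
    case (step c x y) then show ?case using assms(1)[of x a] a by (simp add: H_add_left H_scale_left)
  qed simp
  then have "H a a = 0" using a by blast
  moreover have "a \<noteq> 0" using a assms(2) by auto
  ultimately show False using H_pos[of a] by simp
qed

end

context positive_hermitian begin

lemma orthogonal_decomposition:
  assumes o: "H u1 u2 = 0" "H u1 u3 = 0" "H u2 u3 = 0" and n: "u1 \<noteq> 0" "u2 \<noteq> 0" "u3 \<noteq> 0"
    and card: "CARD('n) = 3"
  shows "x = (H x u1 / H u1 u1) *s u1 + (H x u2 / H u2 u2) *s u2 + (H x u3 / H u3 u3) *s u3"
proof -
  have o': "H u2 u1 = 0" "H u3 u1 = 0" "H u3 u2 = 0" using o H_cnj[of u2 u1] H_cnj[of u3 u1] H_cnj[of u3 u2] by simp_all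
  have nz: "H u1 u1 \<noteq> 0" "H u2 u2 \<noteq> 0" "H u3 u3 \<noteq> 0" using H_pos[OF n(1)] H_pos[OF n(2)] H_pos[OF n(3)] by auto
  have d: "u1 \<noteq> u2" "u1 \<noteq> u3" "u2 \<noteq> u3" using o nz by auto
  have "vec.independent {u1, u2, u3}"
    by (rule orthogonal_independent) (use o o' n in auto)
  moreover have "card {u1, u2, u3} = 3" using d by simp
  ultimately have span: "UNIV \<subseteq> vec.span {u1, u2, u3}"
    by (intro vec.card_ge_dim_independent) (simp_all add: vec_dim_card card del: vec.dim_UNIV)
  define r where "r = x - ((H x u1 / H u1 u1) *s u1 + (H x u2 / H u2 u2) *s u2 + (H x u3 / H u3 u3) *s u3)"
  have r: "H r u1 = 0" "H r u2 = 0" "H r u3 = 0"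
    unfolding r_def by (simp_all add: H_diff_left H_add_left H_scale_left o o' nz)
  have "H r y = 0" if "y \<in> vec.span {u1, u2, u3}" for y
    using that
  proof (induction rule: vec.span_induct_alt)
    case (step c a b) then show ?case using r by (auto simp: H_add_right H_scale_right)
  qed simp
  then have "H r r = 0" using span by blast
  then have "r = 0" using H_pos[of r] by auto
  then show ?thesis unfolding r_def by simp
qed

end

context rm_object begin

text \<open>The lattice \<open>W \<inter> \<Lambda>\<close> spans \<open>W\<close> over the reals, and \<open>E\<close> determines \<open>H\<close>.\<close>

lemma E_of_W_zero:
  assumes a: "adapted c u v y z" and q: "E q u = 0" "E q v = 0" "E q y = 0" "E q z = 0" and w: "w \<in> W"
  shows "H q w = 0"
proof -
  have "E q x = 0" if "x \<in> W \<inter> \<Lambda>" for x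
  proof -
    obtain m n k l where "x = zcomb u v y z m n k l" using \<open>x \<in> W \<inter> \<Lambda>\<close> a unfolding adapted_def by blast
    then show ?thesis unfolding zcomb_def by (simp add: E_bilinear q)
  qed
  moreover have "span (W \<inter> \<Lambda>) = W" using W_torus unfolding complex_torus_def by (intro lattice_span) simp
  ultimately have EW: "E q x = 0" if "x \<in> W" for x using E_zero_span[of "W \<inter> \<Lambda>" q x] that by simp
  have "Im (H q w) = 0" using EW[OF w] unfolding E_def .
  moreover have "Re (H q w) = 0" using EW[OF W_smult[OF w, of \<i>]] unfolding E_def H_scale_right by simp
  ultimately show ?thesis by (simp add: complex_eq_iff)
qed

text \<open>The two eigenlines of \<open>\<gamma>\<close> in \<open>W\<close> are orthogonal because \<open>\<gamma>\<close> is self-adjoint. They contain the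
  components \<open>u\<^sub>1\<close> and \<open>u\<^sub>2\<close> of \<open>u\<close>, and \<open>u\<^sub>3 = N3\<close> spans the orthogonal complement of \<open>W\<close>. In this
  orthogonal basis of \<open>\<complex>\<^sup>3\<close> the symplectic basis of \<open>\<Lambda>\<close> has the coordinates of the family, where \<open>\<tau>\<^sub>1\<close>
  and \<open>\<tau>\<^sub>2\<close> are up to real factors the ratios of the components of \<open>y\<close> and \<open>u\<close>, and \<open>\<tau>\<^sub>3\<close> is that of
  \<open>M3 + y / d\<close> and \<open>N3\<close>. Each imaginary part is the inverse of the value of \<open>H\<close> on a basis vector and hence
  positive.\<close>

lemma family_isomorphic:
  assumes a: "adapted c u v y z" and dc: "int d dvd genpoly c"
  shows "\<exists>\<tau>. (\<forall>k. Im (\<tau> $ k) > 0) \<and>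
    rm_isomorphic D (range (period_vec (rm_family_data.period_matrix D d c \<tau>)),
        siegel_form (rm_family_data.period_matrix D d c \<tau>), rm_family_data.W0 D d c, rm_family_data.rho0 D d c)
      (\<Lambda>, H, W, \<rho>)"
proof -
  interpret F: rm_family_data D d c by unfold_locales (rule d_pos, rule dc)
  define \<xi> where "\<xi> = v - of_int (int D + c) *\<^sub>R u"
  obtain N2 M3 N3 where L3: "N2 \<in> \<Lambda>" "M3 \<in> \<Lambda>" "N3 \<in> \<Lambda>" and N3: "N3 = real d *\<^sub>R N2 - \<xi>"
    and s: "E z N2 = 0" "E u N2 = 0" "E y N2 = 1" "E N2 N3 = 0"
      "E M3 z = 0" "E M3 u = 0" "E M3 y = 0" "E M3 N2 = 0" "E M3 N3 = 1"
    using symplectic_extension[OF a] unfolding \<xi>_def by blast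
  have e: "E u v = 0" "E y z = 0" "E y u = 0" "E y v = real d" "E z u = 1" "E z v = of_int (int D + c)"
    and Gu: "G u = v" and Gy: "G y = real d *\<^sub>R z - of_int c *\<^sub>R y"
    using a unfolding adapted_def by simp_all
  have inL: "u \<in> \<Lambda>" "v \<in> \<Lambda>" "y \<in> \<Lambda>" "z \<in> \<Lambda>" and inW: "u \<in> W" "v \<in> W" "y \<in> W" "z \<in> W"
    using adapted_in[OF a] by blast+
  have ex: "E y \<xi> = real d" "E z \<xi> = 0" "E u \<xi> = 0" unfolding \<xi>_def E_bilinear e by simp_all
  have v_eq: "v = \<xi> + of_int (int D + c) *\<^sub>R u" unfolding \<xi>_def by simp
  let ?r = rootD and ?g = gen and ?g' = F.gen'
  have r0: "?r \<noteq> 0" using rootD_pos by simp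
  have nrm: "real_of_int gnorm = ?g * ?g'" using gen_sq unfolding F.gen'_def by (simp add: algebra_simps)
  have gg: "real D = ?g + ?g'" "?g - ?g' = ?r" using F.gen_gen' by simp_all
  \<comment> \<open>The eigencomponents of a vector of \<open>W\<close>.\<close>
  define p1 where "p1 x = (1 / ?r) *\<^sub>R (G x - ?g' *\<^sub>R x)" for x
  define p2 where "p2 x = (1 / ?r) *\<^sub>R (?g *\<^sub>R x - G x)" for x
  have pW: "p1 x \<in> W" "p2 x \<in> W" if "x \<in> W" for x unfolding p1_def p2_def using that by auto
  have p_sum: "x = p1 x + p2 x" for x
  proof -
    have "p1 x + p2 x = (1 / ?r) *\<^sub>R ((?g - ?g') *\<^sub>R x)" unfolding p1_def p2_def by (simp add: algebra_simps)
    then show ?thesis unfolding gg(2) using r0 by simp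
  qed
  have Gp: "G (p1 x) = ?g *\<^sub>R p1 x" "G (p2 x) = ?g' *\<^sub>R p2 x" if x: "x \<in> W" for x
  proof -
    have G1: "G (G x - t *\<^sub>R x) = (real D - t) *\<^sub>R G x - (?g * ?g') *\<^sub>R x" for t
    proof -
      have "G (G x + (- t) *\<^sub>R x) = G (G x) + (- t) *\<^sub>R G x" using rho_lin[of gen "G x" "(- t) *\<^sub>R x"] rho_scaleR[of gen x "- t"] x by simp
      then show ?thesis unfolding G_sq[OF x] nrm by (simp add: algebra_simps)
    qed
    have "G (p1 x) = (1 / ?r) *\<^sub>R G (G x - ?g' *\<^sub>R x)" unfolding p1_def using rho_scaleR[of gen "G x - ?g' *\<^sub>R x" "1 / ?r"] x by simp
    then show "G (p1 x) = ?g *\<^sub>R p1 x" unfolding G1 p1_def gg by (simp add: algebra_simps)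
    have "p2 x = (- 1 / ?r) *\<^sub>R (G x - ?g *\<^sub>R x)" unfolding p2_def by (simp add: algebra_simps)
    then have "G (p2 x) = (- 1 / ?r) *\<^sub>R G (G x - ?g *\<^sub>R x)" using rho_scaleR[of gen "G x - ?g *\<^sub>R x" "- 1 / ?r"] x by simp
    then show "G (p2 x) = ?g' *\<^sub>R p2 x" unfolding G1 p2_def gg by (simp add: algebra_simps)
  qed
  have orth: "H (p1 x) (p2 w) = 0" "H (p2 w) (p1 x) = 0" if xw: "x \<in> W" "w \<in> W" for x w
  proof -
    have "H (G (p1 x)) (p2 w) = H (p1 x) (G (p2 w))" using rho_adj[of gen "p1 x" "p2 w"] pW xw by simp
    then have "of_real (?g - ?g') * H (p1 x) (p2 w) = 0"
      unfolding Gp(1)[OF xw(1)] Gp(2)[OF xw(2)] H_scaleR_left H_scaleR_right by (simp add: algebra_simps)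
    then show z: "H (p1 x) (p2 w) = 0" unfolding gg(2) using r0 by simp
    show "H (p2 w) (p1 x) = 0" using H_cnj[of "p2 w" "p1 x"] z by simp
  qed
  define u1 u2 y1 y2 where "u1 = p1 u" and "u2 = p2 u" and "y1 = p1 y" and "y2 = p2 y"
  have us: "u = u1 + u2" "y = y1 + y2" unfolding u1_def u2_def y1_def y2_def by (rule p_sum)+
  have uW: "u1 \<in> W" "u2 \<in> W" "y1 \<in> W" "y2 \<in> W" unfolding u1_def u2_def y1_def y2_def using pW inW by blast+
  have Gu12: "G u1 = ?g *\<^sub>R u1" "G u2 = ?g' *\<^sub>R u2" "G y1 = ?g *\<^sub>R y1" "G y2 = ?g' *\<^sub>R y2"
    unfolding u1_def u2_def y1_def y2_def using Gp inW by blast+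
  have ho: "H u1 u2 = 0" "H y1 u2 = 0" "H y2 u1 = 0"
    unfolding u1_def u2_def y1_def y2_def using orth inW by blast+
  then have Eo: "E y1 u2 = 0" "E y2 u1 = 0" unfolding E_def by simp_all
  have v12: "v = ?g *\<^sub>R u1 + ?g' *\<^sub>R u2" using Gu rho_lin[of gen u1 u2] uW Gu12 us by simp
  have E1: "E y1 u1 + E y2 u2 = 0" using e(3) unfolding us E_bilinear Eo by simp
  have E2: "?g * E y1 u1 + ?g' * E y2 u2 = real d" using e(4) unfolding us v12 E_bilinear Eo by (simp add: algebra_simps)
  have "(?g - ?g') * E y1 u1 = real d"
  proof -
    have "E y2 u2 = - E y1 u1" using E1 by linarith
    then show ?thesis using E2 by (simp add: algebra_simps)
  qed
  then have Ey1: "E y1 u1 = real d / ?r" unfolding gg(2) using r0 by (simp add: field_simps)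
  then have Ey2: "E y2 u2 = - (real d / ?r)" using E1 by linarith
  have dr: "real d / ?r \<noteq> 0" using d_pos r0 by simp
  have n12: "u1 \<noteq> 0" "u2 \<noteq> 0" using Ey1 Ey2 dr by auto
  \<comment> \<open>\<open>N3\<close> and \<open>M3 + y / d\<close> are orthogonal to \<open>W\<close>.\<close>
  have EyN3: "E y N3 = 0" unfolding N3 by (simp add: E_bilinear s ex)
  have N3u: "E N3 u = 0" "E N3 y = 0" "E N3 z = 0"
    using EyN3 E_swap[of y N3] E_swap[of u N3] E_swap[of z N3] unfolding N3 by (simp_all add: E_bilinear s ex)
  have "E N2 \<xi> = 0" using s(4) d_pos unfolding N3 by (simp add: E_bilinear)
  then have N3x: "E N3 \<xi> = 0" unfolding N3 by (simp add: E_bilinear)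
  then have "E N3 v = 0" unfolding v_eq by (simp add: E_bilinear N3u)
  then have N3W: "H N3 w = 0" if "w \<in> W" for w using E_of_W_zero[OF a N3u(1) _ N3u(2,3) that] by simp
  have N30: "N3 \<noteq> 0" using s(9) by auto
  define u3 where "u3 = N3"
  have h3: "H u1 u3 = 0" "H u2 u3 = 0" "H y1 u3 = 0" "H y2 u3 = 0"
    unfolding u3_def using N3W uW H_cnj[of _ N3] by simp_all
  note dec = orthogonal_decomposition[OF ho(1) h3(1,2) n12 N30[folded u3_def], simplified]
  define M3' where "M3' = M3 + (1 / real d) *\<^sub>R y"
  have M3\<xi>: "E M3 \<xi> = - 1"
  proof -
    have "\<xi> = real d *\<^sub>R N2 - N3" using N3 by simp
    then show ?thesis by (simp add: E_bilinear s)
  qed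
  have "E M3' u = 0" "E M3' y = 0" "E M3' z = 0" unfolding M3'_def by (simp_all add: E_bilinear s e)
  moreover have "E M3' v = 0" unfolding M3'_def v_eq using d_pos by (simp add: E_bilinear s e ex M3\<xi>)
  ultimately have M3W: "H M3' w = 0" if "w \<in> W" for w using E_of_W_zero[OF a, of M3'] that by simp
  define k1 k2 k3 where "k1 = H y1 u1 / H u1 u1" and "k2 = H y2 u2 / H u2 u2" and "k3 = H M3' u3 / H u3 u3"
  have y1_eq: "y1 = k1 *s u1" using dec[of y1] unfolding k1_def ho h3 by simp
  have y2_eq: "y2 = k2 *s u2" using dec[of y2] unfolding k2_def ho h3 by simp
  have M3_eq: "M3' = k3 *s u3" using dec[of M3'] unfolding k3_def M3W[OF uW(1)] M3W[OF uW(2)] by simp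
  define h1 h2 h3' where "h1 = Re (H u1 u1)" and "h2 = Re (H u2 u2)" and "h3' = Re (H u3 u3)"
  have hp: "h1 > 0" "h2 > 0" "h3' > 0" unfolding h1_def h2_def h3'_def using H_pos n12 N30 unfolding u3_def by blast+
  have hh: "H u1 u1 = of_real h1" "H u2 u2 = of_real h2" "H u3 u3 = of_real h3'"
    unfolding h1_def h2_def h3'_def by (rule H_real)+
  have I1: "Im k1 * h1 = real d / ?r" using Ey1 unfolding y1_eq E_def H_scale_left hh by simp
  have I2: "Im k2 * h2 = - (real d / ?r)" using Ey2 unfolding y2_eq E_def H_scale_left hh by simp
  have I3: "Im k3 * h3' = 1"
  proof -
    have "E M3' u3 = 1" unfolding M3'_def u3_def by (simp add: E_bilinear s EyN3)
    then show ?thesis unfolding M3_eq E_def H_scale_left hh by simp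
  qed
  define \<tau> :: "complex^3" where "\<tau> = vector [k1 * of_real (?r / real d), k2 * of_real (- (?r / real d)), k3]"
  have t: "\<tau> $ 1 = k1 * of_real (?r / real d)" "\<tau> $ 2 = k2 * of_real (- (?r / real d))" "\<tau> $ 3 = k3" unfolding \<tau>_def by simp_all
  have J: "Im (\<tau> $ 1) * h1 = 1" "Im (\<tau> $ 2) * h2 = 1" "Im (\<tau> $ 3) * h3' = 1"
  proof -
    have "Im (\<tau> $ 1) * h1 = (Im k1 * h1) * (?r / real d)" unfolding t by simp
    then show "Im (\<tau> $ 1) * h1 = 1" unfolding I1 using dr by simp
    have "Im (\<tau> $ 2) * h2 = - ((Im k2 * h2) * (?r / real d))" unfolding t by simp
    then show "Im (\<tau> $ 2) * h2 = 1" unfolding I2 using dr by simp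
    show "Im (\<tau> $ 3) * h3' = 1" unfolding t using I3 .
  qed
  have tpos: "Im (\<tau> $ k) > 0" for k
  proof -
    have "t > 0" if "t * h = 1" "h > 0" for t h :: real using that by (metis zero_less_mult_pos2 zero_less_one)
    then have "Im (\<tau> $ 1) > 0" "Im (\<tau> $ 2) > 0" "Im (\<tau> $ 3) > 0" using J hp by blast+
    then show ?thesis using exhaust_3[of k] by auto
  qed
  interpret T: rm_family D d c \<tau> by unfold_locales (rule tpos)
  have tk: "k1 = \<tau> $ 1 * of_real (real d / ?r)" "k2 = \<tau> $ 2 * of_real (- (real d / ?r))"
    unfolding t using r0 d_pos by simp_all
  define f0 where "f0 w = w $ 1 *s u1 + w $ 2 *s u2 + w $ 3 *s u3" for w :: "complex^3"
  have f0_add: "f0 (w + w') = f0 w + f0 w'" for w w'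
    unfolding f0_def by (simp add: vec.scale_left_distrib algebra_simps)
  have f0_smult: "f0 (k *s w) = k *s f0 w" for k w
    unfolding f0_def by (simp add: vec.scale_right_distrib)
  have f0_scaleR: "f0 (k *\<^sub>R w) = k *\<^sub>R f0 w" for k w
    unfolding of_real_smult[symmetric] by (rule f0_smult)
  \<comment> \<open>Coordinates of the symplectic basis with respect to the orthogonal basis \<open>u1, u2, u3\<close>.\<close>
  have c_u: "u = f0 (vector [1, 1, 0])" unfolding f0_def us by simp
  have c_y: "y = f0 (vector [\<tau> $ 1 * of_real (real d / ?r), \<tau> $ 2 * of_real (- (real d / ?r)), 0])"
    unfolding f0_def vector_3 tk[symmetric] us y1_eq y2_eq by simp
  have c_z: "z = f0 (vector [\<tau> $ 1 * of_real ((?g + of_int c) / ?r), \<tau> $ 2 * of_real (- ((?g' + of_int c) / ?r)), 0])"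
  proof -
    have "real d *\<^sub>R z = G y + of_int c *\<^sub>R y" using Gy by simp
    also have "\<dots> = (?g + of_int c) *\<^sub>R y1 + (?g' + of_int c) *\<^sub>R y2"
      using rho_lin[of gen y1 y2] uW Gu12 us by (simp add: algebra_simps)
    finally have "z = (1 / real d) *\<^sub>R ((?g + of_int c) *\<^sub>R y1 + (?g' + of_int c) *\<^sub>R y2)"
      using d_pos by (metis inverse_eq_divide left_inverse of_nat_0_less_iff order_less_irrefl scaleR_one scaleR_scaleR)
    also have "\<dots> = ((?g + of_int c) / real d) *\<^sub>R (k1 *s u1) + ((?g' + of_int c) / real d) *\<^sub>R (k2 *s u2)"
      unfolding y1_eq y2_eq by (simp add: scaleR_add_right)
    also have "\<dots> = (of_real ((?g + of_int c) / real d) * k1) *s u1 + (of_real ((?g' + of_int c) / real d) * k2) *s u2"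
      unfolding of_real_smult[symmetric] by (simp only: vec.scale_scale)
    also have "of_real ((?g + of_int c) / real d) * k1 = \<tau> $ 1 * of_real ((?g + of_int c) / ?r)"
      unfolding tk using d_pos by simp
    also have "of_real ((?g' + of_int c) / real d) * k2 = \<tau> $ 2 * of_real (- ((?g' + of_int c) / ?r))"
      unfolding tk using d_pos by simp
    finally show ?thesis unfolding f0_def by simp
  qed
  have c_N3: "N3 = f0 (vector [0, 0, 1])" unfolding f0_def u3_def by simp
  have c_M3: "M3 = f0 (vector [\<tau> $ 1 * of_real (- (1 / ?r)), \<tau> $ 2 * of_real (1 / ?r), \<tau> $ 3])"
  proof -
    have "M3 = k3 *s u3 + (- (1 / real d)) *\<^sub>R y" using M3_eq unfolding M3'_def by (simp add: algebra_simps)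
    also have "\<dots> = f0 (vector [0, 0, k3]) + f0 ((- (1 / real d)) *\<^sub>R vector [\<tau> $ 1 * of_real (real d / ?r), \<tau> $ 2 * of_real (- (real d / ?r)), 0])"
      unfolding f0_scaleR c_y[symmetric] unfolding f0_def by simp
    also have "\<dots> = f0 (vector [\<tau> $ 1 * of_real (- (1 / ?r)), \<tau> $ 2 * of_real (1 / ?r), \<tau> $ 3])"
      unfolding f0_add[symmetric] using d_pos
      by (intro arg_cong[where f = f0]) (simp add: vec_eq_iff forall_3 t(3) scaleR_conv_of_real[where 'a = complex])
    finally show ?thesis .
  qed
  have c_N2: "N2 = f0 (vector [of_real ((?g - real D - of_int c) / real d), of_real ((?g' - real D - of_int c) / real d), of_real (1 / real d)])"
  proof -
    have x: "\<xi> = f0 (vector [of_real (?g - real D - of_int c), of_real (?g' - real D - of_int c), 0])"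
    proof -
      have "\<xi> = (?g - real D - of_int c) *\<^sub>R u1 + (?g' - real D - of_int c) *\<^sub>R u2"
        unfolding \<xi>_def v12 us by (simp add: algebra_simps)
      then show ?thesis unfolding f0_def of_real_smult[symmetric] by simp
    qed
    have "real d *\<^sub>R N2 = N3 + \<xi>" using N3 by simp
    then have "N2 = (1 / real d) *\<^sub>R (N3 + \<xi>)"
      using d_pos by (metis inverse_eq_divide left_inverse of_nat_0_less_iff order_less_irrefl scaleR_one scaleR_scaleR)
    also have "\<dots> = f0 ((1 / real d) *\<^sub>R (vector [0, 0, 1] + vector [of_real (?g - real D - of_int c), of_real (?g' - real D - of_int c), 0]))"
      unfolding f0_scaleR f0_add x[symmetric] c_N3[symmetric] ..
    also have "\<dots> = f0 (vector [of_real ((?g - real D - of_int c) / real d), of_real ((?g' - real D - of_int c) / real d), of_real (1 / real d)])"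
      by (intro arg_cong[where f = f0]) (simp add: vec_eq_iff forall_3 scaleR_conv_of_real[where 'a = complex])
    finally show ?thesis .
  qed
  let ?Z = "F.period_matrix \<tau>"
  define f where "f x = f0 (F.Q x)" for x
  define six where "six x1 x2 x3 n1 n2 n3 = of_int x1 *\<^sub>R z + of_int x2 *\<^sub>R y + of_int x3 *\<^sub>R M3 + of_int n1 *\<^sub>R u + of_int n2 *\<^sub>R N2 + of_int n3 *\<^sub>R N3"
    for x1 x2 x3 n1 n2 n3 :: int
  have f_pv: "f (pv ?Z x1 x2 x3 n1 n2 n3) = six x1 x2 x3 n1 n2 n3" for x1 x2 x3 n1 n2 n3
  proof -
    define zc yc mc uc nc ec :: "complex^3"
      where "zc = vector [\<tau> $ 1 * of_real ((?g + of_int c) / ?r), \<tau> $ 2 * of_real (- ((?g' + of_int c) / ?r)), 0]"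
      and "yc = vector [\<tau> $ 1 * of_real (real d / ?r), \<tau> $ 2 * of_real (- (real d / ?r)), 0]"
      and "mc = vector [\<tau> $ 1 * of_real (- (1 / ?r)), \<tau> $ 2 * of_real (1 / ?r), \<tau> $ 3]"
      and "uc = vector [1, 1, 0]"
      and "nc = vector [of_real ((?g - real D - of_int c) / real d), of_real ((?g' - real D - of_int c) / real d), of_real (1 / real d)]"
      and "ec = vector [0, 0, 1]"
    have "F.Q (pv ?Z x1 x2 x3 n1 n2 n3) = of_int x1 *\<^sub>R zc + of_int x2 *\<^sub>R yc + of_int x3 *\<^sub>R mc + of_int n1 *\<^sub>R uc + of_int n2 *\<^sub>R nc + of_int n3 *\<^sub>R ec"
      unfolding vec_eq_iff forall_3 F.Q_period zc_def yc_def mc_def uc_def nc_def ec_def vector_add_component vector_scaleR_component vector_3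
      by (simp add: scaleR_conv_of_real[where 'a = complex] add_divide_distrib diff_divide_distrib algebra_simps)
    then have "f (pv ?Z x1 x2 x3 n1 n2 n3) = of_int x1 *\<^sub>R f0 zc + of_int x2 *\<^sub>R f0 yc + of_int x3 *\<^sub>R f0 mc + of_int n1 *\<^sub>R f0 uc + of_int n2 *\<^sub>R f0 nc + of_int n3 *\<^sub>R f0 ec"
      unfolding f_def by (simp only: f0_add f0_scaleR)
    then show ?thesis unfolding six_def zc_def yc_def mc_def uc_def nc_def ec_def
        c_z[symmetric] c_y[symmetric] c_M3[symmetric] c_u[symmetric] c_N2[symmetric] c_N3[symmetric] .
  qed
  have six_L: "\<Lambda> = {six x1 x2 x3 n1 n2 n3 | x1 x2 x3 n1 n2 n3. True}"
  proof
    show "{six x1 x2 x3 n1 n2 n3 | x1 x2 x3 n1 n2 n3. True} \<subseteq> \<Lambda>"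
      unfolding six_def using inL L3 by (auto intro!: Lambda_add Lambda_scale)
    have sw: "E u z = - 1" "E N2 y = - 1" "E N3 M3 = - 1" "E u y = 0" "E z y = 0" "E N2 z = 0" "E N2 u = 0"
      "E z M3 = 0" "E u M3 = 0" "E y M3 = 0" "E N2 M3 = 0" "E N3 N2 = 0"
      using e s E_swap[of z u] E_swap[of y N2] E_swap[of M3 N3] E_swap[of y u] E_swap[of y z] E_swap[of z N2] E_swap[of u N2]
        E_swap[of M3 z] E_swap[of M3 u] E_swap[of M3 y] E_swap[of M3 N2] E_swap[of N2 N3] by linarith+
    have sN3: "E z N3 = 0" "E u N3 = 0" using N3u E_swap[of N3 z] E_swap[of N3 u] by linarith+
    note all = e(2,3,5) s sw sN3 N3u EyN3
    define A where "A i = (if i = 0 then z else if i = 1 then y else M3)" for i :: nat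
    define B where "B i = (if i = 0 then u else if i = 1 then N2 else N3)" for i :: nat
    have sum6: "(\<Sum>i<3. real_of_int (m i) *\<^sub>R A i + real_of_int (n i) *\<^sub>R B i) = six (m 0) (m 1) (m (2::nat)) (n 0) (n 1) (n (2::nat))" for m n
      unfolding A_def B_def six_def by (simp add: numeral_3_eq_3 lessThan_Suc numeral_2_eq_2 algebra_simps)
    have AB: "E (A i) (A j) = 0" "E (B i) (B j) = 0" "E (A i) (B j) = (if i = j then 1 else 0)" if "i < 3" "j < 3" for i j
    proof -
      have ij: "i = 0 \<or> i = 1 \<or> i = 2" "j = 0 \<or> j = 1 \<or> j = 2" using that by auto
      then show "E (A i) (A j) = 0" "E (B i) (B j) = 0" "E (A i) (B j) = (if i = j then 1 else 0)"
        unfolding A_def B_def by (elim disjE; simp add: all)+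
    qed
    have "is_lattice UNIV {\<Sum>i<3. real_of_int (m i) *\<^sub>R A i + real_of_int (n i) *\<^sub>R B i | m n. True}"
      by (rule symplectic_is_lattice[where \<delta> = "\<lambda>_. 1"]) (use AB in \<open>simp_all add: vec_dim_card del: vec.dim_UNIV\<close>)
    then have sp: "span {six (m 0) (m 1) (m (2::nat)) (n 0) (n 1) (n (2::nat)) | (m :: nat \<Rightarrow> int) (n :: nat \<Rightarrow> int). True} = UNIV"
      unfolding sum6 by (rule lattice_span)
    show "\<Lambda> \<subseteq> {six x1 x2 x3 n1 n2 n3 | x1 x2 x3 n1 n2 n3. True}"
    proof
      fix x assume x: "x \<in> \<Lambda>"
      obtain x1 x2 x3 n1 n2 n3 :: int where co: "E x u = of_int x1" "E x N2 = of_int x2" "E x N3 = of_int x3"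
        "E x z = of_int n1" "E x y = of_int n2" "E x M3 = of_int n3"
        using Lambda_E_int[OF x] inL L3 by metis
      define x' where "x' = x - six x1 x2 x3 (- n1) (- n2) (- n3)"
      have "E x' u = 0" "E x' N2 = 0" "E x' N3 = 0" "E x' z = 0" "E x' y = 0" "E x' M3 = 0"
        unfolding x'_def six_def by (simp_all add: E_bilinear co all)
      then have "E x' w = 0" if "w \<in> {six (m 0) (m 1) (m (2::nat)) (n 0) (n 1) (n (2::nat)) | (m :: nat \<Rightarrow> int) (n :: nat \<Rightarrow> int). True}" for w
        using that unfolding six_def by (auto simp: E_bilinear)
      then have "E x' w = 0" for w using E_zero_span[of _ x' w] sp by blast
      then have "x' = 0" by (rule E_nondegenerate)
      then have "x = six x1 x2 x3 (- n1) (- n2) (- n3)" unfolding x'_def by simp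
      then show "x \<in> {six x1 x2 x3 n1 n2 n3 | x1 x2 x3 n1 n2 n3. True}" by blast
    qed
  qed
  have f_add: "f (x + w) = f x + f w" and f_smult: "f (k *s x) = k *s f x" for x w k
    unfolding f_def by (simp_all add: F.Q_add F.Q_smult f0_add f0_smult)
  have f_scaleR: "f (k *\<^sub>R x) = k *\<^sub>R f x" for x k unfolding of_real_smult[symmetric] by (rule f_smult)
  have lin: "Vector_Spaces.linear (*s) (*s) f"
    by unfold_locales (simp_all add: f_add f_smult)
  have ho': "H u2 u1 = 0" "H u3 u1 = 0" "H u3 u2 = 0"
    using ho h3 H_cnj[of u2 u1] H_cnj[of u3 u1] H_cnj[of u3 u2] by simp_all
  have Hf0: "H (f0 w) (f0 w') = w $ 1 * cnj (w' $ 1) * of_real h1 + w $ 2 * cnj (w' $ 2) * of_real h2 + w $ 3 * cnj (w' $ 3) * of_real h3'" for w w'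
    unfolding f0_def by (simp add: H_add_left H_add_right H_scale_left H_scale_right ho ho' h3 hh)
  have inv: "of_real h1 = 1 / complex_of_real (Im (\<tau> $ 1))" "of_real h2 = 1 / complex_of_real (Im (\<tau> $ 2))"
    "of_real h3' = 1 / complex_of_real (Im (\<tau> $ 3))"
  proof -
    have "h = 1 / t" if "t * h = 1" for t h :: real using that by (metis mult_eq_0_iff nonzero_mult_div_cancel_left zero_neq_one)
    then have "h1 = 1 / Im (\<tau> $ 1)" "h2 = 1 / Im (\<tau> $ 2)" "h3' = 1 / Im (\<tau> $ 3)" using J by blast+
    then show "of_real h1 = 1 / complex_of_real (Im (\<tau> $ 1))" "of_real h2 = 1 / complex_of_real (Im (\<tau> $ 2))"
      "of_real h3' = 1 / complex_of_real (Im (\<tau> $ 3))" by simp_all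
  qed
  have form: "H (f x) (f w) = siegel_form ?Z x w" for x w
    unfolding f_def Hf0 T.form_Q sum_3 inv by simp
  define coords :: "complex^3 \<Rightarrow> complex^3" where "coords x = vector [H x u1 / H u1 u1, H x u2 / H u2 u2, H x u3 / H u3 u3]" for x
  have f0_coords: "f0 (coords x) = x" for x unfolding f0_def coords_def using dec[of x] by simp
  have coords_f0: "coords (f0 w) = w" for w
    unfolding coords_def f0_def using hp
    by (simp add: vec_eq_iff forall_3 H_add_left H_scale_left ho ho' h3 hh)
  have bij: "bij f"
    by (rule bij_betw_byWitness[where f' = "\<lambda>x. F.P (coords x)"]) (simp_all add: f_def f0_coords coords_f0)
  have f_W: "f x \<in> W \<longleftrightarrow> x \<in> F.W0" for x
  proof
    assume "x \<in> F.W0"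
    then show "f x \<in> W" unfolding F.W0_def f_def f0_def using uW by auto
  next
    assume fx: "f x \<in> W"
    have "H u3 (f x) = 0" unfolding u3_def by (rule N3W[OF fx])
    then have "cnj (F.Q x $ 3) * of_real h3' = 0"
      unfolding f_def f0_def by (simp add: H_add_right H_scale_right ho' hh)
    then show "x \<in> F.W0" unfolding F.W0_def using hp by simp
  qed
  have fW: "f ` F.W0 = W"
  proof
    show "f ` F.W0 \<subseteq> W" using f_W by blast
    show "W \<subseteq> f ` F.W0" using f_W bij by (metis bij_pointE image_eqI subsetI)
  qed
  have fL: "f ` range (period_vec ?Z) = \<Lambda>"
  proof
    show "f ` range (period_vec ?Z) \<subseteq> \<Lambda>" 
    proof (rule image_subsetI)
      fix q assume "q \<in> range (period_vec ?Z)"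
      then obtain x1 x2 x3 n1 n2 n3 where q: "q = pv ?Z x1 x2 x3 n1 n2 n3" unfolding range_period_pv by blast
      show "f q \<in> \<Lambda>" unfolding q f_pv six_L by blast
    qed
    show "\<Lambda> \<subseteq> f ` range (period_vec ?Z)"
    proof
      fix x assume "x \<in> \<Lambda>"
      then obtain x1 x2 x3 n1 n2 n3 where "x = f (pv ?Z x1 x2 x3 n1 n2 n3)" unfolding six_L f_pv by blast
      then show "x \<in> f ` range (period_vec ?Z)" unfolding range_period_pv by blast
    qed
  qed
  have rho_gen: "f (F.rho0 gen x) = G (f x)" if x: "x \<in> F.W0" for x
  proof -
    have x3: "F.Q x $ 3 = 0" using x unfolding F.W0_def by simp
    have cg: "quad_conj D gen = ?g'" unfolding F.gen'_def by simp
    have "f (F.rho0 gen x) = (of_real ?g * F.Q x $ 1) *s u1 + (of_real ?g' * F.Q x $ 2) *s u2"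
      unfolding f_def F.Q_rho0[OF x] f0_def vector_3 cg by simp
    also have "\<dots> = F.Q x $ 1 *s (?g *\<^sub>R u1) + F.Q x $ 2 *s (?g' *\<^sub>R u2)"
      unfolding of_real_smult[symmetric] by (simp add: mult.commute)
    also have "\<dots> = G (F.Q x $ 1 *s u1 + F.Q x $ 2 *s u2)"
      using rho_lin[of gen "F.Q x $ 1 *s u1" "F.Q x $ 2 *s u2"] rho_smult[of gen] uW Gu12 by simp
    also have "\<dots> = G (f x)" unfolding f_def f0_def x3 by simp
    finally show ?thesis .
  qed
  have rho: "f (F.rho0 \<alpha> x) = \<rho> \<alpha> (f x)" if al: "\<alpha> \<in> quad_order D" and x: "x \<in> F.W0" for \<alpha> x
  proof -
    obtain i j where ij: "\<alpha> = elt i j" using al by (rule orderE)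
    have "f x \<in> W" using f_W x by blast
    then show ?thesis unfolding ij F.rho0_elt[OF x] f_add f_scaleR rho_gen[OF x] by (simp add: rho_elt)
  qed
  have "rm_isomorphic D (range (period_vec ?Z), siegel_form ?Z, F.W0, F.rho0) (\<Lambda>, H, W, \<rho>)"
    unfolding rm_isomorphic_def prod.case using lin bij fL form fW rho by blast
  then show ?thesis using tpos by blast
qed

end

section \<open>Isomorphism classes and the loci\<close>

lemma rm_isomorphic_refl: "rm_isomorphic D q q"
proof -
  obtain \<Lambda> H W \<rho> where q: "q = (\<Lambda>, H, W, \<rho>)" by (metis surj_pair)
  have "Vector_Spaces.linear (*s) (*s) (\<lambda>x :: complex^3. x)" by (rule vec.linear_ident)
  then show ?thesis unfolding q rm_isomorphic_def prod.case
    by (intro exI[of _ "\<lambda>x. x"]) (auto simp: bij_def)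
qed

lemma rm_isomorphic_sym:
  assumes "rm_isomorphic D q q'" shows "rm_isomorphic D q' q"
proof -
  obtain \<Lambda> H W \<rho> where q: "q = (\<Lambda>, H, W, \<rho>)" by (metis surj_pair)
  obtain \<Lambda>' H' W' \<rho>' where q': "q' = (\<Lambda>', H', W', \<rho>')" by (metis surj_pair)
  obtain f where lin: "Vector_Spaces.linear (*s) (*s) f" and bij: "bij f" and fL: "f ` \<Lambda> = \<Lambda>'"
    and fH: "\<And>x y. H' (f x) (f y) = H x y" and fW: "f ` W = W'"
    and fr: "\<And>\<alpha> x. \<alpha> \<in> quad_order D \<Longrightarrow> x \<in> W \<Longrightarrow> f (\<rho> \<alpha> x) = \<rho>' \<alpha> (f x)"
    using assms unfolding q q' rm_isomorphic_def prod.case by blast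
  let ?g = "inv_into UNIV f"
  have gf: "?g (f x) = x" and fg: "f (?g y) = y" for x y
    using bij by (simp_all add: bij_is_inj bij_is_surj surj_f_inv_f)
  interpret f: Vector_Spaces.linear "(*s)" "(*s)" f by (rule lin)
  have "Vector_Spaces.linear (*s) (*s) ?g"
  proof unfold_locales
    show "?g (x + y) = ?g x + ?g y" for x y
      using gf[of "?g x + ?g y"] unfolding f.add fg by simp
    show "?g (c *s x) = c *s ?g x" for c x
      using gf[of "c *s ?g x"] unfolding f.scale fg by simp
  qed
  moreover have "?g ` \<Lambda>' = \<Lambda>" "?g ` W' = W" unfolding fL[symmetric] fW[symmetric] image_image gf by simp_all
  moreover have "H (?g x) (?g y) = H' x y" for x y using fH[of "?g x" "?g y"] unfolding fg by simp
  moreover have "?g (\<rho>' \<alpha> x) = \<rho> \<alpha> (?g x)" if "\<alpha> \<in> quad_order D" "x \<in> W'" for \<alpha> x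
  proof -
    obtain w where w: "w \<in> W" "x = f w" using \<open>x \<in> W'\<close> fW by blast
    then show ?thesis using gf[of "\<rho> \<alpha> w"] fr[OF that(1) w(1)] by (simp add: gf)
  qed
  ultimately show ?thesis unfolding q q' rm_isomorphic_def prod.case
    using bij_imp_bij_inv[OF bij] by blast
qed

lemma rm_isomorphic_trans:
  assumes "rm_isomorphic D q q'" "rm_isomorphic D q' q''" shows "rm_isomorphic D q q''"
proof -
  obtain \<Lambda> H W \<rho> where q: "q = (\<Lambda>, H, W, \<rho>)" by (metis surj_pair)
  obtain \<Lambda>' H' W' \<rho>' where q': "q' = (\<Lambda>', H', W', \<rho>')" by (metis surj_pair)
  obtain \<Lambda>'' H'' W'' \<rho>'' where q'': "q'' = (\<Lambda>'', H'', W'', \<rho>'')" by (metis surj_pair)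
  obtain f where lin: "Vector_Spaces.linear (*s) (*s) f" and bij: "bij f" and fL: "f ` \<Lambda> = \<Lambda>'"
    and fH: "\<And>x y. H' (f x) (f y) = H x y" and fW: "f ` W = W'"
    and fr: "\<And>\<alpha> x. \<alpha> \<in> quad_order D \<Longrightarrow> x \<in> W \<Longrightarrow> f (\<rho> \<alpha> x) = \<rho>' \<alpha> (f x)"
    using assms(1) unfolding q q' rm_isomorphic_def prod.case by blast
  obtain g where lin': "Vector_Spaces.linear (*s) (*s) g" and bij': "bij g" and gL: "g ` \<Lambda>' = \<Lambda>''"
    and gH: "\<And>x y. H'' (g x) (g y) = H' x y" and gW: "g ` W' = W''"
    and gr: "\<And>\<alpha> x. \<alpha> \<in> quad_order D \<Longrightarrow> x \<in> W' \<Longrightarrow> g (\<rho>' \<alpha> x) = \<rho>'' \<alpha> (g x)"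
    using assms(2) unfolding q' q'' rm_isomorphic_def prod.case by blast
  have "Vector_Spaces.linear (*s) (*s) (g \<circ> f)" by (rule Vector_Spaces.linear_compose[OF lin lin'])
  moreover have "bij (g \<circ> f)" using bij bij' by (rule bij_comp)
  moreover have "(g \<circ> f) ` \<Lambda> = \<Lambda>''" "(g \<circ> f) ` W = W''" unfolding image_comp[symmetric] fL gL fW gW by simp_all
  moreover have "H'' ((g \<circ> f) x) ((g \<circ> f) y) = H x y" for x y using fH gH by simp
  moreover have "(g \<circ> f) (\<rho> \<alpha> x) = \<rho>'' \<alpha> ((g \<circ> f) x)" if "\<alpha> \<in> quad_order D" "x \<in> W" for \<alpha> x
  proof -
    have "f x \<in> W'" using that fW by blast
    then show ?thesis using fr[OF that] gr[OF that(1)] by simp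
  qed
  ultimately show ?thesis unfolding q q'' rm_isomorphic_def prod.case by blast
qed

lemma rm_iso_rel_equiv: "equiv (rm_objects D d) (rm_iso_rel D d)"
proof (rule equivI)
  show "rm_iso_rel D d \<subseteq> rm_objects D d \<times> rm_objects D d" unfolding rm_iso_rel_def by blast
  show "refl_on (rm_objects D d) (rm_iso_rel D d)"
    unfolding refl_on_def rm_iso_rel_def using rm_isomorphic_refl by blast
  show "sym (rm_iso_rel D d)" unfolding sym_def rm_iso_rel_def using rm_isomorphic_sym by blast
  show "trans (rm_iso_rel D d)" unfolding trans_def rm_iso_rel_def using rm_isomorphic_trans by blast
qed

abbreviation rm_class :: "nat \<Rightarrow> nat \<Rightarrow> rm_data \<Rightarrow> rm_data set" where
  "rm_class D d q \<equiv> rm_iso_rel D d `` {q}"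

lemma moduli_spaceE:
  assumes "C \<in> moduli_space D d" obtains q where "q \<in> rm_objects D d" "C = rm_class D d q"
  using assms unfolding moduli_space_def by (blast elim: quotientE)

lemma rm_class_in_moduli_space: "q \<in> rm_objects D d \<Longrightarrow> rm_class D d q \<in> moduli_space D d"
  unfolding moduli_space_def by (rule quotientI)

lemma rm_class_eq:
  "q \<in> rm_objects D d \<Longrightarrow> q' \<in> rm_objects D d \<Longrightarrow> rm_isomorphic D q q' \<Longrightarrow> rm_class D d q = rm_class D d q'"
  by (rule equiv_class_eq[OF rm_iso_rel_equiv]) (simp add: rm_iso_rel_def)

text \<open>The type of the module \<open>W \<inter> \<Lambda>\<close> depends on the isomorphism class only, since an isomorphism
  of objects restricts to one of the modules.\<close>

lemma module_type_isomorphic: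
  assumes "rm_isomorphic D q q'" "module_type D \<aa> q" shows "module_type D \<aa> q'"
proof -
  obtain \<Lambda> H W \<rho> where q: "q = (\<Lambda>, H, W, \<rho>)" by (metis surj_pair)
  obtain \<Lambda>' H' W' \<rho>' where q': "q' = (\<Lambda>', H', W', \<rho>')" by (metis surj_pair)
  obtain f where lin: "Vector_Spaces.linear (*s) (*s) f" and bij: "bij f" and fL: "f ` \<Lambda> = \<Lambda>'"
    and fH: "\<And>x y. H' (f x) (f y) = H x y" and fW: "f ` W = W'"
    and fr: "\<And>\<alpha> x. \<alpha> \<in> quad_order D \<Longrightarrow> x \<in> W \<Longrightarrow> f (\<rho> \<alpha> x) = \<rho>' \<alpha> (f x)"
    using assms(1) unfolding q q' rm_isomorphic_def prod.case by blast
  obtain \<phi> where b: "bij_betw \<phi> (W \<inter> \<Lambda>) (quad_order D \<times> (\<lambda>x. x / sqrt (real D)) ` \<aa>)"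
    and a: "\<And>u v. u\<in>W \<inter> \<Lambda> \<Longrightarrow> v\<in>W \<inter> \<Lambda> \<Longrightarrow> \<phi> (u + v) = \<phi> u + \<phi> v"
    and e: "\<And>\<alpha> u. \<alpha>\<in>quad_order D \<Longrightarrow> u\<in>W \<inter> \<Lambda> \<Longrightarrow> \<phi> (\<rho> \<alpha> u) = (\<alpha> * fst (\<phi> u), \<alpha> * snd (\<phi> u))"
    and t: "\<And>u v. u\<in>W \<inter> \<Lambda> \<Longrightarrow> v\<in>W \<inter> \<Lambda> \<Longrightarrow> trace_pairing D (\<phi> u) (\<phi> v) = Im (H u v)"
    using assms(2) unfolding q module_type_def prod.case by blast
  let ?g = "inv_into UNIV f"
  have gf: "?g (f x) = x" for x using bij by (simp add: bij_is_inj)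
  interpret f: Vector_Spaces.linear "(*s)" "(*s)" f by (rule lin)
  have L: "W' \<inter> \<Lambda>' = f ` (W \<inter> \<Lambda>)"
    unfolding fL[symmetric] fW[symmetric] using image_Int[OF bij_is_inj[OF bij]] by blast
  have gL: "?g ` (f ` (W \<inter> \<Lambda>)) = W \<inter> \<Lambda>" unfolding image_image gf by simp
  have "bij_betw ?g (W' \<inter> \<Lambda>') (W \<inter> \<Lambda>)"
    unfolding L using bij_betw_subset[OF bij_imp_bij_inv[OF bij] subset_UNIV gL] .
  then have "bij_betw (\<phi> \<circ> ?g) (W' \<inter> \<Lambda>') (quad_order D \<times> (\<lambda>x. x / sqrt (real D)) ` \<aa>)"
    using b by (rule bij_betw_trans)
  moreover have "(\<phi> \<circ> ?g) (u + v) = (\<phi> \<circ> ?g) u + (\<phi> \<circ> ?g) v"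
    "trace_pairing D ((\<phi> \<circ> ?g) u) ((\<phi> \<circ> ?g) v) = Im (H' u v)" if uv: "u \<in> W' \<inter> \<Lambda>'" "v \<in> W' \<inter> \<Lambda>'" for u v
  proof -
    obtain x y where x: "x \<in> W \<inter> \<Lambda>" "u = f x" and y: "y \<in> W \<inter> \<Lambda>" "v = f y" using uv unfolding L by blast
    show "(\<phi> \<circ> ?g) (u + v) = (\<phi> \<circ> ?g) u + (\<phi> \<circ> ?g) v"
      using a[OF x(1) y(1)] gf[of "x + y"] unfolding x(2) y(2) f.add by (simp add: gf)
    show "trace_pairing D ((\<phi> \<circ> ?g) u) ((\<phi> \<circ> ?g) v) = Im (H' u v)"
      using t[OF x(1) y(1)] unfolding x(2) y(2) by (simp add: gf fH)
  qed
  moreover have "(\<phi> \<circ> ?g) (\<rho>' \<alpha> u) = (\<alpha> * fst ((\<phi> \<circ> ?g) u), \<alpha> * snd ((\<phi> \<circ> ?g) u))"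
    if al: "\<alpha> \<in> quad_order D" and u: "u \<in> W' \<inter> \<Lambda>'" for \<alpha> u
  proof -
    obtain x where x: "x \<in> W \<inter> \<Lambda>" "u = f x" using u unfolding L by blast
    then have "\<rho>' \<alpha> u = f (\<rho> \<alpha> x)" using fr[OF al, of x] by simp
    then show ?thesis using e[OF al x(1)] unfolding x(2) by (simp add: gf)
  qed
  ultimately show ?thesis unfolding q' module_type_def prod.case
    by (intro exI[of _ "\<phi> \<circ> ?g"] conjI ballI)
qed

lemma rm_class_in_locus:
  assumes q: "q \<in> rm_objects D d"
  shows "rm_class D d q \<in> moduli_locus D d \<aa> \<longleftrightarrow> module_type D \<aa> q"
proof
  assume "rm_class D d q \<in> moduli_locus D d \<aa>"
  then obtain q' where "q' \<in> rm_class D d q" "module_type D \<aa> q'" unfolding moduli_locus_eq by blast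
  then show "module_type D \<aa> q"
    using module_type_isomorphic[of D q' q \<aa>] rm_isomorphic_sym[of D q q'] unfolding rm_iso_rel_def by blast
next
  assume "module_type D \<aa> q"
  moreover have "q \<in> rm_class D d q" using q rm_isomorphic_refl unfolding rm_iso_rel_def by blast
  ultimately show "rm_class D d q \<in> moduli_locus D d \<aa>"
    unfolding moduli_locus_eq using rm_class_in_moduli_space[OF q] by blast
qed

lemma moduli_locus_subset: "moduli_locus D d \<aa> \<subseteq> moduli_space D d"
  unfolding moduli_locus_eq by blast

context rm_object begin

text \<open>The ideal is determined by the module: with \<open>x\<close> and \<open>z\<close> the images of the first and the last
  vector of a second adapted basis, the determinant of \<open>(x, z)\<close> is the element \<open>(\<gamma> + c') / \<surd>D\<close> of
  the second summand, because the trace form determines it. Hence \<open>c' \<equiv> c (mod d)\<close>.\<close>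

lemma adapted_unique:
  assumes a: "adapted c u v y z" and a': "adapted c' u' v' y' z'" and dc: "int d dvd genpoly c"
  shows "int d dvd c - c'"
proof -
  obtain g where g: "genpoly c = int d * g" using dc by blast
  have L: "W \<inter> \<Lambda> = {zcomb u v y z m n k l | m n k l. True}" using a unfolding adapted_def by blast
  obtain m n k l where u': "u' = zcomb u v y z m n k l" using adapted_in(1)[OF a'] unfolding L by blast
  obtain m' n' k' l' where z': "z' = zcomb u v y z m' n' k' l'" using adapted_in(4)[OF a'] unfolding L by blast
  have "E z' u' = 1" "E z' (G u') = of_int (int D + c')" using a' unfolding adapted_def by simp_all
  then have e1: "(l' * m - m' * l) + int d * (k' * n - n' * k) + (int D + c) * (l' * n - n' * l) = 1"
    and e2: "(l' * (- (n * gnorm)) - m' * (k * int d + l * (int D + c))) + int d * (k' * (m + n * int D) - n' * (- (k * c) - l * g))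
      + (int D + c) * (l' * (m + n * int D) - n' * (k * int d + l * (int D + c))) = int D + c'"
    unfolding u' z' adapted_G[OF a g] adapted_E[OF a] by (simp_all only: of_int_eq_iff of_int_eq_1_iff)
  have gn: "gnorm = int d * g - c * c - int D * c" using g unfolding genpoly_def power2_eq_square by linarith
  have "c' - c = (int D + c') - (int D + c) * 1" by simp
  also have "\<dots> = int d * (- m' * k + k' * (m + n * int D) + n' * k * c - (int D + c) * n' * k
      - (int D + c) * (k' * n - n' * k) + g * (n' * l - l' * n))"
    unfolding e1[symmetric] e2[symmetric] gn by (simp add: algebra_simps)
  finally have "int d dvd c' - c" by simp
  then show ?thesis by (simp add: dvd_diff_commute)
qed

end

context quadratic_discriminant begin

lemma locus_exists:
  assumes q: "q \<in> rm_objects D d" shows "\<exists>\<aa>\<in>primitive_ideals D d. module_type D \<aa> q"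
proof -
  obtain \<Lambda> H W \<rho> where q': "q = (\<Lambda>, H, W, \<rho>)" by (metis surj_pair)
  have o: "(\<Lambda>, H, W, \<rho>) \<in> rm_objects D d" using q unfolding q' .
  then have "positive_hermitian H" unfolding rm_objects_def polarization_def by unfold_locales simp
  then interpret positive_hermitian H .
  interpret rm_object D H d \<Lambda> W \<rho> by unfold_locales (rule o)
  obtain c u v y z where c: "int d dvd genpoly c" "adapted c u v y z" using adapted_exists by blast
  show ?thesis unfolding q'
    using adapted_module_type[OF c(2,1)] root_ideal_primitive[OF d_pos c(1)] by blast
qed

lemma locus_unique:
  assumes q: "q \<in> rm_objects D d" and ab: "\<aa> \<in> primitive_ideals D d" "\<bb> \<in> primitive_ideals D d"
    and t: "module_type D \<aa> q" "module_type D \<bb> q"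
  shows "\<aa> = \<bb>"
proof -
  obtain \<Lambda> H W \<rho> where q': "q = (\<Lambda>, H, W, \<rho>)" by (metis surj_pair)
  have o: "(\<Lambda>, H, W, \<rho>) \<in> rm_objects D d" using q unfolding q' .
  then have "positive_hermitian H" unfolding rm_objects_def polarization_def by unfold_locales simp
  then interpret positive_hermitian H .
  interpret rm_object D H d \<Lambda> W \<rho> by unfold_locales (rule o)
  obtain c where c: "int d dvd genpoly c" "\<aa> = root_ideal (int d) c" using primitive_ideal_root[OF d_pos ab(1)] by blast
  obtain c' where c': "int d dvd genpoly c'" "\<bb> = root_ideal (int d) c'" using primitive_ideal_root[OF d_pos ab(2)] by blast
  obtain u v y z where a: "adapted c u v y z" using module_type_adapted[OF t(1)[unfolded q' c(2)]] by blast
  obtain u' v' y' z' where a': "adapted c' u' v' y' z'" using module_type_adapted[OF t(2)[unfolded q' c'(2)]] by blast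
  show ?thesis unfolding c(2) c'(2) by (rule root_ideal_eq_iff[OF adapted_unique[OF a a' c(1)]])
qed

lemma moduli_space_loci: "moduli_space D d = (\<Union>\<aa>\<in>primitive_ideals D d. moduli_locus D d \<aa>)"
proof
  show "moduli_space D d \<subseteq> (\<Union>\<aa>\<in>primitive_ideals D d. moduli_locus D d \<aa>)"
  proof
    fix C assume "C \<in> moduli_space D d"
    then obtain q where q: "q \<in> rm_objects D d" "C = rm_class D d q" by (rule moduli_spaceE)
    then show "C \<in> (\<Union>\<aa>\<in>primitive_ideals D d. moduli_locus D d \<aa>)"
      using locus_exists[OF q(1)] rm_class_in_locus[OF q(1)] by auto
  qed
  show "(\<Union>\<aa>\<in>primitive_ideals D d. moduli_locus D d \<aa>) \<subseteq> moduli_space D d"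
    using moduli_locus_subset by blast
qed

lemma moduli_locus_disjoint:
  assumes "\<aa> \<in> primitive_ideals D d" "\<bb> \<in> primitive_ideals D d" "C \<in> moduli_locus D d \<aa>" "C \<in> moduli_locus D d \<bb>"
  shows "\<aa> = \<bb>"
proof -
  have "C \<in> moduli_space D d" using assms(3) moduli_locus_subset by blast
  then obtain q where q: "q \<in> rm_objects D d" "C = rm_class D d q" by (rule moduli_spaceE)
  then show ?thesis using assms locus_unique[OF q(1)] rm_class_in_locus[OF q(1)] by blast
qed

end

section \<open>Markings\<close>

definition marked ::
    "nat \<Rightarrow> nat \<Rightarrow> ((int^3) \<times> (int^3)) set \<Rightarrow> (real \<Rightarrow> (int^3) \<times> (int^3) \<Rightarrow> (int^3) \<times> (int^3)) \<Rightarrow>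
     complex^3^3 \<Rightarrow> rm_data \<Rightarrow> bool" where
  "marked D d L r Z q \<longleftrightarrow> q \<in> rm_objects D d \<and>
     (\<exists>W \<rho>. q = (range (period_vec Z), siegel_form Z, W, \<rho>) \<and> {c. period_vec Z c \<in> W} = L \<and>
        (\<forall>\<alpha>\<in>quad_order D. \<forall>c\<in>L. \<rho> \<alpha> (period_vec Z c) = period_vec Z (r \<alpha> c)))"

lemma Int_range_image: "A \<inter> range p = p ` {c. p c \<in> A}"
  by blast

lemma siegel_preimage_marked:
  "siegel_preimage D d L r Y = {Z \<in> siegel_space. \<exists>q. marked D d L r Z q \<and> rm_class D d q \<in> Y}"
  unfolding siegel_preimage_def marked_def Let_def by blast

text \<open>A marking determines the module with its symplectic form, so that it decides to which locus
  the objects carrying it belong.\<close>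

lemma marked_module_type:
  assumes Z: "Z \<in> siegel_space" "Z' \<in> siegel_space" and m: "marked D d L r Z q" "marked D d L r Z' q'"
    and t: "module_type D \<aa> q"
  shows "module_type D \<aa> q'"
proof -
  interpret Z: siegel Z by unfold_locales (rule Z)
  interpret Z': siegel Z' by unfold_locales (rule Z)
  let ?p = "period_vec Z" and ?p' = "period_vec Z'"
  obtain W \<rho> where q: "q = (range ?p, siegel_form Z, W, \<rho>)" and L: "{c. ?p c \<in> W} = L"
    and r: "\<And>\<alpha> c. \<alpha>\<in>quad_order D \<Longrightarrow> c\<in>L \<Longrightarrow> \<rho> \<alpha> (?p c) = ?p (r \<alpha> c)"
    using m(1) unfolding marked_def by blast
  obtain W' \<rho>' where q': "q' = (range ?p', siegel_form Z', W', \<rho>')" and L': "{c. ?p' c \<in> W'} = L"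
    and r': "\<And>\<alpha> c. \<alpha>\<in>quad_order D \<Longrightarrow> c\<in>L \<Longrightarrow> \<rho>' \<alpha> (?p' c) = ?p' (r \<alpha> c)"
    using m(2) unfolding marked_def by blast
  have inj: "inj ?p'" "inj ?p"
  proof -
    show "inj ?p'" by (rule injI) (metis Z'.period_inject prod.collapse)
    show "inj ?p" by (rule injI) (metis Z.period_inject prod.collapse)
  qed
  have WL: "W \<inter> range ?p = ?p ` L" "W' \<inter> range ?p' = ?p' ` L"
  proof -
    show "W \<inter> range ?p = ?p ` L" using Int_range_image[of W ?p] unfolding L .
    show "W' \<inter> range ?p' = ?p' ` L" using Int_range_image[of W' ?p'] unfolding L' .
  qed
  define S where "S = ?p ` L"
  obtain \<phi> where b: "bij_betw \<phi> (S) (quad_order D \<times> (\<lambda>x. x / sqrt (real D)) ` \<aa>)"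
    and a: "\<And>u v. u\<in>S \<Longrightarrow> v\<in>S \<Longrightarrow> \<phi> (u + v) = \<phi> u + \<phi> v"
    and e: "\<And>\<alpha> u. \<alpha>\<in>quad_order D \<Longrightarrow> u\<in>S \<Longrightarrow> \<phi> (\<rho> \<alpha> u) = (\<alpha> * fst (\<phi> u), \<alpha> * snd (\<phi> u))"
    and t: "\<And>u v. u\<in>S \<Longrightarrow> v\<in>S \<Longrightarrow> trace_pairing D (\<phi> u) (\<phi> v) = Im (siegel_form Z u v)"
    using t unfolding q module_type_def prod.case WL(1) S_def[symmetric] by blast
  have pS: "?p c \<in> S" if "c \<in> L" for c unfolding S_def using that by blast
  define \<psi> where "\<psi> x = \<phi> (?p (inv_into UNIV ?p' x))" for x
  have psi: "\<psi> (?p' c) = \<phi> (?p c)" for c unfolding \<psi>_def using inj by simp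
  have plus: "?p c + ?p c' = ?p (fst c + fst c', snd c + snd c')" "?p' c + ?p' c' = ?p' (fst c + fst c', snd c + snd c')" for c c'
    using Z.period_add[of "fst c" "snd c" "fst c'" "snd c'"] Z'.period_add[of "fst c" "snd c" "fst c'" "snd c'"] by simp_all
  have pair: "Im (siegel_form Z (?p c) (?p c')) = Im (siegel_form Z' (?p' c) (?p' c'))" for c c'
    using Z.E_period[of "fst c" "snd c" "fst c'" "snd c'"] Z'.E_period[of "fst c" "snd c" "fst c'" "snd c'"]
    unfolding Z.H.E_def Z'.H.E_def by simp
  have "bij_betw (inv_into UNIV ?p') (?p' ` L) L" by (rule bij_betw_byWitness[where f' = ?p']) (use inj(1) in auto)
  moreover have "bij_betw ?p L (?p ` L)" using inj(2) by (simp add: inj_on_imp_bij_betw inj_on_subset)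
  ultimately have "bij_betw (\<phi> \<circ> (?p \<circ> inv_into UNIV ?p')) (?p' ` L) (quad_order D \<times> (\<lambda>x. x / sqrt (real D)) ` \<aa>)"
    using b unfolding S_def by (intro bij_betw_trans)
  then have bij: "bij_betw \<psi> (?p' ` L) (quad_order D \<times> (\<lambda>x. x / sqrt (real D)) ` \<aa>)"
    unfolding \<psi>_def comp_def .
  have "\<psi> (u + v) = \<psi> u + \<psi> v" "trace_pairing D (\<psi> u) (\<psi> v) = Im (siegel_form Z' u v)"
    if uv: "u \<in> ?p' ` L" "v \<in> ?p' ` L" for u v
  proof -
    obtain c c' where c: "c \<in> L" "u = ?p' c" and c': "c' \<in> L" "v = ?p' c'" using uv by blast
    show "\<psi> (u + v) = \<psi> u + \<psi> v"
      using a[OF pS[OF c(1)] pS[OF c'(1)]] unfolding c(2) c'(2) plus psi by simp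
    show "trace_pairing D (\<psi> u) (\<psi> v) = Im (siegel_form Z' u v)"
      using t[OF pS[OF c(1)] pS[OF c'(1)]] unfolding c(2) c'(2) psi pair by simp
  qed
  moreover have "\<psi> (\<rho>' \<alpha> u) = (\<alpha> * fst (\<psi> u), \<alpha> * snd (\<psi> u))"
    if al: "\<alpha> \<in> quad_order D" and u: "u \<in> ?p' ` L" for \<alpha> u
  proof -
    obtain c where c: "c \<in> L" "u = ?p' c" using u by blast
    show ?thesis using e[OF al pS[OF c(1)]] unfolding c(2) r'[OF al c(1)] psi r[OF al c(1)] by simp
  qed
  ultimately show ?thesis unfolding q' module_type_def prod.case WL using bij
    by (intro exI[of _ \<psi>] conjI ballI)
qed

lemma analytic_subset_all: "analytic_subset M M"
  unfolding analytic_subset_def by (intro conjI ballI exI[of _ UNIV] exI[of _ "{}"]) auto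

lemma analytic_subset_empty: "analytic_subset M {}"
proof -
  have "holomorphic3 (\<lambda>_. 1) UNIV" unfolding holomorphic3_def by (auto intro!: exI[of _ "\<lambda>_. 0"])
  then show ?thesis
    unfolding analytic_subset_def by (intro conjI ballI exI[of _ UNIV] exI[of _ "{\<lambda>_. 1}"]) auto
qed

text \<open>For each marking, one of the two sets has the same preimage as \<open>Y\<close> and the other an empty one, as all
  objects with this marking lie in the locus or none does.\<close>

lemma moduli_analytic_locus:
  assumes Y: "moduli_analytic D d Y"
  shows "moduli_analytic D d (Y \<inter> moduli_locus D d \<aa>)" "moduli_analytic D d (Y - moduli_locus D d \<aa>)"
proof -
  let ?P = "siegel_preimage D d" and ?X = "moduli_locus D d \<aa>"
  have sub: "Y \<subseteq> moduli_space D d" and an: "analytic_subset (?P L r (moduli_space D d)) (?P L r Y)" for L r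
    using Y unfolding moduli_analytic_def by blast+
  have both: "analytic_subset (?P L r (moduli_space D d)) (?P L r (Y \<inter> ?X)) \<and>
    analytic_subset (?P L r (moduli_space D d)) (?P L r (Y - ?X))" for L r
  proof (cases "\<exists>Z q. Z \<in> siegel_space \<and> marked D d L r Z q \<and> module_type D \<aa> q")
    case True
    then have t: "module_type D \<aa> q" if "Z \<in> siegel_space" "marked D d L r Z q" for Z q
      using marked_module_type that by blast
    then have "rm_class D d q \<in> ?X" if "Z \<in> siegel_space" "marked D d L r Z q" for Z q
      using rm_class_in_locus[of q D d \<aa>] that unfolding marked_def by blast
    then have "?P L r (Y \<inter> ?X) = ?P L r Y" "?P L r (Y - ?X) = {}"
      unfolding siegel_preimage_marked by blast+
    then show ?thesis using an analytic_subset_empty by simp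
  next
    case False
    then have "rm_class D d q \<notin> ?X" if "Z \<in> siegel_space" "marked D d L r Z q" for Z q
      using rm_class_in_locus[of q D d \<aa>] that unfolding marked_def by blast
    then have "?P L r (Y \<inter> ?X) = {}" "?P L r (Y - ?X) = ?P L r Y"
      unfolding siegel_preimage_marked by blast+
    then show ?thesis using an analytic_subset_empty by simp
  qed
  show "moduli_analytic D d (Y \<inter> ?X)" "moduli_analytic D d (Y - ?X)"
    unfolding moduli_analytic_def using sub both by blast+
qed

lemma moduli_analytic_all: "moduli_analytic D d (moduli_space D d)"
  unfolding moduli_analytic_def using analytic_subset_all by blast

lemma moduli_locus_analytic: "moduli_analytic D d (moduli_locus D d \<aa>)"
  using moduli_analytic_locus(1)[OF moduli_analytic_all, of D d \<aa>] moduli_locus_subset[of D d \<aa>]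
  by (simp add: Int_absorb1)

text \<open>An irreducible set that meets a locus lies in it, as the locus and its complement are both
  analytic.\<close>

lemma irreducible_subset_locus:
  assumes Y: "moduli_irreducible D d Y" and C: "C \<in> Y" "C \<in> moduli_locus D d \<aa>"
  shows "Y \<subseteq> moduli_locus D d \<aa>"
proof -
  have "moduli_analytic D d Y" using Y unfolding moduli_irreducible_def by blast
  note an = moduli_analytic_locus[OF this, of \<aa>]
  have "Y = (Y \<inter> moduli_locus D d \<aa>) \<union> (Y - moduli_locus D d \<aa>)" by blast
  then have "Y = Y \<inter> moduli_locus D d \<aa> \<or> Y = Y - moduli_locus D d \<aa>"
    using Y an unfolding moduli_irreducible_def by blast
  then show ?thesis using C by blast
qed

text \<open>Over a given point of Siegel space the marking determines the object: the lattice \<open>W \<inter> \<Lambda>\<close>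
  spans \<open>W\<close>.\<close>

lemma (in quadratic_discriminant) marked_unique:
  assumes m: "marked D d L r Z q" "marked D d L r Z q'"
  shows "rm_isomorphic D q q'"
proof -
  let ?p = "period_vec Z" and ?H = "siegel_form Z"
  obtain W \<rho> where q: "q = (range ?p, ?H, W, \<rho>)" and L: "{c. ?p c \<in> W} = L"
    and r: "\<And>\<alpha> c. \<alpha>\<in>quad_order D \<Longrightarrow> c\<in>L \<Longrightarrow> \<rho> \<alpha> (?p c) = ?p (r \<alpha> c)"
    and o: "(range ?p, ?H, W, \<rho>) \<in> rm_objects D d"
    using m(1) unfolding marked_def by blast
  obtain W' \<rho>' where q': "q' = (range ?p, ?H, W', \<rho>')" and L': "{c. ?p c \<in> W'} = L"
    and r': "\<And>\<alpha> c. \<alpha>\<in>quad_order D \<Longrightarrow> c\<in>L \<Longrightarrow> \<rho>' \<alpha> (?p c) = ?p (r \<alpha> c)"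
    and o': "(range ?p, ?H, W', \<rho>') \<in> rm_objects D d"
    using m(2) unfolding marked_def by blast
  have "positive_hermitian ?H" using o unfolding rm_objects_def polarization_def by unfold_locales simp
  then interpret positive_hermitian ?H .
  interpret A: rm_object D ?H d "range ?p" W \<rho> by unfold_locales (rule o)
  interpret B: rm_object D ?H d "range ?p" W' \<rho>' by unfold_locales (rule o')
  have WL: "W \<inter> range ?p = ?p ` L" "W' \<inter> range ?p = ?p ` L"
  proof -
    show "W \<inter> range ?p = ?p ` L" using Int_range_image[of W ?p] unfolding L .
    show "W' \<inter> range ?p = ?p ` L" using Int_range_image[of W' ?p] unfolding L' .
  qed
  have sp: "span (?p ` L) = W" "span (?p ` L) = W'"
    using A.W_torus B.W_torus unfolding WL complex_torus_def by (intro lattice_span; simp)+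
  then have W: "W' = W" by simp
  have "x \<in> W \<and> \<rho> \<alpha> x = \<rho>' \<alpha> x" if al: "\<alpha> \<in> quad_order D" and x: "x \<in> span (?p ` L)" for \<alpha> x
    using x
  proof (induction rule: span_induct_alt)
    case base
    then show ?case using A.rho_scaleR[OF al, of 0 0] B.rho_scaleR[OF al, of 0 0] A.W_subspace
      by (simp add: W vec.subspace_0)
  next
    case (step t a b)
    obtain c where c: "c \<in> L" "a = ?p c" using step(1) by blast
    have a: "a \<in> W" using c L by blast
    have "\<rho> \<alpha> a = \<rho>' \<alpha> a" unfolding c(2) using r[OF al c(1)] r'[OF al c(1)] by simp
    then show ?case
      using step(2) a A.rho_lin[OF al, of "t *\<^sub>R a" b] B.rho_lin[OF al, of "t *\<^sub>R a" b] A.rho_scaleR[OF al a] B.rho_scaleR[OF al, of a]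
      by (simp add: W)
  qed
  then have "\<rho> \<alpha> x = \<rho>' \<alpha> x" if "\<alpha> \<in> quad_order D" "x \<in> W" for \<alpha> x using that sp by blast
  moreover have "Vector_Spaces.linear (*s) (*s) (\<lambda>x :: complex^3. x)" by (rule vec.linear_ident)
  ultimately show ?thesis unfolding q q' W rm_isomorphic_def prod.case
    by (intro exI[of _ "\<lambda>x. x"]) (auto simp: bij_def)
qed

section \<open>Irreducibility of the loci\<close>

definition locally_zero_set :: "complex set \<Rightarrow> complex set \<Rightarrow> bool" where
  "locally_zero_set S A \<longleftrightarrow>
     (\<forall>s\<in>S. \<exists>e>0. \<exists>F. ball s e \<subseteq> S \<and> (\<forall>f\<in>F. f holomorphic_on ball s e) \<and>
        A \<inter> ball s e = {t \<in> ball s e. \<forall>f\<in>F. f t = 0})"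

text \<open>By the identity theorem the set of interior points of \<open>A\<close> is closed in \<open>S\<close>.\<close>

lemma locally_zero_set_interior:
  assumes S: "open S" "connected S" and A: "locally_zero_set S A" "A \<subseteq> S" and i: "interior A \<noteq> {}"
  shows "A = S"
proof -
  have in_interior: "s \<in> interior A" if s: "s \<in> S" "s \<in> closure (interior A)" for s
  proof -
    obtain e F where e: "e > 0" and F: "\<And>f. f \<in> F \<Longrightarrow> f holomorphic_on ball s e"
      and AF: "A \<inter> ball s e = {t \<in> ball s e. \<forall>f\<in>F. f t = 0}"
      using A(1) s(1) unfolding locally_zero_set_def by meson
    have ne: "interior A \<inter> ball s e \<noteq> {}"
      using s(2) e by (metis Int_commute centre_in_ball closure_iff_nhds_not_empty open_ball subset_refl)
    have "f t = 0" if f: "f \<in> F" and t: "t \<in> ball s e" for f t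
    proof -
      have z: "f z = 0" if "z \<in> interior A \<inter> ball s e" for z
        using that AF f interior_subset by blast
      show ?thesis
        using analytic_continuation_open[OF open_Int[OF open_interior open_ball] _ ne connected_ball _ F[OF f] holomorphic_on_const[of 0], of t] z t by simp
    qed
    then have "ball s e \<subseteq> A \<inter> ball s e" unfolding AF by blast
    then have "ball s e \<subseteq> A" by blast
    then show ?thesis using e by (meson centre_in_ball interior_maximal open_ball subsetD)
  qed
  have "interior A = S"
  proof (rule ccontr)
    assume ne: "interior A \<noteq> S"
    let ?B = "S - closure (interior A)"
    have "open (interior A)" "open ?B" using S(1) by auto
    moreover have "S \<subseteq> interior A \<union> ?B" using in_interior by blast
    moreover have "interior A \<inter> ?B \<inter> S = {}" using closure_subset by blast
    moreover have "interior A \<inter> S \<noteq> {}" using i A(2) interior_subset by blast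
    moreover have "?B \<inter> S \<noteq> {}" using ne in_interior A(2) interior_subset by blast
    ultimately show False using S(2) unfolding connected_def by blast
  qed
  then show ?thesis using A(2) interior_subset by blast
qed

text \<open>The complement of \<open>B\<close> is open and contained in \<open>A\<close>.\<close>

lemma locally_zero_set_Un:
  assumes S: "open S" "connected S" and A: "locally_zero_set S A" "A \<subseteq> S" and B: "locally_zero_set S B" "B \<subseteq> S"
    and un: "S = A \<union> B"
  shows "A = S \<or> B = S"
proof (rule disjCI)
  assume "B \<noteq> S"
  then obtain s where s: "s \<in> S" "s \<notin> B" using B by blast
  obtain e F where e: "e > 0" "ball s e \<subseteq> S" and F: "\<And>f. f \<in> F \<Longrightarrow> f holomorphic_on ball s e"
    and BF: "B \<inter> ball s e = {t \<in> ball s e. \<forall>f\<in>F. f t = 0}"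
    using B(1) s(1) unfolding locally_zero_set_def by meson
  have "s \<notin> {t \<in> ball s e. \<forall>f\<in>F. f t = 0}" using s(2) unfolding BF[symmetric] by simp
  then obtain f where f: "f \<in> F" "f s \<noteq> 0" using e(1) by auto
  have "continuous_on (ball s e) f" using F[OF f(1)] by (rule holomorphic_on_imp_continuous_on)
  then have "open (ball s e \<inter> f -` (- {0}))" by (rule continuous_open_preimage) auto
  moreover have "ball s e \<inter> f -` (- {0}) \<subseteq> A"
  proof
    fix t assume t: "t \<in> ball s e \<inter> f -` (- {0})"
    then have "t \<notin> {t \<in> ball s e. \<forall>f\<in>F. f t = 0}" using f(1) by auto
    then have "t \<notin> B" unfolding BF[symmetric] using t by blast
    then show "t \<in> A" using un e(2) t by blast
  qed
  ultimately have "s \<in> interior A"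
    using f(2) e(1) by (intro interiorI[of "ball s e \<inter> f -` (- {0})"]) auto
  then show "A = S" using locally_zero_set_interior[OF S A] by blast
qed

definition scale_matrix :: "complex^3^3 \<Rightarrow> complex \<Rightarrow> complex^3^3" where
  "scale_matrix V s = (\<chi> i j. s * V $ i $ j)"

lemma scale_matrix_bounded_linear: "bounded_linear (scale_matrix V)"
proof -
  have "linear (scale_matrix V)"
    by (rule linearI) (simp_all add: scale_matrix_def vec_eq_iff algebra_simps)
  then show ?thesis by (simp add: linear_conv_bounded_linear)
qed

text \<open>A holomorphic function on matrix space is holomorphic along a complex line, by the chain rule.\<close>

lemma analytic_subset_line:
  assumes an: "analytic_subset M Y" and S: "open S" and line: "\<And>s. s \<in> S \<Longrightarrow> U + scale_matrix V s \<in> M"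
  shows "locally_zero_set S {s \<in> S. U + scale_matrix V s \<in> Y}"
  unfolding locally_zero_set_def
proof
  fix s assume s: "s \<in> S"
  let ?l = "\<lambda>t. U + scale_matrix V t"
  have dl: "(?l has_derivative scale_matrix V) (at t)" for t
    using bounded_linear_imp_has_derivative[OF scale_matrix_bounded_linear] by (intro derivative_eq_intros) (auto)
  have cl: "continuous_on UNIV ?l" by (rule has_derivative_continuous_on[OF has_derivative_at_withinI[OF dl]])
  obtain N F where N: "open N" "?l s \<in> N" and F: "\<And>f. f \<in> F \<Longrightarrow> holomorphic3 f N"
    and YN: "Y \<inter> N = {T \<in> M \<inter> N. \<forall>f\<in>F. f T = 0}"
    using an line[OF s] unfolding analytic_subset_def by meson
  have "open (?l -` N)" using cl N(1) by (metis continuous_on_open_vimage open_UNIV vimage_Int inf_top_right)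
  then have "open (S \<inter> ?l -` N)" using S by blast
  moreover have "s \<in> S \<inter> ?l -` N" using s N(2) by simp
  ultimately obtain e where e: "e > 0" "ball s e \<subseteq> S \<inter> ?l -` N" by (meson open_contains_ball)
  have hol: "(f \<circ> ?l) holomorphic_on ball s e" if f: "f \<in> F" for f
    unfolding holomorphic_on_open[OF open_ball]
  proof
    fix t assume t: "t \<in> ball s e"
    then have "?l t \<in> N" using e(2) by blast
    then obtain f' where f': "(f has_derivative f') (at (?l t))" "\<And>c v. f' (\<chi> i j. c * v $ i $ j) = c * f' v"
      using F[OF f] unfolding holomorphic3_def by blast
    have "(f \<circ> ?l has_derivative f' \<circ> scale_matrix V) (at t)" using diff_chain_at[OF dl f'(1)] .
    moreover have "f' \<circ> scale_matrix V = (*) (f' V)"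
      unfolding comp_def scale_matrix_def f'(2) by (intro ext) (rule mult.commute)
    ultimately show "\<exists>D. (f \<circ> ?l has_field_derivative D) (at t)" unfolding has_field_derivative_def by auto
  qed
  have "{t \<in> S. ?l t \<in> Y} \<inter> ball s e = {t \<in> ball s e. \<forall>g\<in>(\<lambda>f. f \<circ> ?l) ` F. g t = 0}"
  proof -
    have "?l t \<in> Y \<longleftrightarrow> (\<forall>f\<in>F. f (?l t) = 0)" if "t \<in> ball s e" for t
    proof -
      have "?l t \<in> N" "?l t \<in> M" using that e(2) line by blast+
      then have "?l t \<in> Y \<longleftrightarrow> ?l t \<in> Y \<inter> N" by blast
      then show ?thesis unfolding YN using \<open>?l t \<in> N\<close> \<open>?l t \<in> M\<close> by blast
    qed
    then show ?thesis using e(2) by auto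
  qed
  then show "\<exists>e>0. \<exists>F. ball s e \<subseteq> S \<and> (\<forall>f\<in>F. f holomorphic_on ball s e) \<and>
      {t \<in> S. ?l t \<in> Y} \<inter> ball s e = {t \<in> ball s e. \<forall>f\<in>F. f t = 0}"
    using e hol by (intro exI[of _ e] conjI exI[of _ "(\<lambda>f. f \<circ> ?l) ` F"]) auto
qed

context rm_family_data begin

definition family_member :: "complex^3 \<Rightarrow> rm_data" where
  "family_member \<tau> = (range (period_vec (period_matrix \<tau>)), siegel_form (period_matrix \<tau>), W0, rho0)"

text \<open>The action of the order on the sublattice in lattice coordinates, which does not depend on
  the member of the family.\<close>

definition family_action :: "real \<Rightarrow> (int^3) \<times> (int^3) \<Rightarrow> (int^3) \<times> (int^3)" where
  "family_action \<alpha> x = (SOME y. \<forall>\<tau>. rho0 \<alpha> (period_vec (period_matrix \<tau>) x) = period_vec (period_matrix \<tau>) y)"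

lemma family_action:
  assumes al: "\<alpha> \<in> quad_order D" and x: "x \<in> L0"
  shows "rho0 \<alpha> (period_vec (period_matrix \<tau>) x) = period_vec (period_matrix \<tau>) (family_action \<alpha> x)"
proof -
  obtain m n where mn: "x = (m, n)" "m $ 3 = 0" "n $ 2 = - int d * n $ 3" using x unfolding L0_def by blast
  have p: "period_vec Z x = pl Z (m $ 1) (m $ 2) (n $ 1) (n $ 3)" for Z
    unfolding mn(1) period_vec_pv mn(2,3) ..
  obtain x1 x2 y1 y3 where "\<forall>\<tau>. rho0 \<alpha> (period_vec (period_matrix \<tau>) x) = pl (period_matrix \<tau>) x1 x2 y1 y3"
    using rho0_pl[OF al] unfolding p by meson
  then have "\<exists>y. \<forall>\<tau>. rho0 \<alpha> (period_vec (period_matrix \<tau>) x) = period_vec (period_matrix \<tau>) y"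
    unfolding pv_def by blast
  then show ?thesis unfolding family_action_def by (rule someI_ex[THEN spec])
qed

lemma family_member_marked:
  assumes "\<And>k. Im (\<tau> $ k) > 0"
  shows "marked D d L0 family_action (period_matrix \<tau>) (family_member \<tau>)"
proof -
  interpret T: rm_family D d c \<tau> by unfold_locales (rule assms)
  have "{x. period_vec (period_matrix \<tau>) x \<in> W0} = L0"
    unfolding L0_def by (auto simp: period_vec_pv T.pv_W0)
  then show ?thesis unfolding marked_def family_member_def
    using T.family_object family_action by blast
qed

lemma family_preimage:
  assumes tau: "\<And>k. Im (\<tau> $ k) > 0"
  shows "period_matrix \<tau> \<in> siegel_preimage D d L0 family_action Y \<longleftrightarrow> rm_class D d (family_member \<tau>) \<in> Y"
proof -
  interpret T: rm_family D d c \<tau> by unfold_locales (rule tau)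
  note m = family_member_marked[OF tau]
  have "rm_class D d q = rm_class D d (family_member \<tau>)" if q: "marked D d L0 family_action (period_matrix \<tau>) q" for q
    using q m by (intro rm_class_eq marked_unique[OF q m]) (auto simp: marked_def)
  then have "(\<exists>q. marked D d L0 family_action (period_matrix \<tau>) q \<and> rm_class D d q \<in> Y) \<longleftrightarrow> rm_class D d (family_member \<tau>) \<in> Y"
    using m by metis
  then show ?thesis unfolding siegel_preimage_marked using T.Z_siegel by simp
qed

lemma family_locus:
  assumes tau: "\<And>k. Im (\<tau> $ k) > 0"
  shows "rm_class D d (family_member \<tau>) \<in> moduli_locus D d (root_ideal (int d) c)"
proof -
  interpret T: rm_family D d c \<tau> by unfold_locales (rule tau)
  show ?thesis unfolding family_member_def
    using rm_class_in_locus[OF T.family_object] T.family_module_type by blast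
qed

lemma locus_family:
  assumes C: "C \<in> moduli_locus D d (root_ideal (int d) c)"
  shows "\<exists>\<tau>. (\<forall>k. Im (\<tau> $ k) > 0) \<and> C = rm_class D d (family_member \<tau>)"
proof -
  have "C \<in> moduli_space D d" using C moduli_locus_subset by blast
  then obtain q where q: "q \<in> rm_objects D d" "C = rm_class D d q" by (rule moduli_spaceE)
  obtain \<Lambda> H W \<rho> where q': "q = (\<Lambda>, H, W, \<rho>)" by (metis surj_pair)
  have o: "(\<Lambda>, H, W, \<rho>) \<in> rm_objects D d" using q unfolding q' by simp
  then have "positive_hermitian H" unfolding rm_objects_def polarization_def by unfold_locales simp
  then interpret positive_hermitian H .
  interpret O: rm_object D H d \<Lambda> W \<rho> by unfold_locales (rule o)
  have "module_type D (root_ideal (int d) c) (\<Lambda>, H, W, \<rho>)"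
    using C rm_class_in_locus[OF q(1)] unfolding q(2) q' by blast
  then obtain u v y z where "O.adapted c u v y z" using O.module_type_adapted by blast
  then obtain \<tau> where t: "\<forall>k. Im (\<tau> $ k) > 0" "rm_isomorphic D (family_member \<tau>) q"
    using O.family_isomorphic root unfolding q' family_member_def by blast
  interpret T: rm_family D d c \<tau> by unfold_locales (use t in blast)
  have "rm_class D d (family_member \<tau>) = C"
    unfolding q(2) using T.family_object q(1) t(2) by (intro rm_class_eq) (simp_all add: family_member_def)
  then show ?thesis using t(1) by blast
qed

lemma period_matrix_line:
  "period_matrix (\<chi> k. \<tau> $ k + s * (\<tau>' $ k - \<tau> $ k)) = period_matrix \<tau> + scale_matrix (period_matrix (\<tau>' - \<tau>)) s"
  unfolding period_matrix_def scale_matrix_def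
  by (simp add: vec_eq_iff sum_3 algebra_simps)

text \<open>Every class in the locus comes from the family over the product of half planes. Two points of
  the product lie on a complex line, and its part in the product is convex; if the locus were the
  union of two smaller analytic sets, this part would be such a union as well.\<close>

lemma locus_irreducible: "moduli_irreducible D d (moduli_locus D d (root_ideal (int d) c))" (is "moduli_irreducible D d ?X")
  unfolding moduli_irreducible_def
proof (intro conjI allI impI)
  show "moduli_analytic D d ?X" by (rule moduli_locus_analytic)
  show "?X \<noteq> {}" using family_locus[of "\<chi> k. \<i>"] by auto
  fix Y1 Y2 assume Y: "moduli_analytic D d Y1 \<and> moduli_analytic D d Y2 \<and> ?X = Y1 \<union> Y2"
  show "?X = Y1 \<or> ?X = Y2"
  proof (rule ccontr)
    assume "\<not> (?X = Y1 \<or> ?X = Y2)"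
    then obtain C1 C2 where C: "C1 \<in> ?X" "C1 \<notin> Y1" "C2 \<in> ?X" "C2 \<notin> Y2" using Y by blast
    obtain \<tau> where t: "\<forall>k. Im (\<tau> $ k) > 0" "C1 = rm_class D d (family_member \<tau>)" using locus_family[OF C(1)] by blast
    obtain \<tau>' where t': "\<forall>k. Im (\<tau>' $ k) > 0" "C2 = rm_class D d (family_member \<tau>')" using locus_family[OF C(3)] by blast
    define l where "l s = (\<chi> k. \<tau> $ k + s * (\<tau>' $ k - \<tau> $ k))" for s
    define S where "S = (\<Inter>k. {s. Im (l s $ k) > 0})"
    have l01: "l 0 = \<tau>" "l 1 = \<tau>'" unfolding l_def by (simp_all add: vec_eq_iff)
    then have S01: "0 \<in> S" "1 \<in> S" unfolding S_def using t(1) t'(1) by auto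
    have up: "Im (l s $ k) > 0" if "s \<in> S" for s k using that unfolding S_def by blast
    have "open {s. Im (l s $ k) > 0}" for k
      unfolding l_def vec_lambda_beta by (intro open_Collect_less continuous_intros)
    then have "open S" unfolding S_def by (intro open_INT) auto
    have "convex {s. Im (l s $ k) > 0}" for k
    proof -
      let ?v = "\<tau>' $ k - \<tau> $ k"
      have "linear (\<lambda>s. Im (s * ?v))" by (rule linearI) (simp_all add: algebra_simps)
      then have "convex ((\<lambda>s. Im (s * ?v)) -` {- Im (\<tau> $ k)<..})" by (rule convex_linear_vimage) simp
      moreover have "{s. Im (l s $ k) > 0} = (\<lambda>s. Im (s * ?v)) -` {- Im (\<tau> $ k)<..}"
        unfolding l_def vec_lambda_beta vimage_def plus_complex.sel by (rule Collect_cong) auto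
      ultimately show ?thesis by simp
    qed
    then have "connected S" unfolding S_def by (intro convex_connected convex_INT) auto
    define A where "A Y = {s \<in> S. rm_class D d (family_member (l s)) \<in> Y}" for Y
    have zero_set: "locally_zero_set S (A Y)" if Y: "moduli_analytic D d Y" for Y
    proof -
      let ?P = "siegel_preimage D d L0 family_action"
      have l: "period_matrix \<tau> + scale_matrix (period_matrix (\<tau>' - \<tau>)) s = period_matrix (l s)" for s
        unfolding l_def period_matrix_line ..
      have "analytic_subset (?P (moduli_space D d)) (?P Y)" using Y unfolding moduli_analytic_def by blast
      moreover have "period_matrix (l s) \<in> ?P (moduli_space D d)" if "s \<in> S" for s
        using family_preimage[OF up[OF that]] family_locus[OF up[OF that]] moduli_locus_subset by blast
      ultimately have "locally_zero_set S {s \<in> S. period_matrix (l s) \<in> ?P Y}"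
        using analytic_subset_line[OF _ \<open>open S\<close>, of "?P (moduli_space D d)" "?P Y" "period_matrix \<tau>" "period_matrix (\<tau>' - \<tau>)"]
        unfolding l by blast
      moreover have "{s \<in> S. period_matrix (l s) \<in> ?P Y} = A Y"
        unfolding A_def using family_preimage[OF up] by blast
      ultimately show ?thesis by simp
    qed
    have "S = A Y1 \<union> A Y2" unfolding A_def using family_locus[OF up] Y by blast
    moreover have "A Y1 \<subseteq> S" "A Y2 \<subseteq> S" unfolding A_def by blast+
    ultimately have "A Y1 = S \<or> A Y2 = S"
      using locally_zero_set_Un[OF \<open>open S\<close> \<open>connected S\<close>] zero_set Y by blast
    then have "0 \<in> A Y1 \<or> 1 \<in> A Y2" using S01 by blast
    then show False using C(2,4) unfolding t(2) t'(2) A_def by (simp add: l01)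
  qed
qed

end

context quadratic_discriminant begin

lemma primitive_locus_irreducible:
  assumes d: "d > 0" and a: "\<aa> \<in> primitive_ideals D d"
  shows "moduli_irreducible D d (moduli_locus D d \<aa>)"
proof -
  obtain c where c: "int d dvd genpoly c" "\<aa> = root_ideal (int d) c" using primitive_ideal_root[OF d a] by blast
  interpret rm_family_data D d c by unfold_locales (rule d, rule c(1))
  show ?thesis unfolding c(2) by (rule locus_irreducible)
qed

lemma moduli_locus_nonempty: "d > 0 \<Longrightarrow> \<aa> \<in> primitive_ideals D d \<Longrightarrow> moduli_locus D d \<aa> \<noteq> {}"
  using primitive_locus_irreducible unfolding moduli_irreducible_def by blast

lemma irreducible_in_locus:
  assumes Y: "moduli_irreducible D d Y"
  shows "\<exists>\<aa>\<in>primitive_ideals D d. Y \<subseteq> moduli_locus D d \<aa>"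
proof -
  obtain C where C: "C \<in> Y" using Y unfolding moduli_irreducible_def by blast
  then have "C \<in> moduli_space D d" using Y unfolding moduli_irreducible_def moduli_analytic_def by blast
  then have "C \<in> (\<Union>\<aa>\<in>primitive_ideals D d. moduli_locus D d \<aa>)" unfolding moduli_space_loci .
  then obtain \<aa> where a: "\<aa> \<in> primitive_ideals D d" "C \<in> moduli_locus D d \<aa>" by (rule UN_E)
  show ?thesis using a(1) irreducible_subset_locus[OF Y C a(2)] by (rule bexI[rotated])
qed

text \<open>Every irreducible set lies in one of the loci, and these are irreducible, disjoint and nonempty.\<close>

theorem components_bij:
  assumes d: "d > 0"
  shows "bij_betw (moduli_locus D d) (primitive_ideals D d) (irreducible_components D d)"
  unfolding bij_betw_def
proof (intro conjI inj_onI)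
  fix \<aa> \<bb> assume ab: "\<aa> \<in> primitive_ideals D d" "\<bb> \<in> primitive_ideals D d" "moduli_locus D d \<aa> = moduli_locus D d \<bb>"
  obtain C where C: "C \<in> moduli_locus D d \<aa>" using moduli_locus_nonempty[OF d ab(1)] by blast
  show "\<aa> = \<bb>" by (rule moduli_locus_disjoint[OF ab(1,2) C C[unfolded ab(3)]])
next
  show "moduli_locus D d ` primitive_ideals D d = irreducible_components D d"
  proof (intro equalityI subsetI)
    fix Y assume "Y \<in> moduli_locus D d ` primitive_ideals D d"
    then obtain \<aa> where a: "\<aa> \<in> primitive_ideals D d" "Y = moduli_locus D d \<aa>" by (rule imageE)
    have Y: "moduli_irreducible D d Y" unfolding a(2) by (rule primitive_locus_irreducible[OF d a(1)])
    have "Y' = Y" if Y': "moduli_irreducible D d Y'" "Y \<subseteq> Y'" for Y'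
    proof -
      obtain \<bb> where b: "\<bb> \<in> primitive_ideals D d" "Y' \<subseteq> moduli_locus D d \<bb>" using irreducible_in_locus[OF Y'(1)] by blast
      obtain C where C: "C \<in> moduli_locus D d \<aa>" using moduli_locus_nonempty[OF d a(1)] by blast
      then have "C \<in> Y'" using Y'(2) unfolding a(2) by (rule rev_subsetD)
      then have "C \<in> moduli_locus D d \<bb>" using b(2) by (rule rev_subsetD)
      then have "\<aa> = \<bb>" by (rule moduli_locus_disjoint[OF a(1) b(1) C])
      then show ?thesis using Y'(2) b(2) unfolding a(2) by simp
    qed
    then show "Y \<in> irreducible_components D d" unfolding irreducible_components_def using Y by simp
  next
    fix Y assume Y: "Y \<in> irreducible_components D d"
    then have "moduli_irreducible D d Y" unfolding irreducible_components_def by simp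
    then obtain \<aa> where a: "\<aa> \<in> primitive_ideals D d" "Y \<subseteq> moduli_locus D d \<aa>" using irreducible_in_locus by blast
    then have "moduli_locus D d \<aa> = Y"
      using Y primitive_locus_irreducible[OF d a(1)] unfolding irreducible_components_def by simp
    then show "Y \<in> moduli_locus D d ` primitive_ideals D d" using a(1) by (rule image_eqI[OF sym])
  qed
qed

theorem moduli_space_nonempty_iff:
  assumes d: "d > 0" "coprime d (conductor D)"
  shows "moduli_space D d \<noteq> {} \<longleftrightarrow> prime_factor_condition D d"
proof -
  have "moduli_space D d \<noteq> {} \<longleftrightarrow> primitive_ideals D d \<noteq> {}"
    unfolding moduli_space_loci using moduli_locus_nonempty[OF d(1)] by blast
  also have "\<dots> \<longleftrightarrow> card (primitive_ideals D d) \<noteq> 0"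
    using primitive_ideals_count(1)[OF d] by simp
  also have "\<dots> \<longleftrightarrow> prime_factor_condition D d"
    unfolding primitive_ideals_count(2)[OF d] by simp
  finally show ?thesis .
qed

end

theorem theorem1p1:
  fixes D d :: nat
  assumes "D mod 4 = 0 \<or> D mod 4 = 1"
    and "\<not> (\<exists>k::nat. D = k\<^sup>2)"
    and "d > 0"
    and "coprime d (conductor D)"
  shows "(moduli_space D d \<noteq> {} \<longleftrightarrow> prime_factor_condition D d) \<and>
    (prime_factor_condition D d \<longrightarrow>
       moduli_space D d = (\<Union>\<aa>\<in>primitive_ideals D d. moduli_locus D d \<aa>) \<and>
       bij_betw (moduli_locus D d) (primitive_ideals D d) (irreducible_components D d) \<and>
       card (irreducible_components D d) = 2 ^ card (splitting_primes D d))"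
proof -
  interpret quadratic_discriminant D by unfold_locales (rule assms(1), rule assms(2))
  have "card (irreducible_components D d) = 2 ^ card (splitting_primes D d)" if "prime_factor_condition D d"
    using bij_betw_same_card[OF components_bij[OF assms(3)]] primitive_ideals_count(2)[OF assms(3,4)] that by simp
  then show ?thesis
    using moduli_space_nonempty_iff[OF assms(3,4)] moduli_space_loci components_bij[OF assms(3)] by blast
qed

end
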